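(* Let $(X,\omega)$ be a compact Kähler manifold and $D$ a reduced divisor on $X$ with simple normal crossings (snc). Let $F$ and $M$ be holomorphic line bundles on $X$ with potentials $\varphi_F$ and $\varphi_M$ such that (1) $\mathbf{i}\partial\bar\partial\varphi_F\ge 0$ and $-C\omega\le \mathbf{i}\partial\bar\partial\varphi_M\le C\,\mathbf{i}\partial\bar\partial\varphi_F$ on $X$ in the sense of currents for some constant $C>0$; (2) $\varphi_F$ and $\varphi_M$ have only neat analytic singularities; (3) the polar sets $P_F:=\varphi_F^{-1}(-\infty)$ and $P_M:=\varphi_M^{-1}(-\infty)$ both contain no lc centres of $(X,D)$; (4) $P_F$ and $P_M$ are divisors and $P_F\cup P_M\cup D$ has only snc, in the sense that every point of $X$ has a neighbourhood $V$ with holomorphic coordinates $(z_1,\dots,z_n)$ in which $D\cap V=\{z_1\cdots z_{\sigma}=0\}$ for some $\sigma\le n$ and $\varphi_\bullet|_V=\sum_{k=\sigma+1}^n b_{\bullet,k}\log|z_k|^2+\beta_\bullet$ for $\bullet=F,M$, with constants $b_{\bullet,k}\ge 0$ and smooth functions $\beta_\bullet$. Let $s\in H^0(X,M)$ be a non-trivial holomorphic section with $\sup_X|s|^2_{\varphi_M}<\infty$. Let $q\ge 0$ be an integer and let $\iota_\sigma,\mu_\sigma$ ($0\le\sigma\le\sigma_{\rm mlc}$) and $\tau_\sigma,\nu_\sigma$ ($1\le \sigma\le\sigma_{\rm mlc}$) be the homomorphisms between cohomology groups of degree $q$ defined in the context. If $\ker\mu_0=\ker\iota_0$ and $\ker\nu_\sigma=\ker\tau_\sigma$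 for $\sigma=1,\dots,\sigma_{\rm mlc}$, then $\mu_{\sigma_{\rm mlc}}$, that is, the multiplication map $$H^q(X,K_X\otimes D\otimes F\otimes\mathcal I(\varphi_F))\xrightarrow{\ \otimes s\ }H^q(X,K_X\otimes D\otimes F\otimes M\otimes\mathcal I(\varphi_F+\varphi_M)),$$ is injective. In particular, if moreover $\varphi_F$ and $\varphi_M$ are smooth, $M=F^{\otimes m}$ for some integer $m\ge1$, $s$ does not vanish identically on any lc centre of $(X,D)$, and the equalities $\ker\mu_0=\ker\iota_0$ and $\ker\nu_\sigma=\ker\tau_\sigma$ for $\sigma=1,\dots,\sigma_{\rm mlc}$ hold for every $q\ge0$, then the multiplication map $H^q(X,K_X\otimes D\otimes F)\xrightarrow{\otimes s}H^q(X,K_X\otimes D\otimes F^{\otimes(m+1)})$ is injective for every $q\ge0$ (i.e. the conclusion of Fujino's conjecture holds).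
   Context: $\mathbf{i}:=\frac{\sqrt{-1}}{2\pi}$, $n=\dim_{\mathbb C}X$. A potential $\varphi$ on a holomorphic line bundle is a collection of local functions such that $e^{-\varphi}$ defines a (possibly singular) hermitian metric; $|s|^2_\varphi:=|s|^2e^{-\varphi}$. A quasi-psh potential has neat analytic singularities if locally it equals $c\log\big(\sum_{j=1}^N|g_j|^2\big)$ plus a smooth function, $c\in\mathbb R_{\ge0}$, $g_j$ holomorphic. $\mathcal I(\varphi)$ is the multiplier ideal sheaf of $\varphi$. A divisor and its line bundle are denoted by the same symbol. The lc centres of $(X,D)$ are the irreducible components of all intersections of irreducible components of $D$; $\sigma_{\rm mlc}$ is the codimension of the minimal lc centres, i.e. the largest codimension of an lc centre. Let $s_D$ be a canonical section of $D$, $\phi_D:=\log|s_D|^2$, $\phi_D^{\rm sm}$ a smooth potential on $D$ such that the global function $\psi_D:=\phi_D-\phi_D^{\rm sm}$ satisfies $\psi_D\le-1$. For $(L,\varphi_L)=(F,\varphi_F)$ or $(F\otimes M,\varphi_F+\varphi_M)$ and an integer $\sigma\ge0$, the analytic adjoint ideal sheaf $\mathcal J_\sigma(\varphi_L)$ of index $\sigma$ is the ideal sheaf whose stalk at $x$ consists of the $f\in\mathcal O_{X,x}$ for which there is an open $V_x\ni x$ such that $\frac{|f|^2e^{-\varphi_L-\psi_D}}{|\psi_D|^\sigma(\log|e\psi_D|)^{1+\varepsilon}}\in L^1(V_x)$ for all $\varepsilon>0$. One has $\mathcal I(\varphi_L+\phi_D)=\mathcal J_0(\varphi_L)\subset\mathcal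 J_1(\varphi_L)\subset\dots\subset\mathcal J_{\sigma_{\rm mlc}}(\varphi_L)=\mathcal I(\varphi_L)$. Put $\mathcal R_\sigma(\varphi_L):=\mathcal J_\sigma(\varphi_L)/\mathcal J_{\sigma-1}(\varphi_L)$. For a sheaf $\mathcal G$ put $\mathcal H^q(\mathcal G):=H^q(X,K_X\otimes D\otimes F\otimes\mathcal G)$. Then: - $\iota_\sigma:\mathcal H^q(\mathcal J_\sigma(\varphi_F))\to\mathcal H^q(\mathcal I(\varphi_F))$ is induced by the inclusion, and $\mu_\sigma:\mathcal H^q(\mathcal J_\sigma(\varphi_F))\to\mathcal H^q(M\otimes\mathcal I(\varphi_F+\varphi_M))$ is $\iota_\sigma$ followed by $\otimes s$; - $\tau_\sigma:\mathcal H^q(\mathcal R_\sigma(\varphi_F))\to\mathcal H^q\big(\mathcal I(\varphi_F)/\mathcal J_{\sigma-1}(\varphi_F)\big)$ is induced by the inclusion, and $\nu_\sigma:\mathcal H^q(\mathcal R_\sigma(\varphi_F))\to\mathcal H^q\big(M\otimes\tfrac{\mathcal I(\varphi_F+\varphi_M)}{\mathcal J_{\sigma-1}(\varphi_F+\varphi_M)}\big)$ is $\tau_\sigma$ followed by $\otimes s$. *)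

theory Defs
  imports "HOL-Analysis.Analysis" "HOL-Algebra.Coset" "HOL-Algebra.FiniteProduct"
    "HOL-Algebra.Product_Groups"
begin

definition holo_on :: "(complex^'n::finite) set \<Rightarrow> (complex^'n \<Rightarrow> complex) \<Rightarrow> bool" where
  "holo_on S f \<longleftrightarrow>
     (\<forall>w\<in>S. \<exists>f'. (f has_derivative f') (at w) \<and> (\<forall>c v. f' (c *s v) = c * f' v))"

primrec Ck_on :: "nat \<Rightarrow> ('v::real_normed_vector) set \<Rightarrow> ('v \<Rightarrow> 'w::real_normed_vector) \<Rightarrow> bool" where
  "Ck_on 0 S f \<longleftrightarrow> continuous_on S f"
| "Ck_on (Suc k) S f \<longleftrightarrow>
     f differentiable_on S \<and> (\<forall>v. Ck_on k S (\<lambda>w. frechet_derivative f (at w) v))"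

text \<open>Only used for open \<open>S\<close>.\<close>
definition smooth_on :: "('v::real_normed_vector) set \<Rightarrow> ('v \<Rightarrow> 'w::real_normed_vector) \<Rightarrow> bool" where
  "smooth_on S f \<longleftrightarrow> (\<forall>k. Ck_on k S f)"

definition d_z :: "'n::finite \<Rightarrow> (complex^'n \<Rightarrow> complex) \<Rightarrow> complex^'n \<Rightarrow> complex" where
  "d_z k f w = (frechet_derivative f (at w) (axis k 1)
                 - \<i> * frechet_derivative f (at w) (axis k \<i>)) / 2"

definition d_zbar :: "'n::finite \<Rightarrow> (complex^'n \<Rightarrow> complex) \<Rightarrow> complex^'n \<Rightarrow> complex" where
  "d_zbar k f w = (frechet_derivative f (at w) (axis k 1)
                 + \<i> * frechet_derivative f (at w) (axis k \<i>)) / 2"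

text \<open>The underlying space of a manifold is a whole Hausdorff type; the manifold is given by its
  holomorphic atlas.\<close>

type_synonym ('a, 'n) chart = "'a set \<times> ('a \<Rightarrow> complex^'n)"

definition in_chart :: "('a, 'n) chart \<Rightarrow> ('a \<Rightarrow> 'c) \<Rightarrow> complex^'n \<Rightarrow> 'c" where
  "in_chart \<kappa> f = (\<lambda>w. f (inv_into (fst \<kappa>) (snd \<kappa>) w))"

definition is_chart :: "('a::topological_space, 'n::finite) chart \<Rightarrow> bool" where
  "is_chart \<kappa> \<longleftrightarrow> open (fst \<kappa>) \<and> open (snd \<kappa> ` fst \<kappa>) \<and>
     (\<exists>g. homeomorphism (fst \<kappa>) (snd \<kappa> ` fst \<kappa>) (snd \<kappa>) g)"

definition holo_change :: "('a, 'n::finite) chart \<Rightarrow> ('a, 'n) chart \<Rightarrow> bool" where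
  "holo_change \<kappa> \<kappa>' \<longleftrightarrow>
     (\<forall>k. holo_on (snd \<kappa> ` (fst \<kappa> \<inter> fst \<kappa>')) (in_chart \<kappa> (\<lambda>x. snd \<kappa>' x $ k)))"

definition complex_manifold :: "('a::t2_space, 'n::finite) chart set \<Rightarrow> bool" where
  "complex_manifold X \<longleftrightarrow> (\<forall>\<kappa>\<in>X. is_chart \<kappa>) \<and> (\<Union>\<kappa>\<in>X. fst \<kappa>) = UNIV \<and>
     (\<forall>\<kappa>\<in>X. \<forall>\<kappa>'\<in>X. holo_change \<kappa> \<kappa>')"

definition hol_coords :: "('a::t2_space, 'n::finite) chart set \<Rightarrow> ('a, 'n) chart \<Rightarrow> bool" where
  "hol_coords X \<zeta> \<longleftrightarrow> is_chart \<zeta> \<and> (\<forall>\<kappa>\<in>X. holo_change \<kappa> \<zeta> \<and> holo_change \<zeta> \<kappa>)"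

text \<open>Only used for open \<open>U\<close>.\<close>
definition hol_on :: "('a::t2_space, 'n::finite) chart set \<Rightarrow> 'a set \<Rightarrow> ('a \<Rightarrow> complex) \<Rightarrow> bool" where
  "hol_on X U f \<longleftrightarrow> (\<forall>\<kappa>\<in>X. holo_on (snd \<kappa> ` (U \<inter> fst \<kappa>)) (in_chart \<kappa> f))"

definition mfd_smooth_on ::
    "('a::t2_space, 'n::finite) chart set \<Rightarrow> 'a set \<Rightarrow> ('a \<Rightarrow> 'w::real_normed_vector) \<Rightarrow> bool" where
  "mfd_smooth_on X U f \<longleftrightarrow> (\<forall>\<kappa>\<in>X. smooth_on (snd \<kappa> ` (U \<inter> fst \<kappa>)) (in_chart \<kappa> f))"

text \<open>\<open>\<omega> = \<surd>-1 \<Sum> h\<^sub>j\<^sub>k dz\<^sub>j \<and> d\<bar>z\<^sub>k\<close> in each chart. The conditions say that the local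
  expressions agree on overlaps, are smooth, hermitian and positive definite, and that
  \<open>\<partial>\<omega> = 0\<close> (hence \<open>d\<omega> = 0\<close>, as \<open>\<omega>\<close> is real).\<close>
definition kaehler_form ::
    "('a::t2_space, 'n::finite) chart set \<Rightarrow> (('a, 'n) chart \<Rightarrow> 'a \<Rightarrow> complex^'n^'n) \<Rightarrow> bool" where
  "kaehler_form X h \<longleftrightarrow>
     (\<forall>\<kappa>\<in>X. \<forall>j k.
        mfd_smooth_on X (fst \<kappa>) (\<lambda>x. h \<kappa> x $ j $ k) \<and>
        (\<forall>x\<in>fst \<kappa>. h \<kappa> x $ k $ j = cnj (h \<kappa> x $ j $ k)) \<and>
        (\<forall>l. \<forall>w\<in>snd \<kappa> ` fst \<kappa>.
           d_z l (in_chart \<kappa> (\<lambda>x. h \<kappa> x $ j $ k)) w = d_z j (in_chart \<kappa> (\<lambda>x. h \<kappa> x $ l $ k)) w)) \<and>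
     (\<forall>\<kappa>\<in>X. \<forall>x\<in>fst \<kappa>. \<forall>v. v \<noteq> 0 \<longrightarrow>
        Re (\<Sum>j\<in>UNIV. \<Sum>k\<in>UNIV. h \<kappa> x $ j $ k * v $ j * cnj (v $ k)) > 0) \<and>
     (\<forall>\<kappa>\<in>X. \<forall>\<kappa>'\<in>X. \<forall>x\<in>fst \<kappa> \<inter> fst \<kappa>'. \<forall>a b.
        h \<kappa> x $ a $ b = (\<Sum>j\<in>UNIV. \<Sum>k\<in>UNIV. h \<kappa>' x $ j $ k
           * d_z a (in_chart \<kappa> (\<lambda>y. snd \<kappa>' y $ j)) (snd \<kappa> x)
           * cnj (d_z b (in_chart \<kappa> (\<lambda>y. snd \<kappa>' y $ k)) (snd \<kappa> x))))"

definition analytic_set :: "('a::t2_space, 'n::finite) chart set \<Rightarrow> 'a set \<Rightarrow> bool" where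
  "analytic_set X Z \<longleftrightarrow> (\<forall>x. \<exists>V G. open V \<and> x \<in> V \<and> finite G \<and> (\<forall>g\<in>G. hol_on X V g) \<and>
     Z \<inter> V = {y\<in>V. \<forall>g\<in>G. g y = 0})"

definition irreducible_set :: "('a::t2_space, 'n::finite) chart set \<Rightarrow> 'a set \<Rightarrow> bool" where
  "irreducible_set X Z \<longleftrightarrow> analytic_set X Z \<and> Z \<noteq> {} \<and>
     (\<forall>A B. analytic_set X A \<longrightarrow> analytic_set X B \<longrightarrow> Z = A \<union> B \<longrightarrow> Z = A \<or> Z = B)"

definition irred_components :: "('a::t2_space, 'n::finite) chart set \<Rightarrow> 'a set \<Rightarrow> 'a set set" where
  "irred_components X Z = {C. irreducible_set X C \<and> C \<subseteq> Z \<and>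
     (\<forall>C'. irreducible_set X C' \<longrightarrow> C \<subseteq> C' \<longrightarrow> C' \<subseteq> Z \<longrightarrow> C' = C)}"

text \<open>Supports of (possibly zero) effective divisors.\<close>
definition hypersurface :: "('a::t2_space, 'n::finite) chart set \<Rightarrow> 'a set \<Rightarrow> bool" where
  "hypersurface X Z \<longleftrightarrow> (\<forall>x. \<exists>V g. open V \<and> x \<in> V \<and> hol_on X V g \<and>
     Z \<inter> V = {y\<in>V. g y = 0} \<and>
     (\<forall>W. open W \<longrightarrow> W \<noteq> {} \<longrightarrow> W \<subseteq> V \<longrightarrow> (\<exists>y\<in>W. g y \<noteq> 0)))"

text \<open>A reduced divisor is the set of its prime components. Simple normal crossings: near every
  point the components are distinct coordinate hyperplanes.\<close>
definition snc_divisor :: "('a::t2_space, 'n::finite) chart set \<Rightarrow> 'a set set \<Rightarrow> bool" where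
  "snc_divisor X D \<longleftrightarrow> finite D \<and> (\<forall>E\<in>D. irreducible_set X E \<and> hypersurface X E) \<and>
     (\<forall>x. \<exists>V z j. hol_coords X (V, z) \<and> x \<in> V \<and> inj_on j {E\<in>D. E \<inter> V \<noteq> {}} \<and>
        (\<forall>E\<in>D. E \<inter> V \<noteq> {} \<longrightarrow> E \<inter> V = {y\<in>V. z y $ j E = 0}))"

definition lc_centres :: "('a::t2_space, 'n::finite) chart set \<Rightarrow> 'a set set \<Rightarrow> 'a set set" where
  "lc_centres X D = (\<Union>\<E>\<in>{\<E>. \<E> \<subseteq> D \<and> \<E> \<noteq> {}}. irred_components X (\<Inter>\<E>))"

text \<open>For irreducible \<open>Z\<close>: the codimension of \<open>Z\<close> at a regular point.\<close>
definition has_codim :: "('a::t2_space, 'n::finite) chart set \<Rightarrow> 'a set \<Rightarrow> nat \<Rightarrow> bool" where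
  "has_codim X Z c \<longleftrightarrow> (\<exists>V z S. hol_coords X (V, z) \<and> Z \<inter> V \<noteq> {} \<and>
     Z \<inter> V = {y\<in>V. \<forall>k\<in>S. z y $ k = 0} \<and> card S = c)"

text \<open>The \<open>0\<close> only matters for \<open>D = 0\<close>.\<close>
definition sigma_mlc :: "('a::t2_space, 'n::finite) chart set \<Rightarrow> 'a set set \<Rightarrow> nat" where
  "sigma_mlc X D = Max (insert 0 {c. \<exists>Z\<in>lc_centres X D. has_codim X Z c})"

text \<open>A line bundle is given by a trivialising open cover and its cocycle; a section is a family
  \<open>s\<close> with \<open>s i = trans i j * s j\<close> on overlaps.\<close>
record ('a, 'i) line_bundle =
  idx :: "'i set"
  dom :: "'i \<Rightarrow> 'a set"
  trans :: "'i \<Rightarrow> 'i \<Rightarrow> 'a \<Rightarrow> complex"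

definition holomorphic_line_bundle ::
    "('a::t2_space, 'n::finite) chart set \<Rightarrow> ('a, 'i) line_bundle \<Rightarrow> bool" where
  "holomorphic_line_bundle X L \<longleftrightarrow>
     (\<forall>i\<in>idx L. open (dom L i)) \<and> (\<Union>i\<in>idx L. dom L i) = UNIV \<and>
     (\<forall>i\<in>idx L. \<forall>j\<in>idx L. hol_on X (dom L i \<inter> dom L j) (trans L i j)) \<and>
     (\<forall>i\<in>idx L. \<forall>x\<in>dom L i. trans L i i x = 1) \<and>
     (\<forall>i\<in>idx L. \<forall>j\<in>idx L. \<forall>k\<in>idx L. \<forall>x\<in>dom L i \<inter> dom L j \<inter> dom L k.
        trans L i j x * trans L j k x = trans L i k x)"

definition lb_tensor ::
    "('a, 'i) line_bundle \<Rightarrow> ('a, 'j) line_bundle \<Rightarrow> ('a, 'i \<times> 'j) line_bundle" where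
  "lb_tensor L L' = \<lparr>idx = idx L \<times> idx L',
     dom = (\<lambda>(i, j). dom L i \<inter> dom L' j),
     trans = (\<lambda>(i, j) (i', j') x. trans L i i' x * trans L' j j' x)\<rparr>"

definition lb_power :: "('a, 'i) line_bundle \<Rightarrow> nat \<Rightarrow> ('a, 'i) line_bundle" where
  "lb_power L m = L\<lparr>trans := (\<lambda>i j x. trans L i j x ^ m)\<rparr>"

text \<open>\<open>f dz\<^sub>1 \<and> \<dots> \<and> dz\<^sub>n = f' dz'\<^sub>1 \<and> \<dots> \<and> dz'\<^sub>n\<close> iff \<open>f = det (\<partial>z'/\<partial>z) f'\<close>.\<close>
definition canonical_bundle ::
    "('a::t2_space, 'n::finite) chart set \<Rightarrow> ('a, ('a, 'n) chart) line_bundle" where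
  "canonical_bundle X = \<lparr>idx = X, dom = fst,
     trans = (\<lambda>\<kappa> \<kappa>' x. det (\<chi> j k. d_z k (in_chart \<kappa> (\<lambda>y. snd \<kappa>' y $ j)) (snd \<kappa> x)))\<rparr>"

text \<open>Sections over the open set \<open>U\<close>, extended by \<open>0\<close> outside \<open>U\<close> and the trivialising sets.\<close>
definition hol_sections ::
    "('a::t2_space, 'n::finite) chart set \<Rightarrow> ('a, 'i) line_bundle \<Rightarrow> 'a set \<Rightarrow> ('i \<Rightarrow> 'a \<Rightarrow> complex) set" where
  "hol_sections X L U = {t.
     (\<forall>i\<in>idx L. hol_on X (U \<inter> dom L i) (t i)) \<and>
     (\<forall>i\<in>idx L. \<forall>j\<in>idx L. \<forall>x\<in>U \<inter> dom L i \<inter> dom L j. t i x = trans L i j x * t j x) \<and>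
     (\<forall>i x. \<not> (i \<in> idx L \<and> x \<in> U \<inter> dom L i) \<longrightarrow> t i x = 0)}"

definition tensor_sec :: "('j \<Rightarrow> 'a \<Rightarrow> complex) \<Rightarrow> ('i \<Rightarrow> 'a \<Rightarrow> complex) \<Rightarrow> 'i \<times> 'j \<Rightarrow> 'a \<Rightarrow> complex" where
  "tensor_sec s t = (\<lambda>(i, j) x. t i x * s j x)"

text \<open>The multiplication \<open>t \<mapsto> t \<otimes> s\<close> for \<open>t\<close> a section of \<open>N \<otimes> F\<close> and \<open>s\<close> a section of
  \<open>F\<^sup>m\<close>, with values in \<open>N \<otimes> F\<^sup>m\<^sup>+\<^sup>1\<close>; here \<open>F\<close> and its powers share trivialisations.\<close>
definition tensor_sec_power ::
    "('i \<Rightarrow> 'a \<Rightarrow> complex) \<Rightarrow> ('k \<times> 'i \<Rightarrow> 'a \<Rightarrow> complex) \<Rightarrow> 'k \<times> 'i \<Rightarrow> 'a \<Rightarrow> complex" where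
  "tensor_sec_power s t = (\<lambda>(k, i) x. t (k, i) x * s i x)"

text \<open>An isomorphism \<open>L \<cong> L'\<close>, sending the section \<open>t\<close> to \<open>t' j = \<theta> i j * t i\<close>.\<close>
definition lb_iso ::
    "('a::t2_space, 'n::finite) chart set \<Rightarrow> ('a, 'i) line_bundle \<Rightarrow> ('a, 'j) line_bundle
     \<Rightarrow> ('i \<Rightarrow> 'j \<Rightarrow> 'a \<Rightarrow> complex) \<Rightarrow> bool" where
  "lb_iso X L L' \<theta> \<longleftrightarrow> (\<forall>i\<in>idx L. \<forall>j\<in>idx L'.
     hol_on X (dom L i \<inter> dom L' j) (\<theta> i j) \<and>
     (\<forall>x\<in>dom L i \<inter> dom L' j. \<theta> i j x \<noteq> 0) \<and>
     (\<forall>i'\<in>idx L. \<forall>x\<in>dom L i \<inter> dom L i' \<inter> dom L' j. \<theta> i' j x = \<theta> i j x * trans L i i' x) \<and>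
     (\<forall>j'\<in>idx L'. \<forall>x\<in>dom L i \<inter> dom L' j \<inter> dom L' j'. \<theta> i j' x = trans L' j' j x * \<theta> i j x))"

definition lb_iso_sec ::
    "('a, 'i) line_bundle \<Rightarrow> ('a, 'j) line_bundle \<Rightarrow> ('i \<Rightarrow> 'j \<Rightarrow> 'a \<Rightarrow> complex)
     \<Rightarrow> ('i \<Rightarrow> 'a \<Rightarrow> complex) \<Rightarrow> 'j \<Rightarrow> 'a \<Rightarrow> complex" where
  "lb_iso_sec L L' \<theta> t = (\<lambda>j x. if j \<in> idx L' \<and> x \<in> dom L' j
     then (let i = (SOME i. i \<in> idx L \<and> x \<in> dom L i) in \<theta> i j x * t i x) else 0)"

text \<open>\<open>s\<close> is a canonical section of the line bundle of the reduced divisor \<open>D\<close>: its germs generate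
  the ideal of germs vanishing on \<open>D\<close>.\<close>
definition canonical_section ::
    "('a::t2_space, 'n::finite) chart set \<Rightarrow> 'a set set \<Rightarrow> ('a, 'i) line_bundle
     \<Rightarrow> ('i \<Rightarrow> 'a \<Rightarrow> complex) \<Rightarrow> bool" where
  "canonical_section X D L s \<longleftrightarrow> s \<in> hol_sections X L UNIV \<and>
     (\<forall>i\<in>idx L. \<forall>x\<in>dom L i. \<forall>V f. open V \<longrightarrow> x \<in> V \<longrightarrow> hol_on X V f \<longrightarrow>
        (\<exists>W. open W \<and> x \<in> W \<and> W \<subseteq> V \<and> (\<forall>y\<in>W \<inter> \<Union>D. f y = 0)) \<longleftrightarrow>
        (\<exists>W h. open W \<and> x \<in> W \<and> W \<subseteq> V \<inter> dom L i \<and> hol_on X W h \<and>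
           (\<forall>y\<in>W. f y = h y * s i y)))"

definition elog :: "real \<Rightarrow> ereal" where
  "elog r = (if r \<le> 0 then - \<infinity> else ereal (ln r))"

definition eexp_uminus :: "ereal \<Rightarrow> ennreal" where
  "eexp_uminus u = (case u of ereal r \<Rightarrow> ennreal (exp (- r)) | PInfty \<Rightarrow> 0 | MInfty \<Rightarrow> \<infinity>)"

text \<open>\<open>|s|\<^sup>2 e\<^sup>-\<^sup>\<phi>\<close> is independent of the trivialisation; as usual for singular metrics the local
  weights are locally integrable, so in particular \<open>{\<phi> = -\<infinity>}\<close> is a null set.\<close>
definition potential ::
    "('a::t2_space, 'n::finite) chart set \<Rightarrow> ('a, 'i) line_bundle \<Rightarrow> ('i \<Rightarrow> 'a \<Rightarrow> ereal) \<Rightarrow> bool" where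
  "potential X L \<phi> \<longleftrightarrow>
     (\<forall>i\<in>idx L. \<forall>x\<in>dom L i. \<phi> i x \<noteq> \<infinity>) \<and>
     (\<forall>i\<in>idx L. \<forall>j\<in>idx L. \<forall>x\<in>dom L i \<inter> dom L j.
        \<phi> i x = \<phi> j x + ereal (ln ((cmod (trans L i j x))\<^sup>2))) \<and>
     (\<forall>i\<in>idx L. \<forall>\<kappa>\<in>X. \<forall>x\<in>dom L i \<inter> fst \<kappa>. \<exists>V. open V \<and> x \<in> V \<and> V \<subseteq> dom L i \<inter> fst \<kappa> \<and>
        negligible (snd \<kappa> ` {y\<in>V. \<phi> i y = - \<infinity>}) \<and>
        in_chart \<kappa> (\<lambda>y. real_of_ereal (\<phi> i y)) absolutely_integrable_on (snd \<kappa> ` V))"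

definition smooth_potential ::
    "('a::t2_space, 'n::finite) chart set \<Rightarrow> ('a, 'i) line_bundle \<Rightarrow> ('i \<Rightarrow> 'a \<Rightarrow> ereal) \<Rightarrow> bool" where
  "smooth_potential X L \<phi> \<longleftrightarrow> potential X L \<phi> \<and>
     (\<forall>i\<in>idx L. (\<forall>x\<in>dom L i. \<bar>\<phi> i x\<bar> \<noteq> \<infinity>) \<and>
        mfd_smooth_on X (dom L i) (\<lambda>x. real_of_ereal (\<phi> i x)))"

definition tensor_pot :: "('i \<Rightarrow> 'a \<Rightarrow> ereal) \<Rightarrow> ('j \<Rightarrow> 'a \<Rightarrow> ereal) \<Rightarrow> 'i \<times> 'j \<Rightarrow> 'a \<Rightarrow> ereal" where
  "tensor_pot \<phi> \<phi>' = (\<lambda>(i, j) x. \<phi> i x + \<phi>' j x)"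

definition polar_set :: "('a, 'i) line_bundle \<Rightarrow> ('i \<Rightarrow> 'a \<Rightarrow> ereal) \<Rightarrow> 'a set" where
  "polar_set L \<phi> = {x. \<exists>i\<in>idx L. x \<in> dom L i \<and> \<phi> i x = - \<infinity>}"

definition sup_norm_sq ::
    "('a, 'i) line_bundle \<Rightarrow> ('i \<Rightarrow> 'a \<Rightarrow> ereal) \<Rightarrow> ('i \<Rightarrow> 'a \<Rightarrow> complex) \<Rightarrow> ennreal" where
  "sup_norm_sq L \<phi> s =
     (SUP i\<in>idx L. SUP x\<in>dom L i. ennreal ((cmod (s i x))\<^sup>2) * eexp_uminus (\<phi> i x))"

definition neat_analytic_sing ::
    "('a::t2_space, 'n::finite) chart set \<Rightarrow> ('a, 'i) line_bundle \<Rightarrow> ('i \<Rightarrow> 'a \<Rightarrow> ereal) \<Rightarrow> bool" where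
  "neat_analytic_sing X L \<phi> \<longleftrightarrow> (\<forall>i\<in>idx L. \<forall>x\<in>dom L i. \<exists>V c N g \<beta>.
     open V \<and> x \<in> V \<and> V \<subseteq> dom L i \<and> c \<ge> 0 \<and> (\<forall>j<N. hol_on X V (g j)) \<and>
     mfd_smooth_on X V (\<beta> :: 'a \<Rightarrow> real) \<and>
     (\<forall>y\<in>V. \<phi> i y = ereal c * elog (\<Sum>j<(N::nat). (cmod (g j y))\<^sup>2) + ereal (\<beta> y)))"

text \<open>On \<open>V\<close> the divisor is \<open>\<Prod>\<^bsub>k\<in>S\<^esub> z\<^sub>k = 0\<close>, and the potential has poles only along the other
  coordinate hyperplanes.\<close>
definition pot_snc_on ::
    "('a::t2_space, 'n::finite) chart set \<Rightarrow> ('a, 'i) line_bundle \<Rightarrow> ('i \<Rightarrow> 'a \<Rightarrow> ereal)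
     \<Rightarrow> ('a, 'n) chart \<Rightarrow> 'n set \<Rightarrow> bool" where
  "pot_snc_on X L \<phi> \<zeta> S \<longleftrightarrow> (\<exists>i\<in>idx L. \<exists>b \<beta>. fst \<zeta> \<subseteq> dom L i \<and> (\<forall>k. b k \<ge> 0) \<and>
     mfd_smooth_on X (fst \<zeta>) (\<beta> :: 'a \<Rightarrow> real) \<and>
     (\<forall>y\<in>fst \<zeta>. \<phi> i y =
        (\<Sum>k\<in>- S. ereal (b k) * elog ((cmod (snd \<zeta> y $ k))\<^sup>2)) + ereal (\<beta> y)))"

definition snc_with_polar_sets ::
    "('a::t2_space, 'n::finite) chart set \<Rightarrow> 'a set set \<Rightarrow> ('a, 'i) line_bundle
     \<Rightarrow> ('i \<Rightarrow> 'a \<Rightarrow> ereal) \<Rightarrow> ('a, 'j) line_bundle \<Rightarrow> ('j \<Rightarrow> 'a \<Rightarrow> ereal) \<Rightarrow> bool" where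
  "snc_with_polar_sets X D F \<phi>F M \<phi>M \<longleftrightarrow>
     hypersurface X (polar_set F \<phi>F) \<and> hypersurface X (polar_set M \<phi>M) \<and>
     (\<forall>x. \<exists>V z S. hol_coords X (V, z) \<and> x \<in> V \<and>
        \<Union>D \<inter> V = {y\<in>V. (\<Prod>k\<in>S. z y $ k) = 0} \<and>
        pot_snc_on X F \<phi>F (V, z) S \<and> pot_snc_on X M \<phi>M (V, z) S)"

text \<open>A real \<open>(1,1)\<close>-current \<open>T = \<surd>-1 \<Sum> T\<^sub>j\<^sub>k dz\<^sub>j \<and> d\<bar>z\<^sub>k\<close> on a chart is handled through the distributions
  \<open>\<Sum> T\<^sub>j\<^sub>k \<xi>\<^sub>j \<bar>\<xi>\<^sub>k\<close>, \<open>\<xi> \<in> \<complex>\<^sup>n\<close>; \<open>T \<ge> 0\<close> means that they are nonnegative on nonnegative test functions.\<close>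
definition test_fun :: "(complex^'n::finite) set \<Rightarrow> (complex^'n \<Rightarrow> real) \<Rightarrow> bool" where
  "test_fun W \<rho> \<longleftrightarrow> smooth_on UNIV \<rho> \<and> (\<forall>w. \<rho> w \<ge> 0) \<and>
     compact (closure {w. \<rho> w \<noteq> 0}) \<and> closure {w. \<rho> w \<noteq> 0} \<subseteq> W"

definition ddbar_pairing ::
    "('a, 'n::finite) chart \<Rightarrow> ('a \<Rightarrow> ereal) \<Rightarrow> (complex^'n \<Rightarrow> real) \<Rightarrow> complex^'n \<Rightarrow> real" where
  "ddbar_pairing \<kappa> u \<rho> \<xi> = 1 / (2 * pi) * integral (snd \<kappa> ` fst \<kappa>) (\<lambda>w.
     in_chart \<kappa> (\<lambda>x. real_of_ereal (u x)) w *
     Re (\<Sum>j\<in>UNIV. \<Sum>k\<in>UNIV. d_z j (d_zbar k (\<lambda>v. complex_of_real (\<rho> v))) w * \<xi> $ j * cnj (\<xi> $ k)))"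

definition form_pairing ::
    "('a, 'n::finite) chart \<Rightarrow> ('a \<Rightarrow> complex^'n^'n) \<Rightarrow> (complex^'n \<Rightarrow> real) \<Rightarrow> complex^'n \<Rightarrow> real" where
  "form_pairing \<kappa> h \<rho> \<xi> = integral (snd \<kappa> ` fst \<kappa>) (\<lambda>w.
     \<rho> w * Re (\<Sum>j\<in>UNIV. \<Sum>k\<in>UNIV. in_chart \<kappa> h w $ j $ k * \<xi> $ j * cnj (\<xi> $ k)))"

definition curvature_nonneg ::
    "('a::t2_space, 'n::finite) chart set \<Rightarrow> ('a, 'i) line_bundle \<Rightarrow> ('i \<Rightarrow> 'a \<Rightarrow> ereal) \<Rightarrow> bool" where
  "curvature_nonneg X F \<phi>F \<longleftrightarrow> (\<forall>\<kappa>\<in>X. \<forall>i\<in>idx F. \<forall>\<rho> \<xi>.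
     test_fun (snd \<kappa> ` (fst \<kappa> \<inter> dom F i)) \<rho> \<longrightarrow> 0 \<le> ddbar_pairing \<kappa> (\<phi>F i) \<rho> \<xi>)"

definition curvature_bounds ::
    "('a::t2_space, 'n::finite) chart set \<Rightarrow> (('a, 'n) chart \<Rightarrow> 'a \<Rightarrow> complex^'n^'n) \<Rightarrow> real
     \<Rightarrow> ('a, 'i) line_bundle \<Rightarrow> ('i \<Rightarrow> 'a \<Rightarrow> ereal)
     \<Rightarrow> ('a, 'j) line_bundle \<Rightarrow> ('j \<Rightarrow> 'a \<Rightarrow> ereal) \<Rightarrow> bool" where
  "curvature_bounds X \<omega> C F \<phi>F M \<phi>M \<longleftrightarrow>
     (\<forall>\<kappa>\<in>X. \<forall>i\<in>idx F. \<forall>j\<in>idx M. \<forall>\<rho> \<xi>.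
        test_fun (snd \<kappa> ` (fst \<kappa> \<inter> dom F i \<inter> dom M j)) \<rho> \<longrightarrow>
          - C * form_pairing \<kappa> (\<omega> \<kappa>) \<rho> \<xi> \<le> ddbar_pairing \<kappa> (\<phi>M j) \<rho> \<xi> \<and>
          ddbar_pairing \<kappa> (\<phi>M j) \<rho> \<xi> \<le> C * ddbar_pairing \<kappa> (\<phi>F i) \<rho> \<xi>)"

text \<open>\<open>\<psi>\<^sub>D = log |s\<^sub>D|\<^sup>2 - \<phi>\<^sub>D\<^sup>s\<^sup>m\<close>; the value does not depend on the trivialisation.\<close>
definition psi_D ::
    "('a, 'd) line_bundle \<Rightarrow> ('d \<Rightarrow> 'a \<Rightarrow> complex) \<Rightarrow> ('d \<Rightarrow> 'a \<Rightarrow> ereal) \<Rightarrow> 'a \<Rightarrow> ereal" where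
  "psi_D LD sD \<phi>Dsm x = (let d = (SOME d. d \<in> idx LD \<and> x \<in> dom LD d)
     in elog ((cmod (sD d x))\<^sup>2) - \<phi>Dsm d x)"

text \<open>An ideal sheaf is given by its stalks; a germ at \<open>x\<close> is represented by any function that is
  holomorphic near \<open>x\<close>.\<close>
type_synonym 'a ideal_sheaf = "'a \<Rightarrow> ('a \<Rightarrow> complex) set"

definition structure_sheaf :: "('a::t2_space, 'n::finite) chart set \<Rightarrow> 'a ideal_sheaf" where
  "structure_sheaf X x = {f. \<exists>V. open V \<and> x \<in> V \<and> hol_on X V f}"

text \<open>\<^const>\<open>real_of_ereal\<close> alters the integrands only on the polar sets, which are null sets.\<close>
definition multiplier_ideal ::
    "('a::t2_space, 'n::finite) chart set \<Rightarrow> ('a, 'i) line_bundle \<Rightarrow> ('i \<Rightarrow> 'a \<Rightarrow> ereal)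
     \<Rightarrow> 'a ideal_sheaf" where
  "multiplier_ideal X L \<phi> x = {f. \<exists>V. \<exists>\<kappa>\<in>X. \<exists>i\<in>idx L.
     open V \<and> x \<in> V \<and> V \<subseteq> fst \<kappa> \<inter> dom L i \<and> hol_on X V f \<and>
     in_chart \<kappa> (\<lambda>y. (cmod (f y))\<^sup>2 * exp (- real_of_ereal (\<phi> i y)))
       absolutely_integrable_on (snd \<kappa> ` V)}"

definition adjoint_ideal ::
    "('a::t2_space, 'n::finite) chart set \<Rightarrow> ('a \<Rightarrow> ereal) \<Rightarrow> ('a, 'i) line_bundle
     \<Rightarrow> ('i \<Rightarrow> 'a \<Rightarrow> ereal) \<Rightarrow> nat \<Rightarrow> 'a ideal_sheaf" where
  "adjoint_ideal X \<psi> L \<phi> \<sigma> x = {f. \<exists>V. \<exists>\<kappa>\<in>X. \<exists>i\<in>idx L.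
     open V \<and> x \<in> V \<and> V \<subseteq> fst \<kappa> \<inter> dom L i \<and> hol_on X V f \<and>
     (\<forall>\<epsilon>>0. in_chart \<kappa> (\<lambda>y. (cmod (f y))\<^sup>2 * exp (- real_of_ereal (\<phi> i y) - real_of_ereal (\<psi> y))
              / (\<bar>real_of_ereal (\<psi> y)\<bar> ^ \<sigma> * ln \<bar>exp 1 * real_of_ereal (\<psi> y)\<bar> powr (1 + \<epsilon>)))
       absolutely_integrable_on (snd \<kappa> ` V))}"

text \<open>Direct limit (groups are written multiplicatively) over the directed preorder
  \<open>r\<close> on \<open>I\<close> with transition maps \<open>f i k : G i \<rightarrow> G k\<close>.\<close>
definition dlim_class ::
    "'i set \<Rightarrow> ('i \<Rightarrow> 'i \<Rightarrow> bool) \<Rightarrow> ('i \<Rightarrow> 'b monoid) \<Rightarrow> ('i \<Rightarrow> 'i \<Rightarrow> 'b \<Rightarrow> 'b)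
     \<Rightarrow> 'i \<Rightarrow> 'b \<Rightarrow> ('i \<times> 'b) set" where
  "dlim_class I r G f i a = {(j, b). j \<in> I \<and> b \<in> carrier (G j) \<and>
     (\<exists>k\<in>I. r i k \<and> r j k \<and> f i k a = f j k b)}"

definition dlim ::
    "'i set \<Rightarrow> ('i \<Rightarrow> 'i \<Rightarrow> bool) \<Rightarrow> ('i \<Rightarrow> 'b monoid) \<Rightarrow> ('i \<Rightarrow> 'i \<Rightarrow> 'b \<Rightarrow> 'b)
     \<Rightarrow> ('i \<times> 'b) set monoid" where
  "dlim I r G f = \<lparr>
     carrier = {dlim_class I r G f i a | i a. i \<in> I \<and> a \<in> carrier (G i)},
     monoid.mult = (\<lambda>A B. {p. \<exists>(i, a)\<in>A. \<exists>(j, b)\<in>B. \<exists>k\<in>I. r i k \<and> r j k \<and>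
        p \<in> dlim_class I r G f k (f i k a \<otimes>\<^bsub>G k\<^esub> f j k b)}),
     one = {p. \<exists>i\<in>I. p \<in> dlim_class I r G f i \<one>\<^bsub>G i\<^esub>}\<rparr>"

text \<open>The map into the direct limit of \<open>G', f'\<close> induced by maps \<open>h i : G i \<rightarrow> G' i\<close>.\<close>
definition dlim_map ::
    "'i set \<Rightarrow> ('i \<Rightarrow> 'i \<Rightarrow> bool) \<Rightarrow> ('i \<Rightarrow> 'c monoid) \<Rightarrow> ('i \<Rightarrow> 'i \<Rightarrow> 'c \<Rightarrow> 'c)
     \<Rightarrow> ('i \<Rightarrow> 'b \<Rightarrow> 'c) \<Rightarrow> ('i \<times> 'b) set \<Rightarrow> ('i \<times> 'c) set" where
  "dlim_map I r G' f' h A = {p. \<exists>(i, a)\<in>A. p \<in> dlim_class I r G' f' i (h i a)}"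

text \<open>The map into \<open>G' Mod H'\<close> induced by \<open>h\<close>.\<close>
definition mod_map :: "'c monoid \<Rightarrow> 'c set \<Rightarrow> ('b \<Rightarrow> 'c) \<Rightarrow> 'b set \<Rightarrow> 'c set" where
  "mod_map G' H' h A = (\<Union>a\<in>A. H' #>\<^bsub>G'\<^esub> h a)"

text \<open>Only open sets matter; \<open>Res P U V\<close> is the restriction from \<open>U\<close> to \<open>V \<subseteq> U\<close>.\<close>
record ('a, 'b) presheaf =
  Sec :: "'a set \<Rightarrow> 'b monoid"
  Res :: "'a set \<Rightarrow> 'a set \<Rightarrow> 'b \<Rightarrow> 'b"

definition nhds_of :: "'a::topological_space \<Rightarrow> 'a set set" where
  "nhds_of x = {U. open U \<and> x \<in> U}"

definition stalk :: "('a::topological_space, 'b) presheaf \<Rightarrow> 'a \<Rightarrow> ('a set \<times> 'b) set monoid" where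
  "stalk P x = dlim (nhds_of x) (\<lambda>U V. V \<subseteq> U) (Sec P) (Res P)"

definition germ :: "('a::topological_space, 'b) presheaf \<Rightarrow> 'a \<Rightarrow> 'a set \<Rightarrow> 'b \<Rightarrow> ('a set \<times> 'b) set" where
  "germ P x U t = dlim_class (nhds_of x) (\<lambda>U V. V \<subseteq> U) (Sec P) (Res P) U t"

definition sheafify ::
    "('a::topological_space, 'b) presheaf \<Rightarrow> ('a, 'a \<Rightarrow> ('a set \<times> 'b) set) presheaf" where
  "sheafify P = \<lparr>
     Sec = (\<lambda>U. \<lparr>
       carrier = {g \<in> extensional U. \<forall>x\<in>U. \<exists>V. open V \<and> x \<in> V \<and> V \<subseteq> U \<and>
         (\<exists>t\<in>carrier (Sec P V). \<forall>y\<in>V. g y = germ P y V t)},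
       monoid.mult = (\<lambda>g h. \<lambda>x\<in>U. g x \<otimes>\<^bsub>stalk P x\<^esub> h x),
       one = (\<lambda>x\<in>U. \<one>\<^bsub>stalk P x\<^esub>)\<rparr>),
     Res = (\<lambda>U V g. restrict g V)\<rparr>"

definition quotient_presheaf ::
    "('a, 'b) presheaf \<Rightarrow> ('a, 'b) presheaf \<Rightarrow> ('a, 'b set) presheaf" where
  "quotient_presheaf P Q = \<lparr>
     Sec = (\<lambda>U. Sec P U Mod carrier (Sec Q U)),
     Res = (\<lambda>U V. mod_map (Sec P V) (carrier (Sec Q V)) (Res P U V))\<rparr>"

definition quotient_sheaf ::
    "('a::topological_space, 'b) presheaf \<Rightarrow> ('a, 'b) presheaf
     \<Rightarrow> ('a, 'a \<Rightarrow> ('a set \<times> 'b set) set) presheaf" where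
  "quotient_sheaf P Q = sheafify (quotient_presheaf P Q)"

text \<open>The morphism \<open>P/Q \<rightarrow> P'/Q'\<close> of quotient sheaves induced by \<open>\<eta> : P \<rightarrow> P'\<close>.\<close>
definition quotient_sheaf_map ::
    "('a::topological_space, 'c) presheaf \<Rightarrow> ('a, 'c) presheaf \<Rightarrow> ('a set \<Rightarrow> 'b \<Rightarrow> 'c)
     \<Rightarrow> 'a set \<Rightarrow> ('a \<Rightarrow> ('a set \<times> 'b set) set) \<Rightarrow> 'a \<Rightarrow> ('a set \<times> 'c set) set" where
  "quotient_sheaf_map P' Q' \<eta> U g = (\<lambda>x\<in>U.
     dlim_map (nhds_of x) (\<lambda>U V. V \<subseteq> U)
       (Sec (quotient_presheaf P' Q')) (Res (quotient_presheaf P' Q'))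
       (\<lambda>V. mod_map (Sec P' V) (carrier (Sec Q' V)) (\<eta> V)) (g x))"

text \<open>\<open>H\<^sup>q(X, P)\<close> is Cech cohomology, i.e. the direct limit over all open covers. As in Godement's book
  covers are indexed by the points of the space, with \<open>x \<in> \<U> x\<close>; such covers are cofinal and form
  a directed set with canonical refinement maps. On paracompact Hausdorff spaces this is sheaf
  cohomology.\<close>

definition coverings :: "('a::topological_space \<Rightarrow> 'a set) set" where
  "coverings = {\<U>. \<forall>x. open (\<U> x) \<and> x \<in> \<U> x}"

definition refined_by :: "('a \<Rightarrow> 'a set) \<Rightarrow> ('a \<Rightarrow> 'a set) \<Rightarrow> bool" where
  "refined_by \<U> \<V> \<longleftrightarrow> (\<forall>x. \<V> x \<subseteq> \<U> x)"

definition cap :: "('a \<Rightarrow> 'a set) \<Rightarrow> 'a list \<Rightarrow> 'a set" where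
  "cap \<U> xs = (\<Inter>x\<in>set xs. \<U> x)"

definition omit :: "nat \<Rightarrow> 'a list \<Rightarrow> 'a list" where
  "omit k xs = take k xs @ drop (Suc k) xs"

definition simplices :: "nat \<Rightarrow> 'a list set" where
  "simplices q = {xs. length xs = Suc q}"

definition cochains ::
    "('a, 'b) presheaf \<Rightarrow> ('a \<Rightarrow> 'a set) \<Rightarrow> nat \<Rightarrow> ('a list \<Rightarrow> 'b) monoid" where
  "cochains P \<U> q = product_group (simplices q) (\<lambda>xs. Sec P (cap \<U> xs))"

definition cech_d ::
    "('a, 'b) presheaf \<Rightarrow> ('a \<Rightarrow> 'a set) \<Rightarrow> nat \<Rightarrow> ('a list \<Rightarrow> 'b) \<Rightarrow> 'a list \<Rightarrow> 'b" where
  "cech_d P \<U> q c = (\<lambda>xs\<in>simplices (Suc q).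
     finprod (Sec P (cap \<U> xs))
       (\<lambda>k. Res P (cap \<U> (omit k xs)) (cap \<U> xs) (c (omit k xs)) [^]\<^bsub>Sec P (cap \<U> xs)\<^esub> ((- 1 :: int) ^ k))
       {..Suc q})"

definition cocycles :: "('a, 'b) presheaf \<Rightarrow> ('a \<Rightarrow> 'a set) \<Rightarrow> nat \<Rightarrow> ('a list \<Rightarrow> 'b) set" where
  "cocycles P \<U> q = kernel (cochains P \<U> q) (cochains P \<U> (Suc q)) (cech_d P \<U> q)"

primrec coboundaries :: "('a, 'b) presheaf \<Rightarrow> ('a \<Rightarrow> 'a set) \<Rightarrow> nat \<Rightarrow> ('a list \<Rightarrow> 'b) set" where
  "coboundaries P \<U> 0 = {\<one>\<^bsub>cochains P \<U> 0\<^esub>}"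
| "coboundaries P \<U> (Suc q) = cech_d P \<U> q ` carrier (cochains P \<U> q)"

definition cech_group ::
    "('a, 'b) presheaf \<Rightarrow> nat \<Rightarrow> ('a \<Rightarrow> 'a set) \<Rightarrow> ('a list \<Rightarrow> 'b) set monoid" where
  "cech_group P q \<U> = (cochains P \<U> q)\<lparr>carrier := cocycles P \<U> q\<rparr> Mod coboundaries P \<U> q"

definition cech_refine ::
    "('a, 'b) presheaf \<Rightarrow> nat \<Rightarrow> ('a \<Rightarrow> 'a set) \<Rightarrow> ('a \<Rightarrow> 'a set)
     \<Rightarrow> ('a list \<Rightarrow> 'b) set \<Rightarrow> ('a list \<Rightarrow> 'b) set" where
  "cech_refine P q \<U> \<V> = mod_map (cochains P \<V> q) (coboundaries P \<V> q)
     (\<lambda>c. \<lambda>xs\<in>simplices q. Res P (cap \<U> xs) (cap \<V> xs) (c xs))"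

type_synonym ('a, 'b) cohomology_class = "(('a \<Rightarrow> 'a set) \<times> ('a list \<Rightarrow> 'b) set) set"

definition cohomology ::
    "nat \<Rightarrow> ('a::topological_space, 'b) presheaf \<Rightarrow> ('a, 'b) cohomology_class monoid" where
  "cohomology q P = dlim coverings refined_by (cech_group P q) (cech_refine P q)"

text \<open>The map \<open>H\<^sup>q(X, P) \<rightarrow> H\<^sup>q(X, P')\<close> induced by \<open>\<eta> : P \<rightarrow> P'\<close>.\<close>
definition cohomology_map ::
    "nat \<Rightarrow> ('a::topological_space, 'c) presheaf \<Rightarrow> ('a set \<Rightarrow> 'b \<Rightarrow> 'c)
     \<Rightarrow> ('a, 'b) cohomology_class \<Rightarrow> ('a, 'c) cohomology_class" where
  "cohomology_map q P' \<eta> = dlim_map coverings refined_by (cech_group P' q) (cech_refine P' q)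
     (\<lambda>\<U>. mod_map (cochains P' \<U> q) (coboundaries P' \<U> q)
        (\<lambda>c. \<lambda>xs\<in>simplices q. \<eta> (cap \<U> xs) (c xs)))"

text \<open>The sheaf \<open>L \<otimes> J\<close> for a line bundle \<open>L\<close> and an ideal sheaf \<open>J\<close>, i.e. the subsheaf \<open>J\<cdot>L\<close> of
  \<open>L\<close> (the two agree since \<open>L\<close> is locally free).\<close>
definition twisted ::
    "('a::t2_space, 'n::finite) chart set \<Rightarrow> ('a, 'i) line_bundle \<Rightarrow> 'a ideal_sheaf
     \<Rightarrow> ('a, 'i \<Rightarrow> 'a \<Rightarrow> complex) presheaf" where
  "twisted X L J = \<lparr>
     Sec = (\<lambda>U. \<lparr>
       carrier = {t \<in> hol_sections X L U. \<forall>i\<in>idx L. \<forall>x\<in>U \<inter> dom L i. t i \<in> J x},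
       monoid.mult = (\<lambda>t u i x. t i x + u i x),
       one = (\<lambda>i x. 0)\<rparr>),
     Res = (\<lambda>U V t i x. if x \<in> V then t i x else 0)\<rparr>"

definition KDF ::
    "('a::t2_space, 'n::finite) chart set \<Rightarrow> ('a, 'd) line_bundle \<Rightarrow> ('a, 'i) line_bundle
     \<Rightarrow> ('a, (('a, 'n) chart \<times> 'd) \<times> 'i) line_bundle" where
  "KDF X LD F = lb_tensor (lb_tensor (canonical_bundle X) LD) F"

definition "sh_I X LD F \<phi>F = twisted X (KDF X LD F) (multiplier_ideal X F \<phi>F)"

definition "sh_J X LD \<psi> F \<phi>F \<sigma> = twisted X (KDF X LD F) (adjoint_ideal X \<psi> F \<phi>F \<sigma>)"

definition "sh_IM X LD F \<phi>F M \<phi>M =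
  twisted X (lb_tensor (KDF X LD F) M) (multiplier_ideal X (lb_tensor F M) (tensor_pot \<phi>F \<phi>M))"

definition "sh_JM X LD \<psi> F \<phi>F M \<phi>M \<sigma> =
  twisted X (lb_tensor (KDF X LD F) M) (adjoint_ideal X \<psi> (lb_tensor F M) (tensor_pot \<phi>F \<phi>M) \<sigma>)"

text \<open>The twists of \<open>\<R>\<^sub>\<sigma>(\<phi>\<^sub>F) = \<J>\<^sub>\<sigma>(\<phi>\<^sub>F)/\<J>\<^bsub>\<sigma>-1\<^esub>(\<phi>\<^sub>F)\<close>, of
  \<open>\<I>(\<phi>\<^sub>F)/\<J>\<^bsub>\<sigma>-1\<^esub>(\<phi>\<^sub>F)\<close> and of \<open>M \<otimes> \<I>(\<phi>\<^sub>F+\<phi>\<^sub>M)/\<J>\<^bsub>\<sigma>-1\<^esub>(\<phi>\<^sub>F+\<phi>\<^sub>M)\<close>; only used for \<open>\<sigma> \<ge> 1\<close>.\<close>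
definition "sh_R X LD \<psi> F \<phi>F \<sigma> =
  quotient_sheaf (sh_J X LD \<psi> F \<phi>F \<sigma>) (sh_J X LD \<psi> F \<phi>F (\<sigma> - 1))"

definition "sh_IQ X LD \<psi> F \<phi>F \<sigma> =
  quotient_sheaf (sh_I X LD F \<phi>F) (sh_J X LD \<psi> F \<phi>F (\<sigma> - 1))"

definition "sh_IMQ X LD \<psi> F \<phi>F M \<phi>M \<sigma> =
  quotient_sheaf (sh_IM X LD F \<phi>F M \<phi>M) (sh_JM X LD \<psi> F \<phi>F M \<phi>M (\<sigma> - 1))"

text \<open>\<open>\<iota>\<^sub>\<sigma>\<close> and \<open>\<tau>\<^sub>\<sigma>\<close> are induced by inclusions, hence the identity on sections. Since
  \<^const>\<open>cohomology_map\<close> only refers to the target sheaf, \<open>\<iota>\<^sub>\<sigma>\<close> does not mention \<open>\<sigma>\<close>; its source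
  is recorded in \<open>ker_iota\<close>.\<close>
definition "iota X LD F \<phi>F q = cohomology_map q (sh_I X LD F \<phi>F) (\<lambda>U t. t)"

definition "mult_map X LD F \<phi>F M \<phi>M s q =
  cohomology_map q (sh_IM X LD F \<phi>F M \<phi>M) (\<lambda>U. tensor_sec s)"

definition "mu X LD F \<phi>F M \<phi>M s q = mult_map X LD F \<phi>F M \<phi>M s q \<circ> iota X LD F \<phi>F q"

definition "tau X LD \<psi> F \<phi>F \<sigma> q = cohomology_map q (sh_IQ X LD \<psi> F \<phi>F \<sigma>)
  (quotient_sheaf_map (sh_I X LD F \<phi>F) (sh_J X LD \<psi> F \<phi>F (\<sigma> - 1)) (\<lambda>U t. t))"

definition "nu X LD \<psi> F \<phi>F M \<phi>M s \<sigma> q =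
  cohomology_map q (sh_IMQ X LD \<psi> F \<phi>F M \<phi>M \<sigma>)
    (quotient_sheaf_map (sh_IM X LD F \<phi>F M \<phi>M) (sh_JM X LD \<psi> F \<phi>F M \<phi>M (\<sigma> - 1)) (\<lambda>U. tensor_sec s))
  \<circ> tau X LD \<psi> F \<phi>F \<sigma> q"

definition "ker_iota X LD \<psi> F \<phi>F \<sigma> q =
  kernel (cohomology q (sh_J X LD \<psi> F \<phi>F \<sigma>)) (cohomology q (sh_I X LD F \<phi>F)) (iota X LD F \<phi>F q)"

definition "ker_mu X LD \<psi> F \<phi>F M \<phi>M s \<sigma> q =
  kernel (cohomology q (sh_J X LD \<psi> F \<phi>F \<sigma>)) (cohomology q (sh_IM X LD F \<phi>F M \<phi>M))
    (mu X LD F \<phi>F M \<phi>M s q)"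

definition "ker_tau X LD \<psi> F \<phi>F \<sigma> q =
  kernel (cohomology q (sh_R X LD \<psi> F \<phi>F \<sigma>)) (cohomology q (sh_IQ X LD \<psi> F \<phi>F \<sigma>))
    (tau X LD \<psi> F \<phi>F \<sigma> q)"

definition "ker_nu X LD \<psi> F \<phi>F M \<phi>M s \<sigma> q =
  kernel (cohomology q (sh_R X LD \<psi> F \<phi>F \<sigma>)) (cohomology q (sh_IMQ X LD \<psi> F \<phi>F M \<phi>M \<sigma>))
    (nu X LD \<psi> F \<phi>F M \<phi>M s \<sigma> q)"

end

theory Submission
  imports Defs "HOL-Complex_Analysis.Conformal_Mappings"
begin

text \<open>A class in the image of \<open>H\<^sup>q(\<J>\<^sub>\<sigma>)\<close> that is killed by \<open>\<otimes> s\<close> has, by \<open>ker \<nu>\<^sub>\<sigma> = ker \<tau>\<^sub>\<sigma>\<close>, trivial image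
  in \<open>H\<^sup>q(\<I>/\<J>\<^bsub>\<sigma>-1\<^esub>)\<close>. By exactness it comes from \<open>H\<^sup>q(\<J>\<^bsub>\<sigma>-1\<^esub>)\<close>, and one descends to \<open>\<sigma> = 0\<close>, where
  \<open>ker \<mu>\<^sub>0 = ker \<iota>\<^sub>0\<close> applies. The only exactness needed is at the middle term; on a compact Hausdorff
  space it holds for Cech cohomology since a cochain of the quotient lifts after refining the cover.

  The induction reaches \<open>\<I>\<close> because \<open>\<J>\<^sub>\<sigma> = \<I>\<close> as soon as at most \<open>\<sigma>\<close> components of \<open>D\<close> meet at each point.
  In snc coordinates the poles of \<open>\<phi>\<^sub>F\<close> do not involve the coordinates normal to \<open>D\<close>, so by Fubini
  and the sub-mean value inequality in the normal variables the claim reduces to the integrability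
  of \<open>\<Prod> |z\<^sub>k|\<^sup>-\<^sup>2 / (|\<psi>|\<^sup>\<sigma> (log |e \<psi>|)\<^bsup>1+\<epsilon>\<^esup>)\<close>. The components of \<open>D\<close> through a point intersect in a
  submanifold whose connected components are lc centres, so their number is at most \<open>\<sigma>\<^sub>m\<^sub>l\<^sub>c\<close>.

  For smooth potentials all multiplier ideals are trivial, and multiplication by the transported
  section of \<open>F\<^sup>m\<close>, followed by division by the isomorphism \<open>\<theta>\<close>, is multiplication by \<open>s\<close>.\<close>

section \<open>Direct limits\<close>

text \<open>What shapes the proof is the lifting of a cochain of a quotient sheaf. Covers are
  indexed by all points, so there are infinitely many simplices, whereas a neighbourhood can be
  shrunk only finitely often. Hence each point x is sent to a vertex r x from a finite set, and
  (x_0,...,x_p) is lifted through (r x_0,...,r x_p). The direct limit, however, refines by the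
  identity on indices; the prism operator corrects this difference. On the analytic side charts of
  three origins meet: those of the atlas, those adapted to the components of D, and those adapted to
  D together with the poles. For integrability a local Lipschitz bound takes the place of the
  Jacobian. No relation is given between the two kinds of adapted charts, so the hyperplanes of one
  have to be matched with the components seen in the other. The logarithm matters only at the end of
  the integration: each normal variable lowers the power of |psi| by one, and only the last
  integral, of 1/(t (log e t)^(1+eps)), is borderline.\<close>

locale directed_system =
 fixes I :: "'i set" and r :: "'i => 'i => bool" and G :: "'i => 'b monoid"
  and f :: "'i => 'i => 'b => 'b"
 assumes refl: "i \<in> I ==> r i i"
  and trans: "i \<in> I ==> j \<in> I ==> k \<in> I ==> r i j ==> r j k ==> r i k"
  and dir: "i \<in> I ==> j \<in> I ==> \<exists>k\<in>I. r i k \<and> r j k"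
  and maps: "i \<in> I ==> k \<in> I ==> r i k ==> a \<in> carrier (G i) ==> f i k a \<in> carrier (G k)"
  and comp: "i \<in> I ==> j \<in> I ==> k \<in> I ==> r i j ==> r j k ==> a \<in> carrier (G i) ==>
   f j k (f i j a) = f i k a"
begin

abbreviation "cl \<equiv> dlim_class I r G f"

lemma mem_cl_iff:
 "(j, b) \<in> cl i a \<longleftrightarrow> j \<in> I \<and> b \<in> carrier (G j) \<and> (\<exists>k\<in>I. r i k \<and> r j k \<and> f i k a = f j k b)"
 by (simp add: dlim_class_def)

lemma self_mem_cl: "i \<in> I ==> a \<in> carrier (G i) ==> (i, a) \<in> cl i a"
 using refl by (auto simp: mem_cl_iff)

text \<open>Transitivity of eventual equality: the witnesses \<open>k\<close> and \<open>m\<close>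
  are pushed to a common \<open>n\<close>, where \<open>comp\<close> joins the two equalities into
  one between images of \<open>a\<close> and \<open>c\<close>.\<close>

lemma cl_subset:
 assumes i: "i \<in> I" "a \<in> carrier (G i)" and j: "(j, b) \<in> cl i a"
 shows "cl j b \<subseteq> cl i a"
proof
 fix p assume "p \<in> cl j b"
 then obtain l c where p: "p = (l, c)" and "(l, c) \<in> cl j b" by (cases p) auto
 then obtain k where l: "l \<in> I" "c \<in> carrier (G l)" "k \<in> I" "r j k" "r l k" "f j k b = f l k c"
  by (auto simp: mem_cl_iff)
 from j obtain m where m: "j \<in> I" "b \<in> carrier (G j)" "m \<in> I" "r i m" "r j m" "f i m a = f j m b"
  by (auto simp: mem_cl_iff)
 obtain n where n: "n \<in> I" "r k n" "r m n" using dir l(3) m(3) by blast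
 have "f i n a = f m n (f i m a)" using comp[of i m n a] i m n by simp
 also have "\<dots> = f j n b" using comp[of j m n b] m n by simp
 also have "\<dots> = f k n (f j k b)" using comp[of j k n b] l m n by simp
 also have "\<dots> = f l n c" using comp[of l k n c] l n by simp
 finally have "f i n a = f l n c" .
 moreover have "r i n" using trans[of i m n] i m n by simp
 moreover have "r l n" using trans[of l k n] l n by simp
 ultimately show "p \<in> cl i a" using p l n by (auto simp: mem_cl_iff)
qed

lemma cl_eq_iff:
 assumes "i \<in> I" "a \<in> carrier (G i)" "j \<in> I" "b \<in> carrier (G j)"
 shows "cl i a = cl j b \<longleftrightarrow> (\<exists>k\<in>I. r i k \<and> r j k \<and> f i k a = f j k b)"
proof
 assume "cl i a = cl j b"
 then have "(j, b) \<in> cl i a" using self_mem_cl assms by auto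
 then show "\<exists>k\<in>I. r i k \<and> r j k \<and> f i k a = f j k b" by (auto simp: mem_cl_iff)
next
 assume *: "\<exists>k\<in>I. r i k \<and> r j k \<and> f i k a = f j k b"
 then have "(j, b) \<in> cl i a" using assms by (auto simp: mem_cl_iff)
 moreover have "(i, a) \<in> cl j b" using * assms by (auto simp: mem_cl_iff)
 ultimately show "cl i a = cl j b" using cl_subset[of i a j b] cl_subset[of j b i a] assms by simp
qed

lemma cl_res:
 assumes "i \<in> I" "a \<in> carrier (G i)" "k \<in> I" "r i k"
 shows "cl k (f i k a) = cl i a"
proof -
 have "f k k (f i k a) = f i k a" using assms comp[of i k k a] refl[of k] by simp
 then show ?thesis using cl_eq_iff[of k "f i k a" i a] assms refl[of k] maps[of i k a] by blast
qed

lemma dlim_carrier: "carrier (dlim I r G f) = {cl i a | i a. i \<in> I \<and> a \<in> carrier (G i)}"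
 by (simp add: dlim_def)

lemma cl_in_carrier: "i \<in> I ==> a \<in> carrier (G i) ==> cl i a \<in> carrier (dlim I r G f)"
 by (auto simp: dlim_carrier)

text \<open>The unit of \<open>dlim\<close> is a union over all indices; it is one class because any
  two units meet at a common index. The facts about units are hypotheses here because the cohomology
  limit is interpreted as a \<open>directed_system\<close> without group axioms.\<close>

lemma dlim_one:
 assumes one: "\<And>i. i \<in> I ==> \<one>\<^bsub>G i\<^esub> \<in> carrier (G i)"
  and fone: "\<And>i k. i \<in> I ==> k \<in> I ==> r i k ==> f i k \<one>\<^bsub>G i\<^esub> = \<one>\<^bsub>G k\<^esub>"
  and i: "i \<in> I"
 shows "\<one>\<^bsub>dlim I r G f\<^esub> = cl i \<one>\<^bsub>G i\<^esub>"
proof -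
 have "cl j \<one>\<^bsub>G j\<^esub> = cl i \<one>\<^bsub>G i\<^esub>" if j: "j \<in> I" for j

 proof -
  obtain k where k: "k \<in> I" "r j k" "r i k" using dir[OF j i] by blast
  have "f j k \<one>\<^bsub>G j\<^esub> = f i k \<one>\<^bsub>G i\<^esub>" using fone[of j k] fone[of i k] k i j by simp
  then show ?thesis using cl_eq_iff[OF j one[OF j] i one[OF i]] k by blast
 qed
 then have "j \<in> I ==> p \<in> cl j \<one>\<^bsub>G j\<^esub> \<longleftrightarrow> p \<in> cl i \<one>\<^bsub>G i\<^esub>" for j p by (simp only:)
 then have "{p. \<exists>j\<in>I. p \<in> cl j \<one>\<^bsub>G j\<^esub>} = cl i \<one>\<^bsub>G i\<^esub>" using i by blast
 then show ?thesis by (simp add: dlim_def)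
qed

lemma dlim_map_cl:
 assumes "directed_system I r G' f'"
  and h: "\<And>i a. i \<in> I ==> a \<in> carrier (G i) ==> h i a \<in> carrier (G' i)"
  and hf: "\<And>i k a. i \<in> I ==> k \<in> I ==> r i k ==> a \<in> carrier (G i) ==> h k (f i k a) = f' i k (h i a)"
  and i: "i \<in> I" "a \<in> carrier (G i)"
 shows "dlim_map I r G' f' h (cl i a) = dlim_class I r G' f' i (h i a)"
proof -
 interpret D': directed_system I r G' f' by fact
 have "D'.cl j (h j b) = D'.cl i (h i a)" if jb: "(j, b) \<in> cl i a" for j b
 proof -
  obtain k where k: "j \<in> I" "b \<in> carrier (G j)" "k \<in> I" "r i k" "r j k" "f i k a = f j k b"
   using jb by (auto simp: mem_cl_iff)
  then have "f' i k (h i a) = f' j k (h j b)" using hf[of i k a] hf[of j k b] i k by simp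
  then show ?thesis using D'.cl_eq_iff[OF k(1) h[OF k(1,2)] i(1) h[OF i]] k by metis
 qed
 then have "(j, b) \<in> cl i a ==> p \<in> D'.cl j (h j b) \<longleftrightarrow> p \<in> D'.cl i (h i a)" for j b p by (simp only:)
 then show ?thesis using self_mem_cl[OF i] unfolding dlim_map_def by blast
qed

end

text \<open>Serves the stalks, whose group law enters the sheafification. For cohomology,
  differences of classes are formed on the level of cochains instead.\<close>

locale directed_groups = directed_system I r G f
 for I :: "'i set" and r and G :: "'i => 'b monoid" and f +
 assumes grp: "i \<in> I ==> comm_group (G i)"
  and hom: "i \<in> I ==> k \<in> I ==> r i k ==> f i k \<in> hom (G i) (G k)"
  and ne: "I \<noteq> {}"
begin

lemma grp': "i \<in> I ==> group (G i)" "i \<in> I ==> monoid (G i)"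
 using grp comm_group.axioms(2) group.is_monoid by blast+

lemma f_mult: "i \<in> I ==> k \<in> I ==> r i k ==> a \<in> carrier (G i) ==> b \<in> carrier (G i) ==>
 f i k (a \<otimes>\<^bsub>G i\<^esub> b) = f i k a \<otimes>\<^bsub>G k\<^esub> f i k b"
 using hom by (auto simp: hom_def)

lemma f_one: "i \<in> I ==> k \<in> I ==> r i k ==> f i k \<one>\<^bsub>G i\<^esub> = \<one>\<^bsub>G k\<^esub>"
 using hom grp' by (metis hom_one)

lemma dlim_one_cl: "i \<in> I ==> \<one>\<^bsub>dlim I r G f\<^esub> = cl i \<one>\<^bsub>G i\<^esub>"
 by (rule dlim_one) (simp_all add: f_one monoid.one_closed grp')

lemma mult_closed: "i \<in> I ==> a \<in> carrier (G i) ==> b \<in> carrier (G i) ==> a \<otimes>\<^bsub>G i\<^esub> b \<in> carrier (G i)"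
 using grp' monoid.m_closed by metis

text \<open>The product in \<open>dlim\<close> is a union over all representatives and all common
  indices. Any two choices agree at \<open>n'\<close>, which lies above both target indices and
  above the witnesses of the two equivalences, so the union is a single class.\<close>

lemma dlim_mult:
 assumes i: "i \<in> I" "a \<in> carrier (G i)" and j: "j \<in> I" "b \<in> carrier (G j)"
  and k: "k \<in> I" "r i k" "r j k"
 shows "cl i a \<otimes>\<^bsub>dlim I r G f\<^esub> cl j b = cl k (f i k a \<otimes>\<^bsub>G k\<^esub> f j k b)"
proof -
 have "cl k' (f i' k' a' \<otimes>\<^bsub>G k'\<^esub> f j' k' b') = cl k (f i k a \<otimes>\<^bsub>G k\<^esub> f j k b)"
  if "(i', a') \<in> cl i a" "(j', b') \<in> cl j b" and k': "k' \<in> I" "r i' k'" "r j' k'" for i' a' j' b' k'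
 proof -
  from that obtain m where m: "i' \<in> I" "a' \<in> carrier (G i')" "m \<in> I" "r i m" "r i' m" "f i m a = f i' m a'"
   by (auto simp: mem_cl_iff)
  from that obtain n where n: "j' \<in> I" "b' \<in> carrier (G j')" "n \<in> I" "r j n" "r j' n" "f j n b = f j' n b'"
   by (auto simp: mem_cl_iff)
  obtain l where l: "l \<in> I" "r k l" "r k' l" using dir k k' by blast
  obtain l' where l': "l' \<in> I" "r m l'" "r n l'" using dir m n by blast
  obtain n' where n': "n' \<in> I" "r l n'" "r l' n'" using dir l l' by blast
  have r: "r k n'" "r k' n'" "r m n'" "r n n'" 
   using trans[of k l n'] trans[of k' l n'] trans[of m l' n'] trans[of n l' n'] n' l l' k k' m n by auto
  have r': "r i' n'" "r j' n'" "r i n'" "r j n'"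
   using trans[of i' m n'] trans[of j' n n'] trans[of i m n'] trans[of j n n'] r n' i j m n by auto
  have "f k' n' (f i' k' a' \<otimes>\<^bsub>G k'\<^esub> f j' k' b') = f i' n' a' \<otimes>\<^bsub>G n'\<^esub> f j' n' b'"

   using k' m n n' r r' maps[of i' k' a'] maps[of j' k' b'] comp[of i' k' n' a'] comp[of j' k' n' b']
   by (subst f_mult) auto
  also have "f i' n' a' = f i n' a" using comp[of i' m n' a'] comp[of i m n' a] m n' r i by simp
  also have "f j' n' b' = f j n' b" using comp[of j' n n' b'] comp[of j n n' b] n n' r j by simp
  also have "f i n' a \<otimes>\<^bsub>G n'\<^esub> f j n' b = f k n' (f i k a \<otimes>\<^bsub>G k\<^esub> f j k b)"
   
   using i j k n' r r' maps[of i k a] maps[of j k b] comp[of i k n' a] comp[of j k n' b]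
   by (subst f_mult) auto
  finally show ?thesis

   using cl_eq_iff[of k' "f i' k' a' \<otimes>\<^bsub>G k'\<^esub> f j' k' b'" k "f i k a \<otimes>\<^bsub>G k\<^esub> f j k b"]
    n' r k k' m n i j maps[of i' k' a'] maps[of j' k' b'] maps[of i k a] maps[of j k b]
    mult_closed[of k'] mult_closed[of k] by blast
 qed
 note * = this
 have self: "(i, a) \<in> cl i a" "(j, b) \<in> cl j b" using self_mem_cl i j by auto
 have m: "cl i a \<otimes>\<^bsub>dlim I r G f\<^esub> cl j b = {p. \<exists>i' a' j' b' k'. (i', a') \<in> cl i a \<and> (j', b') \<in> cl j b \<and>
   k' \<in> I \<and> r i' k' \<and> r j' k' \<and> p \<in> cl k' (f i' k' a' \<otimes>\<^bsub>G k'\<^esub> f j' k' b')}"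
  unfolding dlim_def monoid.simps Bex_def split_paired_Ex case_prod_conv by blast
 show ?thesis
 proof (intro subset_antisym subsetI)
  fix p assume "p \<in> cl i a \<otimes>\<^bsub>dlim I r G f\<^esub> cl j b"
  then obtain i' a' j' b' k' where p: "(i', a') \<in> cl i a" "(j', b') \<in> cl j b" "k' \<in> I" "r i' k'" "r j' k'"
   "p \<in> cl k' (f i' k' a' \<otimes>\<^bsub>G k'\<^esub> f j' k' b')" unfolding m by blast
  then show "p \<in> cl k (f i k a \<otimes>\<^bsub>G k\<^esub> f j k b)" using *[OF p(1-5)] by (simp only:)
 next
  fix p assume "p \<in> cl k (f i k a \<otimes>\<^bsub>G k\<^esub> f j k b)"
  then show "p \<in> cl i a \<otimes>\<^bsub>dlim I r G f\<^esub> cl j b" unfolding m using self k by blast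
 qed
qed

lemma dlim_mult_same:
 "k \<in> I ==> a \<in> carrier (G k) ==> b \<in> carrier (G k) ==>
 cl k a \<otimes>\<^bsub>dlim I r G f\<^esub> cl k b = cl k (a \<otimes>\<^bsub>G k\<^esub> b)"
 using dlim_mult[of k a k b k] cl_res[of k "a \<otimes>\<^bsub>G k\<^esub> b" k] refl[of k] mult_closed
 by (simp add: f_mult)

lemma common_index:
 assumes "x \<in> carrier (dlim I r G f)" "i \<in> I"
 obtains k a where "k \<in> I" "r i k" "a \<in> carrier (G k)" "x = cl k a"
proof -
 obtain j b where "x = cl j b" "j \<in> I" "b \<in> carrier (G j)" using assms by (auto simp: dlim_carrier)
 moreover then obtain k where "k \<in> I" "r i k" "r j k" using dir assms by blast
 ultimately show ?thesis using that[of k "f j k b"] cl_res[of j b k] maps[of j k b] by simp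
qed

lemma common_index2:
 assumes "x \<in> carrier (dlim I r G f)" "y \<in> carrier (dlim I r G f)" "i \<in> I"
 obtains k a b where "k \<in> I" "r i k" "a \<in> carrier (G k)" "b \<in> carrier (G k)" "x = cl k a" "y = cl k b"
proof -
 obtain j a where j: "j \<in> I" "r i j" "a \<in> carrier (G j)" "x = cl j a"
  using common_index assms by blast
 obtain k b where k: "k \<in> I" "r j k" "b \<in> carrier (G k)" "y = cl k b"
  using common_index assms j by blast
 show ?thesis using that[of k "f j k a" b] j k cl_res[of j a k] maps[of j k a] trans[of i j k] assms by simp
qed

text \<open>Every axiom involves at most three classes, which have representatives at one index
  \<open>k\<close>; there it is an axiom of \<open>G k\<close>.\<close>

lemma comm_group_dlim: "comm_group (dlim I r G f)"
proof (rule comm_groupI)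
 obtain i0 where i0: "i0 \<in> I" using ne by blast
 let ?D = "dlim I r G f"
 show "\<one>\<^bsub>?D\<^esub> \<in> carrier ?D"
  using i0 dlim_one_cl[OF i0] cl_in_carrier[OF i0] grp'(2)[OF i0] by (simp add: monoid.one_closed)
 fix x assume x: "x \<in> carrier ?D"
 obtain i a where i: "i \<in> I" "a \<in> carrier (G i)" "x = cl i a" using common_index x i0 by metis
 show "\<one>\<^bsub>?D\<^esub> \<otimes>\<^bsub>?D\<^esub> x = x"
  using i grp' by (simp add: dlim_one_cl[of i] dlim_mult_same monoid.one_closed monoid.l_one)
 show "\<exists>y\<in>carrier ?D. y \<otimes>\<^bsub>?D\<^esub> x = \<one>\<^bsub>?D\<^esub>"
  using i grp'
  by (intro bexI[of _ "cl i (inv\<^bsub>G i\<^esub> a)"])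
   (auto simp: dlim_one_cl[of i] dlim_mult_same group.l_inv cl_in_carrier)
 fix y assume y: "y \<in> carrier ?D"
 obtain j b c where j: "j \<in> I" "b \<in> carrier (G j)" "c \<in> carrier (G j)" "x = cl j b" "y = cl j c"
  using common_index2 x y i0 by metis
 show "x \<otimes>\<^bsub>?D\<^esub> y \<in> carrier ?D"
  using j by (simp add: dlim_mult_same cl_in_carrier mult_closed)
 show "x \<otimes>\<^bsub>?D\<^esub> y = y \<otimes>\<^bsub>?D\<^esub> x"
  using j grp by (simp add: dlim_mult_same comm_groupE(4))
 fix z assume z: "z \<in> carrier ?D"
 obtain k a where k: "k \<in> I" "r j k" "a \<in> carrier (G k)" "z = cl k a"
  using common_index z j by metis
 define b' c' where "b' = f j k b" and "c' = f j k c"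
 have "b' \<in> carrier (G k)" "c' \<in> carrier (G k)" "x = cl k b'" "y = cl k c'"
  using j k maps[of j k] cl_res[of j _ k] b'_def c'_def by auto
 then show "x \<otimes>\<^bsub>?D\<^esub> y \<otimes>\<^bsub>?D\<^esub> z = x \<otimes>\<^bsub>?D\<^esub> (y \<otimes>\<^bsub>?D\<^esub> z)"
  using k grp' by (simp add: dlim_mult_same mult_closed monoid.m_assoc)
qed

end

lemma dlim_map_hom:
 assumes "directed_groups I r G f" "directed_groups I r G' f'"
  and h: "\<And>i. i \<in> I ==> h i \<in> hom (G i) (G' i)"
  and hf: "\<And>i k a. i \<in> I ==> k \<in> I ==> r i k ==> a \<in> carrier (G i) ==> h k (f i k a) = f' i k (h i a)"
 shows "dlim_map I r G' f' h \<in> hom (dlim I r G f) (dlim I r G' f')"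
proof -
 interpret D: directed_groups I r G f by fact
 interpret D': directed_groups I r G' f' by fact
 have c: "h i a \<in> carrier (G' i)" if "i \<in> I" "a \<in> carrier (G i)" for i a
  using h that by (auto simp: hom_def)
 have m: "dlim_map I r G' f' h (D.cl i a) = D'.cl i (h i a)" if "i \<in> I" "a \<in> carrier (G i)" for i a
  using D.dlim_map_cl[OF D'.directed_system_axioms, of h] c hf that by blast
 obtain i0 where i0: "i0 \<in> I" using D.ne by blast
 show ?thesis
 proof (rule homI)
  fix x assume "x \<in> carrier (dlim I r G f)"
  then show "dlim_map I r G' f' h x \<in> carrier (dlim I r G' f')"
   using m c D'.cl_in_carrier by (auto simp: D.dlim_carrier)
  fix y assume "y \<in> carrier (dlim I r G f)"
  then obtain k a b where k: "k \<in> I" "a \<in> carrier (G k)" "b \<in> carrier (G k)" "x = D.cl k a" "y = D.cl k b"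
   using D.common_index2 i0 \<open>x \<in> _\<close> by metis
  then show "dlim_map I r G' f' h (x \<otimes>\<^bsub>dlim I r G f\<^esub> y) =
    dlim_map I r G' f' h x \<otimes>\<^bsub>dlim I r G' f'\<^esub> dlim_map I r G' f' h y"
   using h[of k] c by (simp add: D.dlim_mult_same D'.dlim_mult_same m D.mult_closed hom_mult)
 qed
qed

section \<open>Quotients of commutative groups\<close>

text \<open>\<open>mod_map\<close> is a union of cosets; since \<open>h\<close> maps
  \<open>H\<close> into \<open>H'\<close>, all elements of one coset contribute the same
  coset.\<close>

lemma mod_map_coset:
 assumes K: "comm_group K" "comm_group K'" and H: "subgroup H K" "subgroup H' K'"
  and h: "h \<in> hom K K'" "h ` H \<subseteq> H'" and c: "c \<in> carrier K"
 shows "mod_map K' H' h (H #>\<^bsub>K\<^esub> c) = H' #>\<^bsub>K'\<^esub> h c"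
proof -
 interpret K: comm_group K by fact
 interpret K': comm_group K' by fact
 interpret H: subgroup H K by fact
 interpret H': subgroup H' K' by fact
 have "H' #>\<^bsub>K'\<^esub> h (b \<otimes>\<^bsub>K\<^esub> c) = H' #>\<^bsub>K'\<^esub> h c" if "b \<in> H" for b
 proof -
  have "h (b \<otimes>\<^bsub>K\<^esub> c) = h b \<otimes>\<^bsub>K'\<^esub> h c" using h c that H.subset by (auto simp: hom_def)
  moreover have "h b \<in> H'" "h c \<in> carrier K'" using h c that by (auto simp: hom_def)
  ultimately show ?thesis

   using K'.coset_mult_assoc[of H' "h b" "h c"] K'.coset_join2[of "h b" H'] H(2) H'.subset by auto
 qed
 moreover have "H \<noteq> {}" using H.one_closed by blast
 ultimately show ?thesis unfolding mod_map_def r_coset_def[of K] by auto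
qed

lemma coset_eq_iff:
 assumes "comm_group K" "subgroup H K" "a \<in> carrier K" "b \<in> carrier K"
 shows "H #>\<^bsub>K\<^esub> a = H #>\<^bsub>K\<^esub> b \<longleftrightarrow> a \<otimes>\<^bsub>K\<^esub> inv\<^bsub>K\<^esub> b \<in> H"
proof -
 interpret K: comm_group K by fact
 interpret H: subgroup H K by fact
 show ?thesis
 proof
  assume "H #>\<^bsub>K\<^esub> a = H #>\<^bsub>K\<^esub> b"
  then have "a \<in> H #>\<^bsub>K\<^esub> b" using K.rcos_self assms by blast
  then show "a \<otimes>\<^bsub>K\<^esub> inv\<^bsub>K\<^esub> b \<in> H" using H.rcos_module_imp[OF K.is_group assms(4)] by simp
 next
  assume "a \<otimes>\<^bsub>K\<^esub> inv\<^bsub>K\<^esub> b \<in> H"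
  then have "a \<in> H #>\<^bsub>K\<^esub> b" using H.rcos_module_rev[OF K.is_group assms(4,3)] by simp
  then show "H #>\<^bsub>K\<^esub> a = H #>\<^bsub>K\<^esub> b" using K.repr_independence assms by metis
 qed
qed

lemma coset_eq_self_iff:
 assumes "comm_group K" "subgroup H K" "a \<in> carrier K"
 shows "H #>\<^bsub>K\<^esub> a = H \<longleftrightarrow> a \<in> H"
proof -
 interpret K: comm_group K by fact
 show ?thesis using K.coset_join1[of H a] K.coset_join2[of a H] assms by (auto intro: subgroup.subset)
qed

lemma comm_group_product_group:
 assumes "\<And>i. i \<in> I ==> comm_group (G i)"
 shows "comm_group (product_group I G)"
proof (rule group.group_comm_groupI)
 show "group (product_group I G)" using assms comm_group.axioms(2) by (auto intro!: product_group)
qed (use assms in \<open>auto simp: restrict_def PiE_def Pi_def fun_eq_iff comm_groupE(4)\<close>)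

lemma hom_finprod:
 assumes "comm_group G" "comm_group H" "h \<in> hom G H" "finite A" "g \<in> A \<rightarrow> carrier G"
 shows "h (finprod G g A) = finprod H (\<lambda>x. h (g x)) A"
proof -
 interpret G: comm_group G by fact
 interpret H: comm_group H by fact
 show ?thesis using assms(4,5)
 proof (induction A)
  case empty
  then show ?case using hom_one[OF assms(3) G.is_group H.is_group] by simp
 next
  case (insert x A)
  then have "h (g x) \<in> carrier H" "(\<lambda>x. h (g x)) \<in> A \<rightarrow> carrier H"
   using assms(3) by (auto simp: hom_def)
  moreover have "g x \<in> carrier G" "g \<in> A \<rightarrow> carrier G" using insert by auto
  ultimately show ?case using insert assms(3) by (simp add: hom_mult)
 qed
qed

section \<open>Presheaves of commutative groups\<close>

locale ab_presheaf =
 fixes P :: "('a::topological_space, 'b) presheaf"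
 assumes grp: "open U ==> comm_group (Sec P U)"
  and res_hom: "open U ==> open V ==> V \<subseteq> U ==> Res P U V \<in> hom (Sec P U) (Sec P V)"
  and res_id: "open U ==> t \<in> carrier (Sec P U) ==> Res P U U t = t"
  and res_comp: "open U ==> open V ==> open W ==> W \<subseteq> V ==> V \<subseteq> U ==> t \<in> carrier (Sec P U) ==>
   Res P V W (Res P U V t) = Res P U W t"
begin

lemma grp': "open U ==> group (Sec P U)"
 using grp comm_group.axioms(2) by blast

lemma res_closed: "open U ==> open V ==> V \<subseteq> U ==> t \<in> carrier (Sec P U) ==> Res P U V t \<in> carrier (Sec P V)"
 using res_hom by (auto simp: hom_def)

end

definition presheaf_hom ::
  "('a::topological_space, 'b) presheaf => ('a, 'c) presheaf => ('a set => 'b => 'c) => bool" where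
 "presheaf_hom P P' \<eta> \<longleftrightarrow> (\<forall>U. open U \<longrightarrow> \<eta> U \<in> hom (Sec P U) (Sec P' U)) \<and>
  (\<forall>U V t. open U \<longrightarrow> open V \<longrightarrow> V \<subseteq> U \<longrightarrow> t \<in> carrier (Sec P U) \<longrightarrow>
    \<eta> V (Res P U V t) = Res P' U V (\<eta> U t))"

section \<open>Cech cochains and the coboundary\<close>

lemma open_cap: "\<U> \<in> coverings ==> open (cap \<U> xs)"
 by (auto simp: cap_def coverings_def intro!: open_INT)

lemma cap_mono: "set ys \<subseteq> set xs ==> refined_by \<U> \<V> ==> cap \<V> xs \<subseteq> cap \<U> ys"
 unfolding cap_def refined_by_def by fastforce

lemma refined_by_refl: "refined_by \<U> \<U>"
 by (simp add: refined_by_def)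

lemma refined_by_trans: "refined_by \<U> \<V> ==> refined_by \<V> \<W> ==> refined_by \<U> \<W>"
 by (auto simp: refined_by_def)

lemma set_omit: "set (omit k xs) \<subseteq> set xs"
 using set_take_subset[of k xs] set_drop_subset[of "Suc k" xs] by (auto simp: omit_def)

lemma cap_omit: "cap \<U> xs \<subseteq> cap \<U> (omit k xs)"
 by (rule cap_mono[OF set_omit refined_by_refl])

lemma omit_simplices: "xs \<in> simplices (Suc q) ==> k \<le> Suc q ==> omit k xs \<in> simplices q"
 by (auto simp: simplices_def omit_def)

lemma carrier_cochains: "carrier (cochains P \<U> q) = (\<Pi>\<^sub>E xs\<in>simplices q. carrier (Sec P (cap \<U> xs)))"
 by (simp add: cochains_def)

lemma cochainsI:
 "(\<And>xs. xs \<in> simplices q ==> c xs \<in> carrier (Sec P (cap \<U> xs))) ==>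
  (\<lambda>xs\<in>simplices q. c xs) \<in> carrier (cochains P \<U> q)"
 by (auto simp: carrier_cochains)

lemma cochainsD:
 "c \<in> carrier (cochains P \<U> q) ==> xs \<in> simplices q ==> c xs \<in> carrier (Sec P (cap \<U> xs))"
 by (auto simp: carrier_cochains PiE_def Pi_def)

lemma cochains_eqI:
 "c \<in> carrier (cochains P \<U> q) ==> c' \<in> carrier (cochains P \<U> q) ==>
  (\<And>xs. xs \<in> simplices q ==> c xs = c' xs) ==> c = c'"
 by (auto simp: carrier_cochains intro: PiE_ext)

lemma cochains_mult: "c \<otimes>\<^bsub>cochains P \<U> q\<^esub> c' = (\<lambda>xs\<in>simplices q. c xs \<otimes>\<^bsub>Sec P (cap \<U> xs)\<^esub> c' xs)"
 by (simp add: cochains_def)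

lemma cochains_one: "\<one>\<^bsub>cochains P \<U> q\<^esub> = (\<lambda>xs\<in>simplices q. \<one>\<^bsub>Sec P (cap \<U> xs)\<^esub>)"
 by (simp add: cochains_def)

text \<open>\<open>\<phi>\<close> is indexed by simplices and not by open sets, so that refinements,
  which change the cover, and morphisms of presheaves, which change the coefficients, are both
  instances.\<close>

definition cochain_map :: "('a list => 'b => 'c) => nat => ('a list => 'b) => 'a list => 'c" where
 "cochain_map \<phi> q c = (\<lambda>xs\<in>simplices q. \<phi> xs (c xs))"

lemma cochain_map_hom:
 assumes "\<And>xs. \<phi> xs \<in> hom (Sec P (cap \<U> xs)) (Sec P' (cap \<V> xs))"
 shows "cochain_map \<phi> q \<in> hom (cochains P \<U> q) (cochains P' \<V> q)"
proof (rule homI)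
 fix c assume c: "c \<in> carrier (cochains P \<U> q)"
 show "cochain_map \<phi> q c \<in> carrier (cochains P' \<V> q)"
  unfolding cochain_map_def using cochainsD[OF c] assms by (intro cochainsI) (auto simp: hom_def)
 fix c' assume c': "c' \<in> carrier (cochains P \<U> q)"
 show "cochain_map \<phi> q (c \<otimes>\<^bsub>cochains P \<U> q\<^esub> c') =
   cochain_map \<phi> q c \<otimes>\<^bsub>cochains P' \<V> q\<^esub> cochain_map \<phi> q c'"
  using hom_mult[OF assms cochainsD[OF c] cochainsD[OF c']]
  by (auto simp: cochain_map_def cochains_mult fun_eq_iff)
qed

context ab_presheaf
begin

lemma cochains_grp: "\<U> \<in> coverings ==> comm_group (cochains P \<U> q)"
 unfolding cochains_def by (intro comm_group_product_group grp open_cap)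

lemma cochains_grp': "\<U> \<in> coverings ==> group (cochains P \<U> q)"
 using cochains_grp comm_group.axioms(2) by blast

lemma cech_term_closed:
 assumes "\<U> \<in> coverings" "c \<in> carrier (cochains P \<U> q)" "xs \<in> simplices (Suc q)"
 shows "(\<lambda>k. Res P (cap \<U> (omit k xs)) (cap \<U> xs) (c (omit k xs)) [^]\<^bsub>Sec P (cap \<U> xs)\<^esub> ((- 1 :: int) ^ k))
  \<in> {..Suc q} \<rightarrow> carrier (Sec P (cap \<U> xs))"
 using grp'[OF open_cap[OF assms(1)]] cochainsD[OF assms(2) omit_simplices[OF assms(3)]]
 by (auto intro!: group.int_pow_closed res_closed open_cap[OF assms(1)] cap_omit)

text \<open>Commutativity is what makes this work: signed powers and \<open>finprod\<close>
  distribute over products.\<close>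

lemma cech_d_hom:
 assumes U: "\<U> \<in> coverings"
 shows "cech_d P \<U> q \<in> hom (cochains P \<U> q) (cochains P \<U> (Suc q))"
proof (rule homI)
 fix c assume c: "c \<in> carrier (cochains P \<U> q)"
 show "cech_d P \<U> q c \<in> carrier (cochains P \<U> (Suc q))"
  unfolding cech_d_def
  using cech_term_closed[OF U c] grp[OF open_cap[OF U]]
  by (intro cochainsI comm_monoid.finprod_closed) (auto simp: comm_group_def)
 fix c' assume c': "c' \<in> carrier (cochains P \<U> q)"
 show "cech_d P \<U> q (c \<otimes>\<^bsub>cochains P \<U> q\<^esub> c') =
   cech_d P \<U> q c \<otimes>\<^bsub>cochains P \<U> (Suc q)\<^esub> cech_d P \<U> q c'"
 proof (rule ext)
  fix xs
  show "cech_d P \<U> q (c \<otimes>\<^bsub>cochains P \<U> q\<^esub> c') xs =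
   (cech_d P \<U> q c \<otimes>\<^bsub>cochains P \<U> (Suc q)\<^esub> cech_d P \<U> q c') xs"
  proof (cases "xs \<in> simplices (Suc q)")
   case True
   let ?S = "Sec P (cap \<U> xs)"
   interpret S: comm_group ?S using grp[OF open_cap[OF U]] .
   let ?t = "\<lambda>c k. Res P (cap \<U> (omit k xs)) (cap \<U> xs) (c (omit k xs)) [^]\<^bsub>?S\<^esub> ((- 1 :: int) ^ k)"
   have "?t (c \<otimes>\<^bsub>cochains P \<U> q\<^esub> c') k = ?t c k \<otimes>\<^bsub>?S\<^esub> ?t c' k" if "k \<le> Suc q" for k
   proof -
    have o: "omit k xs \<in> simplices q" using omit_simplices[OF True that] .
    note cs = cochainsD[OF c o] cochainsD[OF c' o]
    note r = res_hom[OF open_cap[OF U] open_cap[OF U] cap_omit[of \<U> xs k]]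
    show ?thesis using o cs r
     by (simp add: cochains_mult hom_mult[OF r] S.int_pow_distrib hom_in_carrier[OF r])
   qed
   then have "finprod ?S (?t (c \<otimes>\<^bsub>cochains P \<U> q\<^esub> c')) {..Suc q} =
     finprod ?S (\<lambda>k. ?t c k \<otimes>\<^bsub>?S\<^esub> ?t c' k) {..Suc q}"
    using cech_term_closed[OF U c True] cech_term_closed[OF U c' True]
    by (intro S.finprod_cong') (auto simp: Pi_def)
   also have "\<dots> = finprod ?S (?t c) {..Suc q} \<otimes>\<^bsub>?S\<^esub> finprod ?S (?t c') {..Suc q}"
    using cech_term_closed[OF U c True] cech_term_closed[OF U c' True] by (intro S.finprod_multf)
   finally show ?thesis using True by (simp only: cech_d_def cochains_mult restrict_apply if_True)
  qed (simp add: cech_d_def cochains_mult)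
 qed
qed

lemma cech_d_group_hom: "\<U> \<in> coverings ==> group_hom (cochains P \<U> q) (cochains P \<U> (Suc q)) (cech_d P \<U> q)"
 by (simp add: group_hom_def group_hom_axioms_def cech_d_hom cochains_grp')

lemma subgroup_cocycles: "\<U> \<in> coverings ==> subgroup (cocycles P \<U> q) (cochains P \<U> q)"
 unfolding cocycles_def by (rule group_hom.subgroup_kernel[OF cech_d_group_hom])

lemma cocycles_cochains: "c \<in> cocycles P \<U> q ==> c \<in> carrier (cochains P \<U> q)"
 by (simp add: cocycles_def kernel_def)

lemma subgroup_coboundaries: "\<U> \<in> coverings ==> subgroup (coboundaries P \<U> q) (cochains P \<U> q)"
 by (cases q) (simp_all add: group.triv_subgroup cochains_grp' group_hom.img_is_subgroup[OF cech_d_group_hom])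

lemma carrier_cech_group:
 "carrier (cech_group P q \<U>) = {coboundaries P \<U> q #>\<^bsub>cochains P \<U> q\<^esub> c | c. c \<in> cocycles P \<U> q}"
 by (auto simp: cech_group_def FactGroup_def RCOSETS_def r_coset_def)

lemma one_cech_group: "\<one>\<^bsub>cech_group P q \<U>\<^esub> = coboundaries P \<U> q"
 by (simp add: cech_group_def FactGroup_def)

end

text \<open>Two situations share this locale: \<open>P' = P\<close> with a finer cover, and one
  cover with a morphism of presheaves. Compatibility with the restriction from a face to the
  simplex, \<open>\<phi>_res\<close>, is what commutation with \<open>cech_d\<close>
  requires.\<close>

locale cochain_morphism = P: ab_presheaf P + P': ab_presheaf P'
 for P :: "('a::topological_space, 'b) presheaf" and P' :: "('a, 'c) presheaf" +
 fixes \<U> \<V> :: "'a => 'a set" and \<phi> :: "'a list => 'b => 'c"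
 assumes U: "\<U> \<in> coverings" and V: "\<V> \<in> coverings"
  and \<phi>_hom: "\<phi> xs \<in> hom (Sec P (cap \<U> xs)) (Sec P' (cap \<V> xs))"
  and \<phi>_res: "t \<in> carrier (Sec P (cap \<U> (omit k xs))) ==>
   \<phi> xs (Res P (cap \<U> (omit k xs)) (cap \<U> xs) t) =
   Res P' (cap \<V> (omit k xs)) (cap \<V> xs) (\<phi> (omit k xs) t)"
begin

lemma map_hom: "cochain_map \<phi> q \<in> hom (cochains P \<U> q) (cochains P' \<V> q)"
 by (rule cochain_map_hom[OF \<phi>_hom])

lemma map_closed: "c \<in> carrier (cochains P \<U> q) ==> cochain_map \<phi> q c \<in> carrier (cochains P' \<V> q)"
 using map_hom by (auto simp: hom_def)

lemma map_one: "cochain_map \<phi> q \<one>\<^bsub>cochains P \<U> q\<^esub> = \<one>\<^bsub>cochains P' \<V> q\<^esub>"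
 by (rule hom_one[OF map_hom P.cochains_grp'[OF U] P'.cochains_grp'[OF V]])

lemma cech_d_map:
 assumes c: "c \<in> carrier (cochains P \<U> q)"
 shows "cech_d P' \<V> q (cochain_map \<phi> q c) = cochain_map \<phi> (Suc q) (cech_d P \<U> q c)"
proof (rule ext)
 fix xs
 show "cech_d P' \<V> q (cochain_map \<phi> q c) xs = cochain_map \<phi> (Suc q) (cech_d P \<U> q c) xs"
 proof (cases "xs \<in> simplices (Suc q)")
  case True
  let ?S = "Sec P (cap \<U> xs)" and ?S' = "Sec P' (cap \<V> xs)"
  let ?r = "\<lambda>k. Res P (cap \<U> (omit k xs)) (cap \<U> xs) (c (omit k xs))"
  let ?r' = "\<lambda>k. Res P' (cap \<V> (omit k xs)) (cap \<V> xs) (cochain_map \<phi> q c (omit k xs))"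
  have G: "comm_group ?S" "comm_group ?S'" using P.grp P'.grp open_cap U V by blast+
  have G': "group ?S" "group ?S'" using P.grp' P'.grp' open_cap U V by blast+
  have t: "\<phi> xs (?r k [^]\<^bsub>?S\<^esub> ((- 1 :: int) ^ k)) = ?r' k [^]\<^bsub>?S'\<^esub> ((- 1 :: int) ^ k)" if "k \<le> Suc q" for k
  proof -
   have o: "omit k xs \<in> simplices q" using omit_simplices[OF True that] .
   have m: "?r k \<in> carrier ?S"
    by (rule P.res_closed[OF open_cap[OF U] open_cap[OF U] cap_omit cochainsD[OF c o]])
   show ?thesis
    using hom_int_pow[OF \<phi>_hom m G', of "(-1)^k"] \<phi>_res[OF cochainsD[OF c o]] o
    by (simp add: cochain_map_def)
  qed
  have "\<phi> xs (finprod ?S (\<lambda>k. ?r k [^]\<^bsub>?S\<^esub> ((- 1 :: int) ^ k)) {..Suc q}) =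
    finprod ?S' (\<lambda>k. \<phi> xs (?r k [^]\<^bsub>?S\<^esub> ((- 1 :: int) ^ k))) {..Suc q}"
   by (rule hom_finprod[OF G \<phi>_hom]) (use P.cech_term_closed[OF U c True] in auto)
  also have "\<dots> = finprod ?S' (\<lambda>k. ?r' k [^]\<^bsub>?S'\<^esub> ((- 1 :: int) ^ k)) {..Suc q}"
   using t P'.cech_term_closed[OF V map_closed[OF c] True] G(2)
   by (intro comm_monoid.finprod_cong') (auto simp: comm_group_def)
  finally show ?thesis using True by (simp only: cech_d_def restrict_apply cochain_map_def if_True)
 qed (simp add: cech_d_def cochain_map_def)
qed

lemma cocycles_map: "c \<in> cocycles P \<U> q ==> cochain_map \<phi> q c \<in> cocycles P' \<V> q"
 using cech_d_map map_closed hom_one[OF cochain_map_hom[OF \<phi>_hom] P.cochains_grp'[OF U] P'.cochains_grp'[OF V]]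
 by (auto simp: cocycles_def kernel_def)

lemma coboundaries_map: "c \<in> coboundaries P \<U> q ==> cochain_map \<phi> q c \<in> coboundaries P' \<V> q"
proof (cases q)
 case 0
 assume "c \<in> coboundaries P \<U> q"
 then show ?thesis using map_one[of q] 0 by simp
next
 case (Suc p)
 assume "c \<in> coboundaries P \<U> q"
 then obtain e where e: "e \<in> carrier (cochains P \<U> p)" "c = cech_d P \<U> p e" using Suc by auto
 show ?thesis
  using cech_d_map[OF e(1)] map_closed[OF e(1)] e(2) Suc by (metis coboundaries.simps(2) imageI)
qed

lemma mod_map_cochain:
 assumes "c \<in> carrier (cochains P \<U> q)"
 shows "mod_map (cochains P' \<V> q) (coboundaries P' \<V> q) (cochain_map \<phi> q) (coboundaries P \<U> q #>\<^bsub>cochains P \<U> q\<^esub> c)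
  = coboundaries P' \<V> q #>\<^bsub>cochains P' \<V> q\<^esub> cochain_map \<phi> q c"
 using coboundaries_map assms
 by (intro mod_map_coset P.cochains_grp P'.cochains_grp U V P.subgroup_coboundaries P'.subgroup_coboundaries map_hom) auto

end

section \<open>Cohomology classes and induced maps\<close>

definition cochain_res ::
  "('a, 'b) presheaf => ('a => 'a set) => ('a => 'a set) => nat => ('a list => 'b) => 'a list => 'b" where
 "cochain_res P \<U> \<V> = cochain_map (\<lambda>xs. Res P (cap \<U> xs) (cap \<V> xs))"

definition cech_class ::
  "('a::topological_space, 'b) presheaf => nat => ('a => 'a set) => ('a list => 'b) => ('a, 'b) cohomology_class" where
 "cech_class P q \<U> c = dlim_class coverings refined_by (cech_group P q) (cech_refine P q) \<U>
  (coboundaries P \<U> q #>\<^bsub>cochains P \<U> q\<^esub> c)"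

lemma coverings_Int: "\<U> \<in> coverings ==> \<V> \<in> coverings ==> (\<lambda>x. \<U> x \<inter> \<V> x) \<in> coverings"
 by (auto simp: coverings_def)

lemma presheaf_hom_cochain_morphism:
 assumes "ab_presheaf P" "ab_presheaf P'" "presheaf_hom P P' \<eta>" "\<U> \<in> coverings"
 shows "cochain_morphism P P' \<U> \<U> (\<lambda>xs. \<eta> (cap \<U> xs))"
 using assms open_cap[OF assms(4)] cap_omit[of \<U>]
 by (auto simp: cochain_morphism_def cochain_morphism_axioms_def presheaf_hom_def)

context ab_presheaf
begin

lemma refine_morphism:
 assumes "\<U> \<in> coverings" "\<V> \<in> coverings" "refined_by \<U> \<V>"
 shows "cochain_morphism P P \<U> \<V> (\<lambda>xs. Res P (cap \<U> xs) (cap \<V> xs))"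
proof (intro cochain_morphism.intro cochain_morphism_axioms.intro ab_presheaf_axioms assms)
 fix xs and k :: nat
 note o = open_cap[OF assms(1)] open_cap[OF assms(2)]
 have c: "cap \<V> xs \<subseteq> cap \<U> xs" for xs using cap_mono[OF _ assms(3)] by blast
 show "Res P (cap \<U> xs) (cap \<V> xs) \<in> hom (Sec P (cap \<U> xs)) (Sec P (cap \<V> xs))"
  using o c by (intro res_hom)
 fix t assume t: "t \<in> carrier (Sec P (cap \<U> (omit k xs)))"
 show "Res P (cap \<U> xs) (cap \<V> xs) (Res P (cap \<U> (omit k xs)) (cap \<U> xs) t) =
   Res P (cap \<V> (omit k xs)) (cap \<V> xs) (Res P (cap \<U> (omit k xs)) (cap \<V> (omit k xs)) t)"
  using res_comp[OF o(1) o(1) o(2) c cap_omit t] res_comp[OF o(1) o(2) o(2) cap_omit c t] by simp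
qed

lemmas res_closed' = cochain_morphism.map_closed[OF refine_morphism, folded cochain_res_def]
 and res_cocycles = cochain_morphism.cocycles_map[OF refine_morphism, folded cochain_res_def]
 and res_coboundaries = cochain_morphism.coboundaries_map[OF refine_morphism, folded cochain_res_def]
 and res_cochain_hom = cochain_morphism.map_hom[OF refine_morphism, folded cochain_res_def]
 and cech_d_res = cochain_morphism.cech_d_map[OF refine_morphism, folded cochain_res_def]

lemma cech_refine_coset:
 assumes "\<U> \<in> coverings" "\<V> \<in> coverings" "refined_by \<U> \<V>" "c \<in> carrier (cochains P \<U> q)"
 shows "cech_refine P q \<U> \<V> (coboundaries P \<U> q #>\<^bsub>cochains P \<U> q\<^esub> c) =
  coboundaries P \<V> q #>\<^bsub>cochains P \<V> q\<^esub> cochain_res P \<U> \<V> q c"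
 using cochain_morphism.mod_map_cochain[OF refine_morphism[OF assms(1-3)] assms(4)]
 by (simp add: cech_refine_def cochain_res_def cochain_map_def[abs_def])

lemma cochain_res_comp:
 assumes "\<U> \<in> coverings" "\<V> \<in> coverings" "\<W> \<in> coverings" "refined_by \<U> \<V>" "refined_by \<V> \<W>"
  and c: "c \<in> carrier (cochains P \<U> q)"
 shows "cochain_res P \<V> \<W> q (cochain_res P \<U> \<V> q c) = cochain_res P \<U> \<W> q c"
proof -
 have "cap \<V> xs \<subseteq> cap \<U> xs" "cap \<W> xs \<subseteq> cap \<V> xs" for xs using cap_mono assms by blast+
 then show ?thesis
  using cochainsD[OF c] open_cap[OF assms(1)] open_cap[OF assms(2)] open_cap[OF assms(3)]
  by (auto simp: cochain_res_def cochain_map_def fun_eq_iff intro!: res_comp)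
qed

text \<open>Directedness comes from pointwise intersection of two covers. As every cover is indexed
  by the whole space, refinement maps are canonical and compose strictly.\<close>

sublocale coh: directed_system coverings refined_by "cech_group P q" "cech_refine P q" for q
proof
 fix \<U> \<V> \<W> :: "'a => 'a set" and a
 show "refined_by \<U> \<U>" by (rule refined_by_refl)
 show "refined_by \<U> \<V> ==> refined_by \<V> \<W> ==> refined_by \<U> \<W>" by (rule refined_by_trans)
 show "\<U> \<in> coverings ==> \<V> \<in> coverings ==> \<exists>\<W>\<in>coverings. refined_by \<U> \<W> \<and> refined_by \<V> \<W>"
  using coverings_Int[of \<U> \<V>] by (intro bexI[of _ "\<lambda>x. \<U> x \<inter> \<V> x"]) (auto simp: refined_by_def)
 assume UV: "\<U> \<in> coverings" "\<V> \<in> coverings" "refined_by \<U> \<V>" and a: "a \<in> carrier (cech_group P q \<U>)"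
 then obtain c where c: "c \<in> cocycles P \<U> q" "a = coboundaries P \<U> q #>\<^bsub>cochains P \<U> q\<^esub> c"
  by (auto simp: carrier_cech_group)
 note c' = cocycles_cochains[OF c(1)]
 show "cech_refine P q \<U> \<V> a \<in> carrier (cech_group P q \<V>)"
  using res_cocycles[OF UV c(1)] cech_refine_coset[OF UV c'] c(2) by (auto simp: carrier_cech_group)
 assume W: "\<W> \<in> coverings" "refined_by \<V> \<W>"
 show "cech_refine P q \<V> \<W> (cech_refine P q \<U> \<V> a) = cech_refine P q \<U> \<W> a"
  using cech_refine_coset[OF UV c'] cech_refine_coset[OF UV(2) W res_closed'[OF UV c']] c(2)
   cech_refine_coset[OF UV(1) W(1) refined_by_trans[OF UV(3) W(2)] c'] cochain_res_comp[OF UV(1,2) W(1) UV(3) W(2) c']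
  by simp
qed

lemma coset_carrier: "c \<in> cocycles P \<U> q ==> coboundaries P \<U> q #>\<^bsub>cochains P \<U> q\<^esub> c \<in> carrier (cech_group P q \<U>)"
 by (auto simp: carrier_cech_group)

lemma carrier_cohomology:
 "carrier (cohomology q P) = {cech_class P q \<U> c | \<U> c. \<U> \<in> coverings \<and> c \<in> cocycles P \<U> q}"
 unfolding cohomology_def coh.dlim_carrier cech_class_def carrier_cech_group by blast

text \<open>Equality in the limit becomes a condition on cochains: on some common refinement the
  quotient is a coboundary. This lets later arguments work with cochains instead of limits of
  cosets.\<close>

lemma cech_class_eq_iff:
 assumes "\<U> \<in> coverings" "c \<in> cocycles P \<U> q" "\<U>' \<in> coverings" "c' \<in> cocycles P \<U>' q"
 shows "cech_class P q \<U> c = cech_class P q \<U>' c' \<longleftrightarrow>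
  (\<exists>\<W>\<in>coverings. refined_by \<U> \<W> \<and> refined_by \<U>' \<W> \<and>
   cochain_res P \<U> \<W> q c \<otimes>\<^bsub>cochains P \<W> q\<^esub> inv\<^bsub>cochains P \<W> q\<^esub> cochain_res P \<U>' \<W> q c' \<in> coboundaries P \<W> q)"
proof -
 have "cech_refine P q \<U> \<W> (coboundaries P \<U> q #>\<^bsub>cochains P \<U> q\<^esub> c) =
   cech_refine P q \<U>' \<W> (coboundaries P \<U>' q #>\<^bsub>cochains P \<U>' q\<^esub> c') \<longleftrightarrow>
   cochain_res P \<U> \<W> q c \<otimes>\<^bsub>cochains P \<W> q\<^esub> inv\<^bsub>cochains P \<W> q\<^esub> cochain_res P \<U>' \<W> q c' \<in> coboundaries P \<W> q"
  if W: "\<W> \<in> coverings" "refined_by \<U> \<W>" "refined_by \<U>' \<W>" for \<W>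
  using assms W cocycles_cochains
  by (simp add: cech_refine_coset coset_eq_iff[OF cochains_grp subgroup_coboundaries] res_closed')
 then show ?thesis
  unfolding cech_class_def coh.cl_eq_iff[OF assms(1) coset_carrier[OF assms(2)] assms(3) coset_carrier[OF assms(4)]]
  by blast
qed

lemma cech_class_res:
 assumes "\<U> \<in> coverings" "c \<in> cocycles P \<U> q" "\<V> \<in> coverings" "refined_by \<U> \<V>"
 shows "cech_class P q \<V> (cochain_res P \<U> \<V> q c) = cech_class P q \<U> c"
 using coh.cl_res[OF assms(1) coset_carrier[OF assms(2)] assms(3,4)] cech_refine_coset[OF assms(1,3,4) cocycles_cochains[OF assms(2)]]
 by (simp add: cech_class_def)

lemma cohomology_one: "\<U> \<in> coverings ==> \<one>\<^bsub>cohomology q P\<^esub> = cech_class P q \<U> \<one>\<^bsub>cochains P \<U> q\<^esub>"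
proof -
 assume U: "\<U> \<in> coverings"
 have e: "coboundaries P \<U> q #>\<^bsub>cochains P \<U> q\<^esub> \<one>\<^bsub>cochains P \<U> q\<^esub> = coboundaries P \<U> q" if "\<U> \<in> coverings" for \<U>
  using group.coset_mult_one[OF cochains_grp'[OF that]] subgroup.subset[OF subgroup_coboundaries[OF that]] by blast
 have c: "\<one>\<^bsub>cochains P \<U> q\<^esub> \<in> cocycles P \<U> q" if "\<U> \<in> coverings" for \<U>
  using subgroup.one_closed[OF subgroup_cocycles[OF that]] .
 have "\<one>\<^bsub>cohomology q P\<^esub> = coh.cl q \<U> \<one>\<^bsub>cech_group P q \<U>\<^esub>"
  unfolding cohomology_def
 proof (rule coh.dlim_one[OF _ _ U])
  fix \<V> :: "'a => 'a set" assume V: "\<V> \<in> coverings"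
  show "\<one>\<^bsub>cech_group P q \<V>\<^esub> \<in> carrier (cech_group P q \<V>)"
   using coset_carrier[OF c[OF V]] e[OF V] by (simp add: one_cech_group)
  fix \<W> :: "'a => 'a set" assume W: "\<W> \<in> coverings" "refined_by \<V> \<W>"
  show "cech_refine P q \<V> \<W> \<one>\<^bsub>cech_group P q \<V>\<^esub> = \<one>\<^bsub>cech_group P q \<W>\<^esub>"
   using cech_refine_coset[OF V W cocycles_cochains[OF c[OF V]]] e V W
    hom_one[OF res_cochain_hom[OF V W] cochains_grp'[OF V] cochains_grp'[OF W(1)]]
   by (simp add: one_cech_group)
 qed
 then show ?thesis using e[OF U] by (simp add: cech_class_def one_cech_group)
qed

lemma cech_class_eq_one_iff:
 assumes "\<U> \<in> coverings" "c \<in> cocycles P \<U> q"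
 shows "cech_class P q \<U> c = \<one>\<^bsub>cohomology q P\<^esub> \<longleftrightarrow>
  (\<exists>\<W>\<in>coverings. refined_by \<U> \<W> \<and> cochain_res P \<U> \<W> q c \<in> coboundaries P \<W> q)"
proof -
 have c: "\<one>\<^bsub>cochains P \<U> q\<^esub> \<in> cocycles P \<U> q"
  using subgroup.one_closed[OF subgroup_cocycles[OF assms(1)]] .
 have "cochain_res P \<U> \<W> q c \<otimes>\<^bsub>cochains P \<W> q\<^esub> inv\<^bsub>cochains P \<W> q\<^esub> cochain_res P \<U> \<W> q \<one>\<^bsub>cochains P \<U> q\<^esub>
   = cochain_res P \<U> \<W> q c" if W: "\<W> \<in> coverings" "refined_by \<U> \<W>" for \<W>
 proof -
  interpret W: group "cochains P \<W> q" by (rule cochains_grp'[OF W(1)])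
  have "cochain_res P \<U> \<W> q \<one>\<^bsub>cochains P \<U> q\<^esub> = \<one>\<^bsub>cochains P \<W> q\<^esub>"
   by (rule hom_one[OF res_cochain_hom[OF assms(1) W] cochains_grp'[OF assms(1)] cochains_grp'[OF W(1)]])
  then show ?thesis using res_closed'[OF assms(1) W cocycles_cochains[OF assms(2)]] by simp
 qed
 then show ?thesis
  unfolding cohomology_one[OF assms(1)] cech_class_eq_iff[OF assms assms(1) c] by auto
qed

end

lemma cochain_map_res:
 assumes "presheaf_hom P P' \<eta>" "\<U> \<in> coverings" "\<W> \<in> coverings" "refined_by \<U> \<W>"
  and c: "c \<in> carrier (cochains P \<U> q)"
 shows "cochain_map (\<lambda>xs. \<eta> (cap \<W> xs)) q (cochain_res P \<U> \<W> q c) =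
  cochain_res P' \<U> \<W> q (cochain_map (\<lambda>xs. \<eta> (cap \<U> xs)) q c)"
 using assms(1) open_cap[OF assms(2)] open_cap[OF assms(3)] cap_mono[OF _ assms(4)] cochainsD[OF c]
 by (auto simp: cochain_map_def cochain_res_def presheaf_hom_def fun_eq_iff)

text \<open>Both layers of the construction, cosets and direct limit, are removed at once: the
  induced map may be computed on any representing cocycle.\<close>

lemma cohomology_map_class:
 assumes P: "ab_presheaf P" "ab_presheaf P'" and \<eta>: "presheaf_hom P P' \<eta>"
  and c: "\<U> \<in> coverings" "c \<in> cocycles P \<U> q"
 shows "cohomology_map q P' \<eta> (cech_class P q \<U> c) =
  cech_class P' q \<U> (cochain_map (\<lambda>xs. \<eta> (cap \<U> xs)) q c)"
proof -
 interpret P: ab_presheaf P by fact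
 interpret P': ab_presheaf P' by fact
 let ?h = "\<lambda>\<U>. mod_map (cochains P' \<U> q) (coboundaries P' \<U> q) (cochain_map (\<lambda>xs. \<eta> (cap \<U> xs)) q)"
 have h: "?h \<U> (coboundaries P \<U> q #>\<^bsub>cochains P \<U> q\<^esub> c) =
   coboundaries P' \<U> q #>\<^bsub>cochains P' \<U> q\<^esub> cochain_map (\<lambda>xs. \<eta> (cap \<U> xs)) q c"
  if "\<U> \<in> coverings" "c \<in> cocycles P \<U> q" for \<U> c
  by (rule cochain_morphism.mod_map_cochain[OF presheaf_hom_cochain_morphism[OF P \<eta> that(1)] P.cocycles_cochains[OF that(2)]])
 have hc: "cochain_map (\<lambda>xs. \<eta> (cap \<U> xs)) q c \<in> cocycles P' \<U> q"
  if "\<U> \<in> coverings" "c \<in> cocycles P \<U> q" for \<U> c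
  using cochain_morphism.cocycles_map[OF presheaf_hom_cochain_morphism[OF P \<eta> that(1)] that(2)] .
 have "dlim_map coverings refined_by (cech_group P' q) (cech_refine P' q) ?h
   (P.coh.cl q \<U> (coboundaries P \<U> q #>\<^bsub>cochains P \<U> q\<^esub> c)) =
   P'.coh.cl q \<U> (?h \<U> (coboundaries P \<U> q #>\<^bsub>cochains P \<U> q\<^esub> c))"
 proof (rule P.coh.dlim_map_cl[OF P'.coh.directed_system_axioms _ _ c(1) P.coset_carrier[OF c(2)]])
  fix \<V> :: "'a => 'a set" and a assume V: "\<V> \<in> coverings" and a: "a \<in> carrier (cech_group P q \<V>)"
  obtain b where b: "b \<in> cocycles P \<V> q" "a = coboundaries P \<V> q #>\<^bsub>cochains P \<V> q\<^esub> b"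
   using a by (auto simp: P.carrier_cech_group)
  show "?h \<V> a \<in> carrier (cech_group P' q \<V>)"
   unfolding b(2) h[OF V b(1)] by (rule P'.coset_carrier[OF hc[OF V b(1)]])
  fix \<W> :: "'a => 'a set" assume W: "\<W> \<in> coverings" "refined_by \<V> \<W>"
  show "?h \<W> (cech_refine P q \<V> \<W> a) = cech_refine P' q \<V> \<W> (?h \<V> a)"
   unfolding b(2) h[OF V b(1)] P.cech_refine_coset[OF V W P.cocycles_cochains[OF b(1)]]
    P'.cech_refine_coset[OF V W P'.cocycles_cochains[OF hc[OF V b(1)]]]
    h[OF W(1) P.res_cocycles[OF V W b(1)]] cochain_map_res[OF \<eta> V W P.cocycles_cochains[OF b(1)]] ..
 qed
 then show ?thesis
  unfolding h[OF c] by (simp add: cohomology_map_def cech_class_def cochain_map_def[abs_def])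
qed

text \<open>Replaces a group structure on cohomology: both classes are represented on a common cover
  \<open>\<W>\<close>, and the assumption on the kernel is applied to the quotient cocycle
  \<open>e\<close>.\<close>

lemma inj_on_cohomology_map:
 assumes P: "ab_presheaf P" "ab_presheaf P'" and \<eta>: "presheaf_hom P P' \<eta>"
  and ker: "\<And>\<U> c. \<U> \<in> coverings ==> c \<in> cocycles P \<U> q ==>
   cech_class P' q \<U> (cochain_map (\<lambda>xs. \<eta> (cap \<U> xs)) q c) = \<one>\<^bsub>cohomology q P'\<^esub> ==>
   cech_class P q \<U> c = \<one>\<^bsub>cohomology q P\<^esub>"
 shows "inj_on (cohomology_map q P' \<eta>) (carrier (cohomology q P))"
proof (rule inj_onI)
 interpret P: ab_presheaf P by fact
 interpret P': ab_presheaf P' by fact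
 fix A B assume "A \<in> carrier (cohomology q P)" "B \<in> carrier (cohomology q P)"
  and eq: "cohomology_map q P' \<eta> A = cohomology_map q P' \<eta> B"
 then obtain \<U> a \<V> b where a: "\<U> \<in> coverings" "a \<in> cocycles P \<U> q" "A = cech_class P q \<U> a"
  and b: "\<V> \<in> coverings" "b \<in> cocycles P \<V> q" "B = cech_class P q \<V> b"
  by (auto simp: P.carrier_cohomology)
 obtain \<W> where W: "\<W> \<in> coverings" "refined_by \<U> \<W>" "refined_by \<V> \<W>"
  using P.coh.dir[OF a(1) b(1)] by blast
 define c where "c = cochain_res P \<U> \<W> q a"
 define d where "d = cochain_res P \<V> \<W> q b"
 let ?m = "\<lambda>\<W>. cochain_map (\<lambda>xs. \<eta> (cap \<W> xs)) q"
 have cd: "c \<in> cocycles P \<W> q" "d \<in> cocycles P \<W> q" and A: "A = cech_class P q \<W> c" and B: "B = cech_class P q \<W> d"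
  using a b W P.res_cocycles P.cech_class_res by (auto simp: c_def d_def)
 note cd' = cd[THEN P.cocycles_cochains]
 interpret W: comm_group "cochains P \<W> q" by (rule P.cochains_grp[OF W(1)])
 define e where "e = c \<otimes>\<^bsub>cochains P \<W> q\<^esub> inv\<^bsub>cochains P \<W> q\<^esub> d"
 have e: "e \<in> cocycles P \<W> q"
  using cd P.subgroup_cocycles[OF W(1)] by (auto simp: e_def intro: subgroup.m_closed subgroup.m_inv_closed)
 interpret m: cochain_morphism P P' \<W> \<W> "\<lambda>xs. \<eta> (cap \<W> xs)"
  by (rule presheaf_hom_cochain_morphism[OF P \<eta> W(1)])
 have "cech_class P' q \<W> (?m \<W> c) = cech_class P' q \<W> (?m \<W> d)"
  using eq unfolding A B cohomology_map_class[OF P \<eta> W(1) cd(1)] cohomology_map_class[OF P \<eta> W(1) cd(2)] .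
 then obtain \<W>' where W': "\<W>' \<in> coverings" "refined_by \<W> \<W>'"
  "cochain_res P' \<W> \<W>' q (?m \<W> c) \<otimes>\<^bsub>cochains P' \<W>' q\<^esub> inv\<^bsub>cochains P' \<W>' q\<^esub> cochain_res P' \<W> \<W>' q (?m \<W> d)
   \<in> coboundaries P' \<W>' q"
  using P'.cech_class_eq_iff[OF W(1) m.cocycles_map[OF cd(1)] W(1) m.cocycles_map[OF cd(2)]] by blast
 have hm: "group_hom (cochains P \<W> q) (cochains P' \<W> q) (?m \<W>)"
  using m.map_hom P.cochains_grp'[OF W(1)] P'.cochains_grp'[OF W(1)] by (simp add: group_hom_def group_hom_axioms_def)
 have hr: "group_hom (cochains P \<W> q) (cochains P \<W>' q) (cochain_res P \<W> \<W>' q)"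
   "group_hom (cochains P' \<W> q) (cochains P' \<W>' q) (cochain_res P' \<W> \<W>' q)"
  if "\<W>' \<in> coverings" "refined_by \<W> \<W>'" for \<W>'
  using P.res_cochain_hom[OF W(1) that] P'.res_cochain_hom[OF W(1) that] P.cochains_grp' P'.cochains_grp' W(1) that
  by (simp_all add: group_hom_def group_hom_axioms_def)
 have "cochain_res P' \<W> \<W>' q (?m \<W> e) \<in> coboundaries P' \<W>' q"
  using W'(3) cd' group_hom.hom_inv[OF hm] group_hom.hom_mult[OF hm]
   group_hom.hom_inv[OF hr(2)[OF W'(1,2)]] group_hom.hom_mult[OF hr(2)[OF W'(1,2)]]
   m.map_closed group.inv_closed[OF P'.cochains_grp'[OF W(1)]]
  by (simp add: e_def)
 then have "cech_class P' q \<W> (?m \<W> e) = \<one>\<^bsub>cohomology q P'\<^esub>"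
  using P'.cech_class_eq_one_iff[OF W(1) m.cocycles_map[OF e]] W' by blast
 then have "cech_class P q \<W> e = \<one>\<^bsub>cohomology q P\<^esub>" using ker[OF W(1) e] by blast
 then obtain \<W>' where W': "\<W>' \<in> coverings" "refined_by \<W> \<W>'" "cochain_res P \<W> \<W>' q e \<in> coboundaries P \<W>' q"
  using P.cech_class_eq_one_iff[OF W(1) e] by blast
 then have "cochain_res P \<W> \<W>' q c \<otimes>\<^bsub>cochains P \<W>' q\<^esub> inv\<^bsub>cochains P \<W>' q\<^esub> cochain_res P \<W> \<W>' q d
   \<in> coboundaries P \<W>' q"
  using cd' group_hom.hom_inv[OF hr(1)[OF W'(1,2)]] group_hom.hom_mult[OF hr(1)[OF W'(1,2)]]
  by (simp add: e_def)
 then show "A = B"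
  unfolding A B P.cech_class_eq_iff[OF W(1) cd(1) W(1) cd(2)] using W' by blast
qed

section \<open>Sheafification and quotient sheaves\<close>

lemma presheaf_homI:
 assumes "\<And>U. open U ==> \<eta> U \<in> hom (Sec P U) (Sec P' U)"
  and "\<And>U V t. open U ==> open V ==> V \<subseteq> U ==> t \<in> carrier (Sec P U) ==>
   \<eta> V (Res P U V t) = Res P' U V (\<eta> U t)"
 shows "presheaf_hom P P' \<eta>"
 using assms by (simp add: presheaf_hom_def)

lemma presheaf_homD:
 assumes "presheaf_hom P P' \<eta>" "open U"
 shows "\<eta> U \<in> hom (Sec P U) (Sec P' U)"
  and "t \<in> carrier (Sec P U) ==> \<eta> U t \<in> carrier (Sec P' U)"
  and "open V ==> V \<subseteq> U ==> t \<in> carrier (Sec P U) ==> \<eta> V (Res P U V t) = Res P' U V (\<eta> U t)"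
 using assms by (auto simp: presheaf_hom_def hom_def)

lemma presheaf_hom_comp:
 assumes "presheaf_hom P P' \<eta>" "presheaf_hom P' P'' \<eta>'"
 shows "presheaf_hom P P'' (\<lambda>U t. \<eta>' U (\<eta> U t))"
proof (rule presheaf_homI)
 fix U :: "'a set" assume U: "open U"
 show "(\<lambda>t. \<eta>' U (\<eta> U t)) \<in> hom (Sec P U) (Sec P'' U)"
  using hom_compose[OF presheaf_homD(1)[OF assms(1) U] presheaf_homD(1)[OF assms(2) U]] by (simp add: comp_def)
qed (use presheaf_homD(2,3)[OF assms(1)] presheaf_homD(3)[OF assms(2)] in simp)

context ab_presheaf
begin

sublocale st: directed_groups "nhds_of x" "\<lambda>U V. V \<subseteq> U" "Sec P" "Res P" for x
proof (intro directed_groups.intro directed_system.intro directed_groups_axioms.intro)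
 fix U V W :: "'a set" and a
 show "U \<in> nhds_of x ==> V \<in> nhds_of x ==> \<exists>W\<in>nhds_of x. W \<subseteq> U \<and> W \<subseteq> V"
  by (intro bexI[of _ "U \<inter> V"]) (auto simp: nhds_of_def)
 show "nhds_of x \<noteq> {}" by (auto simp: nhds_of_def intro!: exI[of _ UNIV])
qed (auto simp: nhds_of_def res_closed res_comp grp res_hom)

lemma stalk_grp: "comm_group (stalk P x)"
 unfolding stalk_def by (rule st.comm_group_dlim)

lemma germ_eq_iff:
 assumes "open U" "x \<in> U" "t \<in> carrier (Sec P U)" "open V" "x \<in> V" "t' \<in> carrier (Sec P V)"
 shows "germ P x U t = germ P x V t' \<longleftrightarrow> (\<exists>W. open W \<and> x \<in> W \<and> W \<subseteq> U \<and> W \<subseteq> V \<and> Res P U W t = Res P V W t')"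
 unfolding germ_def using assms by (subst st.cl_eq_iff) (auto simp: nhds_of_def)

lemma germ_res:
 assumes "open U" "t \<in> carrier (Sec P U)" "open V" "x \<in> V" "V \<subseteq> U"
 shows "germ P x V (Res P U V t) = germ P x U t"
 unfolding germ_def using assms by (intro st.cl_res) (auto simp: nhds_of_def)

lemma germ_closed: "open U ==> x \<in> U ==> t \<in> carrier (Sec P U) ==> germ P x U t \<in> carrier (stalk P x)"
 unfolding germ_def stalk_def by (intro st.cl_in_carrier) (auto simp: nhds_of_def)

lemma germ_mult:
 assumes "open U" "x \<in> U" "t \<in> carrier (Sec P U)" "t' \<in> carrier (Sec P U)"
 shows "germ P x U t \<otimes>\<^bsub>stalk P x\<^esub> germ P x U t' = germ P x U (t \<otimes>\<^bsub>Sec P U\<^esub> t')"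
 unfolding germ_def stalk_def using assms by (intro st.dlim_mult_same) (auto simp: nhds_of_def)

lemma germ_one: "open U ==> x \<in> U ==> \<one>\<^bsub>stalk P x\<^esub> = germ P x U \<one>\<^bsub>Sec P U\<^esub>"
 unfolding germ_def stalk_def by (intro st.dlim_one_cl) (auto simp: nhds_of_def)

lemma germ_inv:
 assumes "open U" "x \<in> U" "t \<in> carrier (Sec P U)"
 shows "inv\<^bsub>stalk P x\<^esub> germ P x U t = germ P x U (inv\<^bsub>Sec P U\<^esub> t)"
proof -
 interpret S: comm_group "stalk P x" by (rule stalk_grp)
 interpret U: comm_group "Sec P U" by (rule grp[OF assms(1)])
 show ?thesis
  using assms germ_closed[OF assms] germ_closed[OF assms(1,2) U.inv_closed[OF assms(3)]]
   germ_mult[OF assms(1,2) U.inv_closed[OF assms(3)] assms(3)] germ_one[OF assms(1,2)]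
  by (intro S.inv_equality) auto
qed

text \<open>The compatibility condition inside \<open>sheafify\<close>, named so that its stability
  under products, inverses and restriction can be treated separately.\<close>

definition locally_germ :: "'a set => ('a => ('a set \<times> 'b) set) => bool" where
 "locally_germ U g \<longleftrightarrow> (\<forall>x\<in>U. \<exists>V. open V \<and> x \<in> V \<and> V \<subseteq> U \<and> (\<exists>t\<in>carrier (Sec P V). \<forall>y\<in>V. g y = germ P y V t))"

lemma Sec_sheafify: "Sec (sheafify P) U = \<lparr>carrier = {g \<in> extensional U. locally_germ U g},
 monoid.mult = (\<lambda>g h. \<lambda>x\<in>U. g x \<otimes>\<^bsub>stalk P x\<^esub> h x), one = (\<lambda>x\<in>U. \<one>\<^bsub>stalk P x\<^esub>)\<rparr>"
 by (simp add: sheafify_def locally_germ_def)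

lemma Res_sheafify: "Res (sheafify P) U V g = restrict g V"
 by (simp add: sheafify_def)

lemma locally_germD:
 assumes "locally_germ U g" "x \<in> U"
 shows "\<exists>V t. open V \<and> x \<in> V \<and> V \<subseteq> U \<and> t \<in> carrier (Sec P V) \<and> (\<forall>y\<in>V. g y = germ P y V t)"
 using assms unfolding locally_germ_def by fast

lemma locally_germ_stalk: "locally_germ U g ==> x \<in> U ==> g x \<in> carrier (stalk P x)"
 using locally_germD[of U g x] germ_closed by fastforce

lemma locally_germ_res:
 assumes g: "locally_germ U g" and V: "open V" "V \<subseteq> U" and h: "\<And>x. x \<in> V ==> h x = g x"
 shows "locally_germ V h"
 unfolding locally_germ_def
proof
 fix x assume x: "x \<in> V"
 then have "x \<in> U" using V by blast
 from locally_germD[OF g this] obtain W t where W: "open W" "x \<in> W" "W \<subseteq> U" "t \<in> carrier (Sec P W)" "\<forall>y\<in>W. g y = germ P y W t"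
  by (elim exE conjE) (rule that; assumption)
 have "\<forall>y\<in>W \<inter> V. h y = germ P y (W \<inter> V) (Res P W (W \<inter> V) t)"

 proof
  fix y assume y: "y \<in> W \<inter> V"
  have "open (W \<inter> V)" using W V by blast
  then show "h y = germ P y (W \<inter> V) (Res P W (W \<inter> V) t)"
   using y h[of y] bspec[OF W(5), of y] germ_res[OF W(1,4), of "W \<inter> V" y] by simp
 qed
 moreover have "Res P W (W \<inter> V) t \<in> carrier (Sec P (W \<inter> V))"
  using W V by (intro res_closed) auto
 ultimately show "\<exists>W. open W \<and> x \<in> W \<and> W \<subseteq> V \<and> (\<exists>t\<in>carrier (Sec P W). \<forall>y\<in>W. h y = germ P y W t)"
  using x W(1,2) V by (intro exI[of _ "W \<inter> V"]) blast
qed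

lemma locally_germ_mult:
 assumes g: "locally_germ U g" and h: "locally_germ U h"
 shows "locally_germ U (\<lambda>x\<in>U. g x \<otimes>\<^bsub>stalk P x\<^esub> h x)"
 unfolding locally_germ_def
proof
 fix x assume x: "x \<in> U"
 obtain V t where V: "open V" "x \<in> V" "V \<subseteq> U" "t \<in> carrier (Sec P V)" "\<forall>y\<in>V. g y = germ P y V t"
  using locally_germD[OF g x] by (elim exE conjE) (rule that; assumption)
 obtain W u where W: "open W" "x \<in> W" "W \<subseteq> U" "u \<in> carrier (Sec P W)" "\<forall>y\<in>W. h y = germ P y W u"
  using locally_germD[OF h x] by (elim exE conjE) (rule that; assumption)
 let ?N = "V \<inter> W"
 let ?t = "Res P V ?N t" and ?u = "Res P W ?N u"
 have N: "open ?N" using V W by blast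
 have tu: "?t \<in> carrier (Sec P ?N)" "?u \<in> carrier (Sec P ?N)" using V W N by (auto intro!: res_closed)
 have "(\<lambda>x\<in>U. g x \<otimes>\<^bsub>stalk P x\<^esub> h x) y = germ P y ?N (?t \<otimes>\<^bsub>Sec P ?N\<^esub> ?u)" if y: "y \<in> ?N" for y
 proof -
  have "g y = germ P y ?N ?t" "h y = germ P y ?N ?u"
   using y bspec[OF V(5), of y] bspec[OF W(5), of y] germ_res[OF V(1,4) N y] germ_res[OF W(1,4) N y] by simp_all
  moreover have "y \<in> U" using y V(3) by blast
  ultimately show ?thesis using germ_mult[OF N y tu] by simp
 qed
 moreover have "?t \<otimes>\<^bsub>Sec P ?N\<^esub> ?u \<in> carrier (Sec P ?N)"
  using tu monoid.m_closed[OF group.is_monoid[OF grp'[OF N]]] by blast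
 ultimately show "\<exists>N. open N \<and> x \<in> N \<and> N \<subseteq> U \<and>
   (\<exists>t\<in>carrier (Sec P N). \<forall>y\<in>N. (\<lambda>x\<in>U. g x \<otimes>\<^bsub>stalk P x\<^esub> h x) y = germ P y N t)"
  using V(2,3) W(2) N by (intro exI[of _ ?N]) blast
qed

lemma locally_germ_inv:
 assumes g: "locally_germ U g"
 shows "locally_germ U (\<lambda>x\<in>U. inv\<^bsub>stalk P x\<^esub> g x)"
 unfolding locally_germ_def
proof
 fix x assume x: "x \<in> U"
 obtain V t where V: "open V" "x \<in> V" "V \<subseteq> U" "t \<in> carrier (Sec P V)" "\<forall>y\<in>V. g y = germ P y V t"
  using locally_germD[OF g x] by (elim exE conjE) (rule that; assumption)
 have "inv\<^bsub>Sec P V\<^esub> t \<in> carrier (Sec P V)" using group.inv_closed[OF grp'[OF V(1)] V(4)] .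
 moreover have "\<forall>y\<in>V. (\<lambda>x\<in>U. inv\<^bsub>stalk P x\<^esub> g x) y = germ P y V (inv\<^bsub>Sec P V\<^esub> t)"
  using V(3) V(5) germ_inv[OF V(1) _ V(4)] by (simp add: subset_iff)
 ultimately show "\<exists>N. open N \<and> x \<in> N \<and> N \<subseteq> U \<and>
   (\<exists>t\<in>carrier (Sec P N). \<forall>y\<in>N. (\<lambda>x\<in>U. inv\<^bsub>stalk P x\<^esub> g x) y = germ P y N t)"
  using V(1,2,3) by blast
qed

lemma locally_germ_section:
 assumes "open U" "t \<in> carrier (Sec P U)"
 shows "locally_germ U (\<lambda>x\<in>U. germ P x U t)"
 unfolding locally_germ_def using assms by (intro ballI exI[of _ U]) auto

text \<open>All operations are computed stalk by stalk, so the group laws come from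
  \<open>stalk_grp\<close>; what has to be checked is local representability by sections.\<close>

lemma ab_presheaf_sheafify: "ab_presheaf (sheafify P)"
proof (rule ab_presheaf.intro)
 fix U :: "'a set" assume U: "open U"
 show "comm_group (Sec (sheafify P) U)"
 proof (rule comm_groupI; unfold Sec_sheafify; simp only: partial_object.simps monoid.simps mem_Collect_eq)
  have [simp]: "comm_group (stalk P x)" for x by (rule stalk_grp)
  fix g assume g: "g \<in> extensional U \<and> locally_germ U g"
  show "(\<lambda>x\<in>U. (\<lambda>x\<in>U. \<one>\<^bsub>stalk P x\<^esub>) x \<otimes>\<^bsub>stalk P x\<^esub> g x) = g"
  proof (rule extensionalityI[of _ U])
   fix x assume x: "x \<in> U"
   then show "(\<lambda>x\<in>U. (\<lambda>x\<in>U. \<one>\<^bsub>stalk P x\<^esub>) x \<otimes>\<^bsub>stalk P x\<^esub> g x) x = g x"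
    using g locally_germ_stalk[of U g x] comm_groupE(5)[OF stalk_grp] by simp
  qed (use g in auto)
  show "\<exists>h\<in>{g \<in> extensional U. locally_germ U g}. (\<lambda>x\<in>U. h x \<otimes>\<^bsub>stalk P x\<^esub> g x) = (\<lambda>x\<in>U. \<one>\<^bsub>stalk P x\<^esub>)"
  proof (rule bexI[of _ "\<lambda>x\<in>U. inv\<^bsub>stalk P x\<^esub> g x"])
   show "(\<lambda>x\<in>U. (\<lambda>x\<in>U. inv\<^bsub>stalk P x\<^esub> g x) x \<otimes>\<^bsub>stalk P x\<^esub> g x) = (\<lambda>x\<in>U. \<one>\<^bsub>stalk P x\<^esub>)"
    using locally_germ_stalk[of U g] g group.l_inv[OF comm_group.axioms(2)[OF stalk_grp]]
    by (auto intro!: restrict_ext)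
  qed (use locally_germ_inv g in auto)
  fix h assume h: "h \<in> extensional U \<and> locally_germ U h"
  show "(\<lambda>x\<in>U. g x \<otimes>\<^bsub>stalk P x\<^esub> h x) \<in> extensional U \<and> locally_germ U (\<lambda>x\<in>U. g x \<otimes>\<^bsub>stalk P x\<^esub> h x)"
   using g h locally_germ_mult by simp
  show "(\<lambda>x\<in>U. g x \<otimes>\<^bsub>stalk P x\<^esub> h x) = (\<lambda>x\<in>U. h x \<otimes>\<^bsub>stalk P x\<^esub> g x)"
   using g h locally_germ_stalk comm_groupE(4)[OF stalk_grp] by (auto intro!: restrict_ext)
  fix k assume k: "k \<in> extensional U \<and> locally_germ U k"
  show "(\<lambda>x\<in>U. (\<lambda>x\<in>U. g x \<otimes>\<^bsub>stalk P x\<^esub> h x) x \<otimes>\<^bsub>stalk P x\<^esub> k x) =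
   (\<lambda>x\<in>U. g x \<otimes>\<^bsub>stalk P x\<^esub> (\<lambda>x\<in>U. h x \<otimes>\<^bsub>stalk P x\<^esub> k x) x)"
   using g h k locally_germ_stalk comm_groupE(3)[OF stalk_grp] by (auto intro!: restrict_ext)
 next
  have "(\<lambda>x\<in>U. \<one>\<^bsub>stalk P x\<^esub>) = (\<lambda>x\<in>U. germ P x U \<one>\<^bsub>Sec P U\<^esub>)"
   using germ_one[OF U] by (auto intro!: restrict_ext)
  then show "(\<lambda>x\<in>U. \<one>\<^bsub>stalk P x\<^esub>) \<in> extensional U \<and> locally_germ U (\<lambda>x\<in>U. \<one>\<^bsub>stalk P x\<^esub>)"
   using locally_germ_section[OF U monoid.one_closed[OF group.is_monoid[OF grp'[OF U]]]] by simp
 qed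
next
 fix U V :: "'a set" assume UV: "open U" "open V" "V \<subseteq> U"
 show "Res (sheafify P) U V \<in> hom (Sec (sheafify P) U) (Sec (sheafify P) V)"
 proof (rule homI)
  fix g assume "g \<in> carrier (Sec (sheafify P) U)"
  then have "locally_germ U g" by (simp add: Sec_sheafify)
  from locally_germ_res[OF this UV(2,3), of "restrict g V"]
  show "Res (sheafify P) U V g \<in> carrier (Sec (sheafify P) V)"
   by (simp add: Sec_sheafify Res_sheafify)
  fix h
  show "Res (sheafify P) U V (g \<otimes>\<^bsub>Sec (sheafify P) U\<^esub> h) =
    Res (sheafify P) U V g \<otimes>\<^bsub>Sec (sheafify P) V\<^esub> Res (sheafify P) U V h"
   using UV(3) by (simp add: Sec_sheafify Res_sheafify fun_eq_iff subset_iff)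
 qed
qed (auto simp: Res_sheafify Sec_sheafify extensional_restrict Int_absorb1 intro: restrict_ext)

lemma presheaf_hom_to_sheafify: "presheaf_hom P (sheafify P) (\<lambda>U t. \<lambda>x\<in>U. germ P x U t)"
proof (rule presheaf_homI)
 fix U :: "'a set" assume U: "open U"
 show "(\<lambda>t. \<lambda>x\<in>U. germ P x U t) \<in> hom (Sec P U) (Sec (sheafify P) U)"
 proof (rule homI)
  fix t u assume "t \<in> carrier (Sec P U)" "u \<in> carrier (Sec P U)"
  then show "(\<lambda>x\<in>U. germ P x U (t \<otimes>\<^bsub>Sec P U\<^esub> u)) =
   (\<lambda>x\<in>U. germ P x U t) \<otimes>\<^bsub>Sec (sheafify P) U\<^esub> (\<lambda>x\<in>U. germ P x U u)"
   using germ_mult[OF U] by (auto simp: Sec_sheafify intro!: restrict_ext)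
 qed (use locally_germ_section[OF U] in \<open>auto simp: Sec_sheafify\<close>)
 fix V t assume "open V" "V \<subseteq> U" "t \<in> carrier (Sec P U)"
 then show "(\<lambda>x\<in>V. germ P x V (Res P U V t)) = Res (sheafify P) U V (\<lambda>x\<in>U. germ P x U t)"
  using germ_res[OF U] by (auto simp: Res_sheafify fun_eq_iff)
qed

end

text \<open>A stalk map induced by \<open>\<eta>\<close> sends the germ of \<open>t\<close> to the
  germ of \<open>\<eta> U t\<close>, so locally represented families go to such families. The
  explicit \<open>m\<close> is the shape in which \<open>quotient_sheaf_map\<close> is
  given.\<close>

lemma presheaf_hom_sheafify_map:
 assumes P: "ab_presheaf P" "ab_presheaf P'" and \<eta>: "presheaf_hom P P' \<eta>"
 defines "m \<equiv> \<lambda>U g. \<lambda>x\<in>U. dlim_map (nhds_of x) (\<lambda>U V. V \<subseteq> U) (Sec P') (Res P') \<eta> (g x)"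
 shows "presheaf_hom (sheafify P) (sheafify P') m"
  and "open U ==> t \<in> carrier (Sec P U) ==> m U (\<lambda>x\<in>U. germ P x U t) = (\<lambda>x\<in>U. germ P' x U (\<eta> U t))"
proof -
 interpret P: ab_presheaf P by fact
 interpret P': ab_presheaf P' by fact
 let ?d = "\<lambda>x. dlim_map (nhds_of x) (\<lambda>U V. V \<subseteq> U) (Sec P') (Res P') \<eta>"
 have dg: "?d x (germ P x U t) = germ P' x U (\<eta> U t)" if "open U" "x \<in> U" "t \<in> carrier (Sec P U)" for x U t
  unfolding germ_def using that presheaf_homD[OF \<eta>]
  by (intro P.st.dlim_map_cl[OF P'.st.directed_system_axioms]) (auto simp: nhds_of_def)
 show "open U ==> t \<in> carrier (Sec P U) ==> m U (\<lambda>x\<in>U. germ P x U t) = (\<lambda>x\<in>U. germ P' x U (\<eta> U t))"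
  using dg by (auto simp: m_def intro!: restrict_ext)
 have d: "?d x \<in> hom (stalk P x) (stalk P' x)" for x
  unfolding stalk_def using presheaf_homD[OF \<eta>]
  by (intro dlim_map_hom P.st.directed_groups_axioms P'.st.directed_groups_axioms) (auto simp: nhds_of_def)
 show "presheaf_hom (sheafify P) (sheafify P') m"
 proof (rule presheaf_homI)
  fix U :: "'a set" assume U: "open U"
  show "m U \<in> hom (Sec (sheafify P) U) (Sec (sheafify P') U)"
  proof (rule homI; unfold P.Sec_sheafify P'.Sec_sheafify; simp only: partial_object.simps monoid.simps mem_Collect_eq)
   fix g assume g: "g \<in> extensional U \<and> P.locally_germ U g"
   have "P'.locally_germ U (m U g)"
    unfolding P'.locally_germ_def
   proof
    fix x assume x: "x \<in> U"
    obtain V t where V: "open V" "x \<in> V" "V \<subseteq> U" "t \<in> carrier (Sec P V)" "\<forall>y\<in>V. g y = germ P y V t"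
     using P.locally_germD[OF conjunct2[OF g] x] by (elim exE conjE) (rule that; assumption)
    then show "\<exists>V. open V \<and> x \<in> V \<and> V \<subseteq> U \<and> (\<exists>t\<in>carrier (Sec P' V). \<forall>y\<in>V. m U g y = germ P' y V t)"
     using presheaf_homD(2)[OF \<eta> V(1)] dg[OF V(1) _ V(4)]
     by (intro exI[of _ V] conjI bexI[of _ "\<eta> V t"]) (simp_all add: m_def subset_iff)
   qed
   then show "m U g \<in> extensional U \<and> P'.locally_germ U (m U g)" by (simp add: m_def)
   fix h assume h: "h \<in> extensional U \<and> P.locally_germ U h"
   show "m U (\<lambda>x\<in>U. g x \<otimes>\<^bsub>stalk P x\<^esub> h x) = (\<lambda>x\<in>U. m U g x \<otimes>\<^bsub>stalk P' x\<^esub> m U h x)"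
    using g h hom_mult[OF d P.locally_germ_stalk P.locally_germ_stalk] by (auto simp: m_def intro!: restrict_ext)
  qed
 next
  fix U V t
  assume "open U" "open V" "V \<subseteq> U" "t \<in> carrier (Sec (sheafify P) U)"
  then show "m V (Res (sheafify P) U V t) = Res (sheafify P') U V (m U t)"
   by (auto simp: P.Res_sheafify P'.Res_sheafify m_def fun_eq_iff)
 qed
qed

section \<open>Quotients by a sub-presheaf\<close>

locale sub_presheaf = ab_presheaf P
 for P :: "('a::topological_space, 'b) presheaf" +
 fixes Q :: "('a, 'b) presheaf"
 assumes sub: "open U ==> subgroup (carrier (Sec Q U)) (Sec P U)"
  and res_sub: "open U ==> open V ==> V \<subseteq> U ==> t \<in> carrier (Sec Q U) ==> Res P U V t \<in> carrier (Sec Q V)"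
begin

abbreviation "coset U t \<equiv> carrier (Sec Q U) #>\<^bsub>Sec P U\<^esub> t"

lemma Sec_quotient: "Sec (quotient_presheaf P Q) U = Sec P U Mod carrier (Sec Q U)"
 by (simp add: quotient_presheaf_def)

lemma carrier_quotient: "carrier (Sec (quotient_presheaf P Q) U) = {coset U t | t. t \<in> carrier (Sec P U)}"
 by (auto simp: Sec_quotient FactGroup_def RCOSETS_def)

lemma coset_mult:
 assumes "open U" "t \<in> carrier (Sec P U)" "u \<in> carrier (Sec P U)"
 shows "coset U t \<otimes>\<^bsub>Sec (quotient_presheaf P Q) U\<^esub> coset U u = coset U (t \<otimes>\<^bsub>Sec P U\<^esub> u)"
 using normal.rcos_sum[OF comm_group.subgroup_imp_normal[OF grp[OF assms(1)] sub[OF assms(1)]] assms(2,3)]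
 by (simp add: Sec_quotient FactGroup_def)

lemma one_quotient: "\<one>\<^bsub>Sec (quotient_presheaf P Q) U\<^esub> = carrier (Sec Q U)"
 by (simp add: Sec_quotient FactGroup_def)

lemma coset_one: "open U ==> t \<in> carrier (Sec P U) ==>
  coset U t = \<one>\<^bsub>Sec (quotient_presheaf P Q) U\<^esub> \<longleftrightarrow> t \<in> carrier (Sec Q U)"
 unfolding one_quotient by (intro coset_eq_self_iff grp sub)

lemma Res_quotient:
 assumes "open U" "open V" "V \<subseteq> U" "t \<in> carrier (Sec P U)"
 shows "Res (quotient_presheaf P Q) U V (coset U t) = coset V (Res P U V t)"
proof -
 have "mod_map (Sec P V) (carrier (Sec Q V)) (Res P U V) (coset U t) = coset V (Res P U V t)"
  using assms res_sub by (intro mod_map_coset grp sub res_hom) auto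
 then show ?thesis by (simp add: quotient_presheaf_def)
qed

lemma coset_in: "t \<in> carrier (Sec P U) ==> coset U t \<in> carrier (Sec (quotient_presheaf P Q) U)"
 by (auto simp: carrier_quotient)

lemma ab_presheaf_quotient: "ab_presheaf (quotient_presheaf P Q)"
proof (rule ab_presheaf.intro)
 fix U :: "'a set" assume U: "open U"
 show "comm_group (Sec (quotient_presheaf P Q) U)"
  unfolding Sec_quotient by (rule comm_group.abelian_FactGroup[OF grp[OF U] sub[OF U]])
 fix A assume "A \<in> carrier (Sec (quotient_presheaf P Q) U)"
 then obtain t where t: "A = coset U t" "t \<in> carrier (Sec P U)" by (auto simp: carrier_quotient)
 show "Res (quotient_presheaf P Q) U U A = A"
  using t Res_quotient[OF U U _ t(2)] res_id[OF U t(2)] by simp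
 fix V W :: "'a set" assume VW: "open V" "open W" "W \<subseteq> V" "V \<subseteq> U"
 show "Res (quotient_presheaf P Q) V W (Res (quotient_presheaf P Q) U V A) = Res (quotient_presheaf P Q) U W A"
  unfolding t(1) Res_quotient[OF U VW(1,4) t(2)] Res_quotient[OF VW(1-3) res_closed[OF U VW(1,4) t(2)]]
   Res_quotient[OF U VW(2) order.trans[OF VW(3,4)] t(2)] res_comp[OF U VW t(2)] ..
next
 fix U V :: "'a set" assume UV: "open U" "open V" "V \<subseteq> U"
 show "Res (quotient_presheaf P Q) U V \<in> hom (Sec (quotient_presheaf P Q) U) (Sec (quotient_presheaf P Q) V)"
 proof (rule homI)
  fix A assume "A \<in> carrier (Sec (quotient_presheaf P Q) U)"
  then obtain t where t: "A = coset U t" "t \<in> carrier (Sec P U)" by (auto simp: carrier_quotient)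
  show "Res (quotient_presheaf P Q) U V A \<in> carrier (Sec (quotient_presheaf P Q) V)"
   using t Res_quotient[OF UV t(2)] res_closed[OF UV t(2)] by (simp add: coset_in)
  fix B assume "B \<in> carrier (Sec (quotient_presheaf P Q) U)"
  then obtain u where u: "B = coset U u" "u \<in> carrier (Sec P U)" by (auto simp: carrier_quotient)
  have tu: "t \<otimes>\<^bsub>Sec P U\<^esub> u \<in> carrier (Sec P U)"
   using monoid.m_closed[OF group.is_monoid[OF grp'[OF UV(1)]] t(2) u(2)] .
  show "Res (quotient_presheaf P Q) U V (A \<otimes>\<^bsub>Sec (quotient_presheaf P Q) U\<^esub> B) =
    Res (quotient_presheaf P Q) U V A \<otimes>\<^bsub>Sec (quotient_presheaf P Q) V\<^esub> Res (quotient_presheaf P Q) U V B"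
   unfolding t(1) u(1) coset_mult[OF UV(1) t(2) u(2)] Res_quotient[OF UV t(2)] Res_quotient[OF UV u(2)]
    Res_quotient[OF UV tu] coset_mult[OF UV(2) res_closed[OF UV t(2)] res_closed[OF UV u(2)]]
    hom_mult[OF res_hom[OF UV] t(2) u(2)] ..
 qed
qed

lemma presheaf_hom_coset: "presheaf_hom P (quotient_presheaf P Q) coset"
proof (rule presheaf_homI)
 fix U :: "'a set" assume U: "open U"
 show "coset U \<in> hom (Sec P U) (Sec (quotient_presheaf P Q) U)"
  by (rule homI) (simp_all add: coset_in coset_mult[OF U])
qed (simp add: Res_quotient)

sublocale quot: ab_presheaf "quotient_presheaf P Q"
 by (rule ab_presheaf_quotient)

definition proj :: "'a set => 'b => 'a => ('a set \<times> 'b set) set" where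
 "proj U t = (\<lambda>x\<in>U. germ (quotient_presheaf P Q) x U (coset U t))"

lemma ab_presheaf_quotient_sheaf: "ab_presheaf (quotient_sheaf P Q)"
 unfolding quotient_sheaf_def by (rule quot.ab_presheaf_sheafify)

lemma presheaf_hom_proj: "presheaf_hom P (quotient_sheaf P Q) proj"
 using presheaf_hom_comp[OF presheaf_hom_coset quot.presheaf_hom_to_sheafify]
 unfolding proj_def[abs_def] quotient_sheaf_def .

text \<open>Equal germs in the quotient presheaf are equal cosets on a smaller neighbourhood. So
  being trivial in the quotient sheaf means lying in \<open>Q\<close> locally.\<close>

lemma proj_eq_one:
 assumes U: "open U" "t \<in> carrier (Sec P U)" "x \<in> U" and one: "proj U t = \<one>\<^bsub>Sec (quotient_sheaf P Q) U\<^esub>"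
 shows "\<exists>V. open V \<and> x \<in> V \<and> V \<subseteq> U \<and> Res P U V t \<in> carrier (Sec Q V)"
proof -
 let ?R = "quotient_presheaf P Q"
 have "germ ?R x U (coset U t) = germ ?R x U \<one>\<^bsub>Sec ?R U\<^esub>"
  using fun_cong[OF one, of x] U quot.germ_one[OF U(1,3)]
  by (simp add: proj_def quotient_sheaf_def quot.Sec_sheafify)
 moreover have "\<one>\<^bsub>Sec ?R U\<^esub> \<in> carrier (Sec ?R U)"
  using monoid.one_closed[OF group.is_monoid[OF quot.grp'[OF U(1)]]] .
 ultimately obtain V where V: "open V" "x \<in> V" "V \<subseteq> U" "Res ?R U V (coset U t) = Res ?R U V \<one>\<^bsub>Sec ?R U\<^esub>"
  using quot.germ_eq_iff[OF U(1,3) coset_in[OF U(2)] U(1,3), of "\<one>\<^bsub>Sec ?R U\<^esub>"]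
  by (simp only: HOL.simp_thms) (elim exE conjE, rule that; assumption)
 then have "coset V (Res P U V t) = \<one>\<^bsub>Sec ?R V\<^esub>"
  using Res_quotient[OF U(1) V(1,3) U(2)] hom_one[OF quot.res_hom[OF U(1) V(1,3)] quot.grp'[OF U(1)] quot.grp'[OF V(1)]]
  by simp
 then show ?thesis using V coset_one[OF V(1) res_closed[OF U(1) V(1,3) U(2)]] by blast
qed

text \<open>Surjectivity of the projection on germs, in the form in which cochains are
  lifted.\<close>

lemma proj_lift:
 assumes U: "open U" "g \<in> carrier (Sec (quotient_sheaf P Q) U)" "x \<in> U"
 shows "\<exists>V t. open V \<and> x \<in> V \<and> V \<subseteq> U \<and> t \<in> carrier (Sec P V) \<and> Res (quotient_sheaf P Q) U V g = proj V t"
proof -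
 have "quot.locally_germ U g" using U(2) by (simp add: quotient_sheaf_def quot.Sec_sheafify)
 from quot.locally_germD[OF this U(3)] obtain V a where V: "open V" "x \<in> V" "V \<subseteq> U" "a \<in> carrier (Sec (quotient_presheaf P Q) V)"
  "\<forall>y\<in>V. g y = germ (quotient_presheaf P Q) y V a"
  by (elim exE conjE) (rule that; assumption)
 from V(4) obtain t where t: "t \<in> carrier (Sec P V)" "a = coset V t" by (auto simp: carrier_quotient)
 have "Res (quotient_sheaf P Q) U V g = proj V t"
  using V(5) t(2) by (auto simp: quotient_sheaf_def quot.Res_sheafify proj_def intro!: restrict_ext)
 then show ?thesis using V t by blast
qed

text \<open>Sections are extensional functions, so the empty set carries just one. It settles
  simplices with empty intersection when cochains are lifted.\<close>

lemma Sec_quotient_empty: "g \<in> carrier (Sec (quotient_sheaf P Q) {}) ==> g = (\<lambda>x. undefined)"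
 by (auto simp: quotient_sheaf_def quot.Sec_sheafify)

end

lemma quotient_sheaf_map:
 assumes P: "sub_presheaf P Q" "sub_presheaf P' Q'" and \<eta>: "presheaf_hom P P' \<eta>"
  and sub: "\<And>U t. open U ==> t \<in> carrier (Sec Q U) ==> \<eta> U t \<in> carrier (Sec Q' U)"
 shows "presheaf_hom (quotient_sheaf P Q) (quotient_sheaf P' Q') (quotient_sheaf_map P' Q' \<eta>)"
  and "open U ==> t \<in> carrier (Sec P U) ==>
   quotient_sheaf_map P' Q' \<eta> U (sub_presheaf.proj P Q U t) = sub_presheaf.proj P' Q' U (\<eta> U t)"
proof -
 interpret P: sub_presheaf P Q by fact
 interpret P': sub_presheaf P' Q' by fact
 let ?m = "\<lambda>V. mod_map (Sec P' V) (carrier (Sec Q' V)) (\<eta> V)"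
 have m: "?m U (P.coset U t) = P'.coset U (\<eta> U t)" if "open U" "t \<in> carrier (Sec P U)" for U t
  using that sub by (intro mod_map_coset P.grp P'.grp P.sub P'.sub presheaf_homD[OF \<eta>]) auto
 have h: "presheaf_hom (quotient_presheaf P Q) (quotient_presheaf P' Q') ?m"
 proof (rule presheaf_homI)
  fix U :: "'a set" assume U: "open U"
  show "?m U \<in> hom (Sec (quotient_presheaf P Q) U) (Sec (quotient_presheaf P' Q') U)"
  proof (rule homI)
   fix A assume "A \<in> carrier (Sec (quotient_presheaf P Q) U)"
   then obtain t where t: "A = P.coset U t" "t \<in> carrier (Sec P U)" by (auto simp: P.carrier_quotient)
   show "?m U A \<in> carrier (Sec (quotient_presheaf P' Q') U)"
    using t m[OF U t(2)] presheaf_homD(2)[OF \<eta> U t(2)] by (simp add: P'.coset_in)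
   fix B assume "B \<in> carrier (Sec (quotient_presheaf P Q) U)"
   then obtain u where u: "B = P.coset U u" "u \<in> carrier (Sec P U)" by (auto simp: P.carrier_quotient)
   have tu: "t \<otimes>\<^bsub>Sec P U\<^esub> u \<in> carrier (Sec P U)"
    using monoid.m_closed[OF group.is_monoid[OF P.grp'[OF U]] t(2) u(2)] .
   show "?m U (A \<otimes>\<^bsub>Sec (quotient_presheaf P Q) U\<^esub> B) = ?m U A \<otimes>\<^bsub>Sec (quotient_presheaf P' Q') U\<^esub> ?m U B"
    unfolding t(1) u(1) P.coset_mult[OF U t(2) u(2)] m[OF U t(2)] m[OF U u(2)] m[OF U tu]
     P'.coset_mult[OF U presheaf_homD(2)[OF \<eta> U t(2)] presheaf_homD(2)[OF \<eta> U u(2)]]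
     hom_mult[OF presheaf_homD(1)[OF \<eta> U] t(2) u(2)] ..
  qed
  fix V A assume V: "open V" "V \<subseteq> U" and "A \<in> carrier (Sec (quotient_presheaf P Q) U)"
  then obtain t where t: "A = P.coset U t" "t \<in> carrier (Sec P U)" by (auto simp: P.carrier_quotient)
  show "?m V (Res (quotient_presheaf P Q) U V A) = Res (quotient_presheaf P' Q') U V (?m U A)"
   unfolding t(1) P.Res_quotient[OF U V t(2)] m[OF U t(2)] m[OF V(1) P.res_closed[OF U V t(2)]]
    P'.Res_quotient[OF U V presheaf_homD(2)[OF \<eta> U t(2)]] presheaf_homD(3)[OF \<eta> U V t(2)] ..
 qed
 note s = presheaf_hom_sheafify_map[OF P.quot.ab_presheaf_axioms P'.quot.ab_presheaf_axioms h]
 show "presheaf_hom (quotient_sheaf P Q) (quotient_sheaf P' Q') (quotient_sheaf_map P' Q' \<eta>)"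
  using s(1) unfolding quotient_sheaf_def quotient_sheaf_map_def[abs_def] .
 show "open U ==> t \<in> carrier (Sec P U) ==>
   quotient_sheaf_map P' Q' \<eta> U (P.proj U t) = P'.proj U (\<eta> U t)"
  using s(2)[of U "P.coset U t"] P.coset_in m
  by (simp add: P.proj_def P'.proj_def quotient_sheaf_map_def)
qed

section \<open>Alternating sums over lists\<close>

text \<open>Alternating sum over the faces, by recursion on the simplex. This turns
  \<open>d d = 0\<close> and the homotopy formula into list inductions without index bookkeeping;
  \<open>altd_eq_sum\<close> returns to the usual form.\<close>

primrec altd :: "('a list => complex) => 'a list => complex" where
 "altd a [] = 0"
| "altd a (x # xs) = a xs - altd (\<lambda>ys. a (x # ys)) xs"

text \<open>The prism operator of a vertex map \<open>r\<close>: the alternating sum of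
  \<open>a\<close> over the simplices (x_0,...,x_k,r x_k,...,r x_n).\<close>

primrec alth :: "('a => 'a) => ('a list => complex) => 'a list => complex" where
 "alth r a [] = 0"
| "alth r a (x # xs) = a (x # r x # map r xs) - alth r (\<lambda>ys. a (x # ys)) xs"

lemma omit_Cons [simp]: "omit 0 (x # xs) = xs" "omit (Suc k) (x # xs) = x # omit k xs"
 by (auto simp: omit_def)

lemma altd_eq_sum: "altd a xs = (\<Sum>k<length xs. (- 1) ^ k * a (omit k xs))"
proof (induction xs arbitrary: a)
 case (Cons x xs)
 then show ?case by (simp add: sum.lessThan_Suc_shift sum_negf del: sum.lessThan_Suc)
qed simp

lemma alth_eq_sum: "alth r a xs = (\<Sum>k<length xs. (- 1) ^ k * a (take (Suc k) xs @ map r (drop k xs)))"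
proof (induction xs arbitrary: a)
 case (Cons x xs)
 then show ?case by (simp add: sum.lessThan_Suc_shift sum_negf del: sum.lessThan_Suc)
qed simp

lemma altd_diff: "altd (\<lambda>ys. a ys - b ys) xs = altd a xs - altd b xs"
 by (simp add: altd_eq_sum sum_subtractf right_diff_distrib)

lemma alth_diff: "alth r (\<lambda>ys. a ys - b ys) xs = alth r a xs - alth r b xs"
 by (simp add: alth_eq_sum sum_subtractf right_diff_distrib)

lemma altd_altd: "altd (altd a) xs = 0"
proof (induction xs arbitrary: a)
 case (Cons x xs)
 then show ?case by (simp add: altd_diff)
qed simp

lemma altd_map: "altd (\<lambda>ys. b (map r ys)) xs = altd b (map r xs)"
 by (induction xs arbitrary: b) simp_all

text \<open>Homotopy between \<open>r\<close> and the identity. In the induction step the terms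
  \<open>alth r a xs\<close> and those with \<open>a (x # r x # ...)\<close> cancel; what remains is
  the formula for \<open>a\<close> with \<open>x\<close> put in front of every argument.\<close>

lemma altd_alth: "altd (alth r a) xs + alth r (altd a) xs = a (map r xs) - a xs"
proof (induction xs arbitrary: a)
 case (Cons x xs)
 show ?case
  using Cons[of "\<lambda>ys. a (x # ys)"] altd_map[of "\<lambda>ys. a (x # r x # ys)" r xs]
  by (simp add: altd_diff alth_diff algebra_simps)
qed simp

section \<open>Sheaves of functions\<close>

definition restr :: "'a set => ('i => 'a => complex) => 'i => 'a => complex" where
 "restr V t = (\<lambda>i x. if x \<in> V then t i x else 0)"

definition fun_presheaf :: "('a set => ('i => 'a => complex) set) => ('a, 'i => 'a => complex) presheaf" where
 "fun_presheaf S = \<lparr>Sec = (\<lambda>U. \<lparr>carrier = S U, monoid.mult = (\<lambda>t u i x. t i x + u i x), one = (\<lambda>i x. 0)\<rparr>),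
  Res = (\<lambda>U V. restr V)\<rparr>"

lemma fun_presheaf_sel [simp]: "carrier (Sec (fun_presheaf S) U) = S U"
 "Res (fun_presheaf S) U V = restr V" "\<one>\<^bsub>Sec (fun_presheaf S) U\<^esub> = (\<lambda>i x. 0)"
 "t \<otimes>\<^bsub>Sec (fun_presheaf S) U\<^esub> u = (\<lambda>i x. t i x + u i x)"
 by (simp_all add: fun_presheaf_def)

text \<open>Sections are functions extended by zero. The multiplicative language of the presheaves
  then turns into pointwise addition, and a Cech coboundary into \<open>altd\<close> at every
  point.\<close>

locale section_family =
 fixes S :: "'a::topological_space set => ('i => 'a => complex) set"
 assumes zero: "open U ==> (\<lambda>i x. 0) \<in> S U"
  and add: "open U ==> t \<in> S U ==> u \<in> S U ==> (\<lambda>i x. t i x + u i x) \<in> S U"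
  and neg: "open U ==> t \<in> S U ==> (\<lambda>i x. - t i x) \<in> S U"
  and supp: "open U ==> t \<in> S U ==> x \<notin> U ==> t i x = 0"
  and restr_closed: "open U ==> open V ==> V \<subseteq> U ==> t \<in> S U ==> restr V t \<in> S V"
begin

abbreviation "P \<equiv> fun_presheaf S"

lemma ab_presheaf_fun: "ab_presheaf P"
proof (rule ab_presheaf.intro)
 fix U :: "'a set" assume U: "open U"
 show "comm_group (Sec P U)"
  by (rule comm_groupI)
   (use U add zero in \<open>auto simp: add_ac intro!: bexI[of _ "\<lambda>i x. - t i x" for t] neg\<close>)
 fix V :: "'a set" assume "open V" "V \<subseteq> U"
 then show "Res P U V \<in> hom (Sec P U) (Sec P V)"
  using U by (auto intro!: homI simp: restr_closed) (auto simp: restr_def fun_eq_iff)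
qed (auto simp: restr_def fun_eq_iff supp)

sublocale ab_presheaf P by (rule ab_presheaf_fun)

lemma inv_Sec: "open U ==> t \<in> S U ==> inv\<^bsub>Sec P U\<^esub> t = (\<lambda>i x. - t i x)"
 using group.inv_equality[OF grp', of U "\<lambda>i x. - t i x" t] neg by simp

lemma pow_Sec: "open U ==> t \<in> S U ==> t [^]\<^bsub>Sec P U\<^esub> ((- 1 :: int) ^ k) = (\<lambda>i x. (- 1) ^ k * t i x)"
 using group.int_pow_1[OF grp', of U t] group.int_pow_neg[OF grp', of U t 1]
 by (cases "even k") (simp_all add: inv_Sec)

lemma finprod_Sec:
 assumes "open U" "finite A" "g \<in> A \<rightarrow> S U"
 shows "finprod (Sec P U) g A = (\<lambda>i x. \<Sum>k\<in>A. g k i x)"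
 using assms(2,3)
proof (induction A)
 case empty
 then show ?case using comm_monoid.finprod_empty[of "Sec P U" g] grp[OF assms(1)] by (simp add: comm_group_def)
next
 case (insert k A)
 then show ?case
  using comm_monoid.finprod_insert[of "Sec P U" A k g] grp[OF assms(1)] by (simp add: comm_group_def)
qed

lemma sum_closed:
 assumes "open U" "finite A" "\<And>k. k \<in> A ==> g k \<in> S U"
 shows "(\<lambda>i x. \<Sum>k\<in>A. g k i x) \<in> S U"
 using assms(2,3)
proof (induction A)
 case (insert k A)
 then show ?case using add[OF assms(1), of "g k" "\<lambda>i x. \<Sum>k\<in>A. g k i x"] by simp
qed (simp add: zero[OF assms(1)])

lemma sign_closed: "open U ==> t \<in> S U ==> (\<lambda>i x. (- 1) ^ k * t i x) \<in> S U"
 using neg by (cases "even k") simp_all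

lemma cech_d_fun:
 assumes U: "\<U> \<in> coverings" and c: "c \<in> carrier (cochains P \<U> q)" and xs: "xs \<in> simplices (Suc q)"
 shows "cech_d P \<U> q c xs i x = (if x \<in> cap \<U> xs then altd (\<lambda>ys. c ys i x) xs else 0)"
proof -
 let ?U = "cap \<U> xs"
 note o = open_cap[OF U]
 have cs: "c (omit k xs) \<in> S (cap \<U> (omit k xs))" if "k \<le> Suc q" for k
  using cochainsD[OF c omit_simplices[OF xs that]] by simp
 have rs: "restr ?U (c (omit k xs)) \<in> S ?U" if "k \<le> Suc q" for k
  by (rule restr_closed[OF o o cap_omit cs[OF that]])
 have "cech_d P \<U> q c xs = finprod (Sec P ?U) (\<lambda>k i x. (- 1) ^ k * restr ?U (c (omit k xs)) i x) {..Suc q}"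
  unfolding cech_d_def using xs rs pow_Sec[OF o rs] sign_closed[OF o] grp[OF o]
  by (auto simp: comm_group_def intro!: comm_monoid.finprod_cong')
 also have "\<dots> = (\<lambda>i x. \<Sum>k\<le>Suc q. (- 1) ^ k * restr ?U (c (omit k xs)) i x)"
  using rs sign_closed[OF o] by (intro finprod_Sec[OF o]) auto
 finally show ?thesis
  using xs by (simp add: altd_eq_sum restr_def simplices_def lessThan_Suc_atMost[symmetric] del: sum.lessThan_Suc)
qed

lemma cocycles_fun:
 assumes U: "\<U> \<in> coverings" and c: "c \<in> cocycles P \<U> q" and xs: "xs \<in> simplices (Suc q)" "x \<in> cap \<U> xs"
 shows "altd (\<lambda>ys. c ys i x) xs = 0"
proof -
 have "cech_d P \<U> q c xs = (\<lambda>i x. 0)"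
  using c xs by (simp add: cocycles_def kernel_def cochains_one)
 then show ?thesis using cech_d_fun[OF U cocycles_cochains[OF c] xs(1), of i x] xs(2) by simp
qed

lemma cocycles_funI:
 assumes U: "\<U> \<in> coverings" and c: "c \<in> carrier (cochains P \<U> q)"
  and *: "\<And>xs i x. xs \<in> simplices (Suc q) ==> x \<in> cap \<U> xs ==> altd (\<lambda>ys. c ys i x) xs = 0"
 shows "c \<in> cocycles P \<U> q"
proof -
 have d: "cech_d P \<U> q c \<in> carrier (cochains P \<U> (Suc q))"
  using cech_d_hom[OF U] c by (auto simp: hom_def)
 have "cech_d P \<U> q c = \<one>\<^bsub>cochains P \<U> (Suc q)\<^esub>"
 proof (rule cochains_eqI[OF d])
  fix xs :: "'a list" assume xs: "xs \<in> simplices (Suc q)"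
  show "cech_d P \<U> q c xs = \<one>\<^bsub>cochains P \<U> (Suc q)\<^esub> xs"
   using xs *[OF xs] by (intro ext) (simp add: cech_d_fun[OF U c xs] cochains_one)
 qed (rule monoid.one_closed[OF group.is_monoid[OF cochains_grp'[OF U]]])
 then show ?thesis using c by (simp add: cocycles_def kernel_def)
qed

lemma cech_d_cocycle:
 assumes U: "\<U> \<in> coverings" and c: "c \<in> carrier (cochains P \<U> q)"
 shows "cech_d P \<U> q c \<in> cocycles P \<U> (Suc q)"
proof (rule cocycles_funI[OF U])
 show "cech_d P \<U> q c \<in> carrier (cochains P \<U> (Suc q))"
  using cech_d_hom[OF U] c by (auto simp: hom_def)
 fix xs :: "'a list" and i x assume xs: "xs \<in> simplices (Suc (Suc q))" "x \<in> cap \<U> xs"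
 have "cech_d P \<U> q c (omit k xs) i x = altd (\<lambda>ys. c ys i x) (omit k xs)" if "k < length xs" for k
 proof -
  have "omit k xs \<in> simplices (Suc q)" using omit_simplices[OF xs(1)] that xs(1) by (simp add: simplices_def)
  moreover have "x \<in> cap \<U> (omit k xs)" by (rule subsetD[OF cap_omit xs(2)])
  ultimately show ?thesis by (simp add: cech_d_fun[OF U c])
 qed
 then have "altd (\<lambda>ys. cech_d P \<U> q c ys i x) xs = altd (altd (\<lambda>ys. c ys i x)) xs"
  by (simp add: altd_eq_sum[of _ xs])
 then show "altd (\<lambda>ys. cech_d P \<U> q c ys i x) xs = 0" by (simp add: altd_altd)
qed

end

text \<open>Naturality of the coboundary with respect to a map of the vertices that does not fix them; such a
 map is homotopic to the identity, by the prism operator \<^const>\<open>alth\<close>.\<close>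

definition pullback ::
  "('a, 'b) presheaf => ('a => 'a) => ('a => 'a set) => ('a => 'a set) => nat => ('a list => 'b) => 'a list => 'b" where
 "pullback P r \<U> \<V> q c = (\<lambda>xs\<in>simplices q. Res P (cap \<U> (map r xs)) (cap \<V> xs) (c (map r xs)))"

lemma map_simplices: "map r xs \<in> simplices q \<longleftrightarrow> xs \<in> simplices q"
 by (simp add: simplices_def)

lemma omit_map: "omit k (map r xs) = map r (omit k xs)"
 by (simp add: omit_def take_map drop_map)

lemma cap_map: "(\<And>x. \<V> x \<subseteq> \<U> (r x)) ==> cap \<V> xs \<subseteq> cap \<U> (map r xs)"
 by (fastforce simp: cap_def)

context ab_presheaf
begin

lemma pullback_closed:
 assumes "\<U> \<in> coverings" "\<V> \<in> coverings" "\<And>x. \<V> x \<subseteq> \<U> (r x)" "c \<in> carrier (cochains P \<U> q)"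
 shows "pullback P r \<U> \<V> q c \<in> carrier (cochains P \<V> q)"
 unfolding pullback_def
proof (rule cochainsI)
 fix xs :: "'a list" assume "xs \<in> simplices q"
 then show "Res P (cap \<U> (map r xs)) (cap \<V> xs) (c (map r xs)) \<in> carrier (Sec P (cap \<V> xs))"
  by (intro res_closed open_cap[OF assms(1)] open_cap[OF assms(2)] cap_map assms(3) cochainsD[OF assms(4)])
   (simp add: map_simplices)
qed

text \<open>For an arbitrary presheaf, because it is applied to a cochain of the quotient sheaf,
  whose sections are not complex-valued functions.\<close>

lemma cech_d_pullback:
 assumes U: "\<U> \<in> coverings" "\<V> \<in> coverings" and r: "\<And>x. \<V> x \<subseteq> \<U> (r x)" and c: "c \<in> carrier (cochains P \<U> q)"
 shows "cech_d P \<V> q (pullback P r \<U> \<V> q c) = pullback P r \<U> \<V> (Suc q) (cech_d P \<U> q c)"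
proof (rule ext)
 fix xs
 show "cech_d P \<V> q (pullback P r \<U> \<V> q c) xs = pullback P r \<U> \<V> (Suc q) (cech_d P \<U> q c) xs"
 proof (cases "xs \<in> simplices (Suc q)")
  case True
  let ?ys = "map r xs"
  have ys: "?ys \<in> simplices (Suc q)" using True by (simp add: map_simplices)
  note o = open_cap[OF U(1)] open_cap[OF U(2)]
  let ?S = "Sec P (cap \<U> ?ys)" and ?S' = "Sec P (cap \<V> xs)"
  let ?r = "\<lambda>k. Res P (cap \<U> (omit k ?ys)) (cap \<U> ?ys) (c (omit k ?ys))"
  let ?r' = "\<lambda>k. Res P (cap \<V> (omit k xs)) (cap \<V> xs) (pullback P r \<U> \<V> q c (omit k xs))"
  let ?\<rho> = "Res P (cap \<U> ?ys) (cap \<V> xs)"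
  have h: "?\<rho> \<in> hom ?S ?S'" by (intro res_hom o cap_map r)
  have t: "?\<rho> (?r k [^]\<^bsub>?S\<^esub> ((- 1 :: int) ^ k)) = ?r' k [^]\<^bsub>?S'\<^esub> ((- 1 :: int) ^ k)" if "k \<le> Suc q" for k
  proof -
   have o1: "omit k ?ys \<in> simplices q" using omit_simplices[OF ys that] .
   have o2: "omit k xs \<in> simplices q" using omit_simplices[OF True that] .
   have m: "?r k \<in> carrier ?S"
    by (rule res_closed[OF o(1) o(1) cap_omit cochainsD[OF c o1]])
   have "?\<rho> (?r k) = Res P (cap \<U> (omit k ?ys)) (cap \<V> xs) (c (omit k ?ys))"
    by (rule res_comp[OF o(1) o(1) o(2) cap_map[of \<V> \<U> r, OF r] cap_omit cochainsD[OF c o1]])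
   also have "\<dots> = Res P (cap \<V> (omit k xs)) (cap \<V> xs) (Res P (cap \<U> (omit k ?ys)) (cap \<V> (omit k xs)) (c (omit k ?ys)))"
    by (rule res_comp[OF o(1) o(2) o(2) cap_omit _ cochainsD[OF c o1], symmetric])
     (use cap_map[of \<V> \<U> r "omit k xs", OF r] in \<open>simp add: omit_map\<close>)
   also have "\<dots> = ?r' k" using o2 by (simp add: pullback_def omit_map)
   finally show ?thesis
    using hom_int_pow[OF h m grp'[OF o(1)] grp'[OF o(2)], of "(-1)^k"] by simp
  qed
  have "?\<rho> (finprod ?S (\<lambda>k. ?r k [^]\<^bsub>?S\<^esub> ((- 1 :: int) ^ k)) {..Suc q}) =
    finprod ?S' (\<lambda>k. ?\<rho> (?r k [^]\<^bsub>?S\<^esub> ((- 1 :: int) ^ k))) {..Suc q}"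
   by (rule hom_finprod[OF grp[OF o(1)] grp[OF o(2)] h]) (use cech_term_closed[OF U(1) c ys] in auto)
  also have "\<dots> = finprod ?S' (\<lambda>k. ?r' k [^]\<^bsub>?S'\<^esub> ((- 1 :: int) ^ k)) {..Suc q}"
   using t cech_term_closed[OF U(2) pullback_closed[OF U r c] True] grp[OF o(2)]
   by (intro comm_monoid.finprod_cong') (auto simp: comm_group_def)
  finally show ?thesis using True ys by (simp only: cech_d_def pullback_def restrict_apply if_True)
 qed (simp add: cech_d_def pullback_def)
qed

end

context section_family
begin

definition prism :: "('a => 'a) => ('a => 'a set) => nat => ('a list => 'i => 'a => complex) => 'a list => 'i => 'a => complex" where
 "prism r \<V> q c = (\<lambda>xs\<in>simplices q. \<lambda>i x. if x \<in> cap \<V> xs then alth r (\<lambda>ys. c ys i x) xs else 0)"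

text \<open>A prism simplex mixes vertices \<open>x\<close> and \<open>r x\<close>; the sets
  \<open>\<U> x\<close> and \<open>\<U> (r x)\<close> both contain \<open>\<V> x\<close>.\<close>

lemma prism_simplex:
 assumes r: "\<And>x. \<V> x \<subseteq> \<U> (r x)" and UV: "refined_by \<U> \<V>" and xs: "xs \<in> simplices q" and k: "k < length xs"
 defines "ys \<equiv> take (Suc k) xs @ map r (drop k xs)"
 shows "ys \<in> simplices (Suc q)" "cap \<V> xs \<subseteq> cap \<U> ys"
proof -
 show "ys \<in> simplices (Suc q)" using xs k by (simp add: ys_def simplices_def)
 have "set ys \<subseteq> set xs \<union> r ` set xs"
  using set_take_subset[of "Suc k" xs] set_drop_subset[of k xs] by (auto simp: ys_def)
 moreover have "x \<in> \<U> y" "x \<in> \<U> (r y)" if "x \<in> cap \<V> xs" "y \<in> set xs" for x y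
  using that r[of y] UV by (auto simp: cap_def refined_by_def)
 ultimately show "cap \<V> xs \<subseteq> cap \<U> ys" by (fastforce simp: cap_def)
qed

lemma prism_closed:
 assumes UV: "\<U> \<in> coverings" "\<V> \<in> coverings" "refined_by \<U> \<V>" and r: "\<And>x. \<V> x \<subseteq> \<U> (r x)"
  and c: "c \<in> carrier (cochains P \<U> (Suc q))"
 shows "prism r \<V> q c \<in> carrier (cochains P \<V> q)"
 unfolding prism_def
proof (rule cochainsI)
 fix xs :: "'a list" assume xs: "xs \<in> simplices q"
 note o = open_cap[OF UV(1)] open_cap[OF UV(2)]
 let ?y = "\<lambda>k. take (Suc k) xs @ map r (drop k xs)"
 have "(\<lambda>i x. \<Sum>k<length xs. (- 1) ^ k * restr (cap \<V> xs) (c (?y k)) i x) \<in> S (cap \<V> xs)"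
 proof (rule sum_closed[OF o(2)])
  fix k assume "k \<in> {..<length xs}"
  then have y: "?y k \<in> simplices (Suc q)" "cap \<V> xs \<subseteq> cap \<U> (?y k)"
   using prism_simplex[OF r UV(3) xs, of k] by simp_all
  show "(\<lambda>i x. (- 1) ^ k * restr (cap \<V> xs) (c (?y k)) i x) \<in> S (cap \<V> xs)"
   using restr_closed[OF o y(2)] cochainsD[OF c y(1)] by (intro sign_closed[OF o(2)]) simp
 qed simp
 also have "(\<lambda>i x. \<Sum>k<length xs. (- 1) ^ k * restr (cap \<V> xs) (c (?y k)) i x) =
   (\<lambda>i x. if x \<in> cap \<V> xs then alth r (\<lambda>ys. c ys i x) xs else 0)"
  by (auto simp: restr_def alth_eq_sum fun_eq_iff)
 finally show "(\<lambda>i x. if x \<in> cap \<V> xs then alth r (\<lambda>ys. c ys i x) xs else 0) \<in> carrier (Sec P (cap \<V> xs))"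
  by simp
qed

text \<open>\<open>altd_alth\<close> at each point. The term \<open>alth r (altd a)\<close>
  vanishes, since \<open>a\<close> comes from a cocycle and the point lies in the intersection
  belonging to every simplex of the prism, by \<open>prism_simplex\<close>.\<close>

lemma pullback_homotopic:
 assumes UV: "\<U> \<in> coverings" "\<V> \<in> coverings" "refined_by \<U> \<V>" and r: "\<And>x. \<V> x \<subseteq> \<U> (r x)"
  and c: "c \<in> cocycles P \<U> (Suc q)"
 shows "pullback P r \<U> \<V> (Suc q) c = cochain_res P \<U> \<V> (Suc q) c \<otimes>\<^bsub>cochains P \<V> (Suc q)\<^esub> cech_d P \<V> q (prism r \<V> q c)"
proof (rule ext)
 fix xs
 note c' = cocycles_cochains[OF c]
 note h = prism_closed[OF UV r c']
 show "pullback P r \<U> \<V> (Suc q) c xs =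
  (cochain_res P \<U> \<V> (Suc q) c \<otimes>\<^bsub>cochains P \<V> (Suc q)\<^esub> cech_d P \<V> q (prism r \<V> q c)) xs"
 proof (cases "xs \<in> simplices (Suc q)")
  case True
  have "restr (cap \<V> xs) (c (map r xs)) i x = restr (cap \<V> xs) (c xs) i x + cech_d P \<V> q (prism r \<V> q c) xs i x" for i x
  proof (cases "x \<in> cap \<V> xs")
   case x: True
   let ?a = "\<lambda>ys. c ys i x"
   have "prism r \<V> q c (omit k xs) i x = alth r ?a (omit k xs)" if "k < length xs" for k
    using omit_simplices[OF True, of k] that True x cap_omit[of \<V> xs k]
    by (auto simp: prism_def simplices_def)
   then have "altd (\<lambda>ys. prism r \<V> q c ys i x) xs = altd (alth r ?a) xs"
    by (simp add: altd_eq_sum[of _ xs])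
   moreover have "altd ?a (take (Suc k) xs @ map r (drop k xs)) = 0" if "k < length xs" for k
    using prism_simplex[OF r UV(3) True that] x cocycles_fun[OF UV(1) c] by blast
   then have "alth r (altd ?a) xs = 0" by (simp add: alth_eq_sum[of r _ xs])
   ultimately have "altd (\<lambda>ys. prism r \<V> q c ys i x) xs = c (map r xs) i x - c xs i x"
    using altd_alth[of r ?a xs] by simp
   then show ?thesis using x by (simp add: cech_d_fun[OF UV(2) h True] restr_def)
  qed (simp add: cech_d_fun[OF UV(2) h True] restr_def)
  then show ?thesis
   using True by (simp add: pullback_def cochain_res_def cochain_map_def cochains_mult fun_eq_iff)
 qed (simp add: pullback_def cochain_res_def cochain_map_def cochains_mult)
qed

end

section \<open>Exactness of cohomology\<close>

text \<open>Compact Hausdorff spaces are regular: \<open>x\<close> is separated from each point of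
  the compact complement, and finitely many of the neighbourhoods are intersected.\<close>

lemma compact_Hausdorff_shrink:
 fixes W :: "'a::t2_space set"
 assumes comp: "compact (UNIV :: 'a set)" and W: "open W" "x \<in> W"
 shows "\<exists>N. open N \<and> x \<in> N \<and> closure N \<subseteq> W"
proof -
 have W': "compact (- W)" using compact_Int_closed[OF comp closed_Compl[OF W(1)]] by simp
 have "\<exists>U V. open U \<and> open V \<and> x \<in> U \<and> y \<in> V \<and> U \<inter> V = {}" if "y \<in> - W" for y
  using hausdorff[of x y] W(2) that by auto
 then obtain U V where UV: "\<And>y. y \<in> - W ==> open (U y) \<and> open (V y) \<and> x \<in> U y \<and> y \<in> V y \<and> U y \<inter> V y = {}"
  by metis
 then have cov: "- W \<subseteq> (\<Union>y\<in>- W. V y)" by blast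
 obtain C where C: "C \<subseteq> - W" "finite C" "- W \<subseteq> (\<Union>y\<in>C. V y)"
  by (rule compactE_image[OF W' _ cov]) (use UV in blast)+
 let ?N = "\<Inter>y\<in>C. U y"
 have "open ?N" using C UV by (intro open_INT) blast+
 moreover have "x \<in> ?N" using C(1) UV by blast
 moreover have "closure ?N \<subseteq> - (\<Union>y\<in>C. V y)"
 proof (rule closure_minimal)
  show "?N \<subseteq> - (\<Union>y\<in>C. V y)" using C(1) UV by blast
  show "closed (- (\<Union>y\<in>C. V y))" using C(1) UV by (intro closed_Compl open_UN) blast
 qed
 moreover have "- (\<Union>y\<in>C. V y) \<subseteq> W" using C(3) by blast
 ultimately show ?thesis by (meson order.trans)
qed

text \<open>\<open>r x\<close> is a centre, among finitely many, whose shrunk set contains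
  \<open>x\<close>. The closures give room: a point outside \<open>W t\<close> has a neighbourhood
  disjoint from \<open>N t\<close>.\<close>

lemma finite_shrinking:
 fixes W :: "'a::t2_space => 'a set"
 assumes comp: "compact (UNIV :: 'a set)" and W: "W \<in> coverings"
 obtains N r where "\<And>x. open (N x)" "\<And>x. closure (N x) \<subseteq> W x" "finite (range r)" "\<And>x. x \<in> N (r x)"
proof -
 have "\<forall>x. \<exists>N. open N \<and> x \<in> N \<and> closure N \<subseteq> W x"
  using compact_Hausdorff_shrink[OF comp] W by (auto simp: coverings_def)
 then obtain N where N: "\<And>x. open (N x) \<and> x \<in> N x \<and> closure (N x) \<subseteq> W x" by metis
 have "UNIV \<subseteq> (\<Union>x\<in>UNIV. N x)" using N by blast
 obtain C where C: "finite C" "UNIV \<subseteq> (\<Union>x\<in>C. N x)"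
  by (rule compactE_image[OF comp _ \<open>UNIV \<subseteq> _\<close>]) (use N in blast)+
 then have "\<forall>x. \<exists>y\<in>C. x \<in> N y" by blast
 then obtain r where r: "\<And>x. r x \<in> C \<and> x \<in> N (r x)" by metis
 have "range r \<subseteq> C" using r by blast
 then have "finite (range r)" using C(1) finite_subset by blast
 then show ?thesis using that[of N r] N r by blast
qed

lemma finite_common_nhd:
 assumes "finite T" "open W" "x \<in> W"
  and ex: "\<And>t. t \<in> T ==> \<exists>A. open A \<and> x \<in> A \<and> Q t A"
  and mono: "\<And>t A B. t \<in> T ==> open A ==> open B ==> B \<subseteq> A ==> Q t A ==> Q t B"
 shows "\<exists>A. open A \<and> x \<in> A \<and> A \<subseteq> W \<and> (\<forall>t\<in>T. Q t A)"
 using assms(1) ex mono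
proof (induction T)
 case empty
 then show ?case using assms(2,3) by (intro exI[of _ W]) simp
next
 case (insert t T)
 have p1: "\<exists>A. open A \<and> x \<in> A \<and> Q u A" if "u \<in> T" for u
  using insert.prems(1)[of u] that by simp
 have p2: "Q u B" if "u \<in> T" "open A" "open B" "B \<subseteq> A" "Q u A" for u A B
  using insert.prems(2)[of u A B] that by simp
 have "\<exists>A. open A \<and> x \<in> A \<and> A \<subseteq> W \<and> (\<forall>t\<in>T. Q t A)"
 proof (rule insert.IH)
  show "\<exists>A. open A \<and> x \<in> A \<and> Q u A" if "u \<in> T" for u by (rule p1[OF that])
  show "Q u B" if "u \<in> T" "open A" "open B" "B \<subseteq> A" "Q u A" for u A B by (rule p2[OF that])
 qed
 then obtain A where A: "open A" "x \<in> A" "A \<subseteq> W" "\<forall>t\<in>T. Q t A"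
  by (elim exE conjE) (rule that; assumption)
 from insert.prems(1)[of t] obtain B where B: "open B" "x \<in> B" "Q t B" by auto
 have AB: "open (A \<inter> B)" using A B by blast
 have "Q t (A \<inter> B)" by (rule insert.prems(2)[of t B]) (use AB B in auto)
 moreover have "Q u (A \<inter> B)" if "u \<in> T" for u
  using p2[of u A "A \<inter> B"] that A AB by simp
 moreover have "x \<in> A \<inter> B" "A \<inter> B \<subseteq> W" using A B by auto
 ultimately show ?case using AB by (intro exI[of _ "A \<inter> B"]) simp
qed

lemma presheaf_hom_class_one:
 assumes P: "ab_presheaf P" "ab_presheaf P'" and \<eta>: "presheaf_hom P P' \<eta>"
  and c: "\<U> \<in> coverings" "c \<in> cocycles P \<U> q" and one: "cech_class P q \<U> c = \<one>\<^bsub>cohomology q P\<^esub>"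
 shows "cech_class P' q \<U> (cochain_map (\<lambda>xs. \<eta> (cap \<U> xs)) q c) = \<one>\<^bsub>cohomology q P'\<^esub>"
proof -
 interpret P: ab_presheaf P by fact
 interpret P': ab_presheaf P' by fact
 obtain \<W> where W: "\<W> \<in> coverings" "refined_by \<U> \<W>" "cochain_res P \<U> \<W> q c \<in> coboundaries P \<W> q"
  using one P.cech_class_eq_one_iff[OF c] by blast
 interpret U: cochain_morphism P P' \<U> \<U> "\<lambda>xs. \<eta> (cap \<U> xs)"
  by (rule presheaf_hom_cochain_morphism[OF P \<eta> c(1)])
 interpret W: cochain_morphism P P' \<W> \<W> "\<lambda>xs. \<eta> (cap \<W> xs)"
  by (rule presheaf_hom_cochain_morphism[OF P \<eta> W(1)])
 show ?thesis
  using W.coboundaries_map[OF W(3)] W(1,2)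
   cochain_map_res[OF \<eta> c(1) W(1,2) P.cocycles_cochains[OF c(2)]]
   P'.cech_class_eq_one_iff[OF c(1) U.cocycles_map[OF c(2)]] by auto
qed

lemma (in comm_group) conjugate_cancel:
 assumes "a \<in> carrier G" "b \<in> carrier G" "c \<in> carrier G"
 shows "a \<otimes> b \<otimes> inv c \<otimes> inv a = b \<otimes> inv c"
proof -
 have "a \<otimes> b \<otimes> inv c = (b \<otimes> inv c) \<otimes> a" using assms by (simp add: m_ac)
 then show ?thesis using assms by (simp add: m_assoc)
qed

text \<open>\<open>local\<close> says that membership in the subsheaf can be tested near each point;
  it turns local triviality in the quotient sheaf into membership in \<open>S'\<close>.\<close>

locale function_sheaf_pair = section_family S + S': section_family S'
 for S S' :: "'a::t2_space set => ('i => 'a => complex) set" +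
 assumes sub_S: "open U ==> S' U \<subseteq> S U"
  and local: "open U ==> t \<in> S U ==> (\<And>x. x \<in> U ==> \<exists>V. open V \<and> x \<in> V \<and> V \<subseteq> U \<and> restr V t \<in> S' V) ==> t \<in> S' U"
begin

abbreviation "Q \<equiv> fun_presheaf S'"

lemma sub_presheaf_fun: "sub_presheaf P Q"
proof (intro sub_presheaf.intro sub_presheaf_axioms.intro ab_presheaf_axioms)
 fix U :: "'a set" assume U: "open U"
 interpret U: comm_group "Sec P U" by (rule grp[OF U])
 have "S' U \<noteq> {}" using S'.zero[OF U] by blast
 then show "subgroup (carrier (Sec Q U)) (Sec P U)"
  using U sub_S[OF U] S'.add S'.neg S'.zero by (intro U.subgroupI) (auto simp: inv_Sec)
qed (use S'.restr_closed in auto)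

sublocale sub_presheaf P Q by (rule sub_presheaf_fun)

lemma presheaf_hom_inclusion: "presheaf_hom Q P (\<lambda>U t. t)"
 using sub_S by (intro presheaf_homI) (auto simp: hom_def)

lemma cochain_map_inclusion: "c \<in> carrier (cochains R \<U> q) ==> cochain_map (\<lambda>xs t. t) q c = c"
 by (auto simp: cochain_map_def carrier_cochains)

lemma cocycles_sub: "\<U> \<in> coverings ==> c \<in> cocycles Q \<U> q ==> c \<in> cocycles P \<U> q"
 using cochain_morphism.cocycles_map[OF presheaf_hom_cochain_morphism[OF S'.ab_presheaf_fun ab_presheaf_fun presheaf_hom_inclusion]]
  S'.cocycles_cochains cochain_map_inclusion by fastforce

text \<open>Each value of \<open>c\<close> projects to one, hence lies in \<open>S'\<close> locally
  by \<open>proj_eq_one\<close>, hence in \<open>S'\<close> by \<open>local\<close>; the cocycle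
  equation is the same pointwise condition in both sheaves.\<close>

lemma cocycle_subI:
 assumes U: "\<U> \<in> coverings" and c: "c \<in> cocycles P \<U> q"
  and one: "cochain_map (\<lambda>xs. proj (cap \<U> xs)) q c = \<one>\<^bsub>cochains (quotient_sheaf P Q) \<U> q\<^esub>"
 shows "c \<in> cocycles Q \<U> q"
proof (rule S'.cocycles_funI[OF U])
 have c': "c \<in> carrier (cochains P \<U> q)" by (rule cocycles_cochains[OF c])
 have "c xs \<in> S' (cap \<U> xs)" if xs: "xs \<in> simplices q" for xs
 proof (rule local[OF open_cap[OF U]])
  show cxs: "c xs \<in> S (cap \<U> xs)" using cochainsD[OF c' xs] by simp
  fix x assume x: "x \<in> cap \<U> xs"
  have "proj (cap \<U> xs) (c xs) = \<one>\<^bsub>Sec (quotient_sheaf P Q) (cap \<U> xs)\<^esub>"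
   using fun_cong[OF one, of xs] xs by (simp add: cochain_map_def cochains_one)
  then show "\<exists>V. open V \<and> x \<in> V \<and> V \<subseteq> cap \<U> xs \<and> restr V (c xs) \<in> S' V"
   using proj_eq_one[OF open_cap[OF U] _ x, of "c xs"] cxs by simp
 qed
 then show "c \<in> carrier (cochains Q \<U> q)" using c' by (auto simp: carrier_cochains)
 show "\<And>xs i x. xs \<in> simplices (Suc q) ==> x \<in> cap \<U> xs ==> altd (\<lambda>ys. c ys i x) xs = 0"
  by (rule cocycles_fun[OF U c])
qed

text \<open>Over a tuple of vertices in the finite range of \<open>r\<close>, a point either lies in the corresponding
 intersection, where the section of the quotient lifts locally, or it has a neighbourhood missing
 one of the shrunk sets. So finitely many conditions determine the refinement.\<close>

lemma lift_cochain:
 assumes comp: "compact (UNIV :: 'a set)" and U: "\<U> \<in> coverings"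
  and e: "e \<in> carrier (cochains (quotient_sheaf P Q) \<U> p)"
 obtains \<V> r where "\<V> \<in> coverings" "refined_by \<U> \<V>" "\<And>x. \<V> x \<subseteq> \<U> (r x)"
  "\<And>xs. xs \<in> simplices p ==> \<exists>t\<in>S (cap \<V> xs). pullback (quotient_sheaf P Q) r \<U> \<V> p e xs = proj (cap \<V> xs) t"
proof -
 let ?R = "quotient_sheaf P Q"
 interpret R: ab_presheaf ?R by (rule ab_presheaf_quotient_sheaf)
 obtain N r where N: "\<And>x. open (N x)" "\<And>x. closure (N x) \<subseteq> \<U> x" and r: "finite (range r)" "\<And>x. x \<in> N (r x)"
  using finite_shrinking[OF comp U] by blast
 have NU: "N x \<subseteq> \<U> x" for x using N(2)[of x] closure_subset by blast
 \<comment> \<open>In \<open>map r xs\<close> only vertices from the finite range of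
   \<open>r\<close> occur, so in a fixed degree these finitely many tuples are all that the
   refinement must respect.\<close>
 define T where "T = {ts. set ts \<subseteq> range r \<and> length ts = Suc p}"
 have T: "finite T" unfolding T_def by (rule finite_lists_length_eq[OF r(1)])
 have Ts: "ts \<in> simplices p" if "ts \<in> T" for ts using that by (simp add: T_def simplices_def)
 define C where "C ts A \<longleftrightarrow> (A \<subseteq> cap \<U> ts \<and> (\<exists>t\<in>S A. Res ?R (cap \<U> ts) A (e ts) = proj A t)) \<or> (\<exists>t\<in>set ts. A \<inter> N t = {})" for ts A
 have lift_mono: "\<exists>t\<in>S B. Res ?R (cap \<U> ts) B (e ts) = proj B t"
  if "ts \<in> simplices p" "open A" "open B" "B \<subseteq> A" "A \<subseteq> cap \<U> ts" "\<exists>t\<in>S A. Res ?R (cap \<U> ts) A (e ts) = proj A t" for ts A B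
 proof -
  obtain t where t: "t \<in> S A" "Res ?R (cap \<U> ts) A (e ts) = proj A t" using \<open>\<exists>t\<in>S A. _ t\<close> by blast
  have "Res ?R (cap \<U> ts) B (e ts) = Res ?R A B (proj A t)"
   using R.res_comp[OF open_cap[OF U] that(2-5) cochainsD[OF e that(1)]] t(2) by simp
  also have "\<dots> = proj B (restr B t)"
   using presheaf_homD(3)[OF presheaf_hom_proj that(2-4), of t] t(1) by simp
  finally show ?thesis using restr_closed[OF that(2-4) t(1)] by blast
 qed
 have "\<exists>A. open A \<and> x \<in> A \<and> A \<subseteq> \<U> x \<inter> N (r x) \<and> (\<forall>ts\<in>T. C ts A)" for x
 proof (rule finite_common_nhd[OF T])
  show "open (\<U> x \<inter> N (r x))" "x \<in> \<U> x \<inter> N (r x)" using U N r by (auto simp: coverings_def)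
  fix ts assume ts: "ts \<in> T"
  show "\<exists>A. open A \<and> x \<in> A \<and> C ts A"
  proof (cases "x \<in> cap \<U> ts")
   case True
   then show ?thesis
    using proj_lift[OF open_cap[OF U] cochainsD[OF e Ts[OF ts]] True] unfolding C_def by fastforce
  next
   case False
   then obtain t where t: "t \<in> set ts" "x \<notin> \<U> t" by (auto simp: cap_def)
   then have "x \<in> - closure (N t)" using N(2) by blast
   moreover have "- closure (N t) \<inter> N t = {}" using closure_subset by blast
   ultimately show ?thesis using t(1) unfolding C_def by blast
  qed
  fix A B assume "open A" "open B" "B \<subseteq> A" "C ts A"
  then show "C ts B" using lift_mono[OF Ts[OF ts]] unfolding C_def by blast
 qed
 then obtain \<V> where V: "\<And>x. open (\<V> x) \<and> x \<in> \<V> x \<and> \<V> x \<subseteq> \<U> x \<inter> N (r x) \<and> (\<forall>ts\<in>T. C ts (\<V> x))"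
  by metis
 have Vc: "\<V> \<in> coverings" "refined_by \<U> \<V>" using V by (auto simp: coverings_def refined_by_def)
 have Vr: "\<V> x \<subseteq> \<U> (r x)" for x using V NU by blast
 show ?thesis
 proof (rule that[OF Vc Vr])
  fix xs :: "'a list" assume xs: "xs \<in> simplices p"
  let ?ts = "map r xs"
  have ts: "?ts \<in> T" using xs by (auto simp: T_def simplices_def)
  have oV: "open (cap \<V> xs)" by (rule open_cap[OF Vc(1)])
  obtain x where x: "x \<in> set xs" using xs by (cases xs) (auto simp: simplices_def)
  then have cx: "cap \<V> xs \<subseteq> \<V> x" by (auto simp: cap_def)
  have "\<exists>t\<in>S (cap \<V> xs). Res ?R (cap \<U> ?ts) (cap \<V> xs) (e ?ts) = proj (cap \<V> xs) t"
  proof (cases "\<V> x \<subseteq> cap \<U> ?ts \<and> (\<exists>t\<in>S (\<V> x). Res ?R (cap \<U> ?ts) (\<V> x) (e ?ts) = proj (\<V> x) t)")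
   case True
   then show ?thesis using lift_mono[OF Ts[OF ts] _ oV cx] V by blast
  next
   case False
   then obtain t where t: "t \<in> set ?ts" "\<V> x \<inter> N t = {}" using V ts unfolding C_def by blast
   then obtain y where y: "y \<in> set xs" "t = r y" by auto
   \<comment> \<open>\<open>\<V> y\<close> lies in \<open>N (r y)\<close>, which
     \<open>\<V> x\<close> misses; so the intersection is empty, and both sides of the claim are the
     one section over it.\<close>
   have "cap \<V> xs \<subseteq> \<V> y" using y by (auto simp: cap_def)
   then have empty: "cap \<V> xs = {}" using cx t(2) y(2) V[of y] by blast
   have u: "g = (\<lambda>x. undefined)" if "g \<in> carrier (Sec ?R (cap \<V> xs))" for g
    using Sec_quotient_empty[of g] that empty by simp
   have 1: "Res ?R (cap \<U> ?ts) (cap \<V> xs) (e ?ts) \<in> carrier (Sec ?R (cap \<V> xs))"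
    by (intro R.res_closed open_cap[OF U] oV cap_map Vr cochainsD[OF e Ts[OF ts]])
   have 2: "proj (cap \<V> xs) (\<lambda>i x. 0) \<in> carrier (Sec ?R (cap \<V> xs))"
    using presheaf_homD(2)[OF presheaf_hom_proj oV] zero[OF oV] by simp
   show ?thesis using u[OF 1] u[OF 2] zero[OF oV] by (intro bexI[of _ "\<lambda>i x. 0"]) simp_all
  qed
  then show "\<exists>t\<in>S (cap \<V> xs). pullback ?R r \<U> \<V> p e xs = proj (cap \<V> xs) t"
   using xs by (simp add: pullback_def)
 qed
qed

text \<open>A cochain \<open>e\<close> whose coboundary is the projected cocycle lifts to
  \<open>l'\<close> after refining and pulling back along \<open>r\<close>. The pullback of
  \<open>d\<close>, divided by the coboundary of \<open>l'\<close>, projects to one and therefore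
  lies in \<open>Q\<close>; by the prism formula it has the class of \<open>c\<close>.\<close>

lemma cohomology_exact:
 assumes comp: "compact (UNIV :: 'a set)" and U: "\<U> \<in> coverings" and c: "c \<in> cocycles P \<U> q"
  and one: "cech_class (quotient_sheaf P Q) q \<U> (cochain_map (\<lambda>xs. proj (cap \<U> xs)) q c) = \<one>\<^bsub>cohomology q (quotient_sheaf P Q)\<^esub>"
 obtains \<V> c' where "\<V> \<in> coverings" "c' \<in> cocycles Q \<V> q" "cech_class P q \<V> c' = cech_class P q \<U> c"
proof -
 let ?R = "quotient_sheaf P Q"
 let ?m = "\<lambda>\<W>. cochain_map (\<lambda>xs. proj (cap \<W> xs))"
 interpret R: ab_presheaf ?R by (rule ab_presheaf_quotient_sheaf)
 note pm = presheaf_hom_cochain_morphism[OF ab_presheaf_fun R.ab_presheaf_axioms presheaf_hom_proj]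
 obtain \<W> where W: "\<W> \<in> coverings" "refined_by \<U> \<W>" and cob: "cochain_res ?R \<U> \<W> q (?m \<U> q c) \<in> coboundaries ?R \<W> q"
  using one R.cech_class_eq_one_iff[OF U cochain_morphism.cocycles_map[OF pm[OF U] c]] by blast
 define d where "d = cochain_res P \<U> \<W> q c"
 have d: "d \<in> cocycles P \<W> q" unfolding d_def by (rule res_cocycles[OF U W c])
 have cl: "cech_class P q \<W> d = cech_class P q \<U> c" unfolding d_def by (rule cech_class_res[OF U c W])
 have cob: "?m \<W> q d \<in> coboundaries ?R \<W> q"
  using cob cochain_map_res[OF presheaf_hom_proj U W cocycles_cochains[OF c]] by (simp add: d_def)
 show ?thesis
 proof (cases q)
  \<comment> \<open>In degree 0 the only coboundary is one, so the restricted cocycle itself lies in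
    \<open>Q\<close>.\<close>
  case 0
  then have "d \<in> cocycles Q \<W> q" using cob by (intro cocycle_subI[OF W(1) d]) simp
  then show ?thesis using that W(1) cl by blast
 next
  case (Suc p)
  then obtain e where e: "e \<in> carrier (cochains ?R \<W> p)" "?m \<W> q d = cech_d ?R \<W> p e"
   using cob by auto
  obtain \<V> r where V: "\<V> \<in> coverings" "refined_by \<W> \<V>" and r: "\<And>x. \<V> x \<subseteq> \<W> (r x)"
   and lift: "\<And>xs. xs \<in> simplices p ==> \<exists>t\<in>S (cap \<V> xs). pullback ?R r \<W> \<V> p e xs = proj (cap \<V> xs) t"
   using lift_cochain[OF comp W(1) e(1)] by blast
  obtain l where l: "\<And>xs. xs \<in> simplices p ==> l xs \<in> S (cap \<V> xs) \<and> pullback ?R r \<W> \<V> p e xs = proj (cap \<V> xs) (l xs)"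
   using lift by metis
  define l' where "l' = (\<lambda>xs\<in>simplices p. l xs)"
  have l': "l' \<in> carrier (cochains P \<V> p)" unfolding l'_def using l by (intro cochainsI) simp
  have le: "?m \<V> p l' = pullback ?R r \<W> \<V> p e"
   using l by (auto simp: l'_def cochain_map_def pullback_def fun_eq_iff)
  interpret m: cochain_morphism P ?R \<V> \<V> "\<lambda>xs. proj (cap \<V> xs)" by (rule pm[OF V(1)])
  interpret G: comm_group "cochains P \<V> q" by (rule cochains_grp[OF V(1)])
  interpret H: comm_group "cochains ?R \<V> q" by (rule R.cochains_grp[OF V(1)])
  let ?d'' = "pullback P r \<W> \<V> q d"
  have d': "d \<in> carrier (cochains P \<W> q)" by (rule cocycles_cochains[OF d])
  have d'': "?d'' \<in> carrier (cochains P \<V> q)"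
   by (rule pullback_closed[OF W(1) V(1) r d'])
  have "?m \<V> q ?d'' = pullback ?R r \<W> \<V> q (?m \<W> q d)"
  proof (rule ext)
   fix xs
   show "?m \<V> q ?d'' xs = pullback ?R r \<W> \<V> q (?m \<W> q d) xs"
   proof (cases "xs \<in> simplices q")
    case True
    then have "d (map r xs) \<in> carrier (Sec P (cap \<W> (map r xs)))"
     by (intro cochainsD[OF d']) (simp add: map_simplices)
    then show ?thesis
     using True presheaf_homD(3)[OF presheaf_hom_proj open_cap[OF W(1)] open_cap[OF V(1)] cap_map[of \<V> \<W> r, OF r], of "d (map r xs)"]
     by (simp add: cochain_map_def pullback_def map_simplices)
   qed (simp add: cochain_map_def pullback_def)
  qed
  also have "\<dots> = cech_d ?R \<V> p (pullback ?R r \<W> \<V> p e)"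
   unfolding e(2) by (simp only: Suc R.cech_d_pullback[OF W(1) V(1) r e(1)])
  also have "\<dots> = ?m \<V> q (cech_d P \<V> p l')"
   unfolding le[symmetric] m.cech_d_map[OF l'] Suc ..
  finally have eq: "?m \<V> q ?d'' = ?m \<V> q (cech_d P \<V> p l')" .
  have dl: "cech_d P \<V> p l' \<in> cocycles P \<V> q" unfolding Suc by (rule cech_d_cocycle[OF V(1) l'])
  note dl' = cocycles_cochains[OF dl]
  define f where "f = ?d'' \<otimes>\<^bsub>cochains P \<V> q\<^esub> inv\<^bsub>cochains P \<V> q\<^esub> cech_d P \<V> p l'"
  have hom: "group_hom (cochains P \<V> q) (cochains ?R \<V> q) (?m \<V> q)"
   using m.map_hom cochains_grp'[OF V(1)] R.cochains_grp'[OF V(1)] by (simp add: group_hom_def group_hom_axioms_def)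
  have "?m \<V> q f = \<one>\<^bsub>cochains ?R \<V> q\<^esub>"
   using eq d'' dl' m.map_closed[OF d'', unfolded eq]
   by (simp add: f_def group_hom.hom_mult[OF hom] group_hom.hom_inv[OF hom])
  moreover have "?d'' \<in> cocycles P \<V> q"
  proof -
   have "cech_d P \<W> q d = \<one>\<^bsub>cochains P \<W> (Suc q)\<^esub>" using d by (simp add: cocycles_def kernel_def)
   then have "cech_d P \<V> q ?d'' = \<one>\<^bsub>cochains P \<V> (Suc q)\<^esub>"
    unfolding cech_d_pullback[OF W(1) V(1) r d']
    by (auto simp: pullback_def cochains_one map_simplices restr_def fun_eq_iff)
   then show ?thesis using d'' by (simp add: cocycles_def kernel_def)
  qed
  then have f: "f \<in> cocycles P \<V> q"
   unfolding f_def
   by (intro subgroup.m_closed[OF subgroup_cocycles[OF V(1)]] subgroup.m_inv_closed[OF subgroup_cocycles[OF V(1)]] dl)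
  ultimately have fQ: "f \<in> cocycles Q \<V> q" by (intro cocycle_subI[OF V(1)])
  \<comment> \<open>Since \<open>r\<close> moves vertices, the pullback of \<open>d\<close> is not
    its restriction; the two differ by the coboundary of this prism.\<close>
  let ?h = "prism r \<V> p d"
  have h: "?h \<in> carrier (cochains P \<V> p)" using prism_closed[OF W(1) V r] d' Suc by simp
  have dh: "cech_d P \<V> p ?h \<in> carrier (cochains P \<V> q)"
   unfolding Suc using cech_d_hom[OF V(1)] h by (auto simp: hom_def)
  have res: "cochain_res P \<W> \<V> q d \<in> cocycles P \<V> q" by (rule res_cocycles[OF W(1) V d])
  note res' = cocycles_cochains[OF res]
  have "?d'' = cochain_res P \<W> \<V> q d \<otimes>\<^bsub>cochains P \<V> q\<^esub> cech_d P \<V> p ?h"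
   unfolding Suc by (rule pullback_homotopic[OF W(1) V r d[unfolded Suc]])
  then have "f \<otimes>\<^bsub>cochains P \<V> q\<^esub> inv\<^bsub>cochains P \<V> q\<^esub> cochain_res P \<W> \<V> q d =
    cech_d P \<V> p ?h \<otimes>\<^bsub>cochains P \<V> q\<^esub> inv\<^bsub>cochains P \<V> q\<^esub> cech_d P \<V> p l'"
   unfolding f_def using G.conjugate_cancel[OF res' dh dl'] by simp
  also have "\<dots> \<in> coboundaries P \<V> q"
   by (intro subgroup.m_closed[OF subgroup_coboundaries[OF V(1)]] subgroup.m_inv_closed[OF subgroup_coboundaries[OF V(1)]])
    (simp_all add: Suc h l')
  finally have bd: "f \<otimes>\<^bsub>cochains P \<V> q\<^esub> inv\<^bsub>cochains P \<V> q\<^esub> cochain_res P \<W> \<V> q d \<in> coboundaries P \<V> q" .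
  \<comment> \<open>\<open>cech_class_eq_iff\<close> compares after a refinement; here that
    refinement is \<open>\<V>\<close> itself, where restriction is the identity.\<close>
  have id: "cochain_res P \<V> \<V> q a = a" if "a \<in> carrier (cochains P \<V> q)" for a
  proof -
   have "restr (cap \<V> xs) (a xs) = a xs" if "xs \<in> simplices q" for xs
    using res_id[OF open_cap[OF V(1)] cochainsD[OF \<open>a \<in> _\<close> that]] by simp
   then have "cochain_res P \<V> \<V> q a = cochain_map (\<lambda>xs t. t) q a"
    by (auto simp: cochain_res_def cochain_map_def fun_eq_iff)
   then show ?thesis using cochain_map_inclusion[OF that] by simp
  qed
  have "cech_class P q \<V> f = cech_class P q \<V> (cochain_res P \<W> \<V> q d)"
   unfolding cech_class_eq_iff[OF V(1) f V(1) res]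
   using bd id[OF cocycles_cochains[OF f]] id[OF res'] V(1) refined_by_refl by (intro bexI[of _ \<V>]) simp_all
  then show ?thesis using that[OF V(1) fQ] cech_class_res[OF W(1) d V] cl by simp
 qed
qed

end

text \<open>If the class of \<open>c\<close> dies under \<open>\<eta>\<close>, it also dies in the
  quotient of the target. By \<open>nu\<close> its image in the quotient of \<open>S\<close> by
  \<open>S2\<close> is then one, and exactness yields a cocycle of \<open>S2\<close> with the same
  class in \<open>S\<close>, to which \<open>prev\<close> applies.\<close>

lemma kernel_induction_step:
 fixes S S1 S2 :: "'a::t2_space set => ('i => 'a => complex) set"
 assumes comp: "compact (UNIV :: 'a set)"
  and S2: "function_sheaf_pair S S2" and S12: "function_sheaf_pair S1 S2" and S1: "function_sheaf_pair S S1"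
  and PM: "sub_presheaf PM QM" and \<eta>: "presheaf_hom (fun_presheaf S) PM \<eta>"
  and \<eta>2: "\<And>U t. open U ==> t \<in> S2 U ==> \<eta> U t \<in> carrier (Sec QM U)"
  and prev: "\<And>\<U> c. \<U> \<in> coverings ==> c \<in> cocycles (fun_presheaf S2) \<U> q ==>
   cohomology_map q PM \<eta> (cech_class (fun_presheaf S) q \<U> c) = \<one>\<^bsub>cohomology q PM\<^esub> ==>
   cech_class (fun_presheaf S) q \<U> c = \<one>\<^bsub>cohomology q (fun_presheaf S)\<^esub>"
  and nu: "\<And>A. A \<in> carrier (cohomology q (quotient_sheaf (fun_presheaf S1) (fun_presheaf S2))) ==>
   cohomology_map q (quotient_sheaf PM QM) (quotient_sheaf_map PM QM \<eta>)
    (cohomology_map q (quotient_sheaf (fun_presheaf S) (fun_presheaf S2))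
     (quotient_sheaf_map (fun_presheaf S) (fun_presheaf S2) (\<lambda>U t. t)) A) = \<one>\<^bsub>cohomology q (quotient_sheaf PM QM)\<^esub> ==>
   cohomology_map q (quotient_sheaf (fun_presheaf S) (fun_presheaf S2))
     (quotient_sheaf_map (fun_presheaf S) (fun_presheaf S2) (\<lambda>U t. t)) A =
    \<one>\<^bsub>cohomology q (quotient_sheaf (fun_presheaf S) (fun_presheaf S2))\<^esub>"
  and c: "\<U> \<in> coverings" "c \<in> cocycles (fun_presheaf S1) \<U> q"
   "cohomology_map q PM \<eta> (cech_class (fun_presheaf S) q \<U> c) = \<one>\<^bsub>cohomology q PM\<^esub>"
 shows "cech_class (fun_presheaf S) q \<U> c = \<one>\<^bsub>cohomology q (fun_presheaf S)\<^esub>"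
proof -
 interpret I: function_sheaf_pair S S2 by fact
 interpret J: function_sheaf_pair S1 S2 by fact
 interpret IJ: function_sheaf_pair S S1 by fact
 interpret PM: sub_presheaf PM QM by fact
 let ?RJ = "quotient_sheaf (fun_presheaf S1) (fun_presheaf S2)"
 let ?RI = "quotient_sheaf (fun_presheaf S) (fun_presheaf S2)"
 let ?RM = "quotient_sheaf PM QM"
 note aJ = J.ab_presheaf_fun and aI = I.ab_presheaf_fun and aM = PM.ab_presheaf_axioms
 note rJ = J.ab_presheaf_quotient_sheaf and rI = I.ab_presheaf_quotient_sheaf and rM = PM.ab_presheaf_quotient_sheaf
 have cI: "c \<in> cocycles (fun_presheaf S) \<U> q" by (rule IJ.cocycles_sub[OF c(1,2)])
 let ?pJ = "cochain_map (\<lambda>xs. J.proj (cap \<U> xs)) q c"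
 let ?pI = "cochain_map (\<lambda>xs. I.proj (cap \<U> xs)) q c"
 let ?\<eta>c = "cochain_map (\<lambda>xs. \<eta> (cap \<U> xs)) q c"
 let ?pM = "cochain_map (\<lambda>xs. PM.proj (cap \<U> xs)) q ?\<eta>c"
 have pJ: "?pJ \<in> cocycles ?RJ \<U> q"
  by (rule cochain_morphism.cocycles_map[OF presheaf_hom_cochain_morphism[OF aJ rJ J.presheaf_hom_proj c(1)] c(2)])
 have pI: "?pI \<in> cocycles ?RI \<U> q"
  by (rule cochain_morphism.cocycles_map[OF presheaf_hom_cochain_morphism[OF aI rI I.presheaf_hom_proj c(1)] cI])
 have \<eta>c: "?\<eta>c \<in> cocycles PM \<U> q"
  by (rule cochain_morphism.cocycles_map[OF presheaf_hom_cochain_morphism[OF aI aM \<eta> c(1)] cI])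
 note qi = quotient_sheaf_map[OF J.sub_presheaf_fun I.sub_presheaf_fun IJ.presheaf_hom_inclusion]
 note q\<eta> = quotient_sheaf_map[OF I.sub_presheaf_fun PM \<eta>]
 have "cochain_map (\<lambda>xs. quotient_sheaf_map (fun_presheaf S) (fun_presheaf S2) (\<lambda>U t. t) (cap \<U> xs)) q ?pJ = ?pI"
  using qi(2)[OF _ open_cap[OF c(1)]] cochainsD[OF J.cocycles_cochains[OF c(2)]]
  by (auto simp: cochain_map_def fun_eq_iff)
 then have tau: "cohomology_map q ?RI (quotient_sheaf_map (fun_presheaf S) (fun_presheaf S2) (\<lambda>U t. t)) (cech_class ?RJ q \<U> ?pJ)
   = cech_class ?RI q \<U> ?pI"
  using cohomology_map_class[OF rJ rI qi(1) c(1) pJ] by simp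
 have "cochain_map (\<lambda>xs. quotient_sheaf_map PM QM \<eta> (cap \<U> xs)) q ?pI = ?pM"
  using q\<eta>(2)[OF _ open_cap[OF c(1)]] \<eta>2 cochainsD[OF I.cocycles_cochains[OF cI]]
  by (auto simp: cochain_map_def fun_eq_iff)
 then have nu': "cohomology_map q ?RM (quotient_sheaf_map PM QM \<eta>) (cech_class ?RI q \<U> ?pI) = cech_class ?RM q \<U> ?pM"
  using cohomology_map_class[OF rI rM q\<eta>(1) c(1) pI] \<eta>2 by simp
 have "cech_class PM q \<U> ?\<eta>c = \<one>\<^bsub>cohomology q PM\<^esub>"
  using c(3) cohomology_map_class[OF aI aM \<eta> c(1) cI] by simp
 then have "cech_class ?RM q \<U> ?pM = \<one>\<^bsub>cohomology q ?RM\<^esub>"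
  by (rule presheaf_hom_class_one[OF aM rM PM.presheaf_hom_proj c(1) \<eta>c])
 moreover have "cech_class ?RJ q \<U> ?pJ \<in> carrier (cohomology q ?RJ)"
  using c(1) pJ by (auto simp: ab_presheaf.carrier_cohomology[OF rJ])
 ultimately have "cech_class ?RI q \<U> ?pI = \<one>\<^bsub>cohomology q ?RI\<^esub>"
  using nu[of "cech_class ?RJ q \<U> ?pJ"] tau nu' by simp
 then obtain \<V> c' where c': "\<V> \<in> coverings" "c' \<in> cocycles (fun_presheaf S2) \<V> q"
   "cech_class (fun_presheaf S) q \<V> c' = cech_class (fun_presheaf S) q \<U> c"
  using I.cohomology_exact[OF comp c(1) cI] by blast
 then show ?thesis using prev[OF c'(1,2)] c(3) by simp
qed

section \<open>Lipschitz maps and Lebesgue measure\<close>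

lemma content_cube_around:
 fixes c :: "'v::euclidean_space"
 assumes "s \<ge> 0"
 shows "emeasure lborel (cbox (c - s *\<^sub>R One) (c + s *\<^sub>R One)) = ennreal ((2 * s) ^ DIM('v))"
proof -
 have "emeasure lborel (cbox (c - s *\<^sub>R One) (c + s *\<^sub>R One)) = ennreal (\<Prod>b\<in>(Basis::'v set). 2 * s)"
  using assms by (subst emeasure_lborel_cbox) (auto simp: inner_diff_left inner_add_left inner_sum_left inner_Basis if_distrib cong: if_cong intro!: arg_cong[of _ _ ennreal] prod.cong)
 then show ?thesis by (simp add: prod_constant)
qed

text \<open>\<open>A\<close> is covered by dyadic cubes of almost the same total measure. Two points
  of a cube of side s in dimension d are at distance at most d s, so the image of the cube lies in a
  cube of side 2 L d s; this is the origin of the factor.\<close>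

lemma emeasure_lipschitz_image:
 fixes f :: "'v::euclidean_space => 'v"
 assumes A: "A \<in> sets borel" "bounded A" and fA: "f ` A \<in> sets borel"
  and L: "L \<ge> 0" "\<And>x y. x \<in> A ==> y \<in> A ==> norm (f x - f y) \<le> L * norm (x - y)"
 shows "emeasure lborel (f ` A) \<le> ennreal ((2 * (L * DIM('v))) ^ DIM('v)) * emeasure lborel A"
proof -
 let ?d = "DIM('v)"
 let ?C = "ennreal ((2 * (L * ?d)) ^ ?d)"
 obtain R where R: "R > 0" "A \<subseteq> cbox (- R *\<^sub>R One) (R *\<^sub>R One)"
 proof -
  obtain B where B: "B > 0" "\<And>x. x \<in> A ==> norm x \<le> B" using A(2) by (auto simp: bounded_pos)
  have "- B \<le> x \<bullet> i \<and> x \<bullet> i \<le> B" if "x \<in> A" "i \<in> Basis" for x i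
   using Basis_le_norm[OF that(2), of x] B(2)[OF that(1)] by linarith
  then show ?thesis using that[of B] B(1) by (fastforce simp: mem_box inner_sum_left inner_Basis)
 qed
 let ?a = "- R *\<^sub>R One :: 'v" and ?b = "R *\<^sub>R One :: 'v"
 have side: "?b \<bullet> i - ?a \<bullet> i = 2 * R" if "i \<in> Basis" for i
  using that by (simp add: inner_sum_left inner_Basis if_distrib cong: if_cong)
 have box: "box ?a ?b \<noteq> {}" using R(1) by (auto simp: box_ne_empty inner_sum_left inner_Basis if_distrib cong: if_cong)
 have Al: "A \<in> lmeasurable"
  using A by (intro bounded_set_imp_lmeasurable) auto
 have eA: "emeasure lborel A = ennreal (measure lebesgue A)"
  using A emeasure_eq_measure2[OF Al] by (simp add: emeasure_completion)
 show ?thesis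
 proof (rule ennreal_le_epsilon)
  fix e :: real assume e: "e > 0"
  \<comment> \<open>The \<open>+ 1\<close> keeps the denominator positive when
    \<open>L = 0\<close>.\<close>
  define e' where "e' = e / ((2 * (L * ?d)) ^ ?d + 1)"
  have C0: "(2 * (L * ?d)) ^ ?d \<ge> 0" using L(1) by simp
  then have e': "e' > 0" "(2 * (L * ?d)) ^ ?d * e' \<le> e" using e by (auto simp: e'_def field_simps)
  obtain \<D> where D: "countable \<D>" "\<And>K. K \<in> \<D> ==> K \<subseteq> cbox ?a ?b \<and> K \<noteq> {} \<and> (\<exists>c d. K = cbox c d)"
    "pairwise (\<lambda>A B. interior A \<inter> interior B = {}) \<D>"
    "\<And>u v. cbox u v \<in> \<D> ==> \<exists>n. \<forall>i \<in> Basis. v \<bullet> i - u \<bullet> i = (?b \<bullet> i - ?a \<bullet> i)/2^n"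
    "A \<subseteq> \<Union>\<D>" "\<Union>\<D> \<in> lmeasurable" "measure lebesgue (\<Union>\<D>) \<le> measure lebesgue A + e'"
   using measurable_outer_intervals_bounded[OF Al R(2) e'(1)] by metis
  \<comment> \<open>An enumeration of the cubes, padded with empty sets. Additivity is applied to
    the interiors, because the closed cubes may overlap along faces.\<close>
  define g where "g n = (if n \<in> to_nat_on \<D> ` \<D> then from_nat_into \<D> n else {})" for n
  have g_D: "g n = {} \<or> g n \<in> \<D>" for n
   using D(1) by (auto simp: g_def)
  have Ug: "\<Union>\<D> = (\<Union>n. g n)"
   using D(1) by (force simp: g_def)
  have disj: "disjoint_family (\<lambda>n. interior (g n))"
   unfolding disjoint_family_on_def
  proof (intro ballI impI)
   fix m n :: nat assume mn: "m \<noteq> n"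
   show "interior (g m) \<inter> interior (g n) = {}"
   proof (cases "m \<in> to_nat_on \<D> ` \<D> \<and> n \<in> to_nat_on \<D> ` \<D>")
    case True
    then obtain K K' where K: "K \<in> \<D>" "m = to_nat_on \<D> K" "K' \<in> \<D>" "n = to_nat_on \<D> K'" by blast
    then have "K \<noteq> K'" "g m = K" "g n = K'" using mn D(1) by (auto simp: g_def)
    then show ?thesis using D(3) K by (auto simp: pairwise_def)
   qed (auto simp: g_def)
  qed
  have cube: "\<exists>Q. Q \<in> sets borel \<and> f ` (g n \<inter> A) \<subseteq> Q \<and> emeasure lborel Q \<le> ?C * emeasure lborel (interior (g n))" for n
  proof (cases "g n \<inter> A = {}")
   case False
   then obtain p where p: "p \<in> g n" "p \<in> A" by blast
   then have gn: "g n \<in> \<D>" using g_D[of n] by auto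
   then obtain u v where uv: "g n = cbox u v" using D(2) by blast
   obtain k where k: "\<And>i. i \<in> Basis ==> v \<bullet> i - u \<bullet> i = 2 * R / 2 ^ k"
    using D(4) gn uv side by (metis (no_types, lifting))
   let ?s = "2 * R / 2 ^ k"
   have s: "?s > 0" using R(1) by simp
   have dist: "norm (f x - f p) \<le> L * ?d * ?s" if "x \<in> g n \<inter> A" for x
   proof -
    have "\<bar>(x - p) \<bullet> i\<bar> \<le> ?s" if "i \<in> Basis" for i
    proof -
     have "u \<bullet> i \<le> x \<bullet> i" "x \<bullet> i \<le> v \<bullet> i" "u \<bullet> i \<le> p \<bullet> i" "p \<bullet> i \<le> v \<bullet> i"
      using \<open>x \<in> g n \<inter> A\<close> p uv that by (auto simp: mem_box)
     then show ?thesis using k[OF that] by (simp add: inner_diff_left)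
    qed
    then have "(\<Sum>i\<in>Basis. \<bar>(x - p) \<bullet> i\<bar>) \<le> (\<Sum>i\<in>(Basis::'v set). ?s)" by (rule sum_mono)
    then have "norm (x - p) \<le> (\<Sum>i\<in>(Basis::'v set). ?s)"
     using norm_le_l1[of "x - p"] by (rule order.trans[rotated])
    then have "norm (x - p) \<le> ?d * ?s" by simp
    then have "L * norm (x - p) \<le> L * (?d * ?s)" using L(1) by (intro mult_left_mono)
    then show ?thesis using L(2)[of x p] that p(2) by (simp add: mult.assoc)
   qed
   let ?t = "L * ?d * ?s"
   let ?Q = "cbox (f p - ?t *\<^sub>R One) (f p + ?t *\<^sub>R One)"
   have "f ` (g n \<inter> A) \<subseteq> ?Q"
   proof
    fix y assume "y \<in> f ` (g n \<inter> A)"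
    then have y: "norm (y - f p) \<le> ?t" using dist by blast
    show "y \<in> ?Q"
     unfolding mem_box
    proof
     fix i :: 'v assume i: "i \<in> Basis"
     have One: "One \<bullet> i = 1" using i by (simp add: inner_sum_left inner_Basis)
     have "\<bar>(y - f p) \<bullet> i\<bar> \<le> ?t" using Basis_le_norm[OF i, of "y - f p"] y by (rule order.trans)
     then show "(f p - ?t *\<^sub>R One) \<bullet> i \<le> y \<bullet> i \<and> y \<bullet> i \<le> (f p + ?t *\<^sub>R One) \<bullet> i"
      unfolding inner_diff_left inner_add_left inner_scaleR_left One abs_le_iff by linarith
    qed
   qed
   moreover have "emeasure lborel ?Q = ?C * emeasure lborel (interior (g n))"
   proof -
    have t0: "?t \<ge> 0" using L(1) s by (intro mult_nonneg_nonneg) auto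
    have "emeasure lborel (interior (g n)) = ennreal (\<Prod>b\<in>(Basis::'v set). ?s)"
     using k s unfolding uv interior_cbox by (subst emeasure_lborel_box) (auto simp: inner_diff_left algebra_simps intro!: arg_cong[of _ _ ennreal] prod.cong)
    then have i: "emeasure lborel (interior (g n)) = ennreal (?s ^ ?d)" by simp
    have "emeasure lborel ?Q = ennreal ((2 * ?t) ^ ?d)" by (rule content_cube_around[OF t0])
    also have "(2 * ?t) ^ ?d = (2 * (L * ?d)) ^ ?d * ?s ^ ?d"
     by (simp only: power_mult_distrib[symmetric] mult.assoc)
    finally have q: "emeasure lborel ?Q = ennreal ((2 * (L * ?d)) ^ ?d * ?s ^ ?d)" .
    show ?thesis unfolding i q by (rule ennreal_mult[OF C0]) (use s in simp)
   qed
   ultimately show ?thesis by (intro exI[of _ ?Q]) auto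
  qed (intro exI[of _ "{}"], auto)
  then obtain Q where Q: "\<And>n. Q n \<in> sets borel" "\<And>n. f ` (g n \<inter> A) \<subseteq> Q n"
    "\<And>n. emeasure lborel (Q n) \<le> ?C * emeasure lborel (interior (g n))" by metis
  have "f ` A \<subseteq> (\<Union>n. Q n)"
  proof
   fix y assume "y \<in> f ` A"
   then obtain x where x: "x \<in> A" "y = f x" by blast
   then obtain n where "x \<in> g n" using D(5) Ug by blast
   then have "y \<in> Q n" using Q(2)[of n] x by blast
   then show "y \<in> (\<Union>n. Q n)" by blast
  qed
  then have "emeasure lborel (f ` A) \<le> emeasure lborel (\<Union>n. Q n)"
   using Q(1) by (intro emeasure_mono) auto
  also have "\<dots> \<le> (\<Sum>n. emeasure lborel (Q n))"
   using Q(1) by (intro emeasure_subadditive_countably) auto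
  also have "\<dots> \<le> (\<Sum>n. ?C * emeasure lborel (interior (g n)))"
   using Q(3) by (intro suminf_le) auto
  also have "\<dots> = ?C * (\<Sum>n. emeasure lborel (interior (g n)))" by (rule ennreal_suminf_cmult)
  also have "(\<Sum>n. emeasure lborel (interior (g n))) = emeasure lborel (\<Union>n. interior (g n))"
   by (intro suminf_emeasure disj) auto
  also have "\<dots> = emeasure lebesgue (\<Union>n. interior (g n))"
  proof -
   have "(\<Union>n. interior (g n)) \<in> sets lborel" by (auto intro!: borel_open open_UN)
   then show ?thesis by (simp add: emeasure_completion)
  qed
  also have "\<dots> \<le> emeasure lebesgue (\<Union>\<D>)"
  proof (rule emeasure_mono)
   show "(\<Union>n. interior (g n)) \<subseteq> \<Union>\<D>" unfolding Ug by (intro UN_mono interior_subset) simp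
  qed (use D(6) in auto)
  also have "\<dots> = ennreal (measure lebesgue (\<Union>\<D>))"
   using D(6) by (simp add: emeasure_eq_measure2)
  also have "\<dots> \<le> ennreal (measure lebesgue A + e')" using D(7) by (rule ennreal_leI)
  also have "\<dots> = emeasure lborel A + ennreal e'" using e' eA by simp
  finally have "emeasure lborel (f ` A) \<le> ?C * (emeasure lborel A + ennreal e')"
   by (simp add: mult_left_mono)
  also have "\<dots> = ?C * emeasure lborel A + ?C * ennreal e'" by (simp add: distrib_left)
  also have "?C * ennreal e' = ennreal ((2 * (L * ?d)) ^ ?d * e')" using C0 e' by (simp add: ennreal_mult)
  also have "?C * emeasure lborel A + \<dots> \<le> ?C * emeasure lborel A + ennreal e"
   using e'(2) by (intro add_left_mono ennreal_leI)
  finally show "emeasure lborel (f ` A) \<le> ?C * emeasure lborel A + ennreal e" .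
 qed
qed

text \<open>A one-sided change of variables: preimages under \<open>f\<close> are images under the
  Lipschitz map \<open>g\<close>, so the push-forward of Lebesgue measure is bounded by a multiple
  of Lebesgue measure.\<close>

lemma nn_integral_lipschitz:
 fixes f g :: "'v::euclidean_space => 'v" and u :: "'v => ennreal"
 assumes V: "V \<in> sets borel" "W \<in> sets borel" "bounded W"
  and f: "f \<in> borel_measurable (restrict_space borel V)"
  and fg: "f ` V = W" "\<And>x. x \<in> V ==> g (f x) = x"
  and L: "L \<ge> 0" "\<And>x y. x \<in> W ==> y \<in> W ==> norm (g x - g y) \<le> L * norm (x - y)"
  and u: "u \<in> borel_measurable borel"
 shows "(\<integral>\<^sup>+x. u (f x) * indicator V x \<partial>lborel)
  \<le> ennreal ((2 * (L * DIM('v))) ^ DIM('v)) * (\<integral>\<^sup>+x. u x * indicator W x \<partial>lborel)"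
proof -
 let ?C = "ennreal ((2 * (L * DIM('v))) ^ DIM('v))"
 let ?R = "restrict_space lborel V"
 let ?\<nu> = "distr ?R borel f"
 have f': "f \<in> measurable ?R borel"
  using f measurable_cong_sets[OF sets_restrict_space_cong[of lborel borel V] refl, of borel] by simp
 have le: "?\<nu> \<le> scale_measure ?C lborel"
 proof (subst le_measure)
  show "\<forall>A\<in>sets ?\<nu>. emeasure ?\<nu> A \<le> emeasure (scale_measure ?C lborel) A"
  proof
   fix A assume "A \<in> sets ?\<nu>"
   then have A: "A \<in> sets borel" by simp
   have m: "f -` A \<inter> V \<in> sets borel"
    using measurable_sets[OF f, of A] A V(1) by (auto simp: sets_restrict_space space_restrict_space)
   have "v = g (f v) \<and> f v \<in> W" if "v \<in> V" for v using fg that by auto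
   then have im: "g ` (A \<inter> W) = f -` A \<inter> V" using fg(2) unfolding fg(1)[symmetric] by (auto intro: rev_image_eqI)
   have "emeasure ?\<nu> A = emeasure lborel (f -` A \<inter> V)"
    using A f' V(1) m by (subst emeasure_distr) (auto simp: emeasure_restrict_space space_restrict_space)
   also have "\<dots> = emeasure lborel (g ` (A \<inter> W))" using im by simp
   also have "\<dots> \<le> ?C * emeasure lborel (A \<inter> W)"
    using A V(2,3) m im L by (intro emeasure_lipschitz_image) (auto intro: bounded_subset)
   also have "\<dots> \<le> ?C * emeasure lborel A"
    using A V(2) by (intro mult_left_mono emeasure_mono) auto
   finally show "emeasure ?\<nu> A \<le> emeasure (scale_measure ?C lborel) A" by simp
  qed
 qed simp
 have m: "(\<lambda>x. u x * indicator W x) \<in> borel_measurable borel" using u V(2) by measurable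
 have "(\<integral>\<^sup>+x. u (f x) * indicator V x \<partial>lborel) = (\<integral>\<^sup>+x. u (f x) * indicator W (f x) \<partial>?R)"
  using V(1) fg(1) by (subst nn_integral_restrict_space) (auto intro!: nn_integral_cong simp: indicator_def)
 also have "\<dots> = (\<integral>\<^sup>+x. u x * indicator W x \<partial>?\<nu>)"
  using f' m by (subst nn_integral_distr) auto
 also have "\<dots> \<le> (\<integral>\<^sup>+x. u x * indicator W x \<partial>scale_measure ?C lborel)"
  using le by (intro nn_integral_mono_measure) auto
 also have "\<dots> = ?C * (\<integral>\<^sup>+x. u x * indicator W x \<partial>lborel)"
  using m by (intro nn_integral_scale_measure) auto
 finally show ?thesis .
qed

section \<open>Holomorphic functions of several variables\<close>

lemma holo_on_subset: "holo_on S f ==> T \<subseteq> S ==> holo_on T f"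
 unfolding holo_on_def by blast

lemma holo_onE:
 assumes "holo_on S f" "w \<in> S"
 obtains f' where "(f has_derivative f') (at w)" "\<And>c v. f' (c *s v) = c * f' v"
 using assms unfolding holo_on_def by blast

lemma holo_on_continuous: "holo_on S f ==> continuous_on S f"
 unfolding holo_on_def by (auto intro!: continuous_at_imp_continuous_on dest: has_derivative_continuous)

lemma holo_on_cong_open:
 assumes "holo_on S f" "open S" "\<And>w. w \<in> S ==> f w = g w"
 shows "holo_on S g"
 unfolding holo_on_def
proof
 fix w assume w: "w \<in> S"
 obtain f' where f': "(f has_derivative f') (at w)" "\<And>c v. f' (c *s v) = c * f' v" by (rule holo_onE[OF assms(1) w]) blast
 have "(g has_derivative f') (at w)" by (rule has_derivative_transform_within_open[OF f'(1) assms(2) w assms(3)])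
 then show "\<exists>f'. (g has_derivative f') (at w) \<and> (\<forall>c v. f' (c *s v) = c * f' v)" using f'(2) by blast
qed

lemma holo_on_const: "holo_on S (\<lambda>w. c)"
 unfolding holo_on_def by (intro ballI exI[of _ "\<lambda>v. 0"]) auto

lemma holo_on_add:
 assumes "holo_on S f" "holo_on S g"
 shows "holo_on S (\<lambda>w. f w + g w)"
 unfolding holo_on_def
proof
 fix w assume w: "w \<in> S"
 obtain f' where f': "(f has_derivative f') (at w)" "\<And>c v. f' (c *s v) = c * f' v" by (rule holo_onE[OF assms(1) w]) blast
 obtain g' where g': "(g has_derivative g') (at w)" "\<And>c v. g' (c *s v) = c * g' v" by (rule holo_onE[OF assms(2) w]) blast
 show "\<exists>h. ((\<lambda>w. f w + g w) has_derivative h) (at w) \<and> (\<forall>c v. h (c *s v) = c * h v)"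
  using has_derivative_add[OF f'(1) g'(1)] f'(2) g'(2)
  by (intro exI[of _ "\<lambda>v. f' v + g' v"]) (simp add: algebra_simps)
qed

lemma holo_on_mult:
 assumes "holo_on S f" "holo_on S g"
 shows "holo_on S (\<lambda>w. f w * g w)"
 unfolding holo_on_def
proof
 fix w assume w: "w \<in> S"
 obtain f' where f': "(f has_derivative f') (at w)" "\<And>c v. f' (c *s v) = c * f' v" by (rule holo_onE[OF assms(1) w]) blast
 obtain g' where g': "(g has_derivative g') (at w)" "\<And>c v. g' (c *s v) = c * g' v" by (rule holo_onE[OF assms(2) w]) blast
 show "\<exists>h. ((\<lambda>w. f w * g w) has_derivative h) (at w) \<and> (\<forall>c v. h (c *s v) = c * h v)"
  using has_derivative_mult[OF f'(1) g'(1)] f'(2) g'(2)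
  by (intro exI[of _ "\<lambda>v. f w * g' v + f' v * g w"]) (simp add: algebra_simps)
qed

lemma holo_on_inverse:
 assumes "holo_on S f" "\<And>w. w \<in> S ==> f w \<noteq> 0"
 shows "holo_on S (\<lambda>w. inverse (f w))"
 unfolding holo_on_def
proof
 fix w assume w: "w \<in> S"
 obtain f' where f': "(f has_derivative f') (at w)" "\<And>c v. f' (c *s v) = c * f' v" by (rule holo_onE[OF assms(1) w]) blast
 show "\<exists>h. ((\<lambda>w. inverse (f w)) has_derivative h) (at w) \<and> (\<forall>c v. h (c *s v) = c * h v)"
  using Deriv.has_derivative_inverse[OF assms(2)[OF w] f'(1)] f'(2)
  by (intro exI[of _ "\<lambda>v. - (inverse (f w) * f' v * inverse (f w))"]) (simp add: algebra_simps)
qed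

text \<open>The map \<open>h\<close> is the sum of its components along the axes and so inherits
  their derivatives; complex homogeneity then passes through the chain rule.\<close>

lemma holo_on_compose:
 fixes h :: "complex^'n::finite => complex^'m::finite"
 assumes f: "holo_on T f" and h: "\<And>k. holo_on S (\<lambda>w. h w $ k)" "h ` S \<subseteq> T"
 shows "holo_on S (\<lambda>w. f (h w))"
 unfolding holo_on_def
proof
 fix w assume w: "w \<in> S"
 obtain f' where f': "(f has_derivative f') (at (h w))" "\<And>c v. f' (c *s v) = c * f' v"
  using holo_onE[OF f, of "h w"] w h(2) by blast
 have "\<forall>k. \<exists>h'. ((\<lambda>w. h w $ k) has_derivative h') (at w) \<and> (\<forall>c v. h' (c *s v) = c * h' v)"
  using h(1) w unfolding holo_on_def by blast
 then obtain h' where h': "\<And>k. ((\<lambda>w. h w $ k) has_derivative h' k) (at w)" "\<And>k c v. h' k (c *s v) = c * h' k v"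
  by metis
 have ax: "bounded_linear (axis k :: complex => complex^'m)" for k
  unfolding linear_conv_bounded_linear[symmetric]
  by (rule linearI) (simp_all add: axis_def vec_eq_iff)
 have ex: "(\<Sum>k\<in>UNIV. axis k (v k)) = (\<chi> k. v k)" for v :: "'m => complex"
  by (simp add: vec_eq_iff axis_def if_distrib cong: if_cong)
 have "((\<lambda>w. \<Sum>k\<in>UNIV. axis k (h w $ k)) has_derivative (\<lambda>v. \<Sum>k\<in>UNIV. axis k (h' k v))) (at w)"
  using h'(1) by (intro has_derivative_sum bounded_linear.has_derivative[OF ax])
 then have "(h has_derivative (\<lambda>v. \<chi> k. h' k v)) (at w)" by (simp add: ex)
 from diff_chain_at[OF this f'(1)]
 have "((\<lambda>w. f (h w)) has_derivative (\<lambda>v. f' (\<chi> k. h' k v))) (at w)" by (simp add: comp_def)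
 moreover have "(\<chi> k. h' k (c *s v)) = c *s (\<chi> k. h' k v)" for c v
  by (simp add: vec_eq_iff h'(2))
 ultimately show "\<exists>d. ((\<lambda>w. f (h w)) has_derivative d) (at w) \<and> (\<forall>c v. d (c *s v) = c * d v)"
  using f'(2) by (intro exI[of _ "\<lambda>v. f' (\<chi> k. h' k v)"]) simp
qed

lemma bounded_linear_scale: "bounded_linear (\<lambda>t :: complex. t *s (v :: complex^'n::finite))"
proof -
 have "(\<lambda>t :: complex. t *s v) = (\<lambda>t. \<chi> k. t * v $ k)" by (simp add: vec_eq_iff fun_eq_iff)
 moreover have "linear (\<lambda>t :: complex. \<chi> k. t * v $ k)"
  by (rule linearI) (simp_all add: vec_eq_iff algebra_simps)
 ultimately show ?thesis by (simp add: linear_conv_bounded_linear)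
qed

text \<open>Complex homogeneity of the derivative is what makes the restriction to a complex line
  differentiable in one complex variable.\<close>

lemma holo_on_line:
 assumes f: "holo_on S f" and a: "\<And>t. t \<in> T ==> a + t *s v \<in> S" and "open T"
 shows "(\<lambda>t. f (a + t *s v)) holomorphic_on T"
proof -
 have "\<exists>d. ((\<lambda>t. f (a + t *s v)) has_field_derivative d) (at t)" if t: "t \<in> T" for t
 proof -
  obtain f' where f': "(f has_derivative f') (at (a + t *s v))" "\<And>c v. f' (c *s v) = c * f' v"
   by (rule holo_onE[OF f a[OF t]]) blast
  have l: "((\<lambda>t. a + t *s v) has_derivative (\<lambda>t. t *s v)) (at t)"
   using bounded_linear_imp_has_derivative[OF bounded_linear_scale, of v "at t"] by (auto intro: derivative_eq_intros)
  have "((\<lambda>t. f (a + t *s v)) has_derivative (\<lambda>c. f' (c *s v))) (at t)"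
   using diff_chain_at[OF l f'(1)] by (simp add: comp_def)
  then show ?thesis unfolding has_field_derivative_def by (intro exI[of _ "f' v"]) (simp add: f'(2) mult_commute_abs)
 qed
 then show ?thesis by (auto simp: holomorphic_on_def field_differentiable_def intro: has_field_derivative_at_within)
qed

lemma norm_scale: "norm (t *s v) = cmod t * norm (v :: complex^'n::finite)"
 unfolding norm_vec_def by (simp add: norm_mult L2_set_right_distrib)

text \<open>Cauchy's inequality on coordinate discs bounds the partial derivatives on a small ball,
  and the mean value inequality on this convex ball concludes. \<open>r = e / 4\<close> keeps discs
  of radius less than \<open>2 * r\<close> around its points inside the compact ball on which
  \<open>f\<close> is bounded.\<close>

lemma holo_on_lipschitz:
 fixes f :: "complex^'n::finite => complex"
 assumes f: "holo_on S f" "open S" and p: "p \<in> S"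
 obtains r L where "r > 0" "L \<ge> 0" "ball p r \<subseteq> S"
  "\<And>x y. x \<in> ball p r ==> y \<in> ball p r ==> norm (f x - f y) \<le> L * norm (x - y)"
proof -
 obtain e where e: "e > 0" "cball p e \<subseteq> S" using f(2) p open_contains_cball by blast
 have "compact (f ` cball p e)"
  using continuous_on_subset[OF holo_on_continuous[OF f(1)] e(2)] by (intro compact_continuous_image) auto
 then obtain B where B: "B > 0" "\<And>x. x \<in> cball p e ==> norm (f x) \<le> B"
  using compact_imp_bounded bounded_pos by (metis image_eqI)
 define r where "r = e / 4"
 have r: "r > 0" using e by (simp add: r_def)
 obtain F where F: "\<And>w. w \<in> S ==> (f has_derivative F w) (at w) \<and> (\<forall>c v. F w (c *s v) = c * F w v)"
  using f(1) unfolding holo_on_def by metis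
 have axis: "norm (F w (axis k 1)) \<le> B / r" if w: "w \<in> ball p r" for w and k :: 'n
 proof -
  let ?g = "\<lambda>t. f (w + t *s axis k 1)"
  have ball: "w + t *s axis k 1 \<in> cball p e" if "norm t < 2 * r" for t
  proof -
   have "dist p (w + t *s axis k 1) \<le> dist p w + norm (t *s (axis k 1 :: complex^'n))"
    by (metis add.commute dist_norm norm_minus_commute add_diff_cancel_left' dist_triangle)
   also have "\<dots> \<le> r + 2 * r" using w that by (simp add: norm_scale norm_axis_1)
   finally show ?thesis using e by (simp add: r_def)
  qed
  have h: "?g holomorphic_on ball 0 (2 * r)"
   by (rule holo_on_line[OF f(1)]) (use ball e(2) in auto)
  have "norm ((deriv ^^ 1) ?g 0) \<le> fact 1 * B / r ^ 1"
  proof (rule Cauchy_inequality[OF _ _ r])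
   show "?g holomorphic_on ball 0 r" using h by (rule holomorphic_on_subset) (use r in auto)
   show "continuous_on (cball 0 r) ?g"
    using holomorphic_on_imp_continuous_on[OF h] by (rule continuous_on_subset) (use r in auto)
   show "norm (?g t) \<le> B" if "norm (0 - t) = r" for t using B(2) ball[of t] that r by simp
  qed
  moreover have "(?g has_field_derivative F w (axis k 1)) (at 0)"
  proof -
   have wS: "w \<in> S" using ball[of 0] e(2) r by auto
   have l: "((\<lambda>t. w + t *s axis k 1) has_derivative (\<lambda>t. t *s axis k 1)) (at 0)"
    using bounded_linear_imp_has_derivative[OF bounded_linear_scale, of "axis k 1" "at 0"] by (auto intro: derivative_eq_intros)
   have "(f has_derivative F w) (at (w + 0 *s axis k 1))" using F[OF wS] by simp
   then have "(?g has_derivative (\<lambda>c. F w (c *s axis k 1))) (at 0)"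
    using diff_chain_at[OF l] by (simp add: comp_def)
   then show ?thesis unfolding has_field_derivative_def using F[OF wS] by (simp add: mult_commute_abs)
  qed
  then have "deriv ?g 0 = F w (axis k 1)" by (rule DERIV_imp_deriv)
  ultimately show ?thesis by simp
 qed
 define L where "L = CARD('n) * (B / r)"
 have L: "L \<ge> 0" using B(1) r by (simp add: L_def)
 have on: "onorm (F w) \<le> L" if w: "w \<in> ball p r" for w
 proof (rule onorm_bound[OF L])
  fix v :: "complex^'n"
  have wS: "w \<in> S" using w e r by (auto simp: r_def)
  have lin: "linear (F w)" using F[OF wS] has_derivative_linear by blast
  have "v $ i = (\<Sum>k\<in>UNIV. if i = k then v $ k else 0)" for i by simp
  also have "\<dots> i = (\<Sum>k\<in>UNIV. (v $ k *s axis k 1) $ i)" for i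
   by (intro sum.cong) (auto simp: axis_def)
  finally have "v = (\<Sum>k\<in>UNIV. v $ k *s axis k 1)" unfolding vec_eq_iff sum_component by blast
  then have "F w v = (\<Sum>k\<in>UNIV. v $ k * F w (axis k 1))"
   using linear_sum[OF lin, of "\<lambda>k. v $ k *s axis k 1" UNIV] F[OF wS] by simp
  also have "norm \<dots> \<le> (\<Sum>k\<in>(UNIV::'n set). norm v * (B / r))"
  proof (rule sum_norm_le)
   fix k :: 'n
   show "norm (v $ k * F w (axis k 1)) \<le> norm v * (B / r)"
    unfolding norm_mult using axis[OF w, of k] Finite_Cartesian_Product.norm_nth_le[of v k] by (intro mult_mono) auto
  qed
  finally show "norm (F w v) \<le> L * norm v" by (simp add: L_def algebra_simps)
 qed
 show ?thesis
 proof (rule that[OF r L])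
  show "ball p r \<subseteq> S" using e r by (auto simp: r_def)
  then have "(f has_derivative F w) (at w within ball p r)" if "w \<in> ball p r" for w
   using F that by (blast intro: has_derivative_at_withinI)
  then show "norm (f x - f y) \<le> L * norm (x - y)" if "x \<in> ball p r" "y \<in> ball p r" for x y
   by (rule differentiable_bound[OF convex_ball _ on that])
 qed
qed

lemma holo_map_lipschitz:
 fixes h :: "complex^'n::finite => complex^'m::finite"
 assumes h: "\<And>k. holo_on S (\<lambda>w. h w $ k)" "open S" and p: "p \<in> S"
 obtains r L where "r > 0" "L \<ge> 0" "ball p r \<subseteq> S"
  "\<And>x y. x \<in> ball p r ==> y \<in> ball p r ==> norm (h x - h y) \<le> L * norm (x - y)"
proof -
 have "\<exists>r L. r > 0 \<and> L \<ge> 0 \<and> ball p r \<subseteq> S \<and>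
   (\<forall>x\<in>ball p r. \<forall>y\<in>ball p r. norm (h x $ k - h y $ k) \<le> L * norm (x - y))" for k
  by (rule holo_on_lipschitz[OF h(1) h(2) p, of k]) blast
 then obtain r L where rL: "\<And>k. r k > 0" "\<And>k. L k \<ge> 0" "\<And>k. ball p (r k) \<subseteq> S"
   "\<And>k x y. x \<in> ball p (r k) ==> y \<in> ball p (r k) ==> norm (h x $ k - h y $ k) \<le> L k * norm (x - y)"
  by metis
 define r0 where "r0 = Min (range r)"
 have r0: "r0 > 0" "\<And>k. r0 \<le> r k" using rL(1) by (auto simp: r0_def)
 show ?thesis
 proof (rule that[of r0 "\<Sum>k\<in>UNIV. L k"])
  show "ball p r0 \<subseteq> S" using r0(2) rL(3) by (meson order.trans subset_ball)
  fix x y assume xy: "x \<in> ball p r0" "y \<in> ball p r0"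
  have "norm (h x - h y) \<le> (\<Sum>k\<in>UNIV. norm ((h x - h y) $ k))"
   by (simp add: norm_vec_def L2_set_le_sum)
  also have "\<dots> \<le> (\<Sum>k\<in>UNIV. L k * norm (x - y))"
   using xy r0(2) rL(4) by (intro sum_mono) (simp, meson order.strict_trans2)
  finally show "norm (h x - h y) \<le> (\<Sum>k\<in>UNIV. L k) * norm (x - y)" by (simp add: sum_distrib_right)
 qed (use r0 rL(2) in \<open>auto intro: sum_nonneg\<close>)
qed

text \<open>Vanishing on a relatively open part of a convex piece of a complex subspace propagates along
 complex lines.\<close>

lemma holo_identity:
 fixes f :: "complex^'n::finite => complex"
 assumes f: "holo_on U f" "open U" "convex U"
  and a: "a \<in> U" "\<And>k. k \<in> S ==> a $ k = 0" and b: "b \<in> U" "\<And>k. k \<in> S ==> b $ k = 0"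
  and W: "open W" "a \<in> W" "\<And>w. w \<in> W ==> w \<in> U ==> (\<And>k. k \<in> S ==> w $ k = 0) ==> f w = 0"
 shows "f b = 0"
proof -
 \<comment> \<open>The line through \<open>a\<close> and \<open>b\<close> stays in the subspace; the
   parameters \<open>t\<close> with \<open>?l t\<close> in \<open>U\<close> form a convex, hence
   connected, set.\<close>
 let ?l = "\<lambda>t :: complex. a + t *s (b - a)"
 let ?T = "?l -` U"
 have cont: "continuous_on UNIV ?l"
  by (intro continuous_intros bounded_linear.continuous_on[OF bounded_linear_scale])
 have T: "open ?T" using cont f(2) by (simp add: continuous_on_open_vimage)
 have conv: "convex ?T"
 proof (rule convexI)
  fix x y :: complex and u v :: real assume xy: "x \<in> ?T" "y \<in> ?T" and uv: "0 \<le> u" "0 \<le> v" "u + v = 1"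
  have "?l (u *\<^sub>R x + v *\<^sub>R y) = u *\<^sub>R ?l x + v *\<^sub>R ?l y"
  proof -
   have v: "v = 1 - u" using uv(3) by simp
   show ?thesis
    unfolding v vec_eq_iff vector_add_component vector_scaleR_component vector_smult_component vector_minus_component
    by (simp add: scaleR_conv_of_real algebra_simps)
  qed
  then show "u *\<^sub>R x + v *\<^sub>R y \<in> ?T" using convexD[OF f(3) _ _ uv, of "?l x" "?l y"] xy by (simp only: vimage_eq)
 qed
 have hol: "(\<lambda>t. f (?l t)) holomorphic_on ?T" by (rule holo_on_line[OF f(1) _ T]) simp
 have W': "open (?l -` W \<inter> ?T)" using cont W(1) T by (simp add: continuous_on_open_vimage open_Int)
 have mem: "0 \<in> ?l -` W \<inter> ?T" "1 \<in> ?T" using a(1) b(1) W(2) by auto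
 have "f (?l 1) = 0"
 proof (rule analytic_continuation_open[OF W' T _ _ _ hol holomorphic_on_const])
  show "?l -` W \<inter> ?T \<noteq> {}" using mem by blast
  show "connected ?T" using conv by (rule convex_connected)
  fix t assume "t \<in> ?l -` W \<inter> ?T"
  then show "f (?l t) = 0" using a(2) b(2) by (intro W(3)) auto
 qed (use mem in auto)
 then show ?thesis by simp
qed

section \<open>Lebesgue measure on complex space as a product measure\<close>

lemma measurable_vec_lambda: "(\<lambda>x. (\<chi> k. x k) :: complex^'n::finite) \<in> borel_measurable (Pi\<^sub>M UNIV (\<lambda>_. lborel))"
proof -
 have ax: "(axis k :: complex => complex^'n) \<in> borel_measurable borel" for k :: 'n
 proof -
  have "linear (axis k :: complex => complex^'n)"
   by (rule linearI) (simp_all add: axis_def vec_eq_iff)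
  then have "continuous_on UNIV (axis k :: complex => complex^'n)"
   by (simp add: linear_conv_bounded_linear linear_continuous_on)
  then show ?thesis by (rule borel_measurable_continuous_onI)
 qed
 have "(\<lambda>x. \<Sum>k\<in>UNIV. axis k (x k) :: complex^'n) \<in> borel_measurable (Pi\<^sub>M UNIV (\<lambda>_. lborel))"
 proof (rule borel_measurable_sum)
  fix k :: 'n
  have "(\<lambda>x. x k) \<in> measurable (Pi\<^sub>M UNIV (\<lambda>_. lborel)) borel"
   using measurable_component_singleton[of k UNIV "\<lambda>_. lborel :: complex measure"] by simp
  then show "(\<lambda>x. axis k (x k) :: complex^'n) \<in> borel_measurable (Pi\<^sub>M UNIV (\<lambda>_. lborel))"
   by (rule measurable_compose[OF _ ax])
 qed
 moreover have "(\<Sum>k\<in>UNIV. axis k (x k)) = ((\<chi> k. x k) :: complex^'n)" for x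
  unfolding vec_eq_iff sum_component by (simp add: axis_def)
 ultimately show ?thesis by simp
qed

text \<open>Lebesgue measure is determined by its values on boxes. The Euclidean basis of the vector
  type consists of the \<open>axis k c\<close> with \<open>c\<close> a basis vector of the complex
  numbers, so the volume of a box factors over the coordinates.\<close>

lemma lborel_vec: "(lborel :: (complex^'n::finite) measure) = distr (Pi\<^sub>M UNIV (\<lambda>_. lborel)) borel (\<lambda>x. \<chi> k. x k)"
proof (rule lborel_eqI)
 interpret product_sigma_finite "\<lambda>_::'n. lborel :: complex measure" ..
 fix l u :: "complex^'n"
 assume lu: "\<And>b. b \<in> Basis ==> l \<bullet> b \<le> u \<bullet> b"
 have ax: "v \<bullet> axis k c = (v $ k) \<bullet> c" for v :: "complex^'n" and k c by (simp add: inner_axis)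
 have pre: "(\<lambda>x. \<chi> k. x k) -` box l u \<inter> space (Pi\<^sub>M UNIV (\<lambda>_. lborel)) = (\<Pi>\<^sub>E k\<in>UNIV. box (l $ k) (u $ k))"
  by (auto simp: space_PiM PiE_iff mem_box Basis_vec_def inner_axis)
 have "emeasure (distr (Pi\<^sub>M UNIV (\<lambda>_. lborel)) borel (\<lambda>x. \<chi> k. x k)) (box l u) =
   (\<Prod>k\<in>UNIV. emeasure lborel (box (l $ k) (u $ k)))"
  by (subst emeasure_distr[OF measurable_vec_lambda]) (simp_all add: pre emeasure_PiM)
 also have "\<dots> = (\<Prod>k\<in>UNIV. \<Prod>c\<in>Basis. ennreal ((u $ k - l $ k) \<bullet> c))"
 proof (rule prod.cong[OF refl])
  fix k
  have "l $ k \<bullet> c \<le> u $ k \<bullet> c" if "c \<in> Basis" for c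
   using lu[of "axis k c"] that by (simp add: inner_axis)
  then show "emeasure lborel (box (l $ k) (u $ k)) = (\<Prod>c\<in>Basis. ennreal ((u $ k - l $ k) \<bullet> c))"
   by (subst emeasure_lborel_box) (auto simp: prod_ennreal inner_diff_left)
 qed
 also have "\<dots> = (\<Prod>(k, c)\<in>UNIV \<times> Basis. ennreal ((u $ k - l $ k) \<bullet> c))"
  by (rule prod.cartesian_product)
 also have "\<dots> = (\<Prod>p\<in>UNIV \<times> Basis. ennreal ((u - l) \<bullet> (case p of (k, c) => axis k c)))"
  by (rule prod.cong) (auto simp: inner_axis)
 also have "\<dots> = (\<Prod>b\<in>(\<lambda>(k, c). axis k c) ` (UNIV \<times> Basis). ennreal ((u - l) \<bullet> b))"
  by (subst prod.reindex) (auto simp: inj_on_def axis_eq_axis comp_def nonzero_Basis)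
 also have "(\<lambda>(k, c). axis k c) ` (UNIV \<times> Basis) = (Basis :: (complex^'n) set)"
  by (auto simp: Basis_vec_def image_iff)
 also have "(\<Prod>b\<in>Basis. ennreal ((u - l) \<bullet> b)) = ennreal (\<Prod>b\<in>Basis. (u - l) \<bullet> b)"
  using lu by (intro prod_ennreal) (simp add: inner_diff_left)
 finally show "emeasure (distr (Pi\<^sub>M UNIV (\<lambda>_. lborel)) borel (\<lambda>x. \<chi> k. x k)) (box l u) = ennreal (\<Prod>b\<in>Basis. (u - l) \<bullet> b)" .
qed simp

lemma nn_integral_vec:
 fixes f :: "complex^'n::finite => ennreal"
 assumes "f \<in> borel_measurable borel"
 shows "(\<integral>\<^sup>+w. f w \<partial>lborel) = (\<integral>\<^sup>+x. f (\<chi> k. x k) \<partial>(Pi\<^sub>M UNIV (\<lambda>_. lborel)))"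
 by (subst lborel_vec) (rule nn_integral_distr[OF measurable_vec_lambda], use assms in simp)

section \<open>The sub-mean value inequality\<close>

text \<open>Cauchy's formula for the holomorphic function h^2 takes the place of subharmonicity of
  |h|^2: the value at the centre is a mean over the circle, and norms are taken afterwards.\<close>

lemma circle_mean:
 assumes h: "h holomorphic_on ball z r" and w: "w \<in> ball 0 r"
 shows "ennreal ((norm (h z))\<^sup>2) \<le> (\<integral>\<^sup>+t. ennreal ((norm (h (z + w * exp (2 * of_real pi * \<i> * of_real t))))\<^sup>2) * indicator {0..1} t \<partial>lborel)"
proof -
 let ?e = "\<lambda>t::real. exp (2 * of_real pi * \<i> * of_real t)"
 let ?F = "\<lambda>y. (h (z + w * y))\<^sup>2"
 have wy: "z + w * y \<in> ball z r" if "norm y \<le> 1" for y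
  using mult_left_le[OF that norm_ge_zero[of w]] w by (simp add: dist_norm norm_mult)
 have "(h \<circ> (\<lambda>y. z + w * y)) holomorphic_on cball 0 1"
  by (rule holomorphic_on_compose_gen[OF _ h]) (use wy in \<open>auto intro!: holomorphic_intros\<close>)
 then have F: "?F holomorphic_on cball 0 1" by (auto intro!: holomorphic_on_power simp: comp_def)
 have e1: "norm (?e t) = 1" for t by (simp add: norm_exp_eq_Re)
 have "((\<lambda>y. ?F y / (y - 0)) has_contour_integral (2 * of_real pi * \<i> * ?F 0)) (circlepath 0 1)"
  by (rule Cauchy_integral_circlepath_simple[OF F]) simp
 then have "((\<lambda>t. ?F (?e t) / ?e t * (2 * pi * \<i> * ?e t)) has_integral (2 * of_real pi * \<i> * ?F 0)) {0..1}"
  unfolding has_contour_integral_def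
 proof (rule has_integral_eq[rotated])
  fix t :: real assume "t \<in> {0..1}"
  then have vd: "vector_derivative (circlepath 0 1) (at t within {0..1}) = 2 * pi * \<i> * ?e t"
   using vector_derivative_circlepath01[of t 0 1] by simp
  have cp: "circlepath 0 1 t = ?e t" by (simp add: circlepath)
  show "?F (circlepath 0 1 t) / (circlepath 0 1 t - 0) * vector_derivative (circlepath 0 1) (at t within {0..1}) =
    ?F (?e t) / ?e t * (2 * pi * \<i> * ?e t)"
   unfolding vd cp by simp
 qed
 then have "((\<lambda>t. (2 * of_real pi * \<i>) * ?F (?e t)) has_integral (2 * of_real pi * \<i> * ?F 0)) {0..1}"
  by (rule has_integral_eq[rotated]) (simp add: field_simps)
 then have int: "((\<lambda>t. ?F (?e t)) has_integral ?F 0) {0..1}"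
  using has_integral_mult_right[of "\<lambda>t. (2 * of_real pi * \<i>) * ?F (?e t)" "2 * of_real pi * \<i> * ?F 0" "{0..1}" "1 / (2 * of_real pi * \<i>)"]
  by simp
 have contF: "continuous_on UNIV (\<lambda>t. ?F (?e t))"
 proof (rule continuous_on_compose2[OF holomorphic_on_imp_continuous_on[OF F]])
  show "continuous_on UNIV ?e" by (intro continuous_intros)
 qed (use e1 in auto)
 let ?n = "\<lambda>t. norm (?F (?e t))"
 have contn: "continuous_on UNIV ?n" by (intro continuous_intros contF)
 then have nint: "?n integrable_on {0..1}" by (intro integrable_continuous_interval continuous_on_subset[OF contn]) auto
 then have hn: "(?n has_integral integral {0..1} ?n) {0..1}" by (rule integrable_integral)
 have "norm (?F 0) \<le> integral {0..1} ?n"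
  using integral_norm_bound_integral[of "\<lambda>t. ?F (?e t)" "{0..1}" ?n] int nint integral_unique[OF int] by auto
 then have "ennreal (norm (?F 0)) \<le> ennreal (integral {0..1} ?n)" by (rule ennreal_leI)
 also have "\<dots> = (\<integral>\<^sup>+t. ennreal (if t \<in> {0..1} then ?n t else 0) \<partial>lborel)"
 proof (rule nn_integral_has_integral_lborel[symmetric])
  show "((\<lambda>t. if t \<in> {0..1} then ?n t else 0) has_integral integral {0..1} ?n) UNIV"
   using hn has_integral_restrict_UNIV[of "{0..1}" ?n] by blast
  have "?n \<in> borel_measurable borel" by (rule borel_measurable_continuous_onI[OF contn])
  then show "(\<lambda>t. if t \<in> {0..1} then ?n t else 0) \<in> borel_measurable borel" by measurable
 qed simp
 also have "\<dots> = (\<integral>\<^sup>+t. ennreal ((norm (h (z + w * ?e t)))\<^sup>2) * indicator {0..1} t \<partial>lborel)"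
  by (intro nn_integral_cong) (auto simp: norm_power indicator_def)
 finally show ?thesis by (simp add: norm_power)
qed

text \<open>\<open>circle_mean\<close> is averaged over all \<open>w\<close> in the disc and the
  integrals are exchanged. For fixed \<open>t\<close> the map w -> z + w exp(2 pi i t) is an
  isometry, whose effect on the integral is controlled by
  \<open>nn_integral_lipschitz\<close>.\<close>

lemma submean:
 fixes r :: real
 assumes r: "r > 0"
 obtains c :: real where "c \<ge> 0" "\<And>h z. h holomorphic_on ball z r ==>
  ennreal ((norm (h z))\<^sup>2) \<le> ennreal c * (\<integral>\<^sup>+y. ennreal ((norm (h y))\<^sup>2) * indicator (ball z r) y \<partial>lborel)"
proof -
 define \<k> where "\<k> = measure lborel (ball (0::complex) r)"
 have \<k>: "\<k> > 0" using r by (simp add: \<k>_def)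
 have e\<k>: "emeasure lborel (ball (0::complex) r) = ennreal \<k>"
  using emeasure_lborel_ball_finite[of "0::complex" r] by (simp add: \<k>_def emeasure_eq_ennreal_measure)
 \<comment> \<open>The factor of \<open>nn_integral_lipschitz\<close> for Lipschitz constant 1 in
   real dimension 2. Rotation invariance would give 1, but any finite factor will do.\<close>
 define C where "C = (2 * (1 * real DIM(complex))) ^ DIM(complex)"
 have C: "C \<ge> 0" by (simp add: C_def)
 show ?thesis
 proof (rule that[of "C / \<k>"])
  show "C / \<k> \<ge> 0" using C \<k> by simp
  fix h :: "complex => complex" and z assume h: "h holomorphic_on ball z r"
  let ?e = "\<lambda>t::real. exp (2 * of_real pi * \<i> * of_real t)"
  let ?u = "\<lambda>y. ennreal ((norm (h y))\<^sup>2) * indicator (ball z r) y"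
  let ?I = "\<integral>\<^sup>+y. ?u y \<partial>lborel"
  have u[measurable]: "?u \<in> borel_measurable borel"
  proof -
   have "(\<lambda>y. if y \<in> ball z r then (norm (h y))\<^sup>2 else 0) \<in> borel_measurable borel"
    by (rule borel_measurable_continuous_on_if) (auto intro!: continuous_intros holomorphic_on_imp_continuous_on[OF h])
   then have m: "(\<lambda>y. ennreal (if y \<in> ball z r then (norm (h y))\<^sup>2 else 0)) \<in> borel_measurable borel" by measurable
   have "(\<lambda>y. ennreal (if y \<in> ball z r then (norm (h y))\<^sup>2 else 0)) = ?u" by (auto simp: indicator_def)
   then show ?thesis by (rule subst[of _ _ "\<lambda>f. f \<in> borel_measurable borel", OF _ m])
  qed
  have e1: "norm (?e t) = 1" for t by (simp add: norm_exp_eq_Re)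
  have ee: "?e t * ?e (- t) = 1" for t by (simp add: exp_add[symmetric])
  have ee': "?e (- t) * ?e t = 1" for t by (subst mult.commute) (rule ee)
  have canc: "(v * a) * b = v" if "b * a = 1" for v a b :: complex
   using that by (simp add: mult.assoc mult.commute[of a])
  have m1[measurable]: "(\<lambda>p::complex \<times> real. z + fst p * ?e (snd p)) \<in> borel_measurable borel"
   by (intro borel_measurable_continuous_onI continuous_intros)
  have m: "(\<lambda>(w, t). ?u (z + w * ?e t) * indicator {0..1} t * indicator (ball 0 r) w) \<in> borel_measurable (lborel \<Otimes>\<^sub>M lborel)"
  proof -
   have a: "(\<lambda>p::complex \<times> real. ?u (z + fst p * ?e (snd p))) \<in> borel_measurable borel"
    by (rule measurable_compose[OF m1 u])
   have b: "(\<lambda>p::complex \<times> real. indicator {0..1} (snd p) :: ennreal) \<in> borel_measurable borel"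
    by (rule measurable_compose[OF borel_measurable_continuous_onI[OF continuous_on_snd[OF continuous_on_id]]]) simp
   have c: "(\<lambda>p::complex \<times> real. indicator (ball 0 r) (fst p) :: ennreal) \<in> borel_measurable borel"
    by (rule measurable_compose[OF borel_measurable_continuous_onI[OF continuous_on_fst[OF continuous_on_id]]])
     (intro borel_measurable_indicator borel_open open_ball)
   show ?thesis
    unfolding lborel_prod split_beta measurable_lborel1 measurable_lborel2
    by (rule borel_measurable_times_ennreal[OF borel_measurable_times_ennreal[OF a b] c])
  qed
  have rot: "(\<integral>\<^sup>+w. ?u (z + w * ?e t) * indicator (ball 0 r) w \<partial>lborel) \<le> ennreal C * ?I" for t
  proof -
   have "(\<integral>\<^sup>+w. ?u (z + w * ?e t) * indicator (ball 0 r) w \<partial>lborel) \<le> ennreal C * (\<integral>\<^sup>+y. ?u y * indicator (ball z r) y \<partial>lborel)"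
    unfolding C_def
   proof (rule nn_integral_lipschitz[where g = "\<lambda>y. (y - z) * ?e (- t)"])
    show "(\<lambda>w. z + w * ?e t) \<in> borel_measurable (restrict_space borel (ball 0 r))"
     by (intro borel_measurable_continuous_on_restrict continuous_intros)
    show "(\<lambda>w. z + w * ?e t) ` ball 0 r = ball z r"
    proof (intro subset_antisym subsetI)
     fix y assume y: "y \<in> ball z r"
     have q: "((y - z) * ?e (- t)) * ?e t = y - z"
      by (rule canc[OF ee])
     have "y = z + ((y - z) * ?e (- t)) * ?e t" unfolding q by simp
     moreover have "(y - z) * ?e (- t) \<in> ball 0 r" using y e1[of "- t"] by (simp add: norm_mult dist_norm norm_minus_commute)
     ultimately show "y \<in> (\<lambda>w. z + w * ?e t) ` ball 0 r" by blast
    qed (use e1 in \<open>auto simp: dist_norm norm_mult\<close>)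
    show "(z + w * ?e t - z) * ?e (- t) = w" for w
     unfolding add_diff_cancel_left' by (rule canc[OF ee'])
    show "norm ((x - z) * ?e (- t) - (y - z) * ?e (- t)) \<le> 1 * norm (x - y)" for x y
     using e1[of "- t"] by (simp add: left_diff_distrib[symmetric] norm_mult)
   qed auto
   also have "(\<integral>\<^sup>+y. ?u y * indicator (ball z r) y \<partial>lborel) = ?I"
    by (intro nn_integral_cong) (auto simp: indicator_def)
   finally show ?thesis .
  qed
  have "ennreal ((norm (h z))\<^sup>2) * ennreal \<k> = (\<integral>\<^sup>+w. ennreal ((norm (h z))\<^sup>2) * indicator (ball (0::complex) r) w \<partial>lborel)"
   by (simp add: nn_integral_cmult_indicator e\<k>)
  also have "\<dots> \<le> (\<integral>\<^sup>+w. (\<integral>\<^sup>+t. ?u (z + w * ?e t) * indicator {0..1} t * indicator (ball 0 r) w \<partial>lborel) \<partial>lborel)"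
  proof (rule nn_integral_mono)
   fix w :: complex
   show "ennreal ((norm (h z))\<^sup>2) * indicator (ball 0 r) w \<le> (\<integral>\<^sup>+t. ?u (z + w * ?e t) * indicator {0..1} t * indicator (ball 0 r) w \<partial>lborel)"
   proof (cases "w \<in> ball 0 r")
    case True
    have "z + w * ?e t \<in> ball z r" for t using True e1[of t] by (simp add: dist_norm norm_mult)
    then show ?thesis using circle_mean[OF h True] True by simp
   qed simp
  qed
  also have "\<dots> = (\<integral>\<^sup>+t. (\<integral>\<^sup>+w. ?u (z + w * ?e t) * indicator {0..1} t * indicator (ball 0 r) w \<partial>lborel) \<partial>lborel)"
   by (rule lborel_pair.Fubini'[OF m, symmetric])
  also have "\<dots> \<le> (\<integral>\<^sup>+t. ennreal C * ?I * indicator {0..1::real} t \<partial>lborel)"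
  proof (rule nn_integral_mono)
   fix t :: real
   have "(\<integral>\<^sup>+w. ?u (z + w * ?e t) * indicator {0..1} t * indicator (ball 0 r) w \<partial>lborel) =
     (\<integral>\<^sup>+w. ?u (z + w * ?e t) * indicator (ball 0 r) w \<partial>lborel) * indicator {0..1} t"
    by (cases "t \<in> {0..1}") auto
   then show "(\<integral>\<^sup>+w. ?u (z + w * ?e t) * indicator {0..1} t * indicator (ball 0 r) w \<partial>lborel) \<le> ennreal C * ?I * indicator {0..1} t"
    using rot[of t] by (simp add: mult_right_mono)
  qed
  also have "\<dots> = ennreal C * ?I" by (subst nn_integral_cmult_indicator) auto
  finally have le: "ennreal ((norm (h z))\<^sup>2) * ennreal \<k> \<le> ennreal C * ?I" .
  have "ennreal ((norm (h z))\<^sup>2) = ennreal ((norm (h z))\<^sup>2) * ennreal \<k> * ennreal (1 / \<k>)"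
   using \<k> by (simp add: ennreal_mult[symmetric])
  also have "\<dots> \<le> ennreal C * ?I * ennreal (1 / \<k>)" using le by (rule mult_right_mono) simp
  also have "\<dots> = ennreal (C * (1 / \<k>)) * ?I" using C \<k> by (subst ennreal_mult) (auto simp: mult_ac)
  finally show "ennreal ((norm (h z))\<^sup>2) \<le> ennreal (C / \<k>) * ?I" by simp
 qed
qed

section \<open>Integrability of the logarithmic weight\<close>

text \<open>The logarithmic weight as a function of t = -psi >= 1: since 1 + log t = log (e t), the
  integrand of \<open>adjoint_ideal\<close> contains exp t times
  \<open>th \<sigma> \<e> t\<close>.\<close>

definition th :: "nat => real => real => real" where
 "th j \<e> t = 1 / (t ^ j * (1 + ln t) powr (1 + \<e>))"

text \<open>|z|^-2 cut off to the unit disc, where log |z|^2 is negative; at the origin division by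
  zero gives 0.\<close>

definition kern :: "complex => real" where
 "kern z = (if cmod z < 1 then 1 / (cmod z)\<^sup>2 else 0)"

lemma th_nonneg: "t \<ge> 1 ==> th j \<e> t \<ge> 0"
 by (simp add: th_def)

lemma kern_nonneg: "kern z \<ge> 0"
 by (simp add: kern_def)

lemma th_denominator_pos: "(t :: real) \<ge> 1 ==> t ^ j * (1 + ln t) powr (1 + \<e>) > 0"
proof -
 assume t: "t \<ge> 1"
 have "1 + ln t > 0" using ln_ge_zero[OF t] by linarith
 then show ?thesis using t by (intro mult_pos_pos) auto
qed

lemma th_antimono: "1 \<le> s ==> s \<le> t ==> \<e> > 0 ==> th j \<e> t \<le> th j \<e> s"
proof -
 assume st: "1 \<le> s" "s \<le> t" and e: "\<e> > 0"
 have "0 \<le> ln s" "ln s \<le> ln t" using st by (simp_all add: ln_ge_zero)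
 then have "(1 + ln s) powr (1 + \<e>) \<le> (1 + ln t) powr (1 + \<e>)" using e by (intro powr_mono2) auto
 then have "s ^ j * (1 + ln s) powr (1 + \<e>) \<le> t ^ j * (1 + ln t) powr (1 + \<e>)"
  using st by (intro mult_mono power_mono) auto
 then show ?thesis
  unfolding th_def using th_denominator_pos[of s j \<e>] th_denominator_pos[of t j \<e>] st
  by (intro divide_left_mono mult_pos_pos) auto
qed

lemma th_le_1: "1 \<le> t ==> \<e> > 0 ==> th j \<e> t \<le> 1"
 using th_antimono[of 1 t \<e> j] by (simp add: th_def)

lemma suminf_ennreal_le:
 assumes "\<And>n. f n \<ge> 0" "\<And>N. sum f {..<N} \<le> c"
 shows "(\<Sum>n. ennreal (f n)) \<le> ennreal c"
 unfolding suminf_eq_SUP using assms by (intro SUP_least) (simp add: sum_ennreal ennreal_leI)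

text \<open>Discrete form of integrating t^(-j-2) from T on: 1/x^2 <= 2/x - 2/(x+1) telescopes, and
  the remaining factor \<open>th j\<close> is decreasing. One power of t is lost.\<close>

lemma sum_th_le:
 assumes T: "T \<ge> 1" and e: "\<e> > 0"
 shows "(\<Sum>n. ennreal (th (Suc (Suc j)) \<e> (T + real n))) \<le> ennreal (2 * th (Suc j) \<e> T)"
proof (rule suminf_ennreal_le)
 show "th (Suc (Suc j)) \<e> (T + real n) \<ge> 0" for n using T by (intro th_nonneg) simp
 fix N
 have step: "th (Suc (Suc j)) \<e> (T + real n) \<le> (2 / (T + real n) - 2 / (T + real (Suc n))) * th j \<e> T" for n
 proof -
  let ?x = "T + real n"
  have x: "?x \<ge> 1" using T by simp
  have "th (Suc (Suc j)) \<e> ?x = 1 / (?x * ?x) * th j \<e> ?x" by (simp add: th_def)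
  also have "\<dots> \<le> 1 / (?x * ?x) * th j \<e> T" using th_antimono[OF T _ e, of ?x j] by (intro mult_left_mono) auto
  also have "\<dots> \<le> (2 / ?x - 2 / (?x + 1)) * th j \<e> T"
  proof (rule mult_right_mono[OF _ th_nonneg[OF T]])
   have "1 / (y * y) \<le> 2 / y - 2 / (y + 1)" if "y \<ge> 1" for y :: real
   proof -
    have "2 / y - 2 / (y + 1) = 2 / (y * (y + 1))" using that by (simp add: field_simps)
    moreover have "y * (y + 1) \<le> 2 * (y * y)" using mult_left_mono[of 1 y y] that by (simp add: algebra_simps)
    then have "1 / (y * y) \<le> 2 / (y * (y + 1))" using that by (simp add: divide_simps)
    ultimately show ?thesis by simp
   qed
   then show "1 / (?x * ?x) \<le> 2 / ?x - 2 / (?x + 1)" using x by blast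
  qed
  finally show ?thesis by (simp add: add_ac)
 qed
 have "(\<Sum>n<N. th (Suc (Suc j)) \<e> (T + real n)) \<le> (\<Sum>n<N. (2 / (T + real n) - 2 / (T + real (Suc n))) * th j \<e> T)"
  by (intro sum_mono step)
 also have "\<dots> = (2 / T - 2 / (T + real N)) * th j \<e> T"
  by (simp only: sum_distrib_right[symmetric] sum_lessThan_telescope'[of "\<lambda>n. 2 / (T + real n)"]) simp
 also have "\<dots> \<le> 2 / T * th j \<e> T" using T by (intro mult_right_mono th_nonneg) auto
 also have "\<dots> = 2 * th (Suc j) \<e> T" by (simp add: th_def)
 finally show "(\<Sum>n<N. th (Suc (Suc j)) \<e> (T + real n)) \<le> 2 * th (Suc j) \<e> T" .
qed

text \<open>The borderline power t^-1 is summable thanks to the logarithm: -(1 + log t)^(-eps)/eps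
  is a primitive of \<open>th 1 \<e>\<close>, compared step by step through the mean value theorem.
  This gives 1/eps; the added 1 bounds the first term.\<close>

lemma sum_th1_le:
 assumes T: "T \<ge> 1" and e: "\<e> > 0"
 shows "(\<Sum>n. ennreal (th 1 \<e> (T + real n))) \<le> ennreal (1 + 1 / \<e>)"
proof (rule suminf_ennreal_le)
 show "th 1 \<e> (T + real n) \<ge> 0" for n using T by (intro th_nonneg) simp
 fix N
 let ?g = "\<lambda>t. (1 + ln t) powr (- \<e>) / \<e>"
 have g0: "?g t \<ge> 0" for t using e by simp
 have step: "th 1 \<e> (T + real (Suc n)) \<le> ?g (T + real n) - ?g (T + real (Suc n))" for n
 proof -
  let ?x = "T + real n"
  have x: "?x \<ge> 1" using T by simp
  have der: "(?g has_real_derivative - th 1 \<e> t) (at t)" if "t \<ge> 1" for t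
  proof -
   have p: "1 + ln t > 0" using ln_ge_zero[OF that] by linarith
   have "((\<lambda>t. 1 + ln t) has_real_derivative 1 / t) (at t)"
    using that by (auto intro!: derivative_eq_intros)
   from DERIV_cdivide[OF DERIV_fun_powr[OF this p, of "- \<e>"], of \<e>]
   have "(?g has_real_derivative ((- \<e>) * (1 + ln t) powr (- \<e> - 1) * (1 / t)) / \<e>) (at t)"
    by simp
   moreover have "((- \<e>) * (1 + ln t) powr (- \<e> - 1) * (1 / t)) / \<e> = - th 1 \<e> t"
   proof -
    have "(1 + ln t) powr (- \<e> - 1) = 1 / (1 + ln t) powr (1 + \<e>)"
    proof -
     have "- \<e> - 1 = - (1 + \<e>)" by simp
     then show ?thesis by (simp only: powr_minus_divide)
    qed
    then show ?thesis using e by (simp add: th_def)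
   qed
   ultimately show ?thesis by simp
  qed
  obtain s where s: "?x < s" "s < ?x + 1" "?g (?x + 1) - ?g ?x = (?x + 1 - ?x) * (- th 1 \<e> s)"
   using MVT2[of ?x "?x + 1" ?g "\<lambda>t. - th 1 \<e> t"] der x by auto
  have "th 1 \<e> (?x + 1) \<le> th 1 \<e> s" using s x e by (intro th_antimono) auto
  then show ?thesis using s(3) by (simp add: add_ac)
 qed
 have "(\<Sum>n<N. th 1 \<e> (T + real (Suc n))) \<le> (\<Sum>n<N. ?g (T + real n) - ?g (T + real (Suc n)))"
  by (intro sum_mono step)
 also have "\<dots> = ?g T - ?g (T + real N)" by (simp only: sum_lessThan_telescope'[of "\<lambda>n. ?g (T + real n)"]) simp
 also have "\<dots> \<le> ?g T" using g0 by simp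
 also have "\<dots> \<le> 1 / \<e>"
 proof -
  have "(1 + ln T) powr (- \<e>) \<le> 1" using powr_mono[of "- \<e>" 0 "1 + ln T"] ln_ge_zero[OF T] e by simp
  then show ?thesis using e by (simp add: divide_right_mono)
 qed
 finally have *: "(\<Sum>n<N. th 1 \<e> (T + real (Suc n))) \<le> 1 / \<e>" .
 have "(\<Sum>n<N. th 1 \<e> (T + real n)) \<le> (\<Sum>n<Suc N. th 1 \<e> (T + real n))"
  using T by (simp add: th_nonneg)
 also have "\<dots> = th 1 \<e> (T + real 0) + (\<Sum>n<N. th 1 \<e> (T + real (Suc n)))" by (rule sum.lessThan_Suc_shift)
 also have "\<dots> \<le> 1 + 1 / \<e>" using * th_le_1[OF T e, of 1] by simp
 finally show "(\<Sum>n<N. th 1 \<e> (T + real n)) \<le> 1 + 1 / \<e>" .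
qed

text \<open>Summation over the annuli \<open>e\<^bsup>-n-1\<^esup> < |z| \<le> e\<^bsup>-n\<^esup>\<close>.\<close>

lemma kern_integral:
 assumes T: "T \<ge> 1" and e: "\<e> > 0"
 shows "(\<integral>\<^sup>+z. ennreal (kern z * th j \<e> (T - ln ((cmod z)\<^sup>2))) \<partial>lborel)
  \<le> ennreal (pi * exp 2) * (\<Sum>n. ennreal (th j \<e> (T + real n)))"
proof -
 \<comment> \<open>On the n-th annulus |z|^-2 is at most exp (2 (n + 1)) and -log |z|^2 is at least
   n. The disc \<open>?A n\<close> has area pi exp (-2 n), whence the constant
   \<open>pi * exp 2\<close>.\<close>
 let ?t = "\<lambda>n. exp (2 * (real n + 1)) * th j \<e> (T + real n)"
 let ?A = "\<lambda>n. cball (0::complex) (exp (- real n))"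
 have t0: "?t n \<ge> 0" for n using T by (simp add: th_nonneg)
 have "(\<integral>\<^sup>+z. ennreal (kern z * th j \<e> (T - ln ((cmod z)\<^sup>2))) \<partial>lborel) \<le>
   (\<integral>\<^sup>+z. (\<Sum>n. ennreal (?t n) * indicator (?A n) z) \<partial>lborel)"
 proof (rule nn_integral_mono)
  fix z :: complex
  show "ennreal (kern z * th j \<e> (T - ln ((cmod z)\<^sup>2))) \<le> (\<Sum>n. ennreal (?t n) * indicator (?A n) z)"
  proof (cases "cmod z < 1 \<and> z \<noteq> 0")
   case True
   then have z: "0 < cmod z" "cmod z < 1" by auto
   let ?l = "- ln (cmod z)"
   have l: "?l > 0" using z by (simp add: ln_less_zero)
   define n where "n = nat \<lfloor>?l\<rfloor>"
   have n: "real n \<le> ?l" "?l < real n + 1" using l unfolding n_def by linarith+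
   have "ln (cmod z) \<le> - real n" using n by simp
   then have zA: "cmod z \<le> exp (- real n)" using z by (metis exp_le_cancel_iff exp_ln)
   have "exp (- (real n + 1)) \<le> cmod z"
    using n z by (metis exp_le_cancel_iff exp_ln less_imp_le minus_le_iff minus_less_iff neg_le_iff_le)
   then have "(exp (- (real n + 1)))\<^sup>2 \<le> (cmod z)\<^sup>2" by (intro power_mono) auto
   then have "1 / (cmod z)\<^sup>2 \<le> 1 / (exp (- (real n + 1)))\<^sup>2" using z by (intro divide_left_mono) auto
   also have "\<dots> = exp (2 * (real n + 1))"
    unfolding exp_double[symmetric] mult_minus_right by (simp only: exp_minus divide_inverse inverse_inverse_eq mult_1)
   finally have k: "kern z \<le> exp (2 * (real n + 1))" using z by (simp add: kern_def)
   have "ln ((cmod z)\<^sup>2) = - 2 * ?l" using z by (simp add: ln_realpow)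
   then have "T + real n \<le> T - ln ((cmod z)\<^sup>2)" using n l by simp
   then have "th j \<e> (T - ln ((cmod z)\<^sup>2)) \<le> th j \<e> (T + real n)" "T - ln ((cmod z)\<^sup>2) \<ge> 1"
    using T e by (auto intro!: th_antimono)
   then have "kern z * th j \<e> (T - ln ((cmod z)\<^sup>2)) \<le> ?t n"
    using k kern_nonneg th_nonneg by (intro mult_mono) auto
   then have "ennreal (kern z * th j \<e> (T - ln ((cmod z)\<^sup>2))) \<le> ennreal (?t n) * indicator (?A n) z"
    using zA by (simp add: ennreal_leI)
   also have "\<dots> \<le> (\<Sum>n. ennreal (?t n) * indicator (?A n) z)"
   proof -
    define f where "f n = ennreal (?t n) * indicator (?A n) z" for n
    have "sum f {n} \<le> suminf f" by (rule sum_le_suminf) auto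
    then have "f n \<le> suminf f" by simp
    then show ?thesis unfolding f_def .
   qed
   finally show ?thesis .
  qed (auto simp: kern_def)
 qed
 also have "\<dots> = (\<Sum>n. \<integral>\<^sup>+z. ennreal (?t n) * indicator (?A n) z \<partial>lborel)"
  by (rule nn_integral_suminf, unfold measurable_lborel2)
   (intro borel_measurable_times_ennreal borel_measurable_const borel_measurable_indicator borel_closed closed_cball)
 also have "\<dots> = (\<Sum>n. ennreal (pi * exp 2) * ennreal (th j \<e> (T + real n)))"
 proof (rule arg_cong[of _ _ suminf], rule ext)
  fix n
  have "(\<integral>\<^sup>+z. ennreal (?t n) * indicator (?A n) z \<partial>lborel) = ennreal (?t n) * emeasure lborel (?A n)"
   by (rule nn_integral_cmult_indicator) simp
  also have "emeasure lborel (?A n) = ennreal (pi * (exp (- real n))\<^sup>2)"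
   by (subst emeasure_cball) (simp_all add: unit_ball_vol_2)
  also have "ennreal (?t n) * \<dots> = ennreal (?t n * (pi * (exp (- real n))\<^sup>2))"
   using t0 by (intro ennreal_mult[symmetric]) auto
  also have "?t n * (pi * (exp (- real n))\<^sup>2) = pi * exp 2 * th j \<e> (T + real n)"
  proof -
   have "exp (2 * (real n + 1)) * (exp (- real n))\<^sup>2 = exp 2"
    by (simp add: exp_double[symmetric] exp_add[symmetric])
   then show ?thesis by (simp add: algebra_simps)
  qed
  also have "ennreal \<dots> = ennreal (pi * exp 2) * ennreal (th j \<e> (T + real n))"
   using T by (intro ennreal_mult th_nonneg) auto
  finally show "(\<integral>\<^sup>+z. ennreal (?t n) * indicator (?A n) z \<partial>lborel) = ennreal (pi * exp 2) * ennreal (th j \<e> (T + real n))" .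
 qed
 also have "\<dots> = ennreal (pi * exp 2) * (\<Sum>n. ennreal (th j \<e> (T + real n)))" by (rule ennreal_suminf_cmult)
 finally show ?thesis .
qed

lemma th_measurable [measurable]: "th j \<e> \<in> borel_measurable borel"
 unfolding th_def[abs_def] by measurable

lemma kern_measurable [measurable]: "kern \<in> borel_measurable borel"
 unfolding kern_def[abs_def] by measurable

text \<open>Models the weight near a point of D: \<open>A\<close> stands for the normal coordinates
  that vanish there, and \<open>T\<close> minus the sum of logarithms for an upper bound of
  -psi.\<close>

definition kern_weight :: "'n set => real => real => ('n => complex) => real" where
 "kern_weight A \<e> T x = (\<Prod>k\<in>A. kern (x k)) * th (card A) \<e> (T - (\<Sum>k\<in>A. ln ((cmod (x k))\<^sup>2)))"

lemma kern_weight_measurable [measurable]: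
 "kern_weight A \<e> T \<in> borel_measurable (Pi\<^sub>M A (\<lambda>_. lborel))"
 unfolding kern_weight_def[abs_def] by measurable

text \<open>Induction on the variables with a bound uniform in \<open>T\<close>: the logarithms of
  the variables held fixed are non-positive and are absorbed into \<open>T\<close>. Integrating one
  variable lowers the exponent of t by one, and only the last variable meets the borderline
  sum.\<close>

lemma kern_weight_integral:
 assumes "finite A" and e: "\<e> > 0"
 shows "\<exists>C::real. \<forall>T\<ge>1. (\<integral>\<^sup>+x. ennreal (kern_weight A \<e> T x) \<partial>(Pi\<^sub>M A (\<lambda>_. lborel))) \<le> ennreal C"
 using assms(1)
proof (induction A)
 case empty
 have "(\<integral>\<^sup>+x. ennreal (kern_weight ({} :: 'a set) \<e> T x) \<partial>(Pi\<^sub>M {} (\<lambda>_. lborel))) \<le> ennreal 1" if "T \<ge> 1" for T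
 proof -
  have "(\<integral>\<^sup>+x. ennreal (kern_weight ({} :: 'a set) \<e> T x) \<partial>(Pi\<^sub>M {} (\<lambda>_. lborel :: complex measure))) \<le> (\<integral>\<^sup>+x. 1 \<partial>(Pi\<^sub>M ({} :: 'a set) (\<lambda>_. lborel :: complex measure)))"
   using th_le_1[OF that e] by (intro nn_integral_mono) (simp add: kern_weight_def)
  also have "\<dots> = 1" by (simp add: PiM_empty space_PiM_empty)
  finally show ?thesis by simp
 qed
 then show ?case by blast
next
 case (insert i I)
 interpret product_sigma_finite "\<lambda>_. lborel :: complex measure" ..
 obtain C where C: "\<And>T. T \<ge> 1 ==> (\<integral>\<^sup>+x. ennreal (kern_weight I \<e> T x) \<partial>(Pi\<^sub>M I (\<lambda>_. lborel))) \<le> ennreal C"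
  using insert.IH by blast
 \<comment> \<open>Covers both bounds: 2 from \<open>sum_th_le\<close> and
   \<open>1 + 1 / \<e>\<close> from \<open>sum_th1_le\<close>.\<close>
 define c where "c = pi * exp 2 * (2 + (1 + 1 / \<e>))"
 have c0: "c \<ge> 0" using e by (simp add: c_def)
 let ?m = "card I"
 \<comment> \<open>For \<open>I = {}\<close> the sum is bounded by a constant and not by a multiple
   of \<open>th 0\<close>, hence the case distinction.\<close>
 have one: "(\<integral>\<^sup>+z. ennreal (kern z * th (Suc ?m) \<e> (T - ln ((cmod z)\<^sup>2))) \<partial>lborel) \<le> ennreal (c * (if I = {} then 1 else th ?m \<e> T))"
  if T: "T \<ge> 1" for T
 proof (cases ?m)
  case 0
  then have I: "I = {}" using insert by simp
  have "(\<integral>\<^sup>+z. ennreal (kern z * th (Suc ?m) \<e> (T - ln ((cmod z)\<^sup>2))) \<partial>lborel) \<le> ennreal (pi * exp 2) * ennreal (1 + 1 / \<e>)"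
   using order.trans[OF kern_integral[OF T e, of 1] mult_left_mono[OF sum_th1_le[OF T e]]] 0 by simp
  also have "\<dots> = ennreal (pi * exp 2 * (1 + 1 / \<e>))" using e by (intro ennreal_mult[symmetric]) auto
  also have "\<dots> \<le> ennreal c" unfolding c_def using e by (intro ennreal_leI mult_left_mono) auto
  finally show ?thesis using I by simp
 next
  case (Suc j)
  then have I: "I \<noteq> {}" by auto
  have "(\<integral>\<^sup>+z. ennreal (kern z * th (Suc ?m) \<e> (T - ln ((cmod z)\<^sup>2))) \<partial>lborel) \<le> ennreal (pi * exp 2) * ennreal (2 * th ?m \<e> T)"
   using order.trans[OF kern_integral[OF T e, of "Suc (Suc j)"] mult_left_mono[OF sum_th_le[OF T e]]] Suc by simp
  also have "\<dots> = ennreal (pi * exp 2 * (2 * th ?m \<e> T))" using T by (intro ennreal_mult[symmetric]) (auto simp: th_nonneg)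
  also have "\<dots> \<le> ennreal (c * th ?m \<e> T)" unfolding c_def using e th_nonneg[OF T, of ?m \<e>]
   by (intro ennreal_leI) (simp add: mult.assoc[symmetric] mult_right_mono)
  finally show ?thesis using I by simp
 qed
 have "(\<integral>\<^sup>+x. ennreal (kern_weight (insert i I) \<e> T x) \<partial>(Pi\<^sub>M (insert i I) (\<lambda>_. lborel))) \<le> ennreal (c * max C 1)"
  if T: "T \<ge> 1" for T
 proof -
  have inner: "(\<integral>\<^sup>+y. ennreal (kern_weight (insert i I) \<e> T (x(i := y))) \<partial>lborel) \<le> ennreal c * (if I = {} then 1 else ennreal (kern_weight I \<e> T x))" for x
  \<comment> \<open>A factor 0 annihilates the weight; otherwise all these variables lie in the unit
    disc and their logarithms can only increase \<open>T\<close>.\<close>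
  proof (cases "\<exists>k\<in>I. kern (x k) = 0")
   case True
   then have "(\<Prod>k\<in>I. kern (x k)) = 0" using insert(1) by (simp add: prod_zero_iff)
   then have "kern_weight (insert i I) \<e> T (x(i := y)) = 0" for y
    using insert(1,2) by (auto simp: kern_weight_def)
   then show ?thesis by simp
  next
   case False
   let ?T = "T - (\<Sum>k\<in>I. ln ((cmod (x k))\<^sup>2))"
   let ?P = "\<Prod>k\<in>I. kern (x k)"
   have "ln ((cmod (x k))\<^sup>2) \<le> 0" if "k \<in> I" for k
    using False that by (auto simp: kern_def ln_le_zero_iff power_le_one split: if_splits)
   then have T': "?T \<ge> 1" using T sum_nonpos[of I "\<lambda>k. ln ((cmod (x k))\<^sup>2)"] by auto
   have P: "?P \<ge> 0" by (simp add: prod_nonneg kern_nonneg)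
   have eq: "kern_weight (insert i I) \<e> T (x(i := y)) = ?P * (kern y * th (Suc ?m) \<e> (?T - ln ((cmod y)\<^sup>2)))" for y
   proof -
    have "(\<Prod>k\<in>I. kern ((x(i := y)) k)) = ?P" using insert(2) by (intro prod.cong) auto
    moreover have "(\<Sum>k\<in>I. ln ((cmod ((x(i := y)) k))\<^sup>2)) = (\<Sum>k\<in>I. ln ((cmod (x k))\<^sup>2))"
     using insert(2) by (intro sum.cong) auto
    ultimately show ?thesis using insert(1,2) by (simp add: kern_weight_def algebra_simps)
   qed
   have "(\<integral>\<^sup>+y. ennreal (kern_weight (insert i I) \<e> T (x(i := y))) \<partial>lborel) =
     (\<integral>\<^sup>+y. ennreal ?P * ennreal (kern y * th (Suc ?m) \<e> (?T - ln ((cmod y)\<^sup>2))) \<partial>lborel)"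
    unfolding eq using P by (simp add: ennreal_mult')
   also have "\<dots> = ennreal ?P * (\<integral>\<^sup>+y. ennreal (kern y * th (Suc ?m) \<e> (?T - ln ((cmod y)\<^sup>2))) \<partial>lborel)"
    by (rule nn_integral_cmult) measurable
   also have "\<dots> \<le> ennreal ?P * ennreal (c * (if I = {} then 1 else th ?m \<e> ?T))"
    by (intro mult_left_mono one[OF T']) simp
   also have "\<dots> = ennreal c * (if I = {} then 1 else ennreal (kern_weight I \<e> T x))"
    using c0 P th_nonneg[OF T'] by (auto simp: kern_weight_def ennreal_mult[symmetric] mult_ac)
   finally show ?thesis .
  qed
  have "(\<integral>\<^sup>+x. ennreal (kern_weight (insert i I) \<e> T x) \<partial>(Pi\<^sub>M (insert i I) (\<lambda>_. lborel))) =
    (\<integral>\<^sup>+x. (\<integral>\<^sup>+y. ennreal (kern_weight (insert i I) \<e> T (x(i := y))) \<partial>lborel) \<partial>(Pi\<^sub>M I (\<lambda>_. lborel)))"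
   by (rule product_nn_integral_insert[OF insert(1,2)]) measurable
  also have "\<dots> \<le> (\<integral>\<^sup>+x. ennreal c * (if I = {} then 1 else ennreal (kern_weight I \<e> T x)) \<partial>(Pi\<^sub>M I (\<lambda>_. lborel)))"
   by (intro nn_integral_mono inner)
  also have "\<dots> \<le> ennreal c * ennreal (max C 1)"
  proof (cases "I = {}")
   case True
   then have "(\<integral>\<^sup>+x. ennreal c * (if I = {} then 1 else ennreal (kern_weight I \<e> T x)) \<partial>(Pi\<^sub>M I (\<lambda>_. lborel))) = ennreal c * 1"
    by (simp add: PiM_empty space_PiM_empty)
   also have "\<dots> \<le> ennreal c * ennreal (max C 1)" by (intro mult_left_mono) (simp_all add: ennreal_1[symmetric] ennreal_leI del: ennreal_1)
   finally show ?thesis .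
  next
   case False
   then have "(\<integral>\<^sup>+x. ennreal c * (if I = {} then 1 else ennreal (kern_weight I \<e> T x)) \<partial>(Pi\<^sub>M I (\<lambda>_. lborel))) = ennreal c * (\<integral>\<^sup>+x. ennreal (kern_weight I \<e> T x) \<partial>(Pi\<^sub>M I (\<lambda>_. lborel)))"
    by (simp add: nn_integral_cmult)
   also have "\<dots> \<le> ennreal c * ennreal (max C 1)"
    by (intro mult_left_mono order.trans[OF C[OF T]] ennreal_leI) auto
   finally show ?thesis .
  qed
  also have "\<dots> = ennreal (c * max C 1)" using c0 by (intro ennreal_mult[symmetric]) auto
  finally show ?thesis .
 qed
 then show ?case by blast
qed

section \<open>The weighted estimate on polydiscs\<close>

text \<open>A product set, so that Fubini can separate the coordinates.\<close>

definition polydisc :: "complex^'n::finite => real => (complex^'n) set" where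
 "polydisc p r = {w. \<forall>k. dist (p $ k) (w $ k) < r}"

lemma open_polydisc: "open (polydisc p r)"
proof -
 have "polydisc p r = (\<Inter>k. {w. dist (p $ k) (w $ k) < r})" by (auto simp: polydisc_def)
 moreover have "open {w. dist (p $ k) (w $ k) < r}" for k
  by (intro open_Collect_less continuous_intros)
 ultimately show ?thesis by auto
qed

lemma polydisc_mono: "r \<le> s ==> polydisc p r \<subseteq> polydisc p s"
 unfolding polydisc_def by (auto intro: less_le_trans)

lemma center_polydisc: "r > 0 ==> p \<in> polydisc p r"
 by (simp add: polydisc_def)

lemma open_contains_polydisc:
 assumes "open S" "p \<in> S"
 obtains r where "r > 0" "polydisc p r \<subseteq> S"
proof -
 obtain e where e: "e > 0" "ball p e \<subseteq> S" using assms open_contains_ball by blast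
 let ?r = "e / (2 * CARD('a))"
 have r: "?r > 0" using e by simp
 have "polydisc p ?r \<subseteq> ball p e"
 proof
  fix w assume w: "w \<in> polydisc p ?r"
  have "norm (p - w) \<le> (\<Sum>k\<in>UNIV. norm ((p - w) $ k))" by (simp add: norm_vec_def L2_set_le_sum)
  also have "\<dots> \<le> (\<Sum>k\<in>(UNIV::'a set). ?r)"
   using w by (intro sum_mono) (auto simp: polydisc_def dist_norm less_imp_le)
  also have "\<dots> = e / 2" by simp
  finally show "w \<in> ball p e" using e by (simp add: dist_norm)
 qed
 then show ?thesis using that[OF r] e by blast
qed

definition override :: "'n set => ('n => complex) => ('n => complex) => 'n => complex" where
 "override A y x = (\<lambda>k. if k \<in> A then y k else x k)"

lemma measurable_override:
 "(\<lambda>y. override A y x) \<in> measurable (Pi\<^sub>M A (\<lambda>_. lborel)) (Pi\<^sub>M UNIV (\<lambda>_. lborel))"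
proof -
 have "(\<lambda>y. \<lambda>k\<in>UNIV. if k \<in> A then y k else x k) \<in> measurable (Pi\<^sub>M A (\<lambda>_. lborel)) (Pi\<^sub>M UNIV (\<lambda>_. lborel))"
 proof (rule measurable_restrict)
  fix k
  show "(\<lambda>y. if k \<in> A then y k else x k) \<in> measurable (Pi\<^sub>M A (\<lambda>_. lborel)) lborel"
   using measurable_component_singleton[of k A "\<lambda>_. lborel :: complex measure"] by (cases "k \<in> A") auto
 qed
 then show ?thesis by (simp add: override_def[abs_def] restrict_def)
qed

definition sq_mass :: "(complex^'n::finite => complex) => (complex^'n) set => complex^'n => ennreal" where
 "sq_mass h U w = ennreal ((norm (h w))\<^sup>2) * indicator U w"

lemma sq_mass_measurable:
 assumes "holo_on U h" "open U"
 shows "sq_mass h U \<in> borel_measurable borel"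
proof -
 have "(\<lambda>y. if y \<in> U then (norm (h y))\<^sup>2 else 0) \<in> borel_measurable borel"
  using assms by (intro borel_measurable_continuous_on_if) (auto intro!: continuous_intros holo_on_continuous)
 then have m: "(\<lambda>y. ennreal (if y \<in> U then (norm (h y))\<^sup>2 else 0)) \<in> borel_measurable borel" by measurable
 have "(\<lambda>y. ennreal (if y \<in> U then (norm (h y))\<^sup>2 else 0)) = sq_mass h U" by (auto simp: sq_mass_def indicator_def)
 then show ?thesis by (rule subst[of _ _ "\<lambda>f. f \<in> borel_measurable borel", OF _ m])
qed

text \<open>One coordinate of \<open>A\<close> at a time: with the others fixed, \<open>h\<close> is
  holomorphic on a disc of radius \<open>r\<close>, which stays inside the polydisc of radius
  \<open>2 * r\<close>. If the point lies outside that polydisc, the extension by zero in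
  \<open>sq_mass\<close> makes the inequality trivial.\<close>

lemma submean_iterated:
 fixes h :: "complex^'n::finite => complex" and A :: "'n set"
 assumes r: "r > 0"
  and c: "\<And>h z. h holomorphic_on ball z r ==>
   ennreal ((norm (h z))\<^sup>2) \<le> ennreal c * (\<integral>\<^sup>+y. ennreal ((norm (h y))\<^sup>2) * indicator (ball z r) y \<partial>lborel)"
  and h: "holo_on (polydisc p (2 * r)) h"
  and x: "\<And>k. k \<in> A ==> dist (p $ k) (x k) < r"
 defines "H \<equiv> \<lambda>x. sq_mass h (polydisc p (2 * r)) (\<chi> k. x k)"
 shows "H x \<le> ennreal c ^ card A * (\<integral>\<^sup>+y. H (override A y x) \<partial>(Pi\<^sub>M A (\<lambda>_. lborel)))"
proof -
 interpret product_sigma_finite "\<lambda>_::'n. lborel :: complex measure" ..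
 have Hm: "H \<in> borel_measurable (Pi\<^sub>M UNIV (\<lambda>_. lborel))"
  unfolding H_def by (rule measurable_compose[OF measurable_vec_lambda sq_mass_measurable[OF h open_polydisc]])
 have one: "H x \<le> ennreal c * (\<integral>\<^sup>+z. H (x(i := z)) \<partial>lborel)" if x: "dist (p $ i) (x i) < r" for x i
 proof (cases "(\<chi> k. x k) \<in> polydisc p (2 * r)")
  case True
  let ?g = "\<lambda>z. h ((\<chi> k. (x(i := 0)) k) + z *s axis i 1)"
  have eq: "(\<chi> k. (x(i := 0)) k) + z *s axis i 1 = (\<chi> k. (x(i := z)) k)" for z
   by (simp add: vec_eq_iff axis_def)
  have in_pd: "(\<chi> k. (x(i := z)) k) \<in> polydisc p (2 * r)" if "z \<in> ball (x i) r" for z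
  proof -
   have "dist (p $ i) z < 2 * r" using dist_triangle[of "p $ i" z "x i"] x that by simp
   then show ?thesis using True by (auto simp: polydisc_def)
  qed
  have "?g holomorphic_on ball (x i) r"
   by (rule holo_on_line[OF h]) (use in_pd eq in auto)
  then have "ennreal ((norm (?g (x i)))\<^sup>2) \<le> ennreal c * (\<integral>\<^sup>+y. ennreal ((norm (?g y))\<^sup>2) * indicator (ball (x i) r) y \<partial>lborel)"
   by (rule c)
  also have "\<dots> \<le> ennreal c * (\<integral>\<^sup>+z. H (x(i := z)) \<partial>lborel)"
  proof (intro mult_left_mono nn_integral_mono)
   fix z
   show "ennreal ((norm (?g z))\<^sup>2) * indicator (ball (x i) r) z \<le> H (x(i := z))"
    unfolding eq H_def sq_mass_def using in_pd[of z] by (cases "z \<in> ball (x i) r") (simp_all del: fun_upd_apply)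
  qed simp
  also have "ennreal ((norm (?g (x i)))\<^sup>2) = H x"
   unfolding eq using True by (simp add: H_def sq_mass_def)
  finally show ?thesis .
 qed (simp add: H_def sq_mass_def)
 have fin: "finite A" by simp
 then show ?thesis using x
 proof (induction A)
  case empty
  then show ?case by (simp add: override_def PiM_empty space_PiM_empty)
 next
  case (insert i I)
  have "H x \<le> ennreal c ^ card I * (\<integral>\<^sup>+y. H (override I y x) \<partial>(Pi\<^sub>M I (\<lambda>_. lborel)))"
   using insert.prems by (intro insert.IH) auto
  also have "\<dots> \<le> ennreal c ^ card I * (\<integral>\<^sup>+y. ennreal c * (\<integral>\<^sup>+z. H (override (insert i I) (y(i := z)) x) \<partial>lborel) \<partial>(Pi\<^sub>M I (\<lambda>_. lborel)))"
  proof (intro mult_left_mono nn_integral_mono)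
   fix y
   have "(override I y x)(i := z) = override (insert i I) (y(i := z)) x" for z
    using insert(2) by (auto simp: override_def fun_eq_iff)
   moreover have "dist (p $ i) (override I y x i) < r" using insert by (simp add: override_def)
   ultimately show "H (override I y x) \<le> ennreal c * (\<integral>\<^sup>+z. H (override (insert i I) (y(i := z)) x) \<partial>lborel)"
    using one[of i "override I y x"] by simp
  qed simp
  also have "\<dots> = ennreal c ^ card I * (ennreal c * (\<integral>\<^sup>+y. (\<integral>\<^sup>+z. H (override (insert i I) (y(i := z)) x) \<partial>lborel) \<partial>(Pi\<^sub>M I (\<lambda>_. lborel))))"
  proof -
   have "(\<lambda>y. H (override (insert i I) y x)) \<in> borel_measurable (Pi\<^sub>M (insert i I) (\<lambda>_. lborel))"
    by (rule measurable_compose[OF measurable_override Hm])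
   then have "(\<lambda>(y, z). H (override (insert i I) (y(i := z)) x)) \<in> borel_measurable (Pi\<^sub>M I (\<lambda>_. lborel) \<Otimes>\<^sub>M lborel)"
    using measurable_compose[OF measurable_add_dim[of i I "\<lambda>_. lborel :: complex measure"]] by (simp add: split_beta)
   then have "(\<lambda>y. \<integral>\<^sup>+z. H (override (insert i I) (y(i := z)) x) \<partial>lborel) \<in> borel_measurable (Pi\<^sub>M I (\<lambda>_. lborel))"
    by (rule lborel.borel_measurable_nn_integral)
   then show ?thesis by (simp add: nn_integral_cmult)
  qed
  also have "(\<integral>\<^sup>+y. (\<integral>\<^sup>+z. H (override (insert i I) (y(i := z)) x) \<partial>lborel) \<partial>(Pi\<^sub>M I (\<lambda>_. lborel))) =
    (\<integral>\<^sup>+y. H (override (insert i I) y x) \<partial>(Pi\<^sub>M (insert i I) (\<lambda>_. lborel)))"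
   by (rule product_nn_integral_insert[OF insert(1,2) measurable_compose[OF measurable_override Hm], symmetric])
  finally show ?case using insert(1,2) by (simp add: mult_ac)
 qed
qed

text \<open>Fubini in the variables outside \<open>A\<close> and those in \<open>A\<close>. As
  \<open>W\<close> depends on the former only, the sub-mean value inequality replaces |h|^2 by its
  integral over the variables in \<open>A\<close>, which no longer depends on them; the kernel
  integrates to at most \<open>C\<close>, and the original mass reappears.\<close>

lemma weighted_estimate:
 fixes h :: "complex^'n::finite => complex" and A :: "'n set" and W :: "complex^'n => ennreal"
 assumes r: "r > 0" and h: "holo_on (polydisc p (2 * r)) h" and pA: "\<And>k. k \<in> A ==> p $ k = 0"
  and W: "W \<in> borel_measurable borel" "\<And>w w'. (\<And>k. k \<notin> A ==> w $ k = w' $ k) ==> W w = W w'"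
  and T: "T \<ge> 1" and e: "\<e> > 0"
  and fin: "(\<integral>\<^sup>+w. sq_mass h (polydisc p (2 * r)) w * W w \<partial>lborel) < \<infinity>"
 shows "(\<integral>\<^sup>+w. sq_mass h (polydisc p r) w * W w * ennreal (kern_weight A \<e> T (\<lambda>k. w $ k)) \<partial>lborel) < \<infinity>"
proof -
 interpret product_sigma_finite "\<lambda>_::'n. lborel :: complex measure" ..
 obtain c where c: "c \<ge> 0" "\<And>h z. h holomorphic_on ball z r ==>
   ennreal ((norm (h z))\<^sup>2) \<le> ennreal c * (\<integral>\<^sup>+y. ennreal ((norm (h y))\<^sup>2) * indicator (ball z r) y \<partial>lborel)"
  by (rule submean[OF r]) blast
 obtain C where C: "(\<integral>\<^sup>+x. ennreal (kern_weight A \<e> T x) \<partial>(Pi\<^sub>M A (\<lambda>_. lborel))) \<le> ennreal C"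
  using kern_weight_integral[of A \<e>] e T by auto
 let ?H = "\<lambda>x. sq_mass h (polydisc p (2 * r)) (\<chi> k. x k)"
 let ?K = "ennreal c ^ card A * ennreal C"
 let ?B = "- A"
 have sub: "polydisc p r \<subseteq> polydisc p (2 * r)" using r by (intro polydisc_mono) simp
 let ?F = "\<lambda>w. sq_mass h (polydisc p r) w * W w * ennreal (kern_weight A \<e> T (\<lambda>k. w $ k))"
 have comp: "(\<lambda>w::complex^'n. w $ k) \<in> borel_measurable borel" for k
  by (intro borel_measurable_continuous_onI continuous_intros)
 have Fm: "?F \<in> borel_measurable borel"
 proof -
  have "(\<lambda>w. kern_weight A \<e> T (\<lambda>k. w $ k)) \<in> borel_measurable borel"
   unfolding kern_weight_def using comp by measurable
  then show ?thesis
   using sq_mass_measurable[OF holo_on_subset[OF h sub] open_polydisc] W(1) by measurable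
 qed
 have Hm: "?H \<in> borel_measurable (Pi\<^sub>M UNIV (\<lambda>_. lborel))"
  by (rule measurable_compose[OF measurable_vec_lambda sq_mass_measurable[OF h open_polydisc]])
 have Wm: "(\<lambda>x. W (\<chi> k. x k)) \<in> borel_measurable (Pi\<^sub>M UNIV (\<lambda>_. lborel))"
  by (rule measurable_compose[OF measurable_vec_lambda W(1)])
 have BA: "?B \<inter> A = {}" "finite ?B" "finite A" "?B \<union> A = UNIV" by auto
 have merge: "merge ?B A (u, y) = override A y u" for u y :: "'n => complex"
  by (auto simp: merge_def override_def fun_eq_iff)
 have "(\<integral>\<^sup>+w. ?F w \<partial>lborel) = (\<integral>\<^sup>+x. ?F (\<chi> k. x k) \<partial>(Pi\<^sub>M (?B \<union> A) (\<lambda>_. lborel)))"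
  unfolding BA(4) by (rule nn_integral_vec[OF Fm])
 also have "\<dots> = (\<integral>\<^sup>+u. (\<integral>\<^sup>+y. ?F (\<chi> k. override A y u k) \<partial>(Pi\<^sub>M A (\<lambda>_. lborel))) \<partial>(Pi\<^sub>M ?B (\<lambda>_. lborel)))"
  unfolding merge[symmetric]
  by (rule product_nn_integral_fold[OF BA(1-3)]) (unfold BA(4), rule measurable_compose[OF measurable_vec_lambda Fm])
 also have "\<dots> \<le> (\<integral>\<^sup>+u. (\<integral>\<^sup>+y. ?K * (?H (override A y u) * W (\<chi> k. override A y u k)) \<partial>(Pi\<^sub>M A (\<lambda>_. lborel))) \<partial>(Pi\<^sub>M ?B (\<lambda>_. lborel)))"
 proof (rule nn_integral_mono)
  fix u :: "'n => complex"
  let ?M = "\<integral>\<^sup>+y. ?H (override A y u) \<partial>(Pi\<^sub>M A (\<lambda>_. lborel))"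
  let ?W = "W (\<chi> k. u k)"
  have Wu: "W (\<chi> k. override A y u k) = ?W" for y by (rule W(2)) (simp add: override_def)
  have Hmu: "(\<lambda>y. ?H (override A y u)) \<in> borel_measurable (Pi\<^sub>M A (\<lambda>_. lborel))"
   by (rule measurable_compose[OF measurable_override Hm])
  have "?F (\<chi> k. override A y u k) \<le> (ennreal c ^ card A * ?M * ?W) * ennreal (kern_weight A \<e> T y)" for y
  proof (cases "(\<chi> k. override A y u k) \<in> polydisc p r")
   case True
   have kw: "kern_weight A \<e> T (\<lambda>k. (\<chi> k. override A y u k) $ k) = kern_weight A \<e> T y"
    by (simp add: kern_weight_def override_def)
   have "sq_mass h (polydisc p r) (\<chi> k. override A y u k) = ?H (override A y u)"
    using True sub by (auto simp: sq_mass_def)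
   also have "\<dots> \<le> ennreal c ^ card A * ?M"
   proof -
    have ov: "override A y' (override A y u) = override A y' u" for y' by (auto simp: override_def)
    have "?H (override A y u) \<le> ennreal c ^ card A * (\<integral>\<^sup>+y'. ?H (override A y' (override A y u)) \<partial>(Pi\<^sub>M A (\<lambda>_. lborel)))"
     by (rule submean_iterated[OF r c(2) h]) (use True in \<open>auto simp: polydisc_def\<close>)
    then show ?thesis unfolding ov .
   qed
   finally show ?thesis unfolding kw Wu by (intro mult_right_mono) auto
  qed (simp add: sq_mass_def)
  then have "(\<integral>\<^sup>+y. ?F (\<chi> k. override A y u k) \<partial>(Pi\<^sub>M A (\<lambda>_. lborel))) \<le>
    (\<integral>\<^sup>+y. (ennreal c ^ card A * ?M * ?W) * ennreal (kern_weight A \<e> T y) \<partial>(Pi\<^sub>M A (\<lambda>_. lborel)))"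
   by (intro nn_integral_mono)
  also have "\<dots> = (ennreal c ^ card A * ?M * ?W) * (\<integral>\<^sup>+y. ennreal (kern_weight A \<e> T y) \<partial>(Pi\<^sub>M A (\<lambda>_. lborel)))"
   by (rule nn_integral_cmult) measurable
  also have "\<dots> \<le> (ennreal c ^ card A * ?M * ?W) * ennreal C" by (intro mult_left_mono C) simp
  also have "\<dots> = (?K * ?W) * ?M" by (simp only: mult_ac)
  also have "\<dots> = (\<integral>\<^sup>+y. (?K * ?W) * ?H (override A y u) \<partial>(Pi\<^sub>M A (\<lambda>_. lborel)))"
   by (rule nn_integral_cmult[OF Hmu, symmetric])
  also have "\<dots> = (\<integral>\<^sup>+y. ?K * (?H (override A y u) * W (\<chi> k. override A y u k)) \<partial>(Pi\<^sub>M A (\<lambda>_. lborel)))"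
   unfolding Wu by (simp only: mult_ac)
  finally show "(\<integral>\<^sup>+y. ?F (\<chi> k. override A y u k) \<partial>(Pi\<^sub>M A (\<lambda>_. lborel))) \<le>
   (\<integral>\<^sup>+y. ?K * (?H (override A y u) * W (\<chi> k. override A y u k)) \<partial>(Pi\<^sub>M A (\<lambda>_. lborel)))" .
 qed
 also have "\<dots> = (\<integral>\<^sup>+x. ?K * (?H x * W (\<chi> k. x k)) \<partial>(Pi\<^sub>M (?B \<union> A) (\<lambda>_. lborel)))"
  unfolding merge[symmetric]
  by (rule product_nn_integral_fold[OF BA(1-3), symmetric])
   (unfold BA(4), intro borel_measurable_times_ennreal borel_measurable_const Hm Wm)
 also have "\<dots> = ?K * (\<integral>\<^sup>+x. ?H x * W (\<chi> k. x k) \<partial>(Pi\<^sub>M UNIV (\<lambda>_. lborel)))"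
  unfolding BA(4) by (rule nn_integral_cmult) (intro borel_measurable_times_ennreal Hm Wm)
 also have "(\<integral>\<^sup>+x. ?H x * W (\<chi> k. x k) \<partial>(Pi\<^sub>M UNIV (\<lambda>_. lborel))) = (\<integral>\<^sup>+w. sq_mass h (polydisc p (2 * r)) w * W w \<partial>lborel)"
  by (rule nn_integral_vec[symmetric])
   (intro borel_measurable_times_ennreal W(1) sq_mass_measurable[OF h open_polydisc])
 also have "?K * \<dots> < \<infinity>"
  using fin c(1) by (simp add: ennreal_mult_less_top ennreal_power)
 finally show ?thesis .
qed

section \<open>Charts and holomorphic functions on manifolds\<close>

lemma is_chartD:
 assumes "is_chart \<k>"
 shows "open (fst \<k>)" "open (snd \<k> ` fst \<k>)" "inj_on (snd \<k>) (fst \<k>)" "continuous_on (fst \<k>) (snd \<k>)"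
  "continuous_on (snd \<k> ` fst \<k>) (inv_into (fst \<k>) (snd \<k>))"
proof -
 obtain g where g: "homeomorphism (fst \<k>) (snd \<k> ` fst \<k>) (snd \<k>) g"
  and o: "open (fst \<k>)" "open (snd \<k> ` fst \<k>)" using assms by (auto simp: is_chart_def)
 show "open (fst \<k>)" "open (snd \<k> ` fst \<k>)" by fact+
 show inj: "inj_on (snd \<k>) (fst \<k>)" using g by (metis homeomorphism_def inj_on_inverseI)
 show "continuous_on (fst \<k>) (snd \<k>)" using g by (simp add: homeomorphism_def)
 have "continuous_on (snd \<k> ` fst \<k>) g" using g by (simp add: homeomorphism_def)
 moreover have "g w = inv_into (fst \<k>) (snd \<k>) w" if "w \<in> snd \<k> ` fst \<k>" for w
  using that g inj by (auto simp: homeomorphism_def)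
 ultimately show "continuous_on (snd \<k> ` fst \<k>) (inv_into (fst \<k>) (snd \<k>))"
  by (simp cong: continuous_on_cong)
qed

lemma in_chart_apply: "is_chart \<k> ==> x \<in> fst \<k> ==> in_chart \<k> f (snd \<k> x) = f x"
 by (simp add: in_chart_def is_chartD(3))

lemma open_chart_image:
 assumes "is_chart \<k>" "open V" "V \<subseteq> fst \<k>"
 shows "open (snd \<k> ` V)"
proof -
 let ?g = "inv_into (fst \<k>) (snd \<k>)"
 have "snd \<k> ` V = snd \<k> ` fst \<k> \<inter> ?g -` V"
  using assms(3) is_chartD(3)[OF assms(1)] by (auto simp: subset_iff)
 then show ?thesis
  using continuous_on_open_vimage[OF is_chartD(2)[OF assms(1)], of ?g] is_chartD(5)[OF assms(1)] assms(2)
  by (metis Int_commute)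
qed

lemma open_chart_preimage:
 assumes "is_chart \<k>" "open W"
 shows "open (fst \<k> \<inter> snd \<k> -` W)"
 using continuous_on_open_vimage[OF is_chartD(1)[OF assms(1)], of "snd \<k>"] is_chartD(4)[OF assms(1)] assms(2)
 by (metis Int_commute)

lemma manifold_chart: "complex_manifold X ==> \<exists>\<k>\<in>X. x \<in> fst \<k>"
 by (auto simp: complex_manifold_def)

lemma manifold_hol_coords: "complex_manifold X ==> \<k> \<in> X ==> hol_coords X \<k>"
 by (auto simp: complex_manifold_def hol_coords_def)

lemma hol_coordsD:
 assumes "hol_coords X \<z>"
 shows "is_chart \<z>" "\<k> \<in> X ==> holo_change \<k> \<z>" "\<k> \<in> X ==> holo_change \<z> \<k>"
 using assms by (auto simp: hol_coords_def)

text \<open>\<open>hol_on\<close> tests charts of the atlas. Near each point one changes from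
  \<open>\<z>\<close> to such a chart, holomorphically by \<open>hol_coords\<close>, and
  differentiability is local.\<close>

lemma hol_on_coords:
 assumes X: "complex_manifold X" and z: "hol_coords X \<z>" and f: "hol_on X V f" "open V"
 shows "holo_on (snd \<z> ` (V \<inter> fst \<z>)) (in_chart \<z> f)"
 unfolding holo_on_def
proof
 fix w assume "w \<in> snd \<z> ` (V \<inter> fst \<z>)"
 then obtain x where x: "x \<in> V" "x \<in> fst \<z>" "w = snd \<z> x" by blast
 obtain \<k> where k: "\<k> \<in> X" "x \<in> fst \<k>" using manifold_chart[OF X] by blast
 note zc = hol_coordsD(1)[OF z] and kc = hol_coordsD(1)[OF manifold_hol_coords[OF X k(1)]]
 let ?O = "V \<inter> fst \<z> \<inter> fst \<k>"
 let ?h = "\<lambda>w. snd \<k> (inv_into (fst \<z>) (snd \<z>) w)"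
 have oO: "open ?O" using f(2) is_chartD(1)[OF zc] is_chartD(1)[OF kc] by blast
 have "holo_on (snd \<z> ` ?O) (\<lambda>w. in_chart \<k> f (?h w))"
 proof (rule holo_on_compose)
  show "holo_on (snd \<k> ` (V \<inter> fst \<k>)) (in_chart \<k> f)" using f(1) k(1) by (simp add: hol_on_def)
  have hj: "holo_on (snd \<z> ` (fst \<z> \<inter> fst \<k>)) (\<lambda>w. ?h w $ j)" for j
   using hol_coordsD(3)[OF z k(1)] by (simp add: holo_change_def in_chart_def)
  show "holo_on (snd \<z> ` ?O) (\<lambda>w. ?h w $ j)" for j
   by (rule holo_on_subset[OF hj]) auto
  show "?h ` snd \<z> ` ?O \<subseteq> snd \<k> ` (V \<inter> fst \<k>)"
   using is_chartD(3)[OF zc] by auto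
 qed
 moreover have "open (snd \<z> ` ?O)" by (rule open_chart_image[OF zc oO]) auto
 moreover have "in_chart \<k> f (?h w) = in_chart \<z> f w" if "w \<in> snd \<z> ` ?O" for w
  using that is_chartD(3)[OF zc] is_chartD(3)[OF kc] by (auto simp: in_chart_def)
 ultimately have "holo_on (snd \<z> ` ?O) (in_chart \<z> f)" by (rule holo_on_cong_open)
 then show "\<exists>f'. (in_chart \<z> f has_derivative f') (at w) \<and> (\<forall>c v. f' (c *s v) = c * f' v)"
  using x k unfolding holo_on_def by blast
qed

lemma hol_on_coordinate:
 assumes "hol_coords X \<z>"
 shows "hol_on X (fst \<z>) (\<lambda>y. snd \<z> y $ k)"
 using hol_coordsD(2)[OF assms] by (auto simp: hol_on_def holo_change_def Int_commute)

lemma hol_on_subset: "hol_on X V f ==> W \<subseteq> V ==> hol_on X W f"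
 unfolding hol_on_def by (meson Int_mono holo_on_subset image_mono order_refl)

lemma hol_on_const: "hol_on X V (\<lambda>x. c)"
 by (simp add: hol_on_def in_chart_def holo_on_const)

lemma hol_on_add: "hol_on X V f ==> hol_on X V g ==> hol_on X V (\<lambda>x. f x + g x)"
 unfolding hol_on_def in_chart_def by (simp add: holo_on_add)

lemma hol_on_mult: "hol_on X V f ==> hol_on X V g ==> hol_on X V (\<lambda>x. f x * g x)"
 unfolding hol_on_def in_chart_def by (simp add: holo_on_mult)

lemma hol_on_uminus: "hol_on X V f ==> hol_on X V (\<lambda>x. - f x)"
 using hol_on_mult[OF hol_on_const[of X V "- 1"]] by simp

lemma hol_on_prod: "finite A ==> (\<And>k. k \<in> A ==> hol_on X V (f k)) ==> hol_on X V (\<lambda>x. \<Prod>k\<in>A. f k x)"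
 by (induction A rule: finite_induct) (simp_all add: hol_on_const hol_on_mult)

lemma hol_on_cong:
 assumes X: "complex_manifold X" and f: "hol_on X V f" and V: "open V" and eq: "\<And>x. x \<in> V ==> f x = g x"
 shows "hol_on X V g"
 unfolding hol_on_def
proof
 fix \<k> assume k: "\<k> \<in> X"
 note kc = hol_coordsD(1)[OF manifold_hol_coords[OF X k]]
 show "holo_on (snd \<k> ` (V \<inter> fst \<k>)) (in_chart \<k> g)"
 proof (rule holo_on_cong_open)
  show "holo_on (snd \<k> ` (V \<inter> fst \<k>)) (in_chart \<k> f)" using f k by (simp add: hol_on_def)
  show "open (snd \<k> ` (V \<inter> fst \<k>))" using V is_chartD(1)[OF kc] by (intro open_chart_image[OF kc]) auto
  fix w assume "w \<in> snd \<k> ` (V \<inter> fst \<k>)"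
  then show "in_chart \<k> f w = in_chart \<k> g w" by (auto simp: in_chart_apply[OF kc] eq)
 qed
qed

lemma hol_on_inverse:
 assumes X: "complex_manifold X" and f: "hol_on X V f" "\<And>x. x \<in> V ==> f x \<noteq> 0"
 shows "hol_on X V (\<lambda>x. inverse (f x))"
 unfolding hol_on_def
proof
 fix \<k> assume k: "\<k> \<in> X"
 note kc = hol_coordsD(1)[OF manifold_hol_coords[OF X k]]
 have "holo_on (snd \<k> ` (V \<inter> fst \<k>)) (\<lambda>w. inverse (in_chart \<k> f w))"
 proof (rule holo_on_inverse)
  show "holo_on (snd \<k> ` (V \<inter> fst \<k>)) (in_chart \<k> f)" using f(1) k by (simp add: hol_on_def)
  fix w assume "w \<in> snd \<k> ` (V \<inter> fst \<k>)"
  then show "in_chart \<k> f w \<noteq> 0" by (auto simp: in_chart_apply[OF kc] f(2))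
 qed
 then show "holo_on (snd \<k> ` (V \<inter> fst \<k>)) (in_chart \<k> (\<lambda>x. inverse (f x)))" by (simp add: in_chart_def)
qed

lemma continuous_on_in_chart:
 assumes X: "complex_manifold X" and V: "open V"
  and f: "\<And>\<k>. \<k> \<in> X ==> continuous_on (snd \<k> ` (V \<inter> fst \<k>)) (in_chart \<k> f)"
 shows "continuous_on V f"
proof -
 have "isCont f x" if x: "x \<in> V" for x
 proof -
  obtain \<k> where k: "\<k> \<in> X" "x \<in> fst \<k>" using manifold_chart[OF X] by blast
  note kc = hol_coordsD(1)[OF manifold_hol_coords[OF X k(1)]]
  let ?O = "V \<inter> fst \<k>"
  have o: "open ?O" using V is_chartD(1)[OF kc] by blast
  have "continuous_on ?O (\<lambda>x. in_chart \<k> f (snd \<k> x))"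
   by (rule continuous_on_compose2[OF f[OF k(1)] continuous_on_subset[OF is_chartD(4)[OF kc]]]) auto
  moreover have "in_chart \<k> f (snd \<k> y) = f y" if "y \<in> ?O" for y using that by (simp add: in_chart_apply[OF kc])
  ultimately have "continuous_on ?O f" by (rule continuous_on_eq)
  then show ?thesis using o x k by (simp add: continuous_on_eq_continuous_at)
 qed
 then show ?thesis by (simp add: continuous_at_imp_continuous_on)
qed

lemma hol_on_continuous: "complex_manifold X ==> hol_on X V f ==> open V ==> continuous_on V f"
 by (rule continuous_on_in_chart) (auto simp: hol_on_def intro: holo_on_continuous)

lemma mfd_smooth_on_continuous: "complex_manifold X ==> mfd_smooth_on X V f ==> open V ==> continuous_on V f"
proof (rule continuous_on_in_chart)
 fix \<k> assume "mfd_smooth_on X V f" "\<k> \<in> X"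
 then have "Ck_on 0 (snd \<k> ` (V \<inter> fst \<k>)) (in_chart \<k> f)" unfolding mfd_smooth_on_def smooth_on_def by blast
 then show "continuous_on (snd \<k> ` (V \<inter> fst \<k>)) (in_chart \<k> f)" by simp
qed auto

lemma bounded_nhd:
 fixes f :: "'a::topological_space => 'b::real_normed_vector"
 assumes "continuous_on V f" "open V" "x \<in> V"
 obtains W B where "open W" "x \<in> W" "W \<subseteq> V" "B > 0" "\<And>y. y \<in> W ==> norm (f y) \<le> B"
proof -
 have "open (V \<inter> f -` ball (f x) 1)" using continuous_on_open_vimage[OF assms(2)] assms(1) by (metis Int_commute open_ball)
 moreover have "norm (f y) \<le> norm (f x) + 1" if "y \<in> V \<inter> f -` ball (f x) 1" for y
 proof -
  have "norm (f y - f x) < 1" using that by (simp add: dist_norm norm_minus_commute)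
  then show ?thesis using norm_triangle_ineq2[of "f y" "f x"] by linarith
 qed
 moreover have "norm (f x) + 1 > 0" using norm_ge_zero[of "f x"] by linarith
 ultimately show ?thesis using that[of "V \<inter> f -` ball (f x) 1" "norm (f x) + 1"] assms(3) by auto
qed

section \<open>Local integrability on manifolds\<close>

lemma absolutely_integrable_on_iff_nn:
 fixes g :: "'v::euclidean_space => real"
 assumes S: "open S" and g: "g \<in> borel_measurable (restrict_space borel S)" "\<And>w. w \<in> S ==> g w \<ge> 0"
 shows "g absolutely_integrable_on S \<longleftrightarrow> (\<integral>\<^sup>+w. ennreal (g w) * indicator S w \<partial>lborel) < \<infinity>"
proof -
 let ?g = "\<lambda>w. indicator S w *\<^sub>R g w"
 have m: "?g \<in> borel_measurable borel"
  using g(1) S by (subst (asm) borel_measurable_restrict_space_iff) auto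
 have "g absolutely_integrable_on S \<longleftrightarrow> integrable lebesgue ?g" by (simp add: set_integrable_def)
 also have "\<dots> \<longleftrightarrow> integrable lborel ?g" using m by (intro integrable_completion) simp
 also have "\<dots> \<longleftrightarrow> (\<integral>\<^sup>+w. ennreal (norm (?g w)) \<partial>lborel) < \<infinity>" using m by (simp add: integrable_iff_bounded)
 also have "(\<integral>\<^sup>+w. ennreal (norm (?g w)) \<partial>lborel) = (\<integral>\<^sup>+w. ennreal (g w) * indicator S w \<partial>lborel)"
  using g(2) by (intro nn_integral_cong) (auto simp: indicator_def)
 finally show ?thesis .
qed

lemma restrict_borel_subset:
 assumes "g \<in> borel_measurable (restrict_space borel V)" "W \<subseteq> V"
 shows "g \<in> borel_measurable (restrict_space borel W)"
 using measurable_restrict_mono[OF assms] .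

lemma in_chart_borel:
 assumes k: "is_chart \<k>" and V: "V \<subseteq> fst \<k>" and g: "g \<in> borel_measurable (restrict_space borel V)"
 shows "in_chart \<k> g \<in> borel_measurable (restrict_space borel (snd \<k> ` V))"
 unfolding in_chart_def
proof (rule measurable_compose[OF _ g])
 let ?g = "inv_into (fst \<k>) (snd \<k>)"
 have "continuous_on (snd \<k> ` V) ?g" by (rule continuous_on_subset[OF is_chartD(5)[OF k]]) (use V in auto)
 then show "?g \<in> measurable (restrict_space borel (snd \<k> ` V)) (restrict_space borel V)"
  using V is_chartD(3)[OF k]
  by (intro measurable_restrict_space2 borel_measurable_continuous_on_restrict) (auto simp: space_restrict_space subset_iff)
qed

text \<open>The parameter set \<open>E\<close> treats two cases at once: a single weight,
  \<open>E = {1}\<close>, for multiplier ideals, and all positive \<epsilon> for adjoint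
  ideals.\<close>

definition nonneg_borel :: "'a::topological_space set => real set => (real => 'a => real) => bool" where
 "nonneg_borel N E G \<longleftrightarrow> (\<forall>\<e>\<in>E. G \<e> \<in> borel_measurable (restrict_space borel N) \<and> (\<forall>y\<in>N. G \<e> y \<ge> 0))"

lemma nonneg_borelD:
 assumes "nonneg_borel N E G" "\<e> \<in> E"
 shows "G \<e> \<in> borel_measurable (restrict_space borel N)" "y \<in> N ==> G \<e> y \<ge> 0"
 using assms by (auto simp: nonneg_borel_def)

text \<open>One neighbourhood serves all parameters in \<open>E\<close>, as in
  \<open>adjoint_ideal\<close>.\<close>

definition loc_int :: "('a::t2_space, 'n::finite) chart => 'a => real set => (real => 'a => real) => bool" where
 "loc_int \<k> x E G \<longleftrightarrow> (\<exists>V. open V \<and> x \<in> V \<and> V \<subseteq> fst \<k> \<and> (\<forall>\<e>\<in>E. in_chart \<k> (G \<e>) absolutely_integrable_on snd \<k> ` V))"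

text \<open>Nonnegativity turns absolute integrability into finiteness of an \<open>ennreal\<close>
  integral, where estimates carry no integrability side conditions.\<close>

lemma loc_int_nn:
 assumes k: "is_chart \<k>" and N: "open N" "x \<in> N"
  and G: "nonneg_borel N E G"
 shows "loc_int \<k> x E G \<longleftrightarrow> (\<exists>V. open V \<and> x \<in> V \<and> V \<subseteq> fst \<k> \<inter> N \<and>
  (\<forall>\<e>\<in>E. (\<integral>\<^sup>+w. ennreal (in_chart \<k> (G \<e>) w) * indicator (snd \<k> ` V) w \<partial>lborel) < \<infinity>))"
proof -
 have iff: "in_chart \<k> (G \<e>) absolutely_integrable_on snd \<k> ` V \<longleftrightarrow>
   (\<integral>\<^sup>+w. ennreal (in_chart \<k> (G \<e>) w) * indicator (snd \<k> ` V) w \<partial>lborel) < \<infinity>"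
  if V: "open V" "V \<subseteq> fst \<k> \<inter> N" and e: "\<e> \<in> E" for V \<e>
 proof (rule absolutely_integrable_on_iff_nn)
  show "open (snd \<k> ` V)" using V by (intro open_chart_image[OF k]) auto
  show "in_chart \<k> (G \<e>) \<in> borel_measurable (restrict_space borel (snd \<k> ` V))"
   using V by (intro in_chart_borel[OF k] restrict_borel_subset[OF nonneg_borelD(1)[OF G e]]) auto
  fix w assume "w \<in> snd \<k> ` V"
  then show "in_chart \<k> (G \<e>) w \<ge> 0" using V by (auto simp: in_chart_apply[OF k] subset_iff intro!: nonneg_borelD(2)[OF G e])
 qed
 show ?thesis
 proof
  assume "loc_int \<k> x E G"
  then obtain V where V: "open V" "x \<in> V" "V \<subseteq> fst \<k>" "\<forall>\<e>\<in>E. in_chart \<k> (G \<e>) absolutely_integrable_on snd \<k> ` V"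
   unfolding loc_int_def by (elim exE conjE) (rule that; assumption)
  have o: "open (V \<inter> N)" using V N by blast
  have "in_chart \<k> (G \<e>) absolutely_integrable_on snd \<k> ` (V \<inter> N)" if "\<e> \<in> E" for \<e>
  proof (rule set_integrable_subset)
   show "in_chart \<k> (G \<e>) absolutely_integrable_on snd \<k> ` V" using V(4) that by blast
   have "open (snd \<k> ` (V \<inter> N))" using V(3) o by (intro open_chart_image[OF k]) auto
   then show "snd \<k> ` (V \<inter> N) \<in> sets lebesgue" by simp
  qed auto
  then show "\<exists>V. open V \<and> x \<in> V \<and> V \<subseteq> fst \<k> \<inter> N \<and>
    (\<forall>\<e>\<in>E. (\<integral>\<^sup>+w. ennreal (in_chart \<k> (G \<e>) w) * indicator (snd \<k> ` V) w \<partial>lborel) < \<infinity>)"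
   using V(2,3) N(2) o by (intro exI[of _ "V \<inter> N"]) (simp add: iff[OF o] le_infI1)
 next
  assume "\<exists>V. open V \<and> x \<in> V \<and> V \<subseteq> fst \<k> \<inter> N \<and>
    (\<forall>\<e>\<in>E. (\<integral>\<^sup>+w. ennreal (in_chart \<k> (G \<e>) w) * indicator (snd \<k> ` V) w \<partial>lborel) < \<infinity>)"
  then obtain V where V: "open V" "x \<in> V" "V \<subseteq> fst \<k> \<inter> N"
    "\<forall>\<e>\<in>E. (\<integral>\<^sup>+w. ennreal (in_chart \<k> (G \<e>) w) * indicator (snd \<k> ` V) w \<partial>lborel) < \<infinity>"
   by (elim exE conjE) (rule that; assumption)
  show "loc_int \<k> x E G" unfolding loc_int_def
   using V by (intro exI[of _ V]) (simp add: iff[OF V(1,3)])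
 qed
qed

text \<open>A change of charts is locally Lipschitz, so it distorts Lebesgue measure by a bounded factor.\<close>

lemma loc_int_change:
 assumes k: "is_chart \<k>" "is_chart \<k>'" "holo_change \<k> \<k>'" and x: "x \<in> fst \<k>" "x \<in> fst \<k>'"
  and N: "open N" "x \<in> N"
  and G: "nonneg_borel N E G"
  and int: "loc_int \<k> x E G"
 shows "loc_int \<k>' x E G"
proof -
 obtain V where V: "open V" "x \<in> V" "V \<subseteq> fst \<k> \<inter> N"
   "\<forall>\<e>\<in>E. (\<integral>\<^sup>+w. ennreal (in_chart \<k> (G \<e>) w) * indicator (snd \<k> ` V) w \<partial>lborel) < \<infinity>"
  using int[unfolded loc_int_nn[OF k(1) N G]] by (elim exE conjE) (rule that; assumption)
 let ?i = "inv_into (fst \<k>) (snd \<k>)" and ?i' = "inv_into (fst \<k>') (snd \<k>')"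
 let ?O = "fst \<k> \<inter> fst \<k>'"
 have oO: "open ?O" using is_chartD(1)[OF k(1)] is_chartD(1)[OF k(2)] by blast
 have h: "holo_on (snd \<k> ` ?O) (\<lambda>w. snd \<k>' (?i w) $ j)" for j
  using k(3) by (simp add: holo_change_def in_chart_def)
 obtain r L where L: "r > 0" "L \<ge> 0"
  "\<And>u v. u \<in> ball (snd \<k> x) r ==> v \<in> ball (snd \<k> x) r ==> norm (snd \<k>' (?i u) - snd \<k>' (?i v)) \<le> L * norm (u - v)"
  by (rule holo_map_lipschitz[OF h open_chart_image[OF k(1) oO]]) (use x in auto)
 define V' where "V' = V \<inter> fst \<k>' \<inter> (fst \<k> \<inter> snd \<k> -` ball (snd \<k> x) r)"
 have V': "open V'" "x \<in> V'" "V' \<subseteq> fst \<k>' \<inter> N" "V' \<subseteq> fst \<k>" "V' \<subseteq> V" "snd \<k> ` V' \<subseteq> ball (snd \<k> x) r"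
  using V x L(1) is_chartD(1)[OF k(2)] open_chart_preimage[OF k(1), of "ball (snd \<k> x) r"] by (auto simp: V'_def)
 have o: "open (snd \<k> ` V')" "open (snd \<k>' ` V')"
  using V' by (auto intro!: open_chart_image[OF k(1)] open_chart_image[OF k(2)])
 have "(\<integral>\<^sup>+w. ennreal (in_chart \<k>' (G \<e>) w) * indicator (snd \<k>' ` V') w \<partial>lborel) < \<infinity>" if e: "\<e> \<in> E" for \<e>
 proof -
  let ?u = "\<lambda>w. ennreal (indicator (snd \<k> ` V') w *\<^sub>R in_chart \<k> (G \<e>) w)"
  have "(\<lambda>w. indicator (snd \<k> ` V') w *\<^sub>R in_chart \<k> (G \<e>) w) \<in> borel_measurable borel"
  proof -
   have "in_chart \<k> (G \<e>) \<in> borel_measurable (restrict_space borel (snd \<k> ` V'))"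
    using V' by (intro in_chart_borel[OF k(1)] restrict_borel_subset[OF nonneg_borelD(1)[OF G e]]) auto
   then show ?thesis using o(1) by (subst (asm) borel_measurable_restrict_space_iff) auto
  qed
  then have um: "?u \<in> borel_measurable borel" by measurable
  have "(\<integral>\<^sup>+w. ennreal (in_chart \<k>' (G \<e>) w) * indicator (snd \<k>' ` V') w \<partial>lborel) =
    (\<integral>\<^sup>+w. ?u (snd \<k> (?i' w)) * indicator (snd \<k>' ` V') w \<partial>lborel)"
  proof (rule nn_integral_cong)
   fix w
   show "ennreal (in_chart \<k>' (G \<e>) w) * indicator (snd \<k>' ` V') w = ?u (snd \<k> (?i' w)) * indicator (snd \<k>' ` V') w"
   proof (cases "w \<in> snd \<k>' ` V'")
    case True
    then obtain y where y: "y \<in> V'" "w = snd \<k>' y" by blast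
    then have "?i' w = y" using is_chartD(3)[OF k(2)] V' by auto
    moreover have "y \<in> fst \<k>" "y \<in> fst \<k>'" using y V' by auto
    ultimately show ?thesis
     using y by (simp add: indicator_def in_chart_apply[OF k(1)] in_chart_apply[OF k(2)])
   qed simp
  qed
  also have "\<dots> \<le> ennreal ((2 * (L * DIM(complex^'b))) ^ DIM(complex^'b)) * (\<integral>\<^sup>+w. ?u w * indicator (snd \<k> ` V') w \<partial>lborel)"
  proof (rule nn_integral_lipschitz[where g = "\<lambda>w. snd \<k>' (?i w)"])
   show "snd \<k>' ` V' \<in> sets borel" "snd \<k> ` V' \<in> sets borel" using o by auto
   show "bounded (snd \<k> ` V')" using V'(6) bounded_subset bounded_ball by blast
   have "continuous_on (snd \<k>' ` V') (\<lambda>w. snd \<k> (?i' w))"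
    by (rule continuous_on_compose2[OF is_chartD(4)[OF k(1)] continuous_on_subset[OF is_chartD(5)[OF k(2)]]])
     (use V' is_chartD(3)[OF k(2)] in auto)
   then show "(\<lambda>w. snd \<k> (?i' w)) \<in> borel_measurable (restrict_space borel (snd \<k>' ` V'))"
    by (rule borel_measurable_continuous_on_restrict)
   show "(\<lambda>w. snd \<k> (?i' w)) ` snd \<k>' ` V' = snd \<k> ` V'"
    using V' is_chartD(3)[OF k(2)] by (force simp: image_image intro!: image_cong)
   fix w assume "w \<in> snd \<k>' ` V'"
   then obtain y where y: "y \<in> V'" "w = snd \<k>' y" by blast
   then have y': "y \<in> fst \<k>" "y \<in> fst \<k>'" using V' by auto
   show "snd \<k>' (?i (snd \<k> (?i' w))) = w"
    unfolding y(2) inv_into_f_f[OF is_chartD(3)[OF k(2)] y'(2)] inv_into_f_f[OF is_chartD(3)[OF k(1)] y'(1)] ..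
  next
   show "norm (snd \<k>' (?i u) - snd \<k>' (?i v)) \<le> L * norm (u - v)" if "u \<in> snd \<k> ` V'" "v \<in> snd \<k> ` V'" for u v
    using L(3) V'(6) that by blast
  qed (use L(2) um in auto)
  also have "\<dots> \<le> ennreal ((2 * (L * DIM(complex^'b))) ^ DIM(complex^'b)) *
    (\<integral>\<^sup>+w. ennreal (in_chart \<k> (G \<e>) w) * indicator (snd \<k> ` V) w \<partial>lborel)"
   using V'(5) by (intro mult_left_mono nn_integral_mono) (auto simp: indicator_def)
  also have "\<dots> < \<infinity>" using V(4) e by (simp add: ennreal_mult_less_top)
  finally show ?thesis .
 qed
 then show ?thesis
  using V' by (intro iffD2[OF loc_int_nn[of \<k>' N x E G, OF k(2) N G]] exI[of _ V']) simp_all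
qed

text \<open>Domination off a null set \<open>Z\<close>, which absorbs the poles, where
  \<open>real_of_ereal\<close> returns a default value. The map \<open>e\<close> lets the parameter
  of the dominating weight depend on that of the dominated one.\<close>

lemma loc_int_compare:
 assumes k: "is_chart \<k>" and x: "x \<in> fst \<k>" and N: "open N" "x \<in> N"
  and G: "nonneg_borel N E G"
  and G': "nonneg_borel N E' G'"
  and e: "\<And>\<e>. \<e> \<in> E' ==> e \<e> \<in> E"
  and Z: "negligible (snd \<k> ` (Z \<inter> fst \<k>))"
  and C: "\<And>\<e>. \<e> \<in> E' ==> \<exists>C\<ge>0. \<forall>y\<in>N - Z. G' \<e> y \<le> C * G (e \<e>) y"
  and int: "loc_int \<k> x E G"
 shows "loc_int \<k> x E' G'"
proof -
 obtain V where V: "open V" "x \<in> V" "V \<subseteq> fst \<k> \<inter> N"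
   "\<forall>\<e>\<in>E. (\<integral>\<^sup>+w. ennreal (in_chart \<k> (G \<e>) w) * indicator (snd \<k> ` V) w \<partial>lborel) < \<infinity>"
  using int[unfolded loc_int_nn[OF k N G]] by (elim exE conjE) (rule that; assumption)
 have "(\<integral>\<^sup>+w. ennreal (in_chart \<k> (G' \<e>) w) * indicator (snd \<k> ` V) w \<partial>lborel) < \<infinity>" if \<e>: "\<e> \<in> E'" for \<e>
 proof -
  obtain C where C': "C \<ge> 0" "\<forall>y\<in>N - Z. G' \<e> y \<le> C * G (e \<e>) y" using C[OF \<e>] by blast
  have oV: "open (snd \<k> ` V)" using V by (intro open_chart_image[OF k]) auto
  have m: "(\<lambda>w. ennreal (g w) * indicator (snd \<k> ` V) w) \<in> borel_measurable borel"
   if "g \<in> borel_measurable (restrict_space borel (snd \<k> ` V))" for g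
  proof -
   have "(\<lambda>w. indicator (snd \<k> ` V) w *\<^sub>R g w) \<in> borel_measurable borel"
    using that oV by (subst (asm) borel_measurable_restrict_space_iff) auto
   then have "(\<lambda>w. ennreal (indicator (snd \<k> ` V) w *\<^sub>R g w)) \<in> borel_measurable borel" by measurable
   then show ?thesis by (rule back_subst[of "\<lambda>f. f \<in> borel_measurable borel"]) (auto simp: indicator_def)
  qed
  have bm: "in_chart \<k> (G (e \<e>)) \<in> borel_measurable (restrict_space borel (snd \<k> ` V))"
   using V by (intro in_chart_borel[OF k] restrict_borel_subset[OF nonneg_borelD(1)[OF G e[OF \<e>]]]) auto
  have "AE w in lebesgue. w \<notin> snd \<k> ` (Z \<inter> fst \<k>)"
   using Z by (auto simp: negligible_iff_null_sets intro: AE_not_in)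
  moreover have "in_chart \<k> (G' \<e>) w \<le> C * in_chart \<k> (G (e \<e>)) w" if w: "w \<in> snd \<k> ` V" "w \<notin> snd \<k> ` (Z \<inter> fst \<k>)" for w
  proof -
   obtain y where y: "y \<in> V" "w = snd \<k> y" using w(1) by (elim imageE) auto
   then have "y \<in> fst \<k>" "y \<in> N - Z" using V(3) w(2) by auto
   then show ?thesis using C'(2) y by (simp add: in_chart_apply[OF k])
  qed
  ultimately have "AE w in lebesgue. ennreal (in_chart \<k> (G' \<e>) w) * indicator (snd \<k> ` V) w \<le>
    ennreal C * (ennreal (in_chart \<k> (G (e \<e>)) w) * indicator (snd \<k> ` V) w)"
   using C'(1) by (elim AE_mp) (auto intro!: AE_I2 simp: indicator_def ennreal_mult[symmetric] ennreal_mult'[symmetric] ennreal_leI)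
  then have "(\<integral>\<^sup>+w. ennreal (in_chart \<k> (G' \<e>) w) * indicator (snd \<k> ` V) w \<partial>lebesgue) \<le>
    (\<integral>\<^sup>+w. ennreal C * (ennreal (in_chart \<k> (G (e \<e>)) w) * indicator (snd \<k> ` V) w) \<partial>lebesgue)"
   by (rule nn_integral_mono_AE)
  also have "\<dots> = (\<integral>\<^sup>+w. ennreal C * (ennreal (in_chart \<k> (G (e \<e>)) w) * indicator (snd \<k> ` V) w) \<partial>lborel)"
   by (rule nn_integral_completion)
  also have "\<dots> = ennreal C * (\<integral>\<^sup>+w. ennreal (in_chart \<k> (G (e \<e>)) w) * indicator (snd \<k> ` V) w \<partial>lborel)"
   using m[OF bm] by (intro nn_integral_cmult) simp
  also have "\<dots> < \<infinity>" using V(4) e[OF \<e>] by (auto simp: ennreal_mult_less_top)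
  finally show ?thesis by (simp add: nn_integral_completion)
 qed
 then show ?thesis using V(1-3)
  by (intro iffD2[OF loc_int_nn[of \<k> N x E' G', OF k N G']] exI[of _ V]) simp_all
qed

lemma loc_int_add:
 assumes k: "is_chart \<k>" and int: "loc_int \<k> x E G" "loc_int \<k> x E H"
 shows "loc_int \<k> x E (\<lambda>\<e> y. G \<e> y + H \<e> y)"
proof -
 obtain V where V: "open V" "x \<in> V" "V \<subseteq> fst \<k>" "\<forall>\<e>\<in>E. in_chart \<k> (G \<e>) absolutely_integrable_on snd \<k> ` V"
  using int(1) unfolding loc_int_def by (elim exE conjE) (rule that; assumption)
 obtain W where W: "open W" "x \<in> W" "W \<subseteq> fst \<k>" "\<forall>\<e>\<in>E. in_chart \<k> (H \<e>) absolutely_integrable_on snd \<k> ` W"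
  using int(2) unfolding loc_int_def by (elim exE conjE) (rule that; assumption)
 have o: "open (snd \<k> ` (V \<inter> W))" using V W by (intro open_chart_image[OF k]) auto
 have "in_chart \<k> (\<lambda>y. G \<e> y + H \<e> y) absolutely_integrable_on snd \<k> ` (V \<inter> W)" if e: "\<e> \<in> E" for \<e>
 proof -
  have "in_chart \<k> (G \<e>) absolutely_integrable_on snd \<k> ` (V \<inter> W)" "in_chart \<k> (H \<e>) absolutely_integrable_on snd \<k> ` (V \<inter> W)"
   using V(4) W(4) e o by (auto intro: set_integrable_subset)
  from set_integral_add(1)[OF this] show ?thesis by (simp add: in_chart_def)
 qed
 then show ?thesis unfolding loc_int_def using V W by (intro exI[of _ "V \<inter> W"]) auto
qed

section \<open>Ideals of germs with an integrability condition\<close>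

lemma nonneg_borelI:
 assumes "\<And>\<e>. \<e> \<in> E ==> G \<e> \<in> borel_measurable (restrict_space borel N)"
  and "\<And>\<e> y. \<e> \<in> E ==> y \<in> N ==> G \<e> y \<ge> 0"
 shows "nonneg_borel N E G"
 using assms by (auto simp: nonneg_borel_def)

lemma nonneg_borel_subset: "nonneg_borel N E G ==> N' \<subseteq> N ==> nonneg_borel N' E G"
 unfolding nonneg_borel_def using restrict_borel_subset by blast

lemma nonneg_borel_times:
 assumes f: "continuous_on N f" and w: "nonneg_borel N E w"
 shows "nonneg_borel N E (\<lambda>\<e> y. (cmod (f y))\<^sup>2 * w \<e> y)"
proof (rule nonneg_borelI)
 fix \<e> assume e: "\<e> \<in> E"
 have "(\<lambda>y. (cmod (f y))\<^sup>2) \<in> borel_measurable (restrict_space borel N)"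
  by (rule borel_measurable_continuous_on_restrict) (intro continuous_intros f)
 then show "(\<lambda>y. (cmod (f y))\<^sup>2 * w \<e> y) \<in> borel_measurable (restrict_space borel N)"
  using nonneg_borelD(1)[OF w e] by (rule borel_measurable_times)
 fix y assume "y \<in> N"
 then show "(cmod (f y))\<^sup>2 * w \<e> y \<ge> 0" using nonneg_borelD(2)[OF w e] by simp
qed

lemma loc_int_shrink:
 assumes k: "is_chart \<k>" and int: "loc_int \<k> x E G" and O: "open W" "x \<in> W"
 obtains V where "open V" "x \<in> V" "V \<subseteq> fst \<k>" "V \<subseteq> W"
  "\<forall>\<e>\<in>E. in_chart \<k> (G \<e>) absolutely_integrable_on snd \<k> ` V"
proof -
 obtain V where V: "open V" "x \<in> V" "V \<subseteq> fst \<k>" "\<forall>\<e>\<in>E. in_chart \<k> (G \<e>) absolutely_integrable_on snd \<k> ` V"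
  using int unfolding loc_int_def by (elim exE conjE) (rule that; assumption)
 have o: "open (snd \<k> ` (V \<inter> W))" using V(1,3) O by (intro open_chart_image[OF k]) auto
 have "in_chart \<k> (G \<e>) absolutely_integrable_on snd \<k> ` (V \<inter> W)" if e: "\<e> \<in> E" for \<e>
  using V(4) e o by (auto intro: set_integrable_subset)
 then show ?thesis using V(1-3) O by (intro that[of "V \<inter> W"]) auto
qed

text \<open>Common form of \<open>multiplier_ideal\<close> and \<open>adjoint_ideal\<close>; in the
  latter the weights are indexed by \<epsilon>.\<close>

definition weighted_ideal :: "('a::t2_space, 'n::finite) chart set => ('a, 'i) line_bundle => real set
  => ('i => real => 'a => real) => 'a ideal_sheaf" where
 "weighted_ideal X L E w x = {f. \<exists>V. \<exists>\<k>\<in>X. \<exists>i\<in>idx L. open V \<and> x \<in> V \<and> V \<subseteq> fst \<k> \<inter> dom L i \<and> hol_on X V f \<and>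
  (\<forall>\<e>\<in>E. in_chart \<k> (\<lambda>y. (cmod (f y))\<^sup>2 * w i \<e> y) absolutely_integrable_on (snd \<k> ` V))}"

text \<open>Borel near each point, and locally comparable between trivialisations: this makes
  membership independent of the chosen frame.\<close>

definition good_weight :: "('a::topological_space, 'i) line_bundle => real set => ('i => real => 'a => real) => bool" where
 "good_weight L E w \<longleftrightarrow>
  (\<forall>i\<in>idx L. \<forall>x\<in>dom L i. \<exists>N. open N \<and> x \<in> N \<and> N \<subseteq> dom L i \<and> nonneg_borel N E (w i)) \<and>
  (\<forall>i\<in>idx L. \<forall>j\<in>idx L. \<forall>x\<in>dom L i \<inter> dom L j. \<exists>N C. open N \<and> x \<in> N \<and> C \<ge> 0 \<and>
   (\<forall>\<e>\<in>E. \<forall>y\<in>N. w i \<e> y \<le> C * w j \<e> y))"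

text \<open>The ideal asks for some atlas chart and some trivialisation. Comparable weights and the
  Lipschitz bound for chart changes show that any holomorphic coordinates and any trivialisation may
  be used instead; this gives access to snc coordinates outside the atlas.\<close>

lemma weighted_ideal_iff:
 assumes X: "complex_manifold X" and w: "good_weight L E w" and z: "hol_coords X \<z>" "x \<in> fst \<z>"
  and i: "i \<in> idx L" "x \<in> dom L i"
 shows "f \<in> weighted_ideal X L E w x \<longleftrightarrow>
  (\<exists>V. open V \<and> x \<in> V \<and> hol_on X V f) \<and> loc_int \<z> x E (\<lambda>\<e> y. (cmod (f y))\<^sup>2 * w i \<e> y)"
proof -
 note zc = hol_coordsD(1)[OF z(1)]
 obtain N where N: "open N" "x \<in> N" "N \<subseteq> dom L i" "nonneg_borel N E (w i)"
  using w i unfolding good_weight_def by blast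
 have nb: "nonneg_borel (V \<inter> N) E (\<lambda>\<e> y. (cmod (f y))\<^sup>2 * w i \<e> y)" if "open V" "hol_on X V f" for V
  using hol_on_continuous[OF X that(2,1)]
  by (intro nonneg_borel_times nonneg_borel_subset[OF N(4)]) (auto intro: continuous_on_subset)
 show ?thesis
 proof
  assume "f \<in> weighted_ideal X L E w x"
  then obtain V \<k> j where V: "open V" "x \<in> V" "V \<subseteq> fst \<k> \<inter> dom L j" "hol_on X V f"
   and kj: "\<k> \<in> X" "j \<in> idx L"
   and int: "\<forall>\<e>\<in>E. in_chart \<k> (\<lambda>y. (cmod (f y))\<^sup>2 * w j \<e> y) absolutely_integrable_on (snd \<k> ` V)"
   unfolding weighted_ideal_def mem_Collect_eq by (elim exE bexE conjE) (rule that; assumption)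
  note kc = hol_coordsD(1)[OF manifold_hol_coords[OF X kj(1)]]
  have xx: "x \<in> fst \<k>" "x \<in> dom L j" using V(2,3) by auto
  obtain N' where N': "open N'" "x \<in> N'" "nonneg_borel N' E (w j)"
   using w kj(2) xx(2) unfolding good_weight_def by blast
  obtain P C where P: "open P" "x \<in> P" "C \<ge> 0" "\<forall>\<e>\<in>E. \<forall>y\<in>P. w i \<e> y \<le> C * w j \<e> y"
   using w i kj(2) xx(2) unfolding good_weight_def by blast
  define Q where "Q = V \<inter> N \<inter> N' \<inter> P"
  have Q: "open Q" "x \<in> Q" using V N N' P by (auto simp: Q_def)
  have cont: "continuous_on Q f"
   using hol_on_continuous[OF X V(4,1)] by (rule continuous_on_subset) (auto simp: Q_def)
  have "loc_int \<k> x E (\<lambda>\<e> y. (cmod (f y))\<^sup>2 * w j \<e> y)"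
   unfolding loc_int_def using V int by (intro exI[of _ V]) simp
  then have "loc_int \<k> x E (\<lambda>\<e> y. (cmod (f y))\<^sup>2 * w i \<e> y)"
  proof (rule loc_int_compare[OF kc xx(1) Q, where e = "\<lambda>\<e>. \<e>" and Z = "{}", rotated -1])
   show "nonneg_borel Q E (\<lambda>\<e> y. (cmod (f y))\<^sup>2 * w j \<e> y)"
    by (intro nonneg_borel_times cont nonneg_borel_subset[OF N'(3)]) (auto simp: Q_def)
   show "nonneg_borel Q E (\<lambda>\<e> y. (cmod (f y))\<^sup>2 * w i \<e> y)"
    by (intro nonneg_borel_times cont nonneg_borel_subset[OF N(4)]) (auto simp: Q_def)
   show "\<exists>C\<ge>0. \<forall>y\<in>Q - {}. (cmod (f y))\<^sup>2 * w i \<e> y \<le> C * ((cmod (f y))\<^sup>2 * w j \<e> y)" if "\<e> \<in> E" for \<e>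
   proof (intro exI[of _ C] conjI ballI)
    fix y assume "y \<in> Q - {}"
    then have "w i \<e> y \<le> C * w j \<e> y" using P(4) that by (auto simp: Q_def)
    from mult_left_mono[OF this, of "(cmod (f y))\<^sup>2"]
    show "(cmod (f y))\<^sup>2 * w i \<e> y \<le> C * ((cmod (f y))\<^sup>2 * w j \<e> y)" by (simp add: mult_ac)
   qed fact
  qed simp_all
  then have "loc_int \<z> x E (\<lambda>\<e> y. (cmod (f y))\<^sup>2 * w i \<e> y)"
   by (rule loc_int_change[OF kc zc hol_coordsD(2)[OF z(1) kj(1)] xx(1) z(2) _ _ nb[OF V(1,4)], rotated -1])
    (use V N in auto)
  then show "(\<exists>V. open V \<and> x \<in> V \<and> hol_on X V f) \<and> loc_int \<z> x E (\<lambda>\<e> y. (cmod (f y))\<^sup>2 * w i \<e> y)"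
   using V(1,2,4) by blast
 next
  assume "(\<exists>V. open V \<and> x \<in> V \<and> hol_on X V f) \<and> loc_int \<z> x E (\<lambda>\<e> y. (cmod (f y))\<^sup>2 * w i \<e> y)"
  then obtain V where V: "open V" "x \<in> V" "hol_on X V f"
   and int: "loc_int \<z> x E (\<lambda>\<e> y. (cmod (f y))\<^sup>2 * w i \<e> y)" by blast
  obtain \<k> where k: "\<k> \<in> X" "x \<in> fst \<k>" using manifold_chart[OF X] by blast
  note kc = hol_coordsD(1)[OF manifold_hol_coords[OF X k(1)]]
  have int': "loc_int \<k> x E (\<lambda>\<e> y. (cmod (f y))\<^sup>2 * w i \<e> y)"
   by (rule loc_int_change[OF zc kc hol_coordsD(3)[OF z(1) k(1)] z(2) k(2) _ _ nb[OF V(1,3)] int])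
    (use V N in auto)
  have VN: "open (V \<inter> N)" "x \<in> V \<inter> N" using V N by auto
  obtain V' where V': "open V'" "x \<in> V'" "V' \<subseteq> fst \<k>" "V' \<subseteq> V \<inter> N"
   "\<forall>\<e>\<in>E. in_chart \<k> (\<lambda>y. (cmod (f y))\<^sup>2 * w i \<e> y) absolutely_integrable_on snd \<k> ` V'"
   by (rule loc_int_shrink[OF kc int' VN])
  have "V' \<subseteq> fst \<k> \<inter> dom L i" "V' \<subseteq> V" using V' N by auto
  then show "f \<in> weighted_ideal X L E w x"
   unfolding weighted_ideal_def mem_Collect_eq using V'(1,2,5) k(1) i(1) hol_on_subset[OF V(3)] 
   by (intro exI[of _ V'] bexI[of _ \<k>] bexI[of _ i] conjI)
 qed
qed

lemma weighted_ideal_hol: "f \<in> weighted_ideal X L E w x ==> \<exists>V. open V \<and> x \<in> V \<and> hol_on X V f"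
 unfolding weighted_ideal_def by blast

text \<open>The comparison principle for inclusions that follow from a pointwise bound: between
  adjoint ideals, from adjoint to multiplier ideals, and for products with a section.\<close>

lemma weighted_ideal_transfer:
 assumes X: "complex_manifold X" and w: "good_weight L E w" "good_weight L' E' w'"
  and i: "i \<in> idx L" "x \<in> dom L i" "i' \<in> idx L'" "x \<in> dom L' i'"
  and f: "f \<in> weighted_ideal X L E w x" and g: "hol_on X V g" "open V" "x \<in> V"
  and z: "hol_coords X \<z>" "x \<in> fst \<z>" and Z: "negligible (snd \<z> ` (Z \<inter> fst \<z>))"
  and C: "\<And>\<e>. \<e> \<in> E' ==> \<exists>C\<ge>0. \<exists>e\<in>E. \<forall>y\<in>V - Z. (cmod (g y))\<^sup>2 * w' i' \<e> y \<le> C * ((cmod (f y))\<^sup>2 * w i e y)"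
 shows "g \<in> weighted_ideal X L' E' w' x"
 unfolding weighted_ideal_iff[OF X w(2) z i(3,4)]
proof
 note zc = hol_coordsD(1)[OF z(1)]
 from f[unfolded weighted_ideal_iff[OF X w(1) z i(1,2)]]
 obtain U where U: "open U" "x \<in> U" "hol_on X U f" and int: "loc_int \<z> x E (\<lambda>\<e> y. (cmod (f y))\<^sup>2 * w i \<e> y)"
  by blast
 obtain N where N: "open N" "x \<in> N" "nonneg_borel N E (w i)" using w(1) i unfolding good_weight_def by blast
 obtain N' where N': "open N'" "x \<in> N'" "nonneg_borel N' E' (w' i')" using w(2) i unfolding good_weight_def by blast
 define Q where "Q = U \<inter> V \<inter> N \<inter> N'"
 have Q: "open Q" "x \<in> Q" using U g N N' by (auto simp: Q_def)
 have "\<forall>\<e>\<in>E'. \<exists>e. e \<in> E \<and> (\<exists>C\<ge>0. \<forall>y\<in>V - Z. (cmod (g y))\<^sup>2 * w' i' \<e> y \<le> C * ((cmod (f y))\<^sup>2 * w i e y))"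
  using C by blast
 then obtain e where e: "\<forall>\<e>\<in>E'. e \<e> \<in> E \<and> (\<exists>C\<ge>0. \<forall>y\<in>V - Z. (cmod (g y))\<^sup>2 * w' i' \<e> y \<le> C * ((cmod (f y))\<^sup>2 * w i (e \<e>) y))"
  by (elim bchoice[THEN exE])
 show "loc_int \<z> x E' (\<lambda>\<e> y. (cmod (g y))\<^sup>2 * w' i' \<e> y)"
 proof (rule loc_int_compare[OF zc z(2) Q _ _ _ Z _ int])
  show "nonneg_borel Q E (\<lambda>\<e> y. (cmod (f y))\<^sup>2 * w i \<e> y)"
   by (intro nonneg_borel_times continuous_on_subset[OF hol_on_continuous[OF X U(3,1)]] nonneg_borel_subset[OF N(3)]) (auto simp: Q_def)
  show "nonneg_borel Q E' (\<lambda>\<e> y. (cmod (g y))\<^sup>2 * w' i' \<e> y)"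
   by (intro nonneg_borel_times continuous_on_subset[OF hol_on_continuous[OF X g(1,2)]] nonneg_borel_subset[OF N'(3)]) (auto simp: Q_def)
  fix \<e> assume \<e>: "\<e> \<in> E'"
  show "e \<e> \<in> E" using e \<e> by blast
  obtain C where "C \<ge> 0" "\<forall>y\<in>V - Z. (cmod (g y))\<^sup>2 * w' i' \<e> y \<le> C * ((cmod (f y))\<^sup>2 * w i (e \<e>) y)"
   using e \<e> by blast
  then show "\<exists>C\<ge>0. \<forall>y\<in>Q - Z. (cmod (g y))\<^sup>2 * w' i' \<e> y \<le> C * ((cmod (f y))\<^sup>2 * w i (e \<e>) y)"
   by (intro exI[of _ C]) (auto simp: Q_def)
 qed
qed (use g in blast)

lemma weighted_ideal_cong:
 assumes X: "complex_manifold X" and f: "f \<in> weighted_ideal X L E w x"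
  and W: "open W" "x \<in> W" and eq: "\<forall>y\<in>W. f y = g y"
 shows "g \<in> weighted_ideal X L E w x"
proof -
 obtain V \<k> j where V: "open V" "x \<in> V" "V \<subseteq> fst \<k> \<inter> dom L j" "hol_on X V f"
   and kj: "\<k> \<in> X" "j \<in> idx L"
   and int: "\<forall>\<e>\<in>E. in_chart \<k> (\<lambda>y. (cmod (f y))\<^sup>2 * w j \<e> y) absolutely_integrable_on (snd \<k> ` V)"
  using f unfolding weighted_ideal_def mem_Collect_eq by (elim exE bexE conjE) (rule that; assumption)
 note kc = hol_coordsD(1)[OF manifold_hol_coords[OF X kj(1)]]
 have o: "open (V \<inter> W)" and sub: "V \<inter> W \<subseteq> fst \<k> \<inter> dom L j" "V \<inter> W \<subseteq> fst \<k>" using V W by auto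
 have oi: "open (snd \<k> ` (V \<inter> W))" by (rule open_chart_image[OF kc o sub(2)])
 have "hol_on X (V \<inter> W) g"
  by (rule hol_on_cong[OF X hol_on_subset[OF V(4)] o]) (use eq in auto)
 moreover have "in_chart \<k> (\<lambda>y. (cmod (g y))\<^sup>2 * w j \<e> y) absolutely_integrable_on (snd \<k> ` (V \<inter> W))"
  if e: "\<e> \<in> E" for \<e>
 proof -
  have "in_chart \<k> (\<lambda>y. (cmod (f y))\<^sup>2 * w j \<e> y) absolutely_integrable_on (snd \<k> ` (V \<inter> W))"
   using int e oi by (auto intro: set_integrable_subset)
  also have "?this \<longleftrightarrow> ?thesis"
  proof (rule set_integrable_cong)
   fix v assume "v \<in> snd \<k> ` (V \<inter> W)"
   then obtain y where y: "y \<in> V \<inter> W" "v = snd \<k> y" by (elim imageE)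
   then show "in_chart \<k> (\<lambda>y. (cmod (f y))\<^sup>2 * w j \<e> y) v = in_chart \<k> (\<lambda>y. (cmod (g y))\<^sup>2 * w j \<e> y) v"
    using sub eq by (auto simp: in_chart_apply[OF kc])
  qed simp_all
  finally show ?thesis .
 qed
 ultimately show ?thesis unfolding weighted_ideal_def mem_Collect_eq
  using V W o sub kj by (intro exI[of _ "V \<inter> W"] bexI[of _ \<k>] bexI[of _ j]) auto
qed

lemma weighted_ideal_zero:
 assumes X: "complex_manifold X" and i: "i \<in> idx L" "x \<in> dom L i" "open (dom L i)"
 shows "(\<lambda>y. 0) \<in> weighted_ideal X L E w x"
proof -
 obtain \<k> where k: "\<k> \<in> X" "x \<in> fst \<k>" using manifold_chart[OF X] by blast
 note kc = hol_coordsD(1)[OF manifold_hol_coords[OF X k(1)]]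
 have "open (fst \<k> \<inter> dom L i)" using is_chartD(1)[OF kc] i(3) by blast
 then show ?thesis unfolding weighted_ideal_def mem_Collect_eq using k i
  by (intro exI[of _ "fst \<k> \<inter> dom L i"] bexI[of _ \<k>] bexI[of _ i]) (auto simp: in_chart_def hol_on_const)
qed

lemma weighted_ideal_uminus: "complex_manifold X ==> f \<in> weighted_ideal X L E w x ==> (\<lambda>y. - f y) \<in> weighted_ideal X L E w x"
 unfolding weighted_ideal_def mem_Collect_eq norm_minus_cancel
 by (elim exE bexE conjE) (intro exI bexI conjI hol_on_uminus; assumption)

text \<open>By |f + g|^2 <= 2 (|f|^2 + |g|^2), after both conditions have been moved to one chart
  and one trivialisation.\<close>

lemma weighted_ideal_add:
 assumes X: "complex_manifold X" and w: "good_weight L E w" and i: "i \<in> idx L" "x \<in> dom L i"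
  and f: "f \<in> weighted_ideal X L E w x" and g: "g \<in> weighted_ideal X L E w x"
 shows "(\<lambda>y. f y + g y) \<in> weighted_ideal X L E w x"
proof -
 obtain \<k> where k: "\<k> \<in> X" "x \<in> fst \<k>" using manifold_chart[OF X] by blast
 note kz = manifold_hol_coords[OF X k(1)]
 note kc = hol_coordsD(1)[OF kz] and iff = weighted_ideal_iff[OF X w kz k(2) i]
 obtain U where U: "open U" "x \<in> U" "hol_on X U f" and intf: "loc_int \<k> x E (\<lambda>\<e> y. (cmod (f y))\<^sup>2 * w i \<e> y)"
  using f[unfolded iff] by blast
 obtain V where V: "open V" "x \<in> V" "hol_on X V g" and intg: "loc_int \<k> x E (\<lambda>\<e> y. (cmod (g y))\<^sup>2 * w i \<e> y)"
  using g[unfolded iff] by blast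
 obtain N where N: "open N" "x \<in> N" "nonneg_borel N E (w i)" using w i unfolding good_weight_def by blast
 define Q where "Q = U \<inter> V \<inter> N"
 have Q: "open Q" "x \<in> Q" "Q \<subseteq> U" "Q \<subseteq> V" "Q \<subseteq> N" using U V N by (auto simp: Q_def)
 have hfg: "hol_on X Q (\<lambda>y. f y + g y)"
  by (intro hol_on_add hol_on_subset[OF U(3) Q(3)] hol_on_subset[OF V(3) Q(4)])
 have nb: "nonneg_borel Q E (\<lambda>\<e> y. (cmod (h y))\<^sup>2 * w i \<e> y)" if "hol_on X Q h" for h
  by (intro nonneg_borel_times hol_on_continuous[OF X that Q(1)] nonneg_borel_subset[OF N(3) Q(5)])
 note nf = nb[OF hol_on_subset[OF U(3) Q(3)]] and ng = nb[OF hol_on_subset[OF V(3) Q(4)]]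
 have "nonneg_borel Q E (\<lambda>\<e> y. (cmod (f y))\<^sup>2 * w i \<e> y + (cmod (g y))\<^sup>2 * w i \<e> y)"
  by (rule nonneg_borelI)
   (auto intro!: borel_measurable_add nonneg_borelD(1)[OF nf] nonneg_borelD(1)[OF ng] add_nonneg_nonneg nonneg_borelD(2)[OF nf] nonneg_borelD(2)[OF ng])
 then have "loc_int \<k> x E (\<lambda>\<e> y. (cmod (f y + g y))\<^sup>2 * w i \<e> y)"
 proof (rule loc_int_compare[OF kc k(2) Q(1,2) _ nb[OF hfg] _ _ _ loc_int_add[OF kc intf intg], where Z = "{}" and e = "\<lambda>\<e>. \<e>"])
  fix \<e> assume e: "\<e> \<in> E"
  show "\<exists>C\<ge>0. \<forall>y\<in>Q - {}. (cmod (f y + g y))\<^sup>2 * w i \<e> y \<le>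
    C * ((cmod (f y))\<^sup>2 * w i \<e> y + (cmod (g y))\<^sup>2 * w i \<e> y)"
  proof (intro exI[of _ 2] conjI ballI)
   fix y assume "y \<in> Q - {}"
   then have "w i \<e> y \<ge> 0" using nonneg_borelD(2)[OF N(3) e] Q(5) by auto
   moreover have "(cmod (f y + g y))\<^sup>2 \<le> (cmod (f y) + cmod (g y))\<^sup>2" by (intro power_mono norm_triangle_ineq) simp
   then have "(cmod (f y + g y))\<^sup>2 \<le> 2 * ((cmod (f y))\<^sup>2 + (cmod (g y))\<^sup>2)"
    using sum_squares_bound[of "cmod (f y)" "cmod (g y)"] by (simp add: power2_sum)
   ultimately have "(cmod (f y + g y))\<^sup>2 * w i \<e> y \<le> 2 * ((cmod (f y))\<^sup>2 + (cmod (g y))\<^sup>2) * w i \<e> y"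
    by (rule mult_right_mono[rotated])
   then show "(cmod (f y + g y))\<^sup>2 * w i \<e> y \<le> 2 * ((cmod (f y))\<^sup>2 * w i \<e> y + (cmod (g y))\<^sup>2 * w i \<e> y)"
    by (simp add: algebra_simps)
  qed simp
 qed simp_all
 then show ?thesis unfolding iff using hfg Q(1,2) by blast
qed

section \<open>Potentials\<close>

text \<open>The features of a potential that integrability relies on, chosen to survive tensor
  products: no value +infinity, local measurability, and differences between trivialisations that
  are bounded near each point.\<close>

definition nice_pot :: "('a::topological_space, 'i) line_bundle => ('i => 'a => ereal) => bool" where
 "nice_pot L \<phi> \<longleftrightarrow> (\<forall>i\<in>idx L. \<forall>x\<in>dom L i. \<phi> i x \<noteq> \<infinity>) \<and>
  (\<forall>i\<in>idx L. \<forall>x\<in>dom L i. \<exists>N. open N \<and> x \<in> N \<and> N \<subseteq> dom L i \<and> \<phi> i \<in> borel_measurable (restrict_space borel N)) \<and>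
  (\<forall>i\<in>idx L. \<forall>j\<in>idx L. \<forall>x\<in>dom L i \<inter> dom L j. \<exists>N B. open N \<and> x \<in> N \<and>
   (\<forall>y\<in>N. \<exists>r. \<bar>r\<bar> \<le> B \<and> \<phi> i y = \<phi> j y + ereal r))"

lemma nice_potD:
 assumes "nice_pot L \<phi>" "i \<in> idx L" "x \<in> dom L i"
 shows "\<phi> i x \<noteq> \<infinity>"
  and "\<exists>N. open N \<and> x \<in> N \<and> N \<subseteq> dom L i \<and> \<phi> i \<in> borel_measurable (restrict_space borel N)"
  and "j \<in> idx L ==> x \<in> dom L j ==> \<exists>N B. open N \<and> x \<in> N \<and> (\<forall>y\<in>N. \<exists>r. \<bar>r\<bar> \<le> B \<and> \<phi> i y = \<phi> j y + ereal r)"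
 using assms unfolding nice_pot_def by blast+

lemma trans_nonzero:
 assumes "holomorphic_line_bundle X L" "i \<in> idx L" "j \<in> idx L" "x \<in> dom L i" "x \<in> dom L j"
 shows "trans L i j x \<noteq> 0"
proof -
 have "trans L i j x * trans L j i x = trans L i i x" "trans L i i x = 1"
  using assms unfolding holomorphic_line_bundle_def by blast+
 then show ?thesis by auto
qed

lemma bundleD:
 assumes "holomorphic_line_bundle X L"
 shows "i \<in> idx L ==> open (dom L i)" "\<exists>i\<in>idx L. x \<in> dom L i"
  "i \<in> idx L ==> j \<in> idx L ==> hol_on X (dom L i \<inter> dom L j) (trans L i j)"
 using assms unfolding holomorphic_line_bundle_def by blast+

lemma elog_measurable [measurable]: "elog \<in> borel_measurable borel"
 unfolding elog_def by measurable

text \<open>Measurability comes from the neat analytic form; the differences are logarithms of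
  transition functions, which are continuous without zeros and so have locally bounded
  logarithms.\<close>

lemma potential_nice:
 assumes X: "complex_manifold X" and L: "holomorphic_line_bundle X L" and p: "potential X L \<phi>"
  and n: "neat_analytic_sing X L \<phi>"
 shows "nice_pot L \<phi>"
 unfolding nice_pot_def
proof (intro conjI ballI)
 show "\<phi> i x \<noteq> \<infinity>" if "i \<in> idx L" "x \<in> dom L i" for i x using p that unfolding potential_def by blast
next
 fix i x assume i: "i \<in> idx L" "x \<in> dom L i"
 obtain V c N g \<beta> where V: "open V" "x \<in> V" "V \<subseteq> dom L i" "\<forall>j<N. hol_on X V (g j)"
   "mfd_smooth_on X V (\<beta> :: 'a => real)"
   "\<forall>y\<in>V. \<phi> i y = ereal c * elog (\<Sum>j<(N::nat). (cmod (g j y))\<^sup>2) + ereal (\<beta> y)"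
  using n[unfolded neat_analytic_sing_def, rule_format, OF i] by (elim exE conjE) (rule that; assumption)
 have g: "continuous_on V (g j)" if "j < N" for j using hol_on_continuous[OF X _ V(1)] V(4) that by blast
 have "(\<lambda>y. \<Sum>j<N. (cmod (g j y))\<^sup>2) \<in> borel_measurable (restrict_space borel V)"
  by (rule borel_measurable_continuous_on_restrict) (intro continuous_intros g, simp)
 moreover have "\<beta> \<in> borel_measurable (restrict_space borel V)"
  by (rule borel_measurable_continuous_on_restrict) (rule mfd_smooth_on_continuous[OF X V(5,1)])
 ultimately have "(\<lambda>y. ereal c * elog (\<Sum>j<(N::nat). (cmod (g j y))\<^sup>2) + ereal (\<beta> y)) \<in> borel_measurable (restrict_space borel V)"
  by (intro borel_measurable_ereal_add borel_measurable_ereal_times borel_measurable_const borel_measurable_ereal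
    measurable_compose[OF _ elog_measurable])
 also have "?this \<longleftrightarrow> \<phi> i \<in> borel_measurable (restrict_space borel V)"
  using V(6) by (intro measurable_cong) (simp add: space_restrict_space)
 finally show "\<exists>N. open N \<and> x \<in> N \<and> N \<subseteq> dom L i \<and> \<phi> i \<in> borel_measurable (restrict_space borel N)"
  using V(1-3) by (intro exI[of _ V] conjI)
next
 fix i j x assume i: "i \<in> idx L" and j: "j \<in> idx L" and x: "x \<in> dom L i \<inter> dom L j"
 let ?O = "dom L i \<inter> dom L j"
 have oO: "open ?O" using bundleD(1)[OF L] i j by blast
 have "continuous_on ?O (trans L i j)" by (rule hol_on_continuous[OF X bundleD(3)[OF L i j] oO])
 then have "continuous_on ?O (\<lambda>y. ln ((cmod (trans L i j y))\<^sup>2))"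
  using trans_nonzero[OF L i j] by (intro continuous_intros) auto
 from bounded_nhd[OF this oO x]
 obtain W B where W: "open W" "x \<in> W" "W \<subseteq> ?O" "B > 0" "\<And>y. y \<in> W ==> norm (ln ((cmod (trans L i j y))\<^sup>2)) \<le> B"
  by blast
 have "\<exists>r. \<bar>r\<bar> \<le> B \<and> \<phi> i y = \<phi> j y + ereal r" if y: "y \<in> W" for y
 proof (intro exI[of _ "ln ((cmod (trans L i j y))\<^sup>2)"] conjI)
  show "\<bar>ln ((cmod (trans L i j y))\<^sup>2)\<bar> \<le> B" using W(5)[OF y] by simp
  show "\<phi> i y = \<phi> j y + ereal (ln ((cmod (trans L i j y))\<^sup>2))"
   using p i j W(3) y unfolding potential_def by blast
 qed
 then show "\<exists>N B. open N \<and> x \<in> N \<and> (\<forall>y\<in>N. \<exists>r. \<bar>r\<bar> \<le> B \<and> \<phi> i y = \<phi> j y + ereal r)"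
  using W(1,2) by (intro exI[of _ W] exI[of _ B]) simp
qed

lemma lb_tensor_sel [simp]:
 "idx (lb_tensor L L') = idx L \<times> idx L'" "dom (lb_tensor L L') (i, j) = dom L i \<inter> dom L' j"
 "trans (lb_tensor L L') (i, j) (i', j') x = trans L i i' x * trans L' j j' x"
 by (simp_all add: lb_tensor_def)

lemma nice_pot_tensor:
 assumes "nice_pot L \<phi>" "nice_pot L' \<phi>'"
 shows "nice_pot (lb_tensor L L') (tensor_pot \<phi> \<phi>')"
 unfolding nice_pot_def
proof (intro conjI ballI)
 fix ij x assume ij: "ij \<in> idx (lb_tensor L L')" "x \<in> dom (lb_tensor L L') ij"
 obtain i j where [simp]: "ij = (i, j)" by (cases ij)
 have i: "i \<in> idx L" "x \<in> dom L i" "j \<in> idx L'" "x \<in> dom L' j" using ij by auto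
 show "tensor_pot \<phi> \<phi>' ij x \<noteq> \<infinity>"
  using nice_potD(1)[OF assms(1) i(1,2)] nice_potD(1)[OF assms(2) i(3,4)] by (simp add: tensor_pot_def)
 obtain N where N: "open N" "x \<in> N" "N \<subseteq> dom L i" "\<phi> i \<in> borel_measurable (restrict_space borel N)"
  using nice_potD(2)[OF assms(1) i(1,2)] by blast
 obtain N' where N': "open N'" "x \<in> N'" "N' \<subseteq> dom L' j" "\<phi>' j \<in> borel_measurable (restrict_space borel N')"
  using nice_potD(2)[OF assms(2) i(3,4)] by blast
 have "(\<lambda>y. \<phi> i y + \<phi>' j y) \<in> borel_measurable (restrict_space borel (N \<inter> N'))"
  by (intro borel_measurable_ereal_add restrict_borel_subset[OF N(4)] restrict_borel_subset[OF N'(4)]) auto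
 then show "\<exists>N. open N \<and> x \<in> N \<and> N \<subseteq> dom (lb_tensor L L') ij \<and> tensor_pot \<phi> \<phi>' ij \<in> borel_measurable (restrict_space borel N)"
  using N(1-3) N'(1-3) by (intro exI[of _ "N \<inter> N'"]) (auto simp: tensor_pot_def)
next
 fix ij kl x assume ij: "ij \<in> idx (lb_tensor L L')" and kl: "kl \<in> idx (lb_tensor L L')"
  and x: "x \<in> dom (lb_tensor L L') ij \<inter> dom (lb_tensor L L') kl"
 obtain i j where [simp]: "ij = (i, j)" by (cases ij)
 obtain k l where [simp]: "kl = (k, l)" by (cases kl)
 have i: "i \<in> idx L" "x \<in> dom L i" "j \<in> idx L'" "x \<in> dom L' j" "k \<in> idx L" "x \<in> dom L k" "l \<in> idx L'" "x \<in> dom L' l"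
  using ij kl x by auto
 obtain N B where N: "open N" "x \<in> N" "\<forall>y\<in>N. \<exists>r. \<bar>r\<bar> \<le> B \<and> \<phi> i y = \<phi> k y + ereal r"
  using nice_potD(3)[OF assms(1) i(1,2,5,6)] by blast
 obtain N' B' where N': "open N'" "x \<in> N'" "\<forall>y\<in>N'. \<exists>r. \<bar>r\<bar> \<le> B' \<and> \<phi>' j y = \<phi>' l y + ereal r"
  using nice_potD(3)[OF assms(2) i(3,4,7,8)] by blast
 have "\<exists>r. \<bar>r\<bar> \<le> B + B' \<and> tensor_pot \<phi> \<phi>' ij y = tensor_pot \<phi> \<phi>' kl y + ereal r" if y: "y \<in> N \<inter> N'" for y
 proof -
  obtain r r' where r: "\<bar>r\<bar> \<le> B" "\<phi> i y = \<phi> k y + ereal r" "\<bar>r'\<bar> \<le> B'" "\<phi>' j y = \<phi>' l y + ereal r'"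
   using N(3) N'(3) y by blast
  have "\<phi> k y + ereal r + (\<phi>' l y + ereal r') = \<phi> k y + \<phi>' l y + ereal (r + r')"
   by (cases "\<phi> k y"; cases "\<phi>' l y") auto
  then show ?thesis using r(1,3) by (intro exI[of _ "r + r'"]) (simp add: tensor_pot_def r(2,4))
 qed
 then show "\<exists>N B. open N \<and> x \<in> N \<and> (\<forall>y\<in>N. \<exists>r. \<bar>r\<bar> \<le> B \<and> tensor_pot \<phi> \<phi>' ij y = tensor_pot \<phi> \<phi>' kl y + ereal r)"
  using N(1,2) N'(1,2) by (intro exI[of _ "N \<inter> N'"] exI[of _ "B + B'"]) auto
qed

definition nice_psi :: "('a::topological_space => ereal) => bool" where
 "nice_psi \<psi> \<longleftrightarrow> (\<forall>x. \<psi> x \<le> - 1) \<and> (\<forall>x. \<exists>N. open N \<and> x \<in> N \<and> \<psi> \<in> borel_measurable (restrict_space borel N))"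

definition psi_weight :: "('a => ereal) => nat => real => 'a => real" where
 "psi_weight \<psi> \<sigma> \<e> y = exp (- real_of_ereal (\<psi> y)) / (\<bar>real_of_ereal (\<psi> y)\<bar> ^ \<sigma> * ln \<bar>exp 1 * real_of_ereal (\<psi> y)\<bar> powr (1 + \<e>))"

lemma psi_weight_nonneg: "psi_weight \<psi> \<sigma> \<e> y \<ge> 0"
 unfolding psi_weight_def by (intro divide_nonneg_nonneg mult_nonneg_nonneg zero_le_power abs_ge_zero powr_ge_zero exp_ge_zero)

text \<open>At a pole \<open>real_of_ereal\<close> gives 0, and the conventions for logarithm, power
  and division then give weight 0, so upper bounds on the weight are trivial there.\<close>

lemma psi_weight_at_pole: "\<psi> y = - \<infinity> ==> psi_weight \<psi> \<sigma> \<e> y = 0"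
 by (simp add: psi_weight_def)

lemma psi_weight_eq:
 assumes "\<psi> y = ereal (- t)" "t \<ge> 1"
 shows "psi_weight \<psi> \<sigma> \<e> y = exp t * th \<sigma> \<e> t"
 using assms by (simp add: psi_weight_def th_def abs_mult ln_mult)

lemma psi_cases:
 assumes "nice_psi \<psi>"
 obtains "\<psi> y = - \<infinity>" | t where "\<psi> y = ereal (- t)" "t \<ge> 1"
proof (cases "\<psi> y")
 case (real r)
 have "\<psi> y \<le> - 1" using assms by (simp add: nice_psi_def)
 then have "- r \<ge> 1" unfolding real by (simp add: one_ereal_def)
 then show ?thesis using real that(2)[of "- r"] by simp
next
 case PInf
 have "\<psi> y \<le> - 1" using assms by (simp add: nice_psi_def)
 then show ?thesis using PInf by (simp add: one_ereal_def)
qed (rule that(1))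

lemma adjoint_ideal_eq:
 "adjoint_ideal X \<psi> L \<phi> \<sigma> = weighted_ideal X L {0<..} (\<lambda>i \<e> y. exp (- real_of_ereal (\<phi> i y)) * psi_weight \<psi> \<sigma> \<e> y)"
 unfolding adjoint_ideal_def weighted_ideal_def psi_weight_def exp_add[symmetric] times_divide_eq_right Ball_def greaterThan_iff
 by (simp only: mult.assoc[symmetric] diff_conv_add_uminus exp_add)

lemma multiplier_ideal_eq:
 "multiplier_ideal X L \<phi> = weighted_ideal X L {1} (\<lambda>i \<e> y. exp (- real_of_ereal (\<phi> i y)))"
 unfolding multiplier_ideal_def weighted_ideal_def by simp

text \<open>Between trivialisations the potential changes by at most \<open>B\<close>, hence its
  exponential by a factor at most \<open>exp B\<close>; \<open>q\<close> is common to all of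
  them.\<close>

lemma good_weight_pot:
 assumes p: "nice_pot L \<phi>" and q: "\<And>\<e> y. q \<e> y \<ge> 0"
  and qm: "\<And>x. \<exists>N. open N \<and> x \<in> N \<and> (\<forall>\<e>\<in>E. q \<e> \<in> borel_measurable (restrict_space borel N))"
 shows "good_weight L E (\<lambda>i \<e> y. exp (- real_of_ereal (\<phi> i y)) * q \<e> y)"
 unfolding good_weight_def
proof (intro conjI ballI)
 fix i x assume i: "i \<in> idx L" "x \<in> dom L i"
 obtain N where N: "open N" "x \<in> N" "N \<subseteq> dom L i" "\<phi> i \<in> borel_measurable (restrict_space borel N)"
  using nice_potD(2)[OF p i] by blast
 obtain N' where N': "open N'" "x \<in> N'" "\<forall>\<e>\<in>E. q \<e> \<in> borel_measurable (restrict_space borel N')"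
  using qm by blast
 have "nonneg_borel (N \<inter> N') E (\<lambda>\<e> y. exp (- real_of_ereal (\<phi> i y)) * q \<e> y)"
 proof (rule nonneg_borelI)
  fix \<e> assume e: "\<e> \<in> E"
  have "\<phi> i \<in> borel_measurable (restrict_space borel (N \<inter> N'))"
   by (rule restrict_borel_subset[OF N(4)]) auto
  then have "(\<lambda>y. exp (- real_of_ereal (\<phi> i y))) \<in> borel_measurable (restrict_space borel (N \<inter> N'))"
   by (intro measurable_compose[OF _ borel_measurable_exp] borel_measurable_uminus borel_measurable_real_of_ereal)
  moreover have "q \<e> \<in> borel_measurable (restrict_space borel (N \<inter> N'))"
   by (rule restrict_borel_subset[OF N'(3)[rule_format, OF e]]) simp
  ultimately show "(\<lambda>y. exp (- real_of_ereal (\<phi> i y)) * q \<e> y) \<in> borel_measurable (restrict_space borel (N \<inter> N'))"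
   by (rule borel_measurable_times)
 qed (use q in simp)
 then show "\<exists>N. open N \<and> x \<in> N \<and> N \<subseteq> dom L i \<and> nonneg_borel N E (\<lambda>\<e> y. exp (- real_of_ereal (\<phi> i y)) * q \<e> y)"
  using N(1-3) N'(1,2) by (intro exI[of _ "N \<inter> N'"]) auto
next
 fix i j x assume i: "i \<in> idx L" and j: "j \<in> idx L" and x: "x \<in> dom L i \<inter> dom L j"
 obtain N B where N: "open N" "x \<in> N" "\<forall>y\<in>N. \<exists>r. \<bar>r\<bar> \<le> B \<and> \<phi> i y = \<phi> j y + ereal r"
  using nice_potD(3)[OF p i _ j] x by blast
 have "exp (- real_of_ereal (\<phi> i y)) * q \<e> y \<le> exp B * (exp (- real_of_ereal (\<phi> j y)) * q \<e> y)" if y: "y \<in> N" for \<e> y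
 proof -
  obtain r where r: "\<bar>r\<bar> \<le> B" "\<phi> i y = \<phi> j y + ereal r" using N(3) y by blast
  have "- real_of_ereal (\<phi> i y) \<le> B + (- real_of_ereal (\<phi> j y))"
   using r by (cases "\<phi> j y") auto
  then have "exp (- real_of_ereal (\<phi> i y)) \<le> exp B * exp (- real_of_ereal (\<phi> j y))"
   unfolding exp_add[symmetric] by simp
  from mult_right_mono[OF this q] show ?thesis by (simp add: mult.assoc)
 qed
 then show "\<exists>N C. open N \<and> x \<in> N \<and> C \<ge> 0 \<and> (\<forall>\<e>\<in>E. \<forall>y\<in>N.
   exp (- real_of_ereal (\<phi> i y)) * q \<e> y \<le> C * (exp (- real_of_ereal (\<phi> j y)) * q \<e> y))"
  using N(1,2) by (intro exI[of _ N] exI[of _ "exp B"]) simp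
qed

lemma good_weight_multiplier:
 "nice_pot L \<phi> ==> good_weight L {1} (\<lambda>i \<e> y. exp (- real_of_ereal (\<phi> i y)))"
 using good_weight_pot[of L \<phi> "\<lambda>\<e> y. 1" "{1}"] by (auto intro: exI[of _ UNIV])

lemma good_weight_adjoint:
 assumes "nice_pot L \<phi>" "nice_psi \<psi>"
 shows "good_weight L {0<..} (\<lambda>i \<e> y. exp (- real_of_ereal (\<phi> i y)) * psi_weight \<psi> \<sigma> \<e> y)"
proof (rule good_weight_pot[OF assms(1) psi_weight_nonneg])
 fix x
 obtain N where N: "open N" "x \<in> N" "\<psi> \<in> borel_measurable (restrict_space borel N)"
  using assms(2) unfolding nice_psi_def by blast
 have "psi_weight \<psi> \<sigma> \<e> \<in> borel_measurable (restrict_space borel N)" for \<e>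
 proof -
  have "(\<lambda>y. real_of_ereal (\<psi> y)) \<in> borel_measurable (restrict_space borel N)"
   by (rule borel_measurable_real_of_ereal[OF N(3)])
  moreover have "(\<lambda>t :: real. exp (- t) / (\<bar>t\<bar> ^ \<sigma> * ln \<bar>exp 1 * t\<bar> powr (1 + \<e>))) \<in> borel_measurable borel"
   by measurable
  ultimately show ?thesis unfolding psi_weight_def by (rule measurable_compose)
 qed
 then show "\<exists>N. open N \<and> x \<in> N \<and> (\<forall>\<e>\<in>{0<..}. psi_weight \<psi> \<sigma> \<e> \<in> borel_measurable (restrict_space borel N))"
  using N(1,2) by blast
qed

text \<open>|psi| >= 1 off the poles, so the denominator grows with the index.\<close>

lemma adjoint_ideal_mono:
 assumes X: "complex_manifold X" and p: "nice_pot L \<phi>" "nice_psi \<psi>" and i: "i \<in> idx L" "x \<in> dom L i"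
  and le: "\<sigma> \<le> \<sigma>'"
 shows "adjoint_ideal X \<psi> L \<phi> \<sigma> x \<subseteq> adjoint_ideal X \<psi> L \<phi> \<sigma>' x"
proof
 fix f assume f: "f \<in> adjoint_ideal X \<psi> L \<phi> \<sigma> x"
 obtain \<k> where k: "\<k> \<in> X" "x \<in> fst \<k>" using manifold_chart[OF X] by blast
 note f' = f[unfolded adjoint_ideal_eq]
 obtain V where V: "open V" "x \<in> V" "hol_on X V f" using weighted_ideal_hol[OF f'] by blast
 have le: "psi_weight \<psi> \<sigma>' \<e> y \<le> psi_weight \<psi> \<sigma> \<e> y" for \<e> y
 proof (rule psi_cases[OF p(2), of y])
  fix t assume t: "\<psi> y = ereal (- t)" "t \<ge> 1"
  have "1 + ln t > 0" using ln_ge_zero[OF t(2)] by linarith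
  then have pos: "(1 + ln t) powr (1 + \<e>) > 0" by simp
  have "th \<sigma>' \<e> t \<le> th \<sigma> \<e> t" unfolding th_def
   by (rule divide_left_mono) (use pos t le in \<open>auto intro!: mult_right_mono power_increasing mult_pos_pos\<close>)
  then show ?thesis by (simp add: psi_weight_eq[of \<psi> y t, OF t])
 qed (simp add: psi_weight_at_pole)
 show "f \<in> adjoint_ideal X \<psi> L \<phi> \<sigma>' x" unfolding adjoint_ideal_eq
  by (rule weighted_ideal_transfer[OF X good_weight_adjoint[OF p, of \<sigma>] good_weight_adjoint[OF p, of \<sigma>'] i i f' V(3,1,2)
     manifold_hol_coords[OF X k(1)] k(2), of "{}"])
   (auto intro!: exI[of _ 1] bexI mult_left_mono le)
qed

section \<open>Potentials along the divisor and products with sections\<close>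

lemma negligible_coordinate_hyperplane: "negligible {w :: complex^'n::finite. w $ k = 0}"
proof -
 have "negligible {w :: complex^'n. axis k 1 \<bullet> w = 0}" by (rule negligible_hyperplane) (simp add: axis_eq_0_iff)
 moreover have "{w :: complex^'n. w $ k = 0} \<subseteq> {w. axis k 1 \<bullet> w = 0}" by (auto simp: inner_axis')
 ultimately show ?thesis by (rule negligible_subset)
qed

lemma hol_sectionsD:
 assumes "t \<in> hol_sections X L U"
 shows "i \<in> idx L ==> hol_on X (U \<inter> dom L i) (t i)"
  and "i \<in> idx L ==> j \<in> idx L ==> x \<in> U ==> x \<in> dom L i ==> x \<in> dom L j ==> t i x = trans L i j x * t j x"
  and "\<not> (i \<in> idx L \<and> x \<in> U \<inter> dom L i) ==> t i x = 0"
 using assms unfolding hol_sections_def by blast+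

lemma potentialD:
 assumes "potential X L \<phi>" "i \<in> idx L" "x \<in> dom L i"
 shows "\<phi> i x \<noteq> \<infinity>" "j \<in> idx L ==> x \<in> dom L j ==> \<phi> i x = \<phi> j x + ereal (ln ((cmod (trans L i j x))\<^sup>2))"
 using assms unfolding potential_def by blast+

lemma smooth_potentialD:
 assumes "smooth_potential X L \<phi>"
 shows "potential X L \<phi>" "i \<in> idx L ==> x \<in> dom L i ==> \<bar>\<phi> i x\<bar> \<noteq> \<infinity>"
  "i \<in> idx L ==> mfd_smooth_on X (dom L i) (\<lambda>x. real_of_ereal (\<phi> i x))"
 using assms by (simp_all add: smooth_potential_def)

text \<open>Both terms change by log |g|^2 under a transition function g, so the choice in
  \<open>psi_D\<close> is immaterial. Where the section vanishes both expressions are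
  -infinity.\<close>

lemma psi_D_eq:
 assumes L: "holomorphic_line_bundle X LD" and s: "sD \<in> hol_sections X LD UNIV" and p: "smooth_potential X LD \<phi>"
  and d: "d \<in> idx LD" "y \<in> dom LD d"
 shows "psi_D LD sD \<phi> y = elog ((cmod (sD d y))\<^sup>2) - \<phi> d y"
proof -
 define e where "e = (SOME d. d \<in> idx LD \<and> y \<in> dom LD d)"
 have e: "e \<in> idx LD" "y \<in> dom LD e" using someI[of "\<lambda>d. d \<in> idx LD \<and> y \<in> dom LD d" d] d by (auto simp: e_def)
 have pot: "potential X LD \<phi>" using p by (simp add: smooth_potential_def)
 let ?g = "trans LD d e y"
 have g: "?g \<noteq> 0" by (rule trans_nonzero[OF L d(1) e(1) d(2) e(2)])
 have sd: "sD d y = ?g * sD e y" using hol_sectionsD(2)[OF s d(1) e(1) UNIV_I d(2) e(2)] .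
 have pd: "\<phi> d y = \<phi> e y + ereal (ln ((cmod ?g)\<^sup>2))" by (rule potentialD(2)[OF pot d e])
 have fin: "\<bar>\<phi> e y\<bar> \<noteq> \<infinity>" by (rule smooth_potentialD(2)[OF p e])
 have "psi_D LD sD \<phi> y = elog ((cmod (sD e y))\<^sup>2) - \<phi> e y" by (simp add: psi_D_def e_def[symmetric])
 also have "\<dots> = elog ((cmod (sD d y))\<^sup>2) - \<phi> d y"
 proof (cases "sD e y = 0")
  case True
  then show ?thesis using fin unfolding sd pd by (cases "\<phi> e y") (auto simp: elog_def)
 next
  case False
  then have "ln ((cmod (sD d y))\<^sup>2) = ln ((cmod ?g)\<^sup>2) + ln ((cmod (sD e y))\<^sup>2)"
   using g unfolding sd by (simp add: norm_mult power_mult_distrib ln_mult)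
  moreover have "sD d y \<noteq> 0" using False g sd by simp
  ultimately show ?thesis using fin False unfolding pd by (cases "\<phi> e y") (auto simp: elog_def)
 qed
 finally show ?thesis .
qed

lemma nice_psi_D:
 assumes X: "complex_manifold X" and L: "holomorphic_line_bundle X LD" and s: "sD \<in> hol_sections X LD UNIV"
  and p: "smooth_potential X LD \<phi>" and le: "\<forall>x. psi_D LD sD \<phi> x \<le> - 1"
 shows "nice_psi (psi_D LD sD \<phi>)"
 unfolding nice_psi_def
proof (intro conjI allI)
 fix x
 show "psi_D LD sD \<phi> x \<le> - 1" using le by blast
 obtain d where d: "d \<in> idx LD" "x \<in> dom LD d" using bundleD(2)[OF L] by blast
 note o = bundleD(1)[OF L d(1)]
 note fin = smooth_potentialD(2)[OF p d(1)] and sm = smooth_potentialD(3)[OF p d(1)]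
 have "continuous_on (dom LD d) (sD d)" using hol_on_continuous[OF X hol_sectionsD(1)[OF s d(1)]] o by simp
 then have "(\<lambda>y. (cmod (sD d y))\<^sup>2) \<in> borel_measurable (restrict_space borel (dom LD d))"
  by (intro borel_measurable_continuous_on_restrict continuous_intros)
 moreover have "(\<lambda>y. real_of_ereal (\<phi> d y)) \<in> borel_measurable (restrict_space borel (dom LD d))"
  by (rule borel_measurable_continuous_on_restrict) (rule mfd_smooth_on_continuous[OF X sm o])
 ultimately have "(\<lambda>y. elog ((cmod (sD d y))\<^sup>2) - ereal (real_of_ereal (\<phi> d y))) \<in> borel_measurable (restrict_space borel (dom LD d))"
  by (intro borel_measurable_ereal_diff borel_measurable_ereal measurable_compose[OF _ elog_measurable])
 also have "?this \<longleftrightarrow> psi_D LD sD \<phi> \<in> borel_measurable (restrict_space borel (dom LD d))"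
  using fin by (intro measurable_cong) (simp add: space_restrict_space psi_D_eq[OF L s p d(1)] ereal_real)
 finally show "\<exists>N. open N \<and> x \<in> N \<and> psi_D LD sD \<phi> \<in> borel_measurable (restrict_space borel N)"
  using d o by blast
qed

text \<open>The product of the coordinates vanishes on D, and the germs of \<open>sD\<close>
  generate the ideal of D. Writing the product as a multiple of \<open>sD\<close> bounds |sD| from
  below, and thereby -psi from above.\<close>

lemma canonical_section_divides:
 assumes s: "canonical_section X D LD sD" and d: "d \<in> idx LD" "x \<in> dom LD d"
  and z: "hol_coords X (V, z)" "x \<in> V" "\<Union>D \<inter> V = {y\<in>V. (\<Prod>k\<in>S. z y $ k) = 0}"
 shows "\<exists>W h. open W \<and> x \<in> W \<and> W \<subseteq> V \<inter> dom LD d \<and> hol_on X W h \<and> (\<forall>y\<in>W. (\<Prod>k\<in>S. z y $ k) = h y * sD d y)"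
proof -
 have V: "open V" using is_chartD(1)[OF hol_coordsD(1)[OF z(1)]] by simp
 have "hol_on X V (\<lambda>y. \<Prod>k\<in>S. z y $ k)"
  using hol_on_coordinate[OF z(1)] by (intro hol_on_prod) auto
 moreover have "\<exists>W. open W \<and> x \<in> W \<and> W \<subseteq> V \<and> (\<forall>y\<in>W \<inter> \<Union>D. (\<Prod>k\<in>S. z y $ k) = 0)"
  using V z(2,3) by (intro exI[of _ V]) blast
 ultimately show ?thesis
  using s d V z(2) unfolding canonical_section_def by blast
qed

lemma negligible_coordinate_product:
 fixes \<z> :: "('a, 'n::finite) chart"
 assumes "\<And>y. y \<in> Z \<inter> fst \<z> ==> (\<Prod>k\<in>S. snd \<z> y $ k) = 0"
 shows "negligible (snd \<z> ` (Z \<inter> fst \<z>))"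
proof -
 have "negligible (\<Union>k\<in>S. {w :: complex^'n. w $ k = 0})"
  by (intro negligible_Union) (auto intro: negligible_coordinate_hyperplane)
 moreover have "snd \<z> ` (Z \<inter> fst \<z>) \<subseteq> (\<Union>k\<in>S. {w. w $ k = 0})" 
 proof (intro subsetI)
  fix w assume "w \<in> snd \<z> ` (Z \<inter> fst \<z>)"
  then obtain y where y: "y \<in> Z \<inter> fst \<z>" "w = snd \<z> y" by (elim imageE)
  have "\<exists>k\<in>S. snd \<z> y $ k = 0" using assms[OF y(1)] by (simp add: prod_zero_iff)
  then show "w \<in> (\<Union>k\<in>S. {w. w $ k = 0})" by (simp add: y(2))
 qed
 ultimately show ?thesis by (rule negligible_subset)
qed

lemma power_le_fact_exp:
 assumes "(t :: real) \<ge> 0"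
 shows "t ^ N \<le> fact N * exp t"
proof -
 have "(\<Sum>n\<in>{N}. inverse (fact n) *\<^sub>R t ^ n) \<le> (\<Sum>n. inverse (fact n) *\<^sub>R t ^ n)"
  using assms by (intro sum_le_suminf summable_exp_generic) auto
 then have "t ^ N / fact N \<le> exp t" by (simp add: exp_def divide_inverse mult.commute)
 then show ?thesis by (simp only: pos_divide_le_eq[OF fact_gt_zero] mult.commute)
qed

text \<open>For \<epsilon> = 1 the denominator is at most t^(sigma+2), because 1 + log t <= t; a
  single term of the exponential series dominates this power, whence the factorial.\<close>

lemma exp_th_lower:
 assumes "t \<ge> 1"
 shows "1 \<le> fact (\<sigma> + 2) * (exp t * th \<sigma> 1 t)"
proof -
 have l: "1 + ln t > 0" "1 + ln t \<le> t" using ln_ge_zero[OF assms] ln_le_minus_one[of t] assms by linarith+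
 have "(1 + ln t) powr (1 + 1) = (1 + ln t)\<^sup>2" using l(1) powr_realpow[of "1 + ln t" 2] by simp
 also have "\<dots> \<le> t\<^sup>2" using l by (intro power_mono) auto
 finally have "t ^ \<sigma> * (1 + ln t) powr (1 + 1) \<le> t ^ \<sigma> * t\<^sup>2" using assms by (intro mult_left_mono) auto
 also have "\<dots> = t ^ (\<sigma> + 2)" by (simp only: power_add)
 also have "\<dots> \<le> fact (\<sigma> + 2) * exp t" using assms by (intro power_le_fact_exp) simp
 finally have "t ^ \<sigma> * (1 + ln t) powr (1 + 1) \<le> fact (\<sigma> + 2) * exp t" .
 moreover have "t ^ \<sigma> * (1 + ln t) powr (1 + 1) > 0" using l assms by (intro mult_pos_pos) auto
 ultimately show ?thesis unfolding th_def by (simp only: times_divide_eq_right mult_1_right pos_le_divide_eq mult_1)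
qed

text \<open>The additional weight for \<epsilon> = 1 is bounded below off the poles of psi, and
  these are negligible.\<close>

lemma adjoint_subset_multiplier:
 assumes X: "complex_manifold X" and p: "nice_pot L \<phi>" "nice_psi \<psi>" and i: "i \<in> idx L" "x \<in> dom L i"
  and z: "hol_coords X \<z>" "x \<in> fst \<z>"
  and W: "open W" "x \<in> W" "negligible (snd \<z> ` ({y\<in>W. \<psi> y = - \<infinity>} \<inter> fst \<z>))"
 shows "adjoint_ideal X \<psi> L \<phi> \<sigma> x \<subseteq> multiplier_ideal X L \<phi> x"
proof
 fix f assume f: "f \<in> adjoint_ideal X \<psi> L \<phi> \<sigma> x"
 note f' = f[unfolded adjoint_ideal_eq]
 obtain V where V: "open V" "x \<in> V" "hol_on X V f" using weighted_ideal_hol[OF f'] by blast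
 have VW: "open (V \<inter> W)" "x \<in> V \<inter> W" "hol_on X (V \<inter> W) f" using V W by (auto intro: hol_on_subset)
 show "f \<in> multiplier_ideal X L \<phi> x" unfolding multiplier_ideal_eq
 proof (rule weighted_ideal_transfer[OF X good_weight_adjoint[OF p, of \<sigma>] good_weight_multiplier[OF p(1)] i i f' VW(3,1,2) z W(3)])
  fix \<e> :: real
  have "(cmod (f y))\<^sup>2 * exp (- real_of_ereal (\<phi> i y))
    \<le> fact (\<sigma> + 2) * ((cmod (f y))\<^sup>2 * (exp (- real_of_ereal (\<phi> i y)) * psi_weight \<psi> \<sigma> 1 y))"
   if y: "y \<in> V \<inter> W - {y \<in> W. \<psi> y = - \<infinity>}" for y
  proof (rule psi_cases[OF p(2), of y])
   fix t assume t: "\<psi> y = ereal (- t)" "t \<ge> 1"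
   have "(cmod (f y))\<^sup>2 * exp (- real_of_ereal (\<phi> i y)) * 1 \<le>
     (cmod (f y))\<^sup>2 * exp (- real_of_ereal (\<phi> i y)) * (fact (\<sigma> + 2) * (exp t * th \<sigma> 1 t))"
    by (rule mult_left_mono[OF exp_th_lower[OF t(2)]]) simp
   then show ?thesis by (simp only: psi_weight_eq[of \<psi> y t, OF t] mult_ac mult_1)
  qed (use y in auto)
  then show "\<exists>C\<ge>0. \<exists>e\<in>{0<..}. \<forall>y\<in>V \<inter> W - {y \<in> W. \<psi> y = - \<infinity>}.
    (cmod (f y))\<^sup>2 * exp (- real_of_ereal (\<phi> i y)) \<le> C * ((cmod (f y))\<^sup>2 * (exp (- real_of_ereal (\<phi> i y)) * psi_weight \<psi> \<sigma> e y))"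
   by (intro exI[of _ "fact (\<sigma> + 2)"] bexI[of _ 1] conjI) auto
 qed
qed

text \<open>At a pole of the potential exp (-phi) is infinite, so a finite supremum forces
  \<open>s\<close> to vanish there.\<close>

lemma sup_norm_bound:
 assumes "sup_norm_sq L \<phi> s < \<infinity>"
 obtains C where "C \<ge> 0" "\<And>j y. j \<in> idx L ==> y \<in> dom L j ==> \<phi> j y = - \<infinity> ==> s j y = 0"
  "\<And>j y r. j \<in> idx L ==> y \<in> dom L j ==> \<phi> j y = ereal r ==> (cmod (s j y))\<^sup>2 * exp (- r) \<le> C"
proof -
 let ?C = "enn2real (sup_norm_sq L \<phi> s)"
 have C: "sup_norm_sq L \<phi> s = ennreal ?C" using assms by simp
 have le: "ennreal ((cmod (s j y))\<^sup>2) * eexp_uminus (\<phi> j y) \<le> ennreal ?C" if "j \<in> idx L" "y \<in> dom L j" for j y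
 proof -
  have "ennreal ((cmod (s j y))\<^sup>2) * eexp_uminus (\<phi> j y) \<le> sup_norm_sq L \<phi> s"
   unfolding sup_norm_sq_def by (rule SUP_upper2[OF that(1)], rule SUP_upper2[OF that(2)]) (rule order_refl)
  then show ?thesis using C by simp
 qed
 show ?thesis
 proof (rule that[of ?C])
  fix j y assume j: "j \<in> idx L" "y \<in> dom L j"
  show "s j y = 0" if "\<phi> j y = - \<infinity>"
  proof (rule ccontr)
   assume "s j y \<noteq> 0"
   then have "ennreal ((cmod (s j y))\<^sup>2) * eexp_uminus (\<phi> j y) = \<infinity>"
    using that by (simp add: eexp_uminus_def ennreal_mult_eq_top_iff)
   then show False using le[OF j] by (simp only: infinity_ennreal_def top_unique ennreal_neq_top)
  qed
  show "(cmod (s j y))\<^sup>2 * exp (- r) \<le> ?C" if "\<phi> j y = ereal r" for r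
   using le[OF j] that by (simp add: eexp_uminus_def ennreal_mult[symmetric])
 qed simp
qed

text \<open>Where both potentials are finite, this is boundedness of |s|^2 exp (-phi_M); the rest
  deals with the default values at poles.\<close>

lemma tensor_weight_bound:
 assumes X: "complex_manifold X" and p: "nice_pot L \<phi>" "nice_pot L' \<phi>'" and L': "open (dom L' j)"
  and i: "i \<in> idx L" "x \<in> dom L i" and j: "j \<in> idx L'" "x \<in> dom L' j"
  and s: "hol_on X (dom L' j) (s j)" "sup_norm_sq L' \<phi>' s < \<infinity>"
 obtains W K where "open W" "x \<in> W" "W \<subseteq> dom L' j" "K \<ge> 0"
  "\<forall>y\<in>W. (cmod (s j y))\<^sup>2 * exp (- real_of_ereal (tensor_pot \<phi> \<phi>' (i, j) y)) \<le> K * exp (- real_of_ereal (\<phi> i y))"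
proof -
 obtain C where C: "C \<ge> 0" "\<And>j y. j \<in> idx L' ==> y \<in> dom L' j ==> \<phi>' j y = - \<infinity> ==> s j y = 0"
  "\<And>j y r. j \<in> idx L' ==> y \<in> dom L' j ==> \<phi>' j y = ereal r ==> (cmod (s j y))\<^sup>2 * exp (- r) \<le> C"
  by (rule sup_norm_bound[OF s(2)]) blast
 obtain N where N: "open N" "x \<in> N" "N \<subseteq> dom L i" using nice_potD(2)[OF p(1) i] by blast
 obtain W B where W: "open W" "x \<in> W" "W \<subseteq> dom L' j" "B > 0" "\<And>y. y \<in> W ==> norm (s j y) \<le> B"
  by (rule bounded_nhd[OF hol_on_continuous[OF X s(1) L'] L' j(2)]) blast
 have "(cmod (s j y))\<^sup>2 * exp (- real_of_ereal (tensor_pot \<phi> \<phi>' (i, j) y)) \<le> (C + B\<^sup>2) * exp (- real_of_ereal (\<phi> i y))"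
  if y: "y \<in> W \<inter> N" for y
 proof -
  have yj: "y \<in> dom L' j" and yi: "y \<in> dom L i" using y W N by auto
  have b: "(cmod (s j y))\<^sup>2 \<le> B\<^sup>2" using W(5)[of y] y by (intro power_mono) auto
  have nn: "\<phi> i y \<noteq> \<infinity>" "\<phi>' j y \<noteq> \<infinity>" using nice_potD(1)[OF p(1) i(1) yi] nice_potD(1)[OF p(2) j(1) yj] by auto
  consider "\<phi>' j y = - \<infinity>" | r where "\<phi>' j y = ereal r" "\<phi> i y = - \<infinity>"
   | r r' where "\<phi>' j y = ereal r" "\<phi> i y = ereal r'"
   using nn by (cases "\<phi> i y"; cases "\<phi>' j y") auto
  then show ?thesis
  proof cases
   case 1
   then show ?thesis using C(2)[OF j(1) yj] C(1) by simp
  next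
   \<comment> \<open>Here \<open>real_of_ereal\<close> gives 0 both for the potential of
     \<open>L\<close> and for the sum, so both exponentials are 1 and the plain bound
     \<open>B\<close> on \<open>s\<close> is called for. Hence the constant
     \<open>C + B\<^sup>2\<close>.\<close>
   case 2
   then show ?thesis using b C(1) by (simp add: tensor_pot_def)
  next
   case 3
   have "(cmod (s j y))\<^sup>2 * exp (- r) * exp (- r') \<le> (C + B\<^sup>2) * exp (- r')"
    using C(3)[OF j(1) yj 3(1)] by (intro mult_right_mono) (auto intro: add_increasing2)
   then show ?thesis using 3 by (simp add: tensor_pot_def mult.assoc exp_add[symmetric] add.commute)
  qed
 qed
 then show ?thesis using W N C(1) by (intro that[of "W \<inter> N" "C + B\<^sup>2"]) auto
qed

lemma weighted_ideal_times_section: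
 assumes X: "complex_manifold X" and p: "nice_pot L \<phi>" "nice_pot L' \<phi>'" and L': "open (dom L' j)"
  and i: "i \<in> idx L" "x \<in> dom L i" and j: "j \<in> idx L'" "x \<in> dom L' j"
  and s: "hol_on X (dom L' j) (s j)" "sup_norm_sq L' \<phi>' s < \<infinity>"
  and q: "\<And>\<e> y. q \<e> y \<ge> 0"
  and w: "good_weight L E (\<lambda>i \<e> y. exp (- real_of_ereal (\<phi> i y)) * q \<e> y)"
   "good_weight (lb_tensor L L') E (\<lambda>i \<e> y. exp (- real_of_ereal (tensor_pot \<phi> \<phi>' i y)) * q \<e> y)"
  and f: "f \<in> weighted_ideal X L E (\<lambda>i \<e> y. exp (- real_of_ereal (\<phi> i y)) * q \<e> y) x"
 shows "(\<lambda>y. f y * s j y) \<in> weighted_ideal X (lb_tensor L L') E (\<lambda>i \<e> y. exp (- real_of_ereal (tensor_pot \<phi> \<phi>' i y)) * q \<e> y) x"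
proof -
 obtain \<k> where k: "\<k> \<in> X" "x \<in> fst \<k>" using manifold_chart[OF X] by blast
 obtain V where V: "open V" "x \<in> V" "hol_on X V f" using weighted_ideal_hol[OF f] by blast
 obtain W K where W: "open W" "x \<in> W" "W \<subseteq> dom L' j" "K \<ge> 0"
  "\<forall>y\<in>W. (cmod (s j y))\<^sup>2 * exp (- real_of_ereal (tensor_pot \<phi> \<phi>' (i, j) y)) \<le> K * exp (- real_of_ereal (\<phi> i y))"
  by (rule tensor_weight_bound[OF X p L' i j s])
 have VW: "open (V \<inter> W)" "x \<in> V \<inter> W" using V W by auto
 have h: "hol_on X (V \<inter> W) (\<lambda>y. f y * s j y)"
  by (intro hol_on_mult hol_on_subset[OF V(3)] hol_on_subset[OF s(1)]) (use W in auto)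
 have ij: "(i, j) \<in> idx (lb_tensor L L')" "x \<in> dom (lb_tensor L L') (i, j)" using i j by auto
 show ?thesis
 proof (rule weighted_ideal_transfer[OF X w i ij f h VW manifold_hol_coords[OF X k(1)] k(2), of "{}"])
  fix \<e> assume e: "\<e> \<in> E"
  have "(cmod (f y * s j y))\<^sup>2 * (exp (- real_of_ereal (tensor_pot \<phi> \<phi>' (i, j) y)) * q \<e> y)
    \<le> K * ((cmod (f y))\<^sup>2 * (exp (- real_of_ereal (\<phi> i y)) * q \<e> y))" if y: "y \<in> V \<inter> W" for y
  proof -
   have "(cmod (f y))\<^sup>2 * q \<e> y * ((cmod (s j y))\<^sup>2 * exp (- real_of_ereal (tensor_pot \<phi> \<phi>' (i, j) y)))
     \<le> (cmod (f y))\<^sup>2 * q \<e> y * (K * exp (- real_of_ereal (\<phi> i y)))"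
    using W(5) y q by (intro mult_left_mono) auto
   then show ?thesis by (simp add: norm_mult power_mult_distrib mult_ac)
  qed
  then show "\<exists>C\<ge>0. \<exists>e\<in>E. \<forall>y\<in>V \<inter> W - {}. (cmod (f y * s j y))\<^sup>2 * (exp (- real_of_ereal (tensor_pot \<phi> \<phi>' (i, j) y)) * q \<e> y)
    \<le> C * ((cmod (f y))\<^sup>2 * (exp (- real_of_ereal (\<phi> i y)) * q e y))"
   using W(4) e by (intro exI[of _ K] bexI[of _ \<e>] conjI) auto
 qed simp
qed

text \<open>With a continuous potential the integrand is bounded on a neighbourhood of finite
  volume.\<close>

lemma multiplier_ideal_continuous:
 assumes X: "complex_manifold X" and L: "\<And>i. i \<in> idx L ==> open (dom L i)" "\<And>x. \<exists>i\<in>idx L. x \<in> dom L i"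
  and p: "nice_pot L \<phi>" and cont: "\<And>i. i \<in> idx L ==> continuous_on (dom L i) (\<lambda>x. real_of_ereal (\<phi> i x))"
 shows "multiplier_ideal X L \<phi> = structure_sheaf X"
proof (intro ext subset_antisym subsetI)
 fix x f assume "f \<in> multiplier_ideal X L \<phi> x"
 then show "f \<in> structure_sheaf X x" unfolding multiplier_ideal_eq structure_sheaf_def mem_Collect_eq by (rule weighted_ideal_hol)
next
 fix x f assume "f \<in> structure_sheaf X x"
 then obtain V where V: "open V" "x \<in> V" "hol_on X V f"
  unfolding structure_sheaf_def mem_Collect_eq by (elim exE conjE) (rule that)
 obtain i where i: "i \<in> idx L" "x \<in> dom L i" using L(2) by blast
 obtain \<k> where k: "\<k> \<in> X" "x \<in> fst \<k>" using manifold_chart[OF X] by blast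
 note kz = manifold_hol_coords[OF X k(1)]
 note kc = hol_coordsD(1)[OF kz] and o = L(1)[OF i(1)]
 define Q where "Q = V \<inter> dom L i \<inter> fst \<k>"
 have Q: "open Q" "x \<in> Q" "Q \<subseteq> V" "Q \<subseteq> dom L i" "Q \<subseteq> fst \<k>"
  using V i k o is_chartD(1)[OF kc] by (auto simp: Q_def)
 let ?G = "\<lambda>y. (cmod (f y))\<^sup>2 * exp (- real_of_ereal (\<phi> i y))"
 have cG: "continuous_on Q ?G"
  by (intro continuous_intros continuous_on_subset[OF hol_on_continuous[OF X V(3,1)] Q(3)]
    continuous_on_subset[OF cont[OF i(1)] Q(4)])
 obtain W B where W: "open W" "x \<in> W" "W \<subseteq> Q" "B > 0" "\<And>y. y \<in> W ==> norm (?G y) \<le> B"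
  by (rule bounded_nhd[OF cG Q(1,2)]) blast
 define U where "U = fst \<k> \<inter> snd \<k> -` ball (snd \<k> x) 1"
 have U: "open U" "x \<in> U" "U \<subseteq> fst \<k>" using open_chart_preimage[OF kc, of "ball (snd \<k> x) 1"] k by (auto simp: U_def)
 have "snd \<k> ` U \<subseteq> ball (snd \<k> x) 1" by (auto simp: U_def)
 then have "snd \<k> ` U \<in> lmeasurable"
  using open_chart_image[OF kc U(1,3)] bounded_subset[OF bounded_ball] by (intro lmeasurable_open) auto
 then have "(\<lambda>w. 1 :: real) absolutely_integrable_on snd \<k> ` U"
  by (simp add: absolutely_integrable_on_const)
 then have one: "loc_int \<k> x {1} (\<lambda>\<e> y. 1)"
  unfolding loc_int_def using U by (intro exI[of _ U]) (simp add: in_chart_def)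
 have "loc_int \<k> x {1} (\<lambda>\<e>. ?G)"
 proof (rule loc_int_compare[OF kc k(2) W(1,2) _ _ _ _ _ one, where e = "\<lambda>\<e>. \<e>" and Z = "{}"])
  show "nonneg_borel W {1} (\<lambda>\<e> y. 1)" by (rule nonneg_borelI) auto
  show "nonneg_borel W {1} (\<lambda>\<e>. ?G)"
   by (rule nonneg_borelI) (auto intro!: borel_measurable_continuous_on_restrict continuous_on_subset[OF cG W(3)])
  show "\<exists>C\<ge>0. \<forall>y\<in>W - {}. ?G y \<le> C * 1" for \<e> :: real
   using W(4,5) by (intro exI[of _ B]) auto
 qed simp_all
 then show "f \<in> multiplier_ideal X L \<phi> x"
  unfolding multiplier_ideal_eq weighted_ideal_iff[OF X good_weight_multiplier[OF p] kz k(2) i] using V by blast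
qed

section \<open>The multiplier ideal is the last adjoint ideal\<close>

text \<open>exp t times \<open>th m \<e> t\<close> need not increase with t, but does so up to a
  constant: for u = L / t the denominators differ by a factor at most u^N, and u <= 1 + (L - t)
  gives u^N <= N! exp 1 exp (L - t). \<open>N\<close> rounds up the total exponent
  \<open>m + 1 + \<e>\<close>.\<close>

lemma exp_th_growth:
 assumes e: "\<e> > 0"
 obtains C where "C \<ge> 0" "\<And>t L. 1 \<le> t ==> t \<le> L ==> exp t * th m \<e> t \<le> C * (exp L * th m \<e> L)"
proof -
 define N where "N = m + nat \<lceil>1 + \<e>\<rceil>"
 show ?thesis
 proof (rule that[of "fact N * exp 1"])
  fix t L :: real assume t: "1 \<le> t" "t \<le> L"
  define u where "u = L / t"
  have u: "u \<ge> 1" "L = u * t" using t by (auto simp: u_def)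
  have lt: "ln t \<ge> 0" using t by (intro ln_ge_zero)
  have "ln L = ln u + ln t" unfolding u(2) using u t by (intro ln_mult_pos) auto
  also have "ln u \<le> u - 1" using u by (intro ln_le_minus_one) auto
  finally have "1 + ln L \<le> u + ln t" by simp
  also have "ln t \<le> u * ln t" using u lt by (simp add: mult_le_cancel_right1)
  finally have lL: "1 + ln L \<le> u * (1 + ln t)" by (simp add: algebra_simps)
  have L1: "1 \<le> L" using t by simp
  have pos: "1 + ln L > 0" "1 + ln t > 0" using ln_ge_zero[OF L1] lt by linarith+
  have "(1 + ln L) powr (1 + \<e>) \<le> (u * (1 + ln t)) powr (1 + \<e>)" using lL pos e by (intro powr_mono2) auto
  also have "\<dots> = u powr (1 + \<e>) * (1 + ln t) powr (1 + \<e>)" using u pos by (intro powr_mult) 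
  also have "u powr (1 + \<e>) \<le> u powr (real (nat \<lceil>1 + \<e>\<rceil>))" using u by (intro powr_mono) linarith+
  also have "\<dots> = u ^ nat \<lceil>1 + \<e>\<rceil>" using u by (intro powr_realpow) auto
  finally have "(1 + ln L) powr (1 + \<e>) \<le> u ^ nat \<lceil>1 + \<e>\<rceil> * (1 + ln t) powr (1 + \<e>)"
   by (simp add: mult_right_mono)
  then have "L ^ m * (1 + ln L) powr (1 + \<e>) \<le> (u ^ m * t ^ m) * (u ^ nat \<lceil>1 + \<e>\<rceil> * (1 + ln t) powr (1 + \<e>))"
   unfolding u(2) power_mult_distrib using u t by (intro mult_left_mono) auto
  also have "\<dots> = u ^ N * (t ^ m * (1 + ln t) powr (1 + \<e>))" by (simp only: N_def power_add mult_ac)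
  finally have a: "L ^ m * (1 + ln L) powr (1 + \<e>) \<le> u ^ N * (t ^ m * (1 + ln t) powr (1 + \<e>))" .
  \<comment> \<open>As t >= 1, u - 1 is at most u t - t = L - t.\<close>
  have "u - 1 \<le> (u - 1) * t" using u(1) t(1) by (simp add: mult_le_cancel_left1)
  then have "u \<le> 1 + (L - t)" unfolding u(2) by (simp add: algebra_simps)
  then have "u ^ N \<le> (1 + (L - t)) ^ N" using u by (intro power_mono) auto
  also have "\<dots> \<le> fact N * exp (1 + (L - t))" using t by (intro power_le_fact_exp) auto
  finally have uN: "u ^ N \<le> fact N * exp 1 * exp (L - t)" by (simp only: exp_add mult.assoc)
  let ?d = "t ^ m * (1 + ln t) powr (1 + \<e>)" and ?D = "L ^ m * (1 + ln L) powr (1 + \<e>)"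
  have d: "?d > 0" "?D > 0" using t L1 pos by (auto intro!: mult_pos_pos)
  have "?D \<le> fact N * exp 1 * exp (L - t) * ?d" using a mult_right_mono[OF uN, of ?d] d by linarith
  then have "exp t * ?D \<le> exp t * (fact N * exp 1 * exp (L - t) * ?d)" by (rule mult_left_mono) simp
  also have "\<dots> = fact N * exp 1 * (exp t * exp (L - t)) * ?d" by (simp only: mult_ac)
  also have "exp t * exp (L - t) = exp L" by (simp add: exp_add[symmetric])
  finally have "exp t * ?D \<le> (fact N * exp 1 * exp L) * ?d" .
  then have "exp t / ?d \<le> fact N * exp 1 * exp L / ?D"
   by (simp only: frac_le_eq[OF less_imp_neq[OF d(1), symmetric] less_imp_neq[OF d(2), symmetric]])
    (intro divide_nonpos_nonneg, use d in \<open>auto simp: mult.commute intro: less_imp_le mult_pos_pos\<close>)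
  then show "exp t * th m \<e> t \<le> fact N * exp 1 * (exp L * th m \<e> L)" by (simp add: th_def mult.assoc)
 qed simp
qed

text \<open>If L denotes the upper bound for t, then exp L is exp T times the product of the
  |w_k|^-2; so the growth estimate \<open>C\<close> turns the weight in t into the kernel. Powers of
  t beyond \<open>card A\<close> only make the weight smaller.\<close>

lemma psi_weight_le_kern_weight:
 assumes psi: "\<psi> y = ereal (- t)" "t \<ge> 1" and m: "card A \<le> \<sigma>"
  and C: "\<And>t L. 1 \<le> t ==> t \<le> L ==> exp t * th (card A) \<e> t \<le> C * (exp L * th (card A) \<e> L)"
  and w: "\<And>k. k \<in> A ==> w k \<noteq> 0" "\<And>k. k \<in> A ==> cmod (w k) < 1" and A: "finite A"
  and t: "t \<le> T - (\<Sum>k\<in>A. ln ((cmod (w k))\<^sup>2))"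
 shows "psi_weight \<psi> \<sigma> \<e> y \<le> C * exp T * kern_weight A \<e> T w"
proof -
 let ?L = "T - (\<Sum>k\<in>A. ln ((cmod (w k))\<^sup>2))"
 have "1 + ln t > 0" using ln_ge_zero[OF psi(2)] by linarith
 then have pos: "(1 + ln t) powr (1 + \<e>) > 0" by simp
 have "th \<sigma> \<e> t \<le> th (card A) \<e> t" unfolding th_def
  by (rule divide_left_mono) (use pos psi(2) m in \<open>auto intro!: mult_right_mono power_increasing mult_pos_pos\<close>)
 then have "exp t * th \<sigma> \<e> t \<le> exp t * th (card A) \<e> t" by (intro mult_left_mono) auto
 also have "\<dots> \<le> C * (exp ?L * th (card A) \<e> ?L)" by (rule C[OF psi(2) t])
 also have "exp ?L = exp T * (\<Prod>k\<in>A. kern (w k))"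
 proof -
  have "exp (- (\<Sum>k\<in>A. ln ((cmod (w k))\<^sup>2))) = (\<Prod>k\<in>A. exp (- ln ((cmod (w k))\<^sup>2)))"
   by (simp add: exp_sum[OF A] sum_negf[symmetric])
  also have "\<dots> = (\<Prod>k\<in>A. kern (w k))"
   by (intro prod.cong) (use w in \<open>auto simp: kern_def exp_minus inverse_eq_divide\<close>)
  finally show ?thesis by (simp add: exp_diff exp_minus divide_inverse)
 qed
 finally show ?thesis using psi_weight_eq[of \<psi> y t \<sigma> \<e>, OF psi] by (simp add: kern_weight_def mult.assoc)
qed

text \<open>The product of the coordinates factors in two ways: as the part over \<open>A\<close>,
  which vanishes at \<open>x\<close>, times \<open>g\<close> with g(x) nonzero, and as
  \<open>h * sD\<close>. Taking logarithms, log |sD|^2 is near \<open>x\<close> at least the sum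
  over \<open>A\<close> minus a constant.\<close>

lemma divisor_local_bounds:
 assumes X: "complex_manifold X" and LD: "holomorphic_line_bundle X LD" "canonical_section X D LD sD"
  and p: "smooth_potential X LD \<phi>Dsm" 
  and z: "hol_coords X (V, z)" "x \<in> V" "\<Union>D \<inter> V = {y\<in>V. (\<Prod>k\<in>S. z y $ k) = 0}"
 defines "A \<equiv> {k\<in>S. z x $ k = 0}"
 obtains W T where "open W" "x \<in> W" "W \<subseteq> V" "T \<ge> 1"
  "\<forall>y\<in>W. psi_D LD sD \<phi>Dsm y = - \<infinity> \<longleftrightarrow> (\<Prod>k\<in>S. z y $ k) = 0"
  "\<forall>y\<in>W. (\<Prod>k\<in>S. z y $ k) \<noteq> 0 \<longrightarrow> - psi_D LD sD \<phi>Dsm y \<le> ereal (T - (\<Sum>k\<in>A. ln ((cmod (z y $ k))\<^sup>2)))"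
proof -
 obtain d where d: "d \<in> idx LD" "x \<in> dom LD d" using bundleD(2)[OF LD(1)] by blast
 have s: "sD \<in> hol_sections X LD UNIV" using LD(2) by (simp add: canonical_section_def)
 obtain W h where W: "open W" "x \<in> W" "W \<subseteq> V \<inter> dom LD d" "hol_on X W h"
  "\<forall>y\<in>W. (\<Prod>k\<in>S. z y $ k) = h y * sD d y"
  using canonical_section_divides[OF LD(2) d z] by blast
 note psi = psi_D_eq[OF LD(1) s p d(1)]
 have oV: "open V" using is_chartD(1)[OF hol_coordsD(1)[OF z(1)]] by simp
 have "continuous_on V (\<lambda>y. z y $ k)" for k
  using hol_on_continuous[OF X hol_on_coordinate[OF z(1), of k]] oV by simp
 then have cz: "continuous_on W (\<lambda>y. z y $ k)" for k
  by (rule continuous_on_subset) (use W(3) in auto)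
 \<comment> \<open>The ideal condition on a canonical section, applied to \<open>sD\<close> as a
   multiple of itself, shows that \<open>sD\<close> vanishes on D.\<close>
 have "\<exists>W h. open W \<and> x \<in> W \<and> W \<subseteq> dom LD d \<inter> dom LD d \<and> hol_on X W h \<and> (\<forall>y\<in>W. sD d y = h y * sD d y)"
  using d bundleD(1)[OF LD(1) d(1)] by (intro exI[of _ "dom LD d"] exI[of _ "\<lambda>_. 1"]) (simp add: hol_on_const)
 then obtain W0 where W0: "open W0" "x \<in> W0" "\<forall>y\<in>W0 \<inter> \<Union>D. sD d y = 0"
  using LD(2) d bundleD(1)[OF LD(1) d(1)] hol_sectionsD(1)[OF s d(1)] unfolding canonical_section_def by (metis Int_UNIV_left)
 define g where "g y = (\<Prod>k\<in>S - A. z y $ k)" for y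
 have cg: "continuous_on W g" unfolding g_def by (intro continuous_intros cz)
 have gx: "g x \<noteq> 0" by (auto simp: g_def A_def prod_zero_iff)
 have oU: "open (W \<inter> g -` (- {0}))" using continuous_on_open_vimage[OF W(1)] cg by (metis Int_commute open_Compl closed_singleton)
 let ?U = "W \<inter> g -` (- {0})"
 have c1: "continuous_on ?U (\<lambda>y. (h y, ln ((cmod (g y))\<^sup>2), real_of_ereal (\<phi>Dsm d y)))"
 proof (intro continuous_intros)
  show "continuous_on ?U h" by (rule continuous_on_subset[OF hol_on_continuous[OF X W(4,1)]]) auto
  show "continuous_on ?U g" by (rule continuous_on_subset[OF cg]) auto
  show "continuous_on ?U (\<lambda>y. real_of_ereal (\<phi>Dsm d y))"
   by (rule continuous_on_subset[OF mfd_smooth_on_continuous[OF X smooth_potentialD(3)[OF p d(1)] bundleD(1)[OF LD(1) d(1)]]]) (use W in auto)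
 qed auto
 obtain W' B where W': "open W'" "x \<in> W'" "W' \<subseteq> ?U" "B > 0"
  "\<And>y. y \<in> W' ==> norm (h y, ln ((cmod (g y))\<^sup>2), real_of_ereal (\<phi>Dsm d y)) \<le> B"
  by (rule bounded_nhd[OF c1 oU]) (use W(2) gx in auto)
 have WW: "open (W' \<inter> W0)" "x \<in> W' \<inter> W0" using W' W0 by auto
 have B: "cmod (h y) \<le> B" "\<bar>ln ((cmod (g y))\<^sup>2)\<bar> \<le> B" "\<bar>real_of_ereal (\<phi>Dsm d y)\<bar> \<le> B" if "y \<in> W'" for y
  using W'(5)[OF that] norm_fst_le[of "h y" "(ln ((cmod (g y))\<^sup>2), real_of_ereal (\<phi>Dsm d y))"]
   norm_snd_le[of "(ln ((cmod (g y))\<^sup>2), real_of_ereal (\<phi>Dsm d y))" "h y"]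
   norm_fst_le[of "ln ((cmod (g y))\<^sup>2)" "real_of_ereal (\<phi>Dsm d y)"]
   norm_snd_le[of "real_of_ereal (\<phi>Dsm d y)" "ln ((cmod (g y))\<^sup>2)"] by auto
 \<comment> \<open>\<open>2 * B\<close> bounds the contributions of log |g|^2 and of the smooth
   potential, \<open>ln (B\<^sup>2)\<close> that of \<open>h\<close>; \<open>1 \<le> T\<close> is
   demanded by the kernel estimate.\<close>
 define T where "T = max 1 (2 * B + ln (B\<^sup>2))"
 show ?thesis
 proof (rule that[of "W' \<inter> W0" T])
  show "open (W' \<inter> W0)" "x \<in> W' \<inter> W0" "W' \<inter> W0 \<subseteq> V" "T \<ge> 1" using WW W' W(3) by (auto simp: T_def)
  show "\<forall>y\<in>W' \<inter> W0. psi_D LD sD \<phi>Dsm y = - \<infinity> \<longleftrightarrow> (\<Prod>k\<in>S. z y $ k) = 0"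
  proof (intro ballI iffI)
   fix y assume y: "y \<in> W' \<inter> W0" "(\<Prod>k\<in>S. z y $ k) = 0"
   have yd: "y \<in> dom LD d" "y \<in> V" using y W' W(3) by auto
   have "y \<in> \<Union>D" using y(2) yd(2) z(3) by blast
   then have "sD d y = 0" using W0(3) y(1) by blast
   then show "psi_D LD sD \<phi>Dsm y = - \<infinity>"
    using smooth_potentialD(2)[OF p d(1) yd(1)] unfolding psi[OF yd(1)] by (cases "\<phi>Dsm d y") (auto simp: elog_def)
  next
   fix y assume y: "y \<in> W' \<inter> W0" "psi_D LD sD \<phi>Dsm y = - \<infinity>"
   have yd: "y \<in> dom LD d" "y \<in> W" using y W' W(3) by auto
   have "sD d y = 0"
   proof (rule ccontr)
    assume "sD d y \<noteq> 0"
    then show False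
     using y(2) smooth_potentialD(2)[OF p d(1) yd(1)] unfolding psi[OF yd(1)] by (cases "\<phi>Dsm d y") (auto simp: elog_def)
   qed
   then show "(\<Prod>k\<in>S. z y $ k) = 0" using W(5) yd by simp
  qed
  show "\<forall>y\<in>W' \<inter> W0. (\<Prod>k\<in>S. z y $ k) \<noteq> 0 \<longrightarrow> - psi_D LD sD \<phi>Dsm y \<le> ereal (T - (\<Sum>k\<in>A. ln ((cmod (z y $ k))\<^sup>2)))"
  proof (intro ballI impI)
   fix y assume "y \<in> W' \<inter> W0" "(\<Prod>k\<in>S. z y $ k) \<noteq> 0"
   then have y: "y \<in> W'" "(\<Prod>k\<in>S. z y $ k) \<noteq> 0" by auto
   have yd: "y \<in> dom LD d" "y \<in> W" using y W' W(3) by auto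
   have f: "(\<Prod>k\<in>S. z y $ k) = h y * sD d y" using W(5) yd by simp
   have nz: "h y \<noteq> 0" "sD d y \<noteq> 0" using y(2) unfolding f by auto
   have split: "(\<Prod>k\<in>S. z y $ k) = (\<Prod>k\<in>A. z y $ k) * g y"
    unfolding g_def by (subst prod.subset_diff[of A S]) (auto simp: A_def mult.commute)
   have nA: "z y $ k \<noteq> 0" if "k \<in> A" for k using y(2) that by (auto simp: A_def prod_zero_iff)
   have ng: "g y \<noteq> 0" using y(2) unfolding split by auto
   have "ln ((cmod (\<Prod>k\<in>S. z y $ k))\<^sup>2) = (\<Sum>k\<in>A. ln ((cmod (z y $ k))\<^sup>2)) + ln ((cmod (g y))\<^sup>2)"
   proof -
    have "ln ((cmod (\<Prod>k\<in>S. z y $ k))\<^sup>2) = ln ((\<Prod>k\<in>A. (cmod (z y $ k))\<^sup>2) * (cmod (g y))\<^sup>2)"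
     unfolding split by (simp add: norm_mult prod_norm[symmetric] power_mult_distrib prod_power_distrib)
    also have "\<dots> = ln (\<Prod>k\<in>A. (cmod (z y $ k))\<^sup>2) + ln ((cmod (g y))\<^sup>2)"
     by (rule ln_mult_pos) (use nA ng in \<open>auto intro!: prod_pos\<close>)
    also have "ln (\<Prod>k\<in>A. (cmod (z y $ k))\<^sup>2) = (\<Sum>k\<in>A. ln ((cmod (z y $ k))\<^sup>2))"
     by (rule ln_prod) (use nA in auto)
    finally show ?thesis .
   qed
   moreover have "ln ((cmod (\<Prod>k\<in>S. z y $ k))\<^sup>2) = ln ((cmod (h y))\<^sup>2) + ln ((cmod (sD d y))\<^sup>2)"
    unfolding f norm_mult power_mult_distrib by (rule ln_mult_pos) (use nz in auto)
   moreover have "ln ((cmod (h y))\<^sup>2) \<le> ln (B\<^sup>2)"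
    using B(1)[OF y(1)] nz(1) W'(4) by (subst ln_le_cancel_iff) (auto intro: power_mono)
   ultimately have le: "real_of_ereal (\<phi>Dsm d y) - ln ((cmod (sD d y))\<^sup>2) \<le> T - (\<Sum>k\<in>A. ln ((cmod (z y $ k))\<^sup>2))"
    using B(2,3)[OF y(1)] unfolding T_def by linarith
   have "- psi_D LD sD \<phi>Dsm y = ereal (real_of_ereal (\<phi>Dsm d y) - ln ((cmod (sD d y))\<^sup>2))"
    using nz(2) smooth_potentialD(2)[OF p d(1) yd(1)] unfolding psi[OF yd(1)] by (cases "\<phi>Dsm d y") (auto simp: elog_def)
   then show "- psi_D LD sD \<phi>Dsm y \<le> ereal (T - (\<Sum>k\<in>A. ln ((cmod (z y $ k))\<^sup>2)))" using le by simp
  qed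
 qed
qed

text \<open>A pointwise comparison fails, since the adjoint weight is unbounded near D. In snc
  coordinates exp (-phi) is, up to bounded factors, a function of the coordinates outside
  \<open>S\<close>, so \<open>weighted_estimate\<close> applies with \<open>A\<close> the
  coordinates in \<open>S\<close> that vanish at \<open>x\<close>, of which there are at most
  \<sigma>.\<close>

lemma multiplier_subset_adjoint:
 assumes X: "complex_manifold X" and LD: "holomorphic_line_bundle X LD" "canonical_section X D LD sD"
  and sm: "smooth_potential X LD \<phi>Dsm" and psi: "nice_psi \<psi>" "\<psi> = psi_D LD sD \<phi>Dsm"
  and p: "nice_pot L \<phi>"
  and z: "hol_coords X (V, z)" "x \<in> V" "\<Union>D \<inter> V = {y\<in>V. (\<Prod>k\<in>S. z y $ k) = 0}"
  and snc: "pot_snc_on X L \<phi> (V, z) S" and m: "card {k\<in>S. z x $ k = 0} \<le> \<sigma>"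
 shows "multiplier_ideal X L \<phi> x \<subseteq> adjoint_ideal X \<psi> L \<phi> \<sigma> x"
proof
 fix f assume f: "f \<in> multiplier_ideal X L \<phi> x"
 let ?A = "{k\<in>S. z x $ k = 0}" and ?z = "(V, z)"
 note zc = hol_coordsD(1)[OF z(1)]
 have oV: "open V" using is_chartD(1)[OF zc] by simp
 have xz: "x \<in> fst ?z" using z(2) by simp
 obtain i b \<beta> where i: "i \<in> idx L" "V \<subseteq> dom L i" and b: "\<forall>k. b k \<ge> 0"
  and \<beta>: "mfd_smooth_on X V (\<beta> :: 'a => real)"
  and \<phi>: "\<forall>y\<in>V. \<phi> i y = (\<Sum>k\<in>- S. ereal (b k) * elog ((cmod (z y $ k))\<^sup>2)) + ereal (\<beta> y)"
  using snc unfolding pot_snc_on_def by auto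
 have xi: "x \<in> dom L i" using i z(2) by blast
 let ?G = "\<lambda>y. (cmod (f y))\<^sup>2 * exp (- real_of_ereal (\<phi> i y))"
 let ?H = "\<lambda>\<e> y. (cmod (f y))\<^sup>2 * (exp (- real_of_ereal (\<phi> i y)) * psi_weight \<psi> \<sigma> \<e> y)"
 from f[unfolded multiplier_ideal_eq weighted_ideal_iff[OF X good_weight_multiplier[OF p] z(1) xz i(1) xi]]
 obtain U where U: "open U" "x \<in> U" "hol_on X U f" and int: "loc_int ?z x {1} (\<lambda>\<e>. ?G)" by blast
 obtain W T where W: "open W" "x \<in> W" "W \<subseteq> V" "T \<ge> 1"
  "\<forall>y\<in>W. \<psi> y = - \<infinity> \<longleftrightarrow> (\<Prod>k\<in>S. z y $ k) = 0"
  "\<forall>y\<in>W. (\<Prod>k\<in>S. z y $ k) \<noteq> 0 \<longrightarrow> - \<psi> y \<le> ereal (T - (\<Sum>k\<in>?A. ln ((cmod (z y $ k))\<^sup>2)))"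
  unfolding psi(2) by (rule divisor_local_bounds[OF X LD sm z])
 obtain W2 B where W2: "open W2" "x \<in> W2" "W2 \<subseteq> V" "B > 0" "\<And>y. y \<in> W2 ==> norm (\<beta> y) \<le> B"
  by (rule bounded_nhd[OF mfd_smooth_on_continuous[OF X \<beta> oV] oV z(2)]) blast
 obtain N where N: "open N" "x \<in> N" "nonneg_borel N {1} (\<lambda>\<e> y. exp (- real_of_ereal (\<phi> i y)))"
  using good_weight_multiplier[OF p] i(1) xi unfolding good_weight_def by blast
 obtain N' where N': "open N'" "x \<in> N'" "nonneg_borel N' {0<..} (\<lambda>\<e> y. exp (- real_of_ereal (\<phi> i y)) * psi_weight \<psi> \<sigma> \<e> y)"
  using good_weight_adjoint[OF p psi(1), of \<sigma>, unfolded good_weight_def, THEN conjunct1, rule_format, OF i(1) xi] by blast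
 define Q where "Q = U \<inter> W \<inter> W2 \<inter> N \<inter> N'"
 have Q: "open Q" "x \<in> Q" "Q \<subseteq> U" "Q \<subseteq> W" "Q \<subseteq> W2" "Q \<subseteq> N" "Q \<subseteq> N'" using U W W2 N N' by (auto simp: Q_def)
 have cf: "continuous_on Q f" by (rule continuous_on_subset[OF hol_on_continuous[OF X U(3,1)] Q(3)])
 note nG = nonneg_borel_times[OF cf nonneg_borel_subset[OF N(3) Q(6)]]
 note nH = nonneg_borel_times[OF cf nonneg_borel_subset[OF N'(3) Q(7)]]
 obtain P where P: "open P" "x \<in> P" "P \<subseteq> fst ?z \<inter> Q"
  "\<forall>\<e>\<in>{1::real}. (\<integral>\<^sup>+w. ennreal (in_chart ?z ?G w) * indicator (snd ?z ` P) w \<partial>lborel) < \<infinity>"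
  using int[unfolded loc_int_nn[OF zc Q(1,2) nG]] by (elim exE conjE) (rule that; assumption)
 have PV: "P \<subseteq> V" "P \<subseteq> Q" using P(3) by auto
 have oP: "open (z ` P)" using open_chart_image[OF zc P(1)] PV by simp
 obtain r0 where r0: "r0 > 0" "polydisc (z x) r0 \<subseteq> z ` P" using open_contains_polydisc[OF oP] P(2) by blast
 \<comment> \<open>\<open>r0 / 2\<close> leaves room for the doubled polydisc;
   \<open>r \<le> 1\<close> puts the coordinates in \<open>?A\<close>, which are zero at
   \<open>x\<close>, into the disc where \<open>kern\<close> is not cut off.\<close>
 define r where "r = min (r0 / 2) 1"
 have r: "r > 0" "r \<le> 1" "polydisc (z x) (2 * r) \<subseteq> z ` P"
 proof -
  have "2 * r \<le> r0" by (simp add: r_def)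
  then show "polydisc (z x) (2 * r) \<subseteq> z ` P" using r0(2) polydisc_mono[of "2 * r" r0 "z x"] by blast
 qed (use r0 in \<open>auto simp: r_def\<close>)
 let ?h = "in_chart ?z f"
 have zf: "in_chart ?z g (z y) = g y" if "y \<in> V" for g :: "'a => real" and y using in_chart_apply[OF zc, of y g] that by simp
 have zh: "?h (z y) = f y" if "y \<in> V" for y using in_chart_apply[OF zc, of y f] that by simp
 have h: "holo_on (polydisc (z x) (2 * r)) ?h"
 proof (rule holo_on_subset[OF hol_on_coords[OF X z(1) U(3,1)]])
  have "P \<subseteq> U \<inter> V" using PV Q(3) by blast
  then show "polydisc (z x) (2 * r) \<subseteq> snd ?z ` (U \<inter> fst ?z)" using r(3) by fastforce
 qed
 \<comment> \<open>The singular part of exp (-phi): it is Borel on the whole space and does not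
   involve the coordinates in \<open>?A\<close>. The smooth part costs a factor
   \<open>exp B\<close>.\<close>
 define wt where "wt w = exp (- real_of_ereal (\<Sum>k\<in>- S. ereal (b k) * elog ((cmod (w $ k))\<^sup>2)))" for w :: "complex^'b"
 have comp: "(\<lambda>w::complex^'b. w $ k) \<in> borel_measurable borel" for k
  by (intro borel_measurable_continuous_onI continuous_intros)
 have wm: "wt \<in> borel_measurable borel" unfolding wt_def using comp by measurable
 have winv: "wt w = wt w'" if "\<And>k. k \<notin> ?A ==> w $ k = w' $ k" for w w'
  using that by (simp add: wt_def)
 have wcmp: "wt (z y) \<le> exp B * exp (- real_of_ereal (\<phi> i y))" "exp (- real_of_ereal (\<phi> i y)) \<le> exp B * wt (z y)"
  if y: "y \<in> P" for y
 proof -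
  have yV: "y \<in> V" "y \<in> W2" using y PV Q by auto
  let ?S = "\<Sum>k\<in>- S. ereal (b k) * elog ((cmod (z y $ k))\<^sup>2)"
  have eq: "\<phi> i y = ?S + ereal (\<beta> y)" using \<phi> yV by blast
  \<comment> \<open>If the sum is infinite, so is the potential; both are read as 0 and the
    difference stays below \<open>B\<close>.\<close>
  have "\<bar>real_of_ereal (\<phi> i y) - real_of_ereal ?S\<bar> \<le> B"
   unfolding eq using W2(5)[OF yV(2)] W2(4) by (cases ?S) auto
  then show "wt (z y) \<le> exp B * exp (- real_of_ereal (\<phi> i y))" "exp (- real_of_ereal (\<phi> i y)) \<le> exp B * wt (z y)"
   unfolding wt_def exp_add[symmetric] by simp_all
 qed
 have "(\<integral>\<^sup>+w. sq_mass ?h (polydisc (z x) (2 * r)) w * ennreal (wt w) \<partial>lborel)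
   \<le> (\<integral>\<^sup>+w. ennreal (exp B) * (ennreal (in_chart ?z ?G w) * indicator (snd ?z ` P) w) \<partial>lborel)"
 proof (rule nn_integral_mono)
  fix w
  show "sq_mass ?h (polydisc (z x) (2 * r)) w * ennreal (wt w)
   \<le> ennreal (exp B) * (ennreal (in_chart ?z ?G w) * indicator (snd ?z ` P) w)"
  proof (cases "w \<in> polydisc (z x) (2 * r)")
   case True
   then obtain y where y: "y \<in> P" "w = z y" using r(3) by blast
   have yV: "y \<in> V" using y PV by blast
   have "(cmod (f y))\<^sup>2 * wt w \<le> (cmod (f y))\<^sup>2 * (exp B * exp (- real_of_ereal (\<phi> i y)))"
    unfolding y(2) by (intro mult_left_mono wcmp[OF y(1)]) simp
   also have "\<dots> = exp B * ?G y" by simp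
   finally have "ennreal ((cmod (f y))\<^sup>2 * wt w) \<le> ennreal (exp B * ?G y)" by (rule ennreal_leI)
   moreover have "w \<in> snd ?z ` P" using y by simp
   ultimately show ?thesis using True yV unfolding y(2) zf[OF yV]
    by (simp add: sq_mass_def zh ennreal_mult[symmetric] wt_def)
  qed (simp add: sq_mass_def)
 qed
 also have "\<dots> < \<infinity>"
 proof -
  have bG: "in_chart ?z ?G \<in> borel_measurable (restrict_space borel (snd ?z ` P))"
   by (intro in_chart_borel[OF zc] restrict_borel_subset[OF nonneg_borelD(1)[OF nG]]) (use PV in auto)
  have oz: "open (snd ?z ` P)" using oP by simp
  have "(\<lambda>w. indicator (snd ?z ` P) w *\<^sub>R in_chart ?z ?G w) \<in> borel_measurable borel"
   using bG oz by (subst (asm) borel_measurable_restrict_space_iff) auto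
  then have "(\<lambda>w. ennreal (indicator (snd ?z ` P) w *\<^sub>R in_chart ?z ?G w)) \<in> borel_measurable borel" by measurable
  then have "(\<lambda>w. ennreal (in_chart ?z ?G w) * indicator (snd ?z ` P) w) \<in> borel_measurable borel"
   by (rule back_subst[of "\<lambda>f. f \<in> borel_measurable borel"]) (auto simp: indicator_def)
  then have "(\<integral>\<^sup>+w. ennreal (exp B) * (ennreal (in_chart ?z ?G w) * indicator (snd ?z ` P) w) \<partial>lborel)
    = ennreal (exp B) * (\<integral>\<^sup>+w. ennreal (in_chart ?z ?G w) * indicator (snd ?z ` P) w \<partial>lborel)"
   by (intro nn_integral_cmult) simp
  also have "\<dots> < \<infinity>" using P(4) by (simp add: ennreal_mult_less_top)
  finally show ?thesis .
 qed
 finally have fin: "(\<integral>\<^sup>+w. sq_mass ?h (polydisc (z x) (2 * r)) w * ennreal (wt w) \<partial>lborel) < \<infinity>" .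
 define P' where "P' = V \<inter> z -` polydisc (z x) r \<inter> P"
 have P': "open P'" "x \<in> P'" "P' \<subseteq> fst ?z \<inter> Q" "P' \<subseteq> P"
  using open_chart_preimage[OF zc open_polydisc, of "z x" r] P PV z(2) center_polydisc[OF r(1)] by (auto simp: P'_def)
 have zP': "z y \<in> polydisc (z x) r" if "y \<in> P'" for y using that by (simp add: P'_def)
 have main: "(\<integral>\<^sup>+w. ennreal (in_chart ?z (?H \<e>) w) * indicator (snd ?z ` P') w \<partial>lborel) < \<infinity>" if e: "\<e> > 0" for \<e>
 proof -
  obtain C where C: "C \<ge> 0" "\<And>t L. 1 \<le> t ==> t \<le> L ==> exp t * th (card ?A) \<e> t \<le> C * (exp L * th (card ?A) \<e> L)"
   by (rule exp_th_growth[OF e, of "card ?A"]) blast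
  let ?K = "exp B * (C * exp T)"
  let ?k = "\<lambda>w. kern_weight ?A \<e> T (\<lambda>k. w $ k)"
  let ?F = "\<lambda>w. sq_mass ?h (polydisc (z x) r) w * ennreal (wt w) * ennreal (?k w)"
  have K: "?K \<ge> 0" using C(1) by simp
  have km: "?k \<in> borel_measurable borel" unfolding kern_weight_def using comp by measurable
  have hr: "holo_on (polydisc (z x) r) ?h" by (rule holo_on_subset[OF h polydisc_mono]) (use r in auto)
  have Fm: "?F \<in> borel_measurable borel"
   by (intro borel_measurable_times_ennreal sq_mass_measurable[OF hr open_polydisc]
     measurable_compose[OF wm measurable_ennreal] measurable_compose[OF km measurable_ennreal])
  have "(\<integral>\<^sup>+w. ennreal (in_chart ?z (?H \<e>) w) * indicator (snd ?z ` P') w \<partial>lborel) \<le> (\<integral>\<^sup>+w. ennreal ?K * ?F w \<partial>lborel)"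
  proof (rule nn_integral_mono)
   fix w
   show "ennreal (in_chart ?z (?H \<e>) w) * indicator (snd ?z ` P') w \<le> ennreal ?K * ?F w"
   proof (cases "w \<in> snd ?z ` P'")
    case True
    then obtain y where y: "y \<in> P'" "w = z y" by auto
    have yP: "y \<in> P" "y \<in> V" "y \<in> W" using y P' PV Q by auto
    have wr: "w \<in> polydisc (z x) r" using zP'[OF y(1)] y(2) by simp
    show ?thesis
    proof (rule psi_cases[OF psi(1), of y])
     assume "\<psi> y = - \<infinity>"
     then show ?thesis using zf[OF yP(2), of "?H \<e>"] y(2) by (simp add: psi_weight_at_pole)
    next
     fix t assume t: "\<psi> y = ereal (- t)" "t \<ge> 1"
     have nz: "(\<Prod>k\<in>S. z y $ k) \<noteq> 0" using W(5) yP(3) t by auto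
     have tT: "t \<le> T - (\<Sum>k\<in>?A. ln ((cmod (z y $ k))\<^sup>2))" using W(6) yP(3) nz t by auto
     have small: "cmod (z y $ k) < 1" if k: "k \<in> ?A" for k
     proof -
      have "dist (z x $ k) (z y $ k) < r" using wr y(2) unfolding polydisc_def by blast
      then show ?thesis using k r(2) by simp
     qed
     have "psi_weight \<psi> \<sigma> \<e> y \<le> C * exp T * ?k (z y)"
     proof (rule psi_weight_le_kern_weight[where \<psi> = \<psi> and y = y and t = t and A = ?A and \<sigma> = \<sigma> and C = C and T = T and \<e> = \<e>])
      show "exp t * th (card ?A) \<e> t \<le> C * (exp L * th (card ?A) \<e> L)" if "1 \<le> t" "t \<le> L" for t L
       by (rule C(2)[OF that])
      show "z y $ k \<noteq> 0" if "k \<in> ?A" for k using nz that by (auto simp: prod_zero_iff)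
      show "cmod (z y $ k) < 1" if "k \<in> ?A" for k by (rule small[OF that])
     qed (use t m tT in auto)
     then have "exp (- real_of_ereal (\<phi> i y)) * psi_weight \<psi> \<sigma> \<e> y \<le> exp B * wt (z y) * (C * exp T * ?k (z y))"
      by (intro mult_mono wcmp(2)[OF yP(1)]) (auto simp: psi_weight_nonneg wt_def)
     then have "?H \<e> y \<le> (cmod (f y))\<^sup>2 * (exp B * wt (z y) * (C * exp T * ?k (z y)))" by (intro mult_left_mono) auto
     also have "\<dots> = ?K * ((cmod (f y))\<^sup>2 * wt (z y) * ?k (z y))" by (simp only: mult_ac)
     finally have "ennreal (?H \<e> y) \<le> ennreal (?K * ((cmod (f y))\<^sup>2 * wt (z y) * ?k (z y)))" by (rule ennreal_leI)
     also have "\<dots> = ennreal ?K * (ennreal ((cmod (f y))\<^sup>2) * ennreal (wt (z y)) * ennreal (?k (z y)))"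
      using K by (simp add: ennreal_mult' wt_def)
     finally show ?thesis using True wr zf[OF yP(2), of "?H \<e>"] unfolding y(2) by (simp add: sq_mass_def zh[OF yP(2)])
    qed
   qed simp
  qed
  also have "\<dots> = ennreal ?K * (\<integral>\<^sup>+w. ?F w \<partial>lborel)" using Fm by (intro nn_integral_cmult) simp
  also have "\<dots> < \<infinity>"
  proof -
   have "(\<integral>\<^sup>+w. ?F w \<partial>lborel) < \<infinity>"
   proof (rule weighted_estimate[where W = "\<lambda>w. ennreal (wt w)" and A = ?A and p = "z x" and r = r and h = ?h, OF r(1) h])
    show "(\<lambda>w. ennreal (wt w)) \<in> borel_measurable borel" by (rule measurable_compose[OF wm measurable_ennreal])
    show "ennreal (wt w) = ennreal (wt w')" if "\<And>k. k \<notin> ?A ==> w $ k = w' $ k" for w w'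
     by (rule arg_cong[OF winv[OF that]])
   qed (use W(4) e fin in \<open>simp_all only: mem_Collect_eq\<close>)
   then show ?thesis by (simp only: ennreal_mult_less_top infinity_ennreal_def ennreal_less_top simp_thms)
  qed
  finally show ?thesis .
 qed
 have "loc_int ?z x {0<..} ?H"
  unfolding loc_int_nn[OF zc Q(1,2) nH] using P' main by (intro exI[of _ P']) simp
 then show "f \<in> adjoint_ideal X \<psi> L \<phi> \<sigma> x"
  unfolding adjoint_ideal_eq weighted_ideal_iff[OF X good_weight_adjoint[OF p psi(1)] z(1) xz i(1) xi] using U by blast
qed

section \<open>The codimension of the minimal lc centres\<close>

text \<open>The identity theorem and the connectedness of linear slices both rest on convexity in
  coordinates.\<close>

lemma convex_chart_nhd:
 assumes k: "is_chart \<z>" and y: "y \<in> fst \<z>" and W: "open W" "y \<in> W"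
 obtains U where "open U" "y \<in> U" "U \<subseteq> fst \<z>" "U \<subseteq> W" "convex (snd \<z> ` U)" "open (snd \<z> ` U)"
proof -
 have o: "open (fst \<z> \<inter> W)" using is_chartD(1)[OF k] W by blast
 have "open (snd \<z> ` (fst \<z> \<inter> W))" by (rule open_chart_image[OF k o]) simp
 then obtain r where r: "r > 0" "ball (snd \<z> y) r \<subseteq> snd \<z> ` (fst \<z> \<inter> W)"
  using y W open_contains_ball by (metis IntI imageI)
 let ?U = "fst \<z> \<inter> snd \<z> -` ball (snd \<z> y) r \<inter> W"
 have "snd \<z> ` ?U = ball (snd \<z> y) r"
 proof (intro subset_antisym subsetI)
  fix w assume w: "w \<in> ball (snd \<z> y) r"
  then obtain u where "u \<in> fst \<z> \<inter> W" "w = snd \<z> u" using r(2) by (meson imageE subsetD)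
  then show "w \<in> snd \<z> ` ?U" using w by blast
 qed auto
 moreover have "open ?U" using open_chart_preimage[OF k, of "ball (snd \<z> y) r"] W by blast
 ultimately show ?thesis using y W r(1) by (intro that[of ?U]) auto
qed

lemma manifold_identity:
 assumes X: "complex_manifold X" and z: "hol_coords X \<z>"
  and U: "open U" "U \<subseteq> fst \<z>" "convex (snd \<z> ` U)" and f: "hol_on X U f"
  and a: "a \<in> U" "\<forall>k\<in>S. snd \<z> a $ k = 0" and W: "open W" "a \<in> W"
  and zero: "\<forall>y\<in>U \<inter> W. (\<forall>k\<in>S. snd \<z> y $ k = 0) \<longrightarrow> f y = 0"
  and b: "b \<in> U" "\<forall>k\<in>S. snd \<z> b $ k = 0"
 shows "f b = 0"
proof -
 note zc = hol_coordsD(1)[OF z]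
 have fc: "in_chart \<z> f (snd \<z> y) = f y" if "y \<in> U" for y using that U(2) by (intro in_chart_apply[OF zc]) auto
 have UW: "open (U \<inter> W)" "U \<inter> W \<subseteq> fst \<z>" using U W by auto
 have "in_chart \<z> f (snd \<z> b) = 0"
 proof (rule holo_identity[where U = "snd \<z> ` U" and S = S and a = "snd \<z> a" and W = "snd \<z> ` (U \<inter> W)"])
  show "holo_on (snd \<z> ` U) (in_chart \<z> f)"
   using hol_on_coords[OF X z f U(1)] U(2) by (simp add: Int_absorb2)
  show "open (snd \<z> ` U)" by (rule open_chart_image[OF zc U(1,2)])
  show "open (snd \<z> ` (U \<inter> W))" by (rule open_chart_image[OF zc UW])
  fix w assume w: "w \<in> snd \<z> ` (U \<inter> W)" "\<And>k. k \<in> S ==> w $ k = 0"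
  then obtain y where y: "y \<in> U \<inter> W" "w = snd \<z> y" by (elim imageE)
  then show "in_chart \<z> f w = 0" using zero w(2) by (simp add: fc)
 qed (use U a b W in auto)
 then show ?thesis using fc b by simp
qed

lemma connected_slice:
 assumes k: "is_chart \<z>" and U: "U \<subseteq> fst \<z>" "convex (snd \<z> ` U)"
 shows "connected {y\<in>U. \<forall>k\<in>S. snd \<z> y $ k = 0}"
proof -
 let ?g = "inv_into (fst \<z>) (snd \<z>)" and ?L = "snd \<z> ` U \<inter> {w. \<forall>k\<in>S. w $ k = 0}"
 have "convex {w :: complex^'b. \<forall>k\<in>S. w $ k = 0}" by (auto simp: convex_def)
 then have "connected ?L" using U(2) by (intro convex_connected convex_Int)
 moreover have "continuous_on ?L ?g" by (rule continuous_on_subset[OF is_chartD(5)[OF k]]) (use U in auto)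
 ultimately have "connected (?g ` ?L)" by (rule connected_continuous_image[rotated])
 moreover have "?g ` ?L = {y\<in>U. \<forall>k\<in>S. snd \<z> y $ k = 0}"
 proof (intro subset_antisym subsetI)
  fix y assume "y \<in> ?g ` ?L"
  then obtain u where "u \<in> U" "\<forall>k\<in>S. snd \<z> u $ k = 0" "y = ?g (snd \<z> u)" by auto
  moreover then have "y = u" using U(1) is_chartD(3)[OF k] by auto
  ultimately show "y \<in> {y\<in>U. \<forall>k\<in>S. snd \<z> y $ k = 0}" by simp
 next
  fix y assume y: "y \<in> {y\<in>U. \<forall>k\<in>S. snd \<z> y $ k = 0}"
  then have "y = ?g (snd \<z> y)" using U(1) is_chartD(3)[OF k] by auto
  then show "y \<in> ?g ` ?L" using y by blast
 qed
 ultimately show ?thesis by simp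
qed

lemma hol_coords_restrict:
 assumes X: "complex_manifold X" and z: "hol_coords X (V, z)" and U: "open U" "U \<subseteq> V"
 shows "hol_coords X (U, z)"
proof -
 note zc = hol_coordsD(1)[OF z]
 have oU: "open (z ` U)" using open_chart_image[OF zc U(1)] U(2) by simp
 obtain g where g: "homeomorphism V (z ` V) z g" using zc by (auto simp: is_chart_def)
 have "homeomorphism U (z ` U) z g" by (rule homeomorphism_of_subsets[OF g U(2)]) (use U in auto)
 then have c: "is_chart (U, z)" using U(1) oU by (auto simp: is_chart_def)
 have inj: "inj_on z V" using is_chartD(3)[OF zc] by simp
 have inv: "inv_into U z w = inv_into V z w" if w: "w \<in> z ` U" for w
 proof -
  obtain u where u: "u \<in> U" "w = z u" using w by blast
  have "inv_into U z w = u" using u inj_on_subset[OF inj U(2)] by simp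
  moreover have "inv_into V z w = u" using u U(2) inj by (simp add: subset_iff)
  ultimately show ?thesis by simp
 qed
 have "holo_change \<k> (U, z) \<and> holo_change (U, z) \<k>" if k: "\<k> \<in> X" for \<k>
 proof
  show "holo_change \<k> (U, z)" unfolding holo_change_def
  proof
   fix j
   have "holo_on (snd \<k> ` (fst \<k> \<inter> V)) (in_chart \<k> (\<lambda>x. z x $ j))"
    using hol_coordsD(2)[OF z k] by (simp add: holo_change_def)
   then show "holo_on (snd \<k> ` (fst \<k> \<inter> fst (U, z))) (in_chart \<k> (\<lambda>x. snd (U, z) x $ j))"
    by (simp, rule holo_on_subset) (use U(2) in auto)
  qed
  show "holo_change (U, z) \<k>" unfolding holo_change_def
  proof
   fix j
   have "holo_on (z ` (V \<inter> fst \<k>)) (in_chart (V, z) (\<lambda>x. snd \<k> x $ j))"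
    using hol_coordsD(3)[OF z k] by (simp add: holo_change_def)
   then have "holo_on (z ` (U \<inter> fst \<k>)) (in_chart (V, z) (\<lambda>x. snd \<k> x $ j))"
    by (rule holo_on_subset) (use U(2) in auto)
   moreover have "open (z ` (U \<inter> fst \<k>))"
   proof -
    have "open (fst \<k>)" by (rule is_chartD(1)[OF hol_coordsD(1)[OF manifold_hol_coords[OF X k]]])
    then show ?thesis using open_chart_image[OF c, of "U \<inter> fst \<k>"] U(1) by auto
   qed
   ultimately show "holo_on (snd (U, z) ` (fst (U, z) \<inter> fst \<k>)) (in_chart (U, z) (\<lambda>x. snd \<k> x $ j))"
    unfolding fst_conv snd_conv by (rule holo_on_cong_open) (auto simp: in_chart_def inv)
  qed
 qed
 then show ?thesis using c by (auto simp: hol_coords_def)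
qed

lemma analytic_closed:
 assumes X: "complex_manifold X" and Z: "analytic_set X Z"
 shows "closed Z"
proof -
 have "\<exists>T. open T \<and> y \<in> T \<and> T \<subseteq> - Z" if y: "y \<in> - Z" for y
 proof -
  obtain V G where V: "open V" "y \<in> V" "\<forall>g\<in>G. hol_on X V g" "Z \<inter> V = {u\<in>V. \<forall>g\<in>G. g u = 0}"
   using Z unfolding analytic_set_def by meson
  then obtain g where g: "g \<in> G" "g y \<noteq> 0" using y by auto
  have "continuous_on V g" using hol_on_continuous[OF X _ V(1)] V(3) g(1) by blast
  then have "open (V \<inter> g -` (- {0}))" using continuous_on_open_vimage[OF V(1)] by (metis Int_commute open_Compl closed_singleton)
  moreover have "V \<inter> g -` (- {0}) \<subseteq> - Z" using V(4) g(1) by blast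
  ultimately show ?thesis using V(2) g(2) by (intro exI[of _ "V \<inter> g -` (- {0})"]) auto
 qed
 then have "open (- Z)" by (subst open_subopen) blast
 then show ?thesis by (simp add: closed_def)
qed

text \<open>Near each of its points \<open>Z\<close> is a connected linear slice, so the connected
  component C is open and closed in \<open>Z\<close>. If C is a union of analytic sets A and B and
  leaves A, then B contains an open piece of C, which the identity theorem propagates along slices
  to all of C. For maximality, an irreducible C' between C and \<open>Z\<close> is the union of the
  analytic sets C and C' - C.\<close>

lemma irred_component_locally_linear:
 assumes X: "complex_manifold X" and Z: "closed Z" "x \<in> Z"
  and lin: "\<forall>y\<in>Z. \<exists>V z S. hol_coords X (V, z) \<and> y \<in> V \<and> Z \<inter> V = {u\<in>V. \<forall>k\<in>S. z u $ k = 0}"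
 shows "connected_component_set Z x \<in> irred_components X Z"
  and "\<And>W. open W ==> x \<in> W ==> \<exists>U. open U \<and> x \<in> U \<and> U \<subseteq> W \<and> connected_component_set Z x \<inter> U = Z \<inter> U"
proof -
 let ?C = "connected_component_set Z x"
 have CZ: "?C \<subseteq> Z" by (rule connected_component_subset)
 have cC: "closed ?C" by (rule closed_connected_component[OF Z(1)])
 have xC: "x \<in> ?C" using Z(2) by simp
 have nhd: "\<exists>V z S U. hol_coords X (V, z) \<and> open U \<and> y \<in> U \<and> U \<subseteq> V \<and> U \<subseteq> W \<and> convex (z ` U) \<and>
   ?C \<inter> U = {u\<in>U. \<forall>k\<in>S. z u $ k = 0} \<and> Z \<inter> U = ?C \<inter> U" if y: "y \<in> ?C" "open W" "y \<in> W" for y W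
 proof -
  obtain V z S where V: "hol_coords X (V, z)" "y \<in> V" "Z \<inter> V = {u\<in>V. \<forall>k\<in>S. z u $ k = 0}"
   using lin y(1) CZ by (meson subsetD)
  obtain U where U: "open U" "y \<in> U" "U \<subseteq> V" "U \<subseteq> W" "convex (z ` U)"
   by (rule convex_chart_nhd[OF hol_coordsD(1)[OF V(1)] _ y(2,3)]) (use V(2) in auto)
  have ZU: "Z \<inter> U = {u\<in>U. \<forall>k\<in>S. z u $ k = 0}" using V(3) U(3) by blast
  have "connected (Z \<inter> U)" unfolding ZU
   using connected_slice[OF hol_coordsD(1)[OF V(1)], of U S] U(3,5) by simp
  then have "Z \<inter> U \<subseteq> connected_component_set Z y"
   using y(1) CZ U(2) by (intro connected_component_maximal) auto
  also have "connected_component_set Z y = ?C" using y(1) by (metis connected_component_eq)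
  finally have "Z \<inter> U = ?C \<inter> U" using CZ by blast
  then show ?thesis using V(1) U ZU by (intro exI[of _ V] exI[of _ z] exI[of _ S] exI[of _ U]) simp
 qed
 show "\<exists>U. open U \<and> x \<in> U \<and> U \<subseteq> W \<and> ?C \<inter> U = Z \<inter> U" if W: "open W" "x \<in> W" for W
  using nhd[OF xC W] by (elim exE conjE) (intro exI conjI, assumption+, simp)
 have off: "\<exists>V G. open V \<and> y \<in> V \<and> finite G \<and> (\<forall>g\<in>G. hol_on X V g) \<and> ?C \<inter> V = {u\<in>V. \<forall>g\<in>G. g u = 0}"
  if y: "y \<notin> ?C" for y
  using cC y by (intro exI[of _ "- ?C"] exI[of _ "{\<lambda>_. 1}"]) (auto simp: hol_on_const open_Compl)
 have aC: "analytic_set X ?C" unfolding analytic_set_def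
 proof
  fix y
  show "\<exists>V G. open V \<and> y \<in> V \<and> finite G \<and> (\<forall>g\<in>G. hol_on X V g) \<and> ?C \<inter> V = {u\<in>V. \<forall>g\<in>G. g u = 0}"
  proof (cases "y \<in> ?C")
   case True
   obtain V z S U where V: "hol_coords X (V, z)" "open U" "y \<in> U" "U \<subseteq> V" "?C \<inter> U = {u\<in>U. \<forall>k\<in>S. z u $ k = 0}"
    using nhd[OF True open_UNIV UNIV_I] by (elim exE conjE) (rule that; assumption)
   have "hol_on X U (\<lambda>u. z u $ k)" for k
    using hol_on_coordinate[OF V(1), of k] V(4) by (simp add: hol_on_subset)
   then show ?thesis using V(2,3,5) by (intro exI[of _ U] exI[of _ "(\<lambda>k u. z u $ k) ` S"]) auto
  qed (rule off)
 qed
 have irr: "irreducible_set X ?C" unfolding irreducible_set_def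
 proof (intro conjI allI impI)
  fix A B assume A: "analytic_set X A" and B: "analytic_set X B" and AB: "?C = A \<union> B"
  show "?C = A \<or> ?C = B"
  proof (cases "?C \<subseteq> A")
   case False
   then obtain a where a: "a \<in> ?C" "a \<notin> A" by blast
   have "b \<in> B" if b: "b \<in> ?C" for b
   proof -
    have "\<exists>W. open W \<and> b \<in> W \<and> ?C \<inter> W \<subseteq> B"
    \<comment> \<open>Inside one slice the property passes from any point to any other;
      connectedness of C does the rest.\<close>
    proof (rule connected_induction_simple[OF connected_connected_component a(1) b,
       where P = "\<lambda>u. \<exists>W. open W \<and> u \<in> W \<and> ?C \<inter> W \<subseteq> B"])
     show "\<exists>W. open W \<and> a \<in> W \<and> ?C \<inter> W \<subseteq> B"
      using analytic_closed[OF X A] a(2) AB by (intro exI[of _ "- A"]) (auto simp: open_Compl)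
     fix u assume u: "u \<in> ?C"
     obtain VB G where VB: "open VB" "u \<in> VB" "\<forall>g\<in>G. hol_on X VB g" "B \<inter> VB = {v\<in>VB. \<forall>g\<in>G. g v = 0}"
      using B unfolding analytic_set_def by meson
     obtain V z S U where V: "hol_coords X (V, z)" "open U" "u \<in> U" "U \<subseteq> V" "U \<subseteq> VB" "convex (z ` U)"
       "?C \<inter> U = {u\<in>U. \<forall>k\<in>S. z u $ k = 0}"
      using nhd[OF u VB(1,2)] by (elim exE conjE) (rule that; assumption)
     have "\<exists>W. open W \<and> w \<in> W \<and> ?C \<inter> W \<subseteq> B"
      if v: "v \<in> ?C \<inter> U" "\<exists>W. open W \<and> v \<in> W \<and> ?C \<inter> W \<subseteq> B" and w: "w \<in> ?C \<inter> U" for v w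
     proof -
      obtain W where W: "open W" "v \<in> W" "?C \<inter> W \<subseteq> B" using v(2) by blast
      have "g c = 0" if g: "g \<in> G" and c: "c \<in> ?C \<inter> U" for g c
      proof (rule manifold_identity[OF X V(1), where U = U and S = S and a = v and W = W])
       show "hol_on X U g" using VB(3) g V(5) by (meson hol_on_subset)
       show "v \<in> U" using v(1) by blast
       show "\<forall>k\<in>S. snd (V, z) v $ k = 0" using v(1) V(7) by auto
       show "\<forall>y\<in>U \<inter> W. (\<forall>k\<in>S. snd (V, z) y $ k = 0) \<longrightarrow> g y = 0"
       proof (intro ballI impI)
        fix y assume y: "y \<in> U \<inter> W" "\<forall>k\<in>S. snd (V, z) y $ k = 0"
        then have "y \<in> ?C \<inter> U" unfolding V(7) by simp
        then have "y \<in> B \<inter> VB" using W(3) y(1) V(5) by blast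
        then show "g y = 0" using VB(4) g by blast
       qed
       show "c \<in> U" using c by blast
       show "\<forall>k\<in>S. snd (V, z) c $ k = 0" using c V(7) by auto
      qed (use V W in auto)
      then have "?C \<inter> U \<subseteq> B" using VB(4) V(5) by blast
      then show ?thesis using V(2) w by (intro exI[of _ U]) blast
     qed
     note step = this
     show "\<exists>T. openin (top_of_set ?C) T \<and> u \<in> T \<and> (\<forall>v\<in>T. \<forall>w\<in>T.
       (\<exists>W. open W \<and> v \<in> W \<and> ?C \<inter> W \<subseteq> B) \<longrightarrow> (\<exists>W. open W \<and> w \<in> W \<and> ?C \<inter> W \<subseteq> B))"
     proof (rule exI[where x = "?C \<inter> U"], intro conjI ballI impI)
      show "openin (top_of_set ?C) (?C \<inter> U)" using V(2) by (rule openin_open_Int)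
      show "u \<in> ?C \<inter> U" by (rule IntI[OF u V(3)])
     qed (rule step)
    qed
    then obtain W where "b \<in> W" "?C \<inter> W \<subseteq> B" by (elim exE conjE) (rule that)
    then show ?thesis using b by (meson IntI subsetD)
   qed
   then show ?thesis using AB by blast
  qed (use AB in blast)
 next
  show "?C \<noteq> {}" using xC by blast
 qed (rule aC)
 have "C' = ?C" if C': "irreducible_set X C'" "?C \<subseteq> C'" "C' \<subseteq> Z" for C'
 proof -
  \<comment> \<open>Near a point of C the difference is empty, as C is open in \<open>Z\<close>;
    away from the closed set C the equations of \<open>C'\<close> serve.\<close>
  have "analytic_set X (C' - ?C)" unfolding analytic_set_def
  proof
   fix y
   show "\<exists>V G. open V \<and> y \<in> V \<and> finite G \<and> (\<forall>g\<in>G. hol_on X V g) \<and> (C' - ?C) \<inter> V = {u\<in>V. \<forall>g\<in>G. g u = 0}"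
   proof (cases "y \<in> ?C")
    case True
    obtain U where U: "open U" "y \<in> U" "Z \<inter> U = ?C \<inter> U"
     using nhd[OF True open_UNIV UNIV_I] by (elim exE conjE) (rule that; assumption)
    then show ?thesis using C'(3) by (intro exI[of _ U] exI[of _ "{\<lambda>_. 1}"]) (auto simp: hol_on_const)
   next
    case False
    obtain V G where V: "open V" "y \<in> V" "finite G" "\<forall>g\<in>G. hol_on X V g" "C' \<inter> V = {u\<in>V. \<forall>g\<in>G. g u = 0}"
     using C'(1) unfolding irreducible_set_def analytic_set_def by meson
    have "(C' - ?C) \<inter> (V - ?C) = {u\<in>V - ?C. \<forall>g\<in>G. g u = 0}" using V(5) by blast
    then show ?thesis using V False cC by (intro exI[of _ "V - ?C"] exI[of _ G]) (auto intro: hol_on_subset)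
   qed
  qed
  moreover have "C' = ?C \<union> (C' - ?C)" using C'(2) by blast
  ultimately have "C' = ?C \<or> C' = C' - ?C" using C'(1) aC unfolding irreducible_set_def by blast
  then show ?thesis using xC C'(2) by blast
 qed
 then show "?C \<in> irred_components X Z" unfolding irred_components_def using irr CZ by blast
qed

lemma snc_chart:
 assumes "snc_divisor X D"
 obtains V z j where "hol_coords X (V, z)" "x \<in> V" "inj_on j {E\<in>D. E \<inter> V \<noteq> {}}"
  "\<forall>E\<in>D. E \<inter> V \<noteq> {} \<longrightarrow> E \<inter> V = {y\<in>V. z y $ j E = 0}"
 using assms[unfolded snc_divisor_def, THEN conjunct2, THEN conjunct2, rule_format, of x]
 by (elim exE conjE) (rule that; assumption)

text \<open>The components through \<open>x\<close> intersect in a set that is a coordinate slice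
  near each of its points, so its connected component at \<open>x\<close> is one of its irreducible
  components. Distinct divisor components have distinct coordinates, so the codimension is their
  number.\<close>

lemma lc_centre_through_point:
 assumes X: "complex_manifold X" and D: "snc_divisor X D" and ne: "{E\<in>D. x \<in> E} \<noteq> {}"
 shows "\<exists>C\<in>lc_centres X D. has_codim X C (card {E\<in>D. x \<in> E})"
proof -
 let ?E = "{E\<in>D. x \<in> E}"
 let ?Z = "\<Inter>?E"
 let ?C = "connected_component_set ?Z x"
 have slice: "?Z \<inter> V = {u\<in>V. \<forall>k\<in>j ` ?E. z u $ k = 0}"
  if "y \<in> ?Z" "y \<in> V" "\<forall>E\<in>D. E \<inter> V \<noteq> {} \<longrightarrow> E \<inter> V = {y\<in>V. z y $ j E = 0}" for y V z j
 proof -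
  have "E \<inter> V = {y\<in>V. z y $ j E = 0}" if "E \<in> ?E" for E
   using that \<open>y \<in> ?Z\<close> \<open>y \<in> V\<close> \<open>\<forall>E\<in>D. _\<close> by blast
  then show ?thesis using ne by blast
 qed
 have cZ: "closed ?Z"
  using D analytic_closed[OF X] unfolding snc_divisor_def irreducible_set_def by (intro closed_Inter) auto
 have xZ: "x \<in> ?Z" by blast
 have lin: "\<forall>y\<in>?Z. \<exists>V z S. hol_coords X (V, z) \<and> y \<in> V \<and> ?Z \<inter> V = {u\<in>V. \<forall>k\<in>S. z u $ k = 0}"
 proof
  fix y assume y: "y \<in> ?Z"
  obtain V z j where V: "hol_coords X (V, z)" "y \<in> V" "\<forall>E\<in>D. E \<inter> V \<noteq> {} \<longrightarrow> E \<inter> V = {y\<in>V. z y $ j E = 0}"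
   by (rule snc_chart[OF D])
  show "\<exists>V z S. hol_coords X (V, z) \<and> y \<in> V \<and> ?Z \<inter> V = {u\<in>V. \<forall>k\<in>S. z u $ k = 0}"
   by (rule exI[of _ V], rule exI[of _ z], rule exI[of _ "j ` ?E"]) (intro conjI V(1,2) slice[OF y V(2,3)])
 qed
 have "?C \<in> lc_centres X D"
  unfolding lc_centres_def
 proof (rule UN_I)
  show "?E \<in> {\<E>. \<E> \<subseteq> D \<and> \<E> \<noteq> {}}" using ne by blast
  show "?C \<in> irred_components X ?Z" by (rule irred_component_locally_linear(1)[OF X cZ xZ lin])
 qed
 moreover have "has_codim X ?C (card ?E)"
 proof -
  obtain V z j where V: "hol_coords X (V, z)" "x \<in> V" "inj_on j {E\<in>D. E \<inter> V \<noteq> {}}"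
    "\<forall>E\<in>D. E \<inter> V \<noteq> {} \<longrightarrow> E \<inter> V = {y\<in>V. z y $ j E = 0}"
   by (rule snc_chart[OF D])
  have oV: "open V" using is_chartD(1)[OF hol_coordsD(1)[OF V(1)]] by simp
  obtain U where U: "open U" "x \<in> U" "U \<subseteq> V" "?C \<inter> U = ?Z \<inter> U"
   using irred_component_locally_linear(2)[OF X cZ xZ lin oV V(2)] by (elim exE conjE) (rule that; assumption)
  have "?C \<inter> U = {u\<in>U. \<forall>k\<in>j ` ?E. z u $ k = 0}"
  proof -
   have "?C \<inter> U = (?Z \<inter> V) \<inter> U" unfolding U(4) using U(3) by (simp add: Int_assoc Int_absorb1)
   also have "\<dots> = {u\<in>V. \<forall>k\<in>j ` ?E. z u $ k = 0} \<inter> U" unfolding slice[OF xZ V(2,4)] ..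
   also have "\<dots> = {u\<in>U. \<forall>k\<in>j ` ?E. z u $ k = 0}" using U(3) by auto
   finally show ?thesis .
  qed
  moreover have "card (j ` ?E) = card ?E" by (intro card_image inj_on_subset[OF V(3)]) (use V(2) in auto)
  moreover have "x \<in> ?C" unfolding mem_Collect_eq by (rule connected_component_refl[OF xZ])
  then have "?C \<inter> U \<noteq> {}" using U(2) by blast
  ultimately show ?thesis unfolding has_codim_def using hol_coords_restrict[OF X V(1) U(1,3)]
   by (intro exI[of _ U] exI[of _ z] exI[of _ "j ` ?E"]) simp
 qed
 ultimately show ?thesis by blast
qed

text \<open>\<open>Max\<close> asks for a finite set: a codimension is the size of a set of
  coordinates, hence at most the dimension.\<close>

lemma card_components_le_sigma_mlc:
 assumes X: "complex_manifold (X :: ('a::t2_space, 'n::finite) chart set)" and D: "snc_divisor X D"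
 shows "card {E\<in>D. x \<in> E} \<le> sigma_mlc X D"
proof (cases "{E\<in>D. x \<in> E} = {}")
 case False
 have "{c. \<exists>Z\<in>lc_centres X D. has_codim X Z c} \<subseteq> {..CARD('n)}"
  unfolding has_codim_def by (auto intro: card_mono)
 then have "finite {c. \<exists>Z\<in>lc_centres X D. has_codim X Z c}" by (rule finite_subset) simp
 then show ?thesis using lc_centre_through_point[OF X D False] unfolding sigma_mlc_def by (intro Max_ge) auto
qed (simp only: card.empty le0)

text \<open>Holomorphic functions on a convex slice have no zero divisors: where one factor is
  nonzero the product of the others vanishes, and the identity theorem extends this to the whole
  slice.\<close>

lemma holomorphic_product_zero_on_slice:
 assumes X: "complex_manifold X" and z: "hol_coords X \<z>"
  and U: "open U" "U \<subseteq> fst \<z>" "convex (snd \<z> ` U)" and A: "finite A" and f: "\<forall>e\<in>A. hol_on X U (f e)"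
  and x: "x \<in> U" "\<forall>k\<in>S. snd \<z> x $ k = 0"
  and zero: "\<forall>y\<in>U. (\<forall>k\<in>S. snd \<z> y $ k = 0) \<longrightarrow> (\<Prod>e\<in>A. f e y) = 0"
 shows "\<exists>e\<in>A. \<forall>y\<in>U. (\<forall>k\<in>S. snd \<z> y $ k = 0) \<longrightarrow> f e y = 0"
 using A f zero
proof (induction A rule: finite_induct)
 case empty
 then show ?case using x by auto
next
 case (insert e A)
 show ?case
 proof (cases "\<forall>y\<in>U. (\<forall>k\<in>S. snd \<z> y $ k = 0) \<longrightarrow> f e y = 0")
  case False
  then obtain a where a: "a \<in> U" "\<forall>k\<in>S. snd \<z> a $ k = 0" "f e a \<noteq> 0" by blast
  have fe: "hol_on X U (f e)" using insert.prems(1) by simp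
  have o: "open (U \<inter> f e -` (- {0}))"
   using continuous_on_open_vimage[OF U(1)] hol_on_continuous[OF X fe U(1)] by (metis Int_commute open_Compl closed_singleton)
  have "(\<Prod>e\<in>A. f e b) = 0" if b: "b \<in> U" "\<forall>k\<in>S. snd \<z> b $ k = 0" for b
  proof (rule manifold_identity[OF X z U _ a(1,2) o _ _ b])
   show "hol_on X U (\<lambda>y. \<Prod>e\<in>A. f e y)" using insert.prems(1) insert.hyps(1) by (intro hol_on_prod) auto
   show "a \<in> U \<inter> f e -` (- {0})" using a by simp
   show "\<forall>y\<in>U \<inter> (U \<inter> f e -` (- {0})). (\<forall>k\<in>S. snd \<z> y $ k = 0) \<longrightarrow> (\<Prod>e\<in>A. f e y) = 0"
   proof (intro ballI impI)
    fix y assume y: "y \<in> U \<inter> (U \<inter> f e -` (- {0}))" "\<forall>k\<in>S. snd \<z> y $ k = 0"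
    then have "(\<Prod>e\<in>insert e A. f e y) = 0" using insert.prems(2) by blast
    then show "(\<Prod>e\<in>A. f e y) = 0" using y(1) insert.hyps by simp
   qed
  qed
  then have "\<forall>y\<in>U. (\<forall>k\<in>S. snd \<z> y $ k = 0) \<longrightarrow> (\<Prod>e\<in>A. f e y) = 0" by blast
  then show ?thesis using insert.IH insert.prems(1) by simp
 qed blast
qed

lemma holo_map_derivative:
 fixes h :: "complex^'n::finite => complex^'m::finite"
 assumes h: "\<And>k. holo_on S (\<lambda>w. h w $ k)" and w: "w \<in> S"
 shows "\<exists>h'. (h has_derivative h') (at w)"
proof -
 have "\<forall>k. \<exists>h'. ((\<lambda>w. h w $ k) has_derivative h') (at w)"
  using h w unfolding holo_on_def by blast
 then obtain h' where h': "\<And>k. ((\<lambda>w. h w $ k) has_derivative h' k) (at w)" by metis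
 have ax: "bounded_linear (axis k :: complex => complex^'m)" for k
  unfolding linear_conv_bounded_linear[symmetric]
  by (rule linearI) (simp_all add: axis_def vec_eq_iff)
 have ex: "(\<Sum>k\<in>UNIV. axis k (v k)) = (\<chi> k. v k)" for v :: "'m => complex"
  by (simp add: vec_eq_iff axis_def if_distrib cong: if_cong)
 have "((\<lambda>w. \<Sum>k\<in>UNIV. axis k (h w $ k)) has_derivative (\<lambda>v. \<Sum>k\<in>UNIV. axis k (h' k v))) (at w)"
  using h' by (intro has_derivative_sum bounded_linear.has_derivative[OF ax])
 then have "(h has_derivative (\<lambda>v. \<chi> k. h' k v)) (at w)" by (simp add: ex)
 then show ?thesis by blast
qed

lemma derivative_zero_on_hyperplane:
 fixes f :: "complex^'n::finite => complex"
 assumes f: "(f has_derivative f') (at p)" and U: "open U" "p \<in> U" and p: "p $ k = 0"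
  and zero: "\<forall>w\<in>U. w $ k = 0 \<longrightarrow> f w = 0" and v: "v $ k = 0"
 shows "f' v = 0"
proof -
 let ?l = "\<lambda>t :: real. p + t *\<^sub>R v"
 have "(?l has_derivative (\<lambda>t. t *\<^sub>R v)) (at 0)" by (auto intro!: derivative_eq_intros)
 moreover have "(f has_derivative f') (at (?l 0))" using f by simp
 ultimately have "((\<lambda>t. f (?l t)) has_derivative (\<lambda>t. f' (t *\<^sub>R v))) (at 0)"
  by (rule has_derivative_compose[unfolded comp_def])
 moreover have "((\<lambda>t. f (?l t)) has_derivative (\<lambda>t. 0)) (at 0)"
 proof (rule has_derivative_transform_within_open)
  show "((\<lambda>t. 0) has_derivative (\<lambda>t. 0)) (at 0)" by simp
  show "open (?l -` U)" by (rule open_vimage[OF U(1)]) (intro continuous_intros)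
  show "0 \<in> ?l -` U" using U(2) by simp
  fix t assume "t \<in> ?l -` U"
  then show "0 = f (?l t)" using zero p v by simp
 qed
 ultimately have "(\<lambda>t. f' (t *\<^sub>R v)) = (\<lambda>t. 0)" by (rule has_derivative_unique)
 from fun_cong[OF this, of 1] show ?thesis by simp
qed

text \<open>A coordinate w_m that vanishes on two distinct hyperplanes through \<open>x\<close> has
  a differential at \<open>x\<close> that vanishes on their span, which is everything; but the
  differential of a coordinate function is not zero.\<close>

lemma coordinate_not_zero_on_two_hyperplanes:
 assumes X: "complex_manifold X" and z: "hol_coords X (V, z)" and w: "hol_coords X (V', w)"
  and x: "x \<in> V" "x \<in> V'" and kl: "k \<noteq> l" "z x $ k = 0" "z x $ l = 0"
  and U: "open U" "x \<in> U" "U \<subseteq> V \<inter> V'"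
  and zero: "\<forall>y\<in>U. z y $ k = 0 \<or> z y $ l = 0 \<longrightarrow> w y $ m = 0"
 shows False
proof -
 note zc = hol_coordsD(1)[OF z] and wc = hol_coordsD(1)[OF w]
 have UV: "U \<subseteq> fst (V, z)" "U \<subseteq> fst (V', w)" using U(3) by auto
 have oz: "open (z ` U)" using open_chart_image[OF zc U(1) UV(1)] by simp
 have ow: "open (w ` U)" using open_chart_image[OF wc U(1) UV(2)] by simp
 let ?f = "in_chart (V, z) (\<lambda>y. w y $ m)" and ?g = "inv_into V' w"
 have inj: "inj_on z V" "inj_on w V'" using is_chartD(3)[OF zc] is_chartD(3)[OF wc] by auto
 have g: "?g (w y) = y" if "y \<in> U" for y using that inj(2) U(3) by (simp add: subset_iff)
 have fz: "?f (z y) = w y $ m" if "y \<in> U" for y using in_chart_apply[OF zc, of y] that UV by auto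
 have hf: "holo_on (z ` U) ?f"
  using hol_on_coords[OF X z hol_on_subset[OF hol_on_coordinate[OF w] UV(2)] U(1), of m] UV(1) by (simp add: Int_absorb2)
 have hz: "holo_on (w ` U) (\<lambda>v. z (?g v) $ j)" for j
  using hol_on_coords[OF X w hol_on_subset[OF hol_on_coordinate[OF z] UV(1)] U(1), of j] UV(2)
  by (simp add: Int_absorb2 in_chart_def)
 obtain f' where f': "(?f has_derivative f') (at (z x))" "\<And>c v. f' (c *s v) = c * f' v"
  by (rule holo_onE[OF hf, of "z x"]) (use U(2) in auto)
 have "\<forall>v\<in>z ` U. v $ k = 0 \<longrightarrow> ?f v = 0" "\<forall>v\<in>z ` U. v $ l = 0 \<longrightarrow> ?f v = 0"
  using zero fz by auto
 then have f0: "f' v = 0" if "v $ k = 0 \<or> v $ l = 0" for v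
  using that derivative_zero_on_hyperplane[OF f'(1) oz _ kl(2)] derivative_zero_on_hyperplane[OF f'(1) oz _ kl(3)] U(2) by blast
 have f'0: "f' v = 0" for v
 proof -
  have "f' v = f' ((v - axis k (v $ k)) + axis k (v $ k))" by simp
  also have "\<dots> = f' (v - axis k (v $ k)) + f' (axis k (v $ k))"
   by (rule linear_add[OF has_derivative_linear[OF f'(1)]])
  also have "\<dots> = 0" using f0[of "v - axis k (v $ k)"] f0[of "axis k (v $ k)"] kl(1) by (simp add: axis_def)
  finally show ?thesis .
 qed
 obtain h' where h': "((\<lambda>v. z (?g v)) has_derivative h') (at (w x))"
  using holo_map_derivative[OF hz, of "w x"] U(2) by blast
 have "(?f has_derivative f') (at (z (?g (w x))))" using f'(1) g[OF U(2)] by simp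
 from has_derivative_compose[OF h' this]
 have "((\<lambda>v. ?f (z (?g v))) has_derivative (\<lambda>v. 0)) (at (w x))" by (simp add: f'0)
 moreover have "((\<lambda>v. ?f (z (?g v))) has_derivative (\<lambda>v. v $ m)) (at (w x))"
 proof (rule has_derivative_transform_within_open[OF _ ow])
  show "((\<lambda>v. v $ m) has_derivative (\<lambda>v. v $ m)) (at (w x))"
   by (rule bounded_linear_imp_has_derivative[OF bounded_linear_vec_nth])
  fix v assume "v \<in> w ` U"
  then show "v $ m = ?f (z (?g v))" using g fz by auto
 qed (use U(2) in blast)
 ultimately have "(\<lambda>v :: complex^'b. 0 :: complex) = (\<lambda>v. v $ m)" by (rule has_derivative_unique)
 from fun_cong[OF this, of "axis m 1"] show False by simp
qed

text \<open>The chart adapted to the poles need not be that of \<open>snc_divisor\<close>. On a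
  hyperplane z_k = 0 near \<open>x\<close> the product of the equations of the components through
  \<open>x\<close> vanishes, so one component contains the hyperplane; two hyperplanes cannot share
  a component.\<close>

lemma card_hyperplanes_le:
 assumes X: "complex_manifold X" and D: "snc_divisor X D"
  and z: "hol_coords X (V, z)" "x \<in> V" "\<Union>D \<inter> V = {y\<in>V. (\<Prod>k\<in>S. z y $ k) = 0}"
 shows "card {k\<in>S. z x $ k = 0} \<le> card {E\<in>D. x \<in> E}"
proof -
 let ?E = "{E\<in>D. x \<in> E}"
 obtain V' w j where W: "hol_coords X (V', w)" "x \<in> V'" "inj_on j {E\<in>D. E \<inter> V' \<noteq> {}}"
   "\<forall>E\<in>D. E \<inter> V' \<noteq> {} \<longrightarrow> E \<inter> V' = {y\<in>V'. w y $ j E = 0}"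
  by (rule snc_chart[OF D])
 have fin: "finite D" using D by (simp add: snc_divisor_def)
 have oV': "open V'" using is_chartD(1)[OF hol_coordsD(1)[OF W(1)]] by simp
 have "closed (\<Union>(D - ?E))"
  using D analytic_closed[OF X] unfolding snc_divisor_def irreducible_set_def by (intro closed_Union) auto
 then have "open (V' - \<Union>(D - ?E))" using oV' by blast
 then obtain U where U: "open U" "x \<in> U" "U \<subseteq> V" "U \<subseteq> V' - \<Union>(D - ?E)" "convex (z ` U)"
  by (rule convex_chart_nhd[OF hol_coordsD(1)[OF z(1)], of x "V' - \<Union>(D - ?E)", rotated]) (use z(2) W(2) in auto)
 have EV: "E \<inter> V' = {y\<in>V'. w y $ j E = 0}" if "E \<in> ?E" for E using W(2,4) that by blast
 have "\<exists>E\<in>?E. \<forall>y\<in>U. (\<forall>i\<in>{k}. snd (V, z) y $ i = 0) \<longrightarrow> w y $ j E = 0" if k: "k \<in> S" "z x $ k = 0" for k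
 proof (rule holomorphic_product_zero_on_slice[OF X z(1) U(1)])
  show "\<forall>E\<in>?E. hol_on X U (\<lambda>y. w y $ j E)"
   using hol_on_subset[OF hol_on_coordinate[OF W(1)]] U(4) by auto
  show "\<forall>y\<in>U. (\<forall>i\<in>{k}. snd (V, z) y $ i = 0) \<longrightarrow> (\<Prod>E\<in>?E. w y $ j E) = 0"
  proof (intro ballI impI)
   fix y assume y: "y \<in> U" "\<forall>i\<in>{k}. snd (V, z) y $ i = 0"
   then have "(\<Prod>k\<in>S. z y $ k) = 0" using k(1) by (intro prod_zero) auto
   then have "y \<in> \<Union>D \<inter> V" using z(3) y(1) U(3) by blast
   then obtain E where E: "E \<in> D" "y \<in> E" by blast
   then have "E \<in> ?E" using y(1) U(4) by blast
   moreover from EV[OF this] have "w y $ j E = 0" using y(1) U(4) E by blast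
   ultimately show "(\<Prod>E\<in>?E. w y $ j E) = 0" using fin by (intro prod_zero) auto
  qed
 qed (use U fin k in auto)
 then have "\<forall>k\<in>{k\<in>S. z x $ k = 0}. \<exists>E. E \<in> ?E \<and> (\<forall>y\<in>U. z y $ k = 0 \<longrightarrow> w y $ j E = 0)" by auto
 then obtain e where e: "\<forall>k\<in>{k\<in>S. z x $ k = 0}. e k \<in> ?E \<and> (\<forall>y\<in>U. z y $ k = 0 \<longrightarrow> w y $ j (e k) = 0)"
  by (elim bchoice[THEN exE])
 have UU: "U \<subseteq> V \<inter> V'" using U by blast
 have "inj_on e {k\<in>S. z x $ k = 0}"
 proof (rule inj_onI, rule ccontr)
  fix k l assume kl: "k \<in> {k\<in>S. z x $ k = 0}" "l \<in> {k\<in>S. z x $ k = 0}" "e k = e l" "k \<noteq> l"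
  show False
   by (rule coordinate_not_zero_on_two_hyperplanes[OF X z(1) W(1) z(2) W(2) kl(4) _ _ U(1,2) UU, where m = "j (e k)"])
    (use e kl in auto)
 qed
 moreover have "e ` {k\<in>S. z x $ k = 0} \<subseteq> ?E" using e by blast
 ultimately show ?thesis using fin by (intro card_inj_on_le) auto
qed

section \<open>Twisted ideal sheaves\<close>

text \<open>What the sheaf arguments ask of a trivialising cover; it passes to tensor products and
  holds for \<open>canonical_bundle\<close> because charts are open and cover.\<close>

definition open_cover_bundle :: "('a::topological_space, 'i) line_bundle => bool" where
 "open_cover_bundle L \<longleftrightarrow> (\<forall>i\<in>idx L. open (dom L i)) \<and> (\<forall>x. \<exists>i\<in>idx L. x \<in> dom L i)"

lemma open_cover_bundleD:
 assumes "open_cover_bundle L"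
 shows "i \<in> idx L ==> open (dom L i)" "\<exists>i\<in>idx L. x \<in> dom L i"
 using assms by (auto simp: open_cover_bundle_def)

lemma open_cover_line_bundle:
 assumes "holomorphic_line_bundle X L"
 shows "open_cover_bundle L"
 unfolding open_cover_bundle_def using bundleD(1)[OF assms] bundleD(2)[OF assms] by simp

lemma open_cover_tensor:
 assumes "open_cover_bundle L" "open_cover_bundle L'"
 shows "open_cover_bundle (lb_tensor L L')"
 unfolding open_cover_bundle_def
proof (intro conjI ballI allI)
 show "open (dom (lb_tensor L L') i)" if "i \<in> idx (lb_tensor L L')" for i
  using that open_cover_bundleD(1)[OF assms(1)] open_cover_bundleD(1)[OF assms(2)] by (cases i) auto
 fix x
 obtain i j where "i \<in> idx L" "x \<in> dom L i" "j \<in> idx L'" "x \<in> dom L' j"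
  using open_cover_bundleD(2)[OF assms(1), of x] open_cover_bundleD(2)[OF assms(2), of x] by blast
 then show "\<exists>i\<in>idx (lb_tensor L L'). x \<in> dom (lb_tensor L L') i" by (intro bexI[of _ "(i, j)"]) auto
qed

lemma open_cover_canonical: "complex_manifold X ==> open_cover_bundle (canonical_bundle X)"
 unfolding open_cover_bundle_def
 using manifold_chart is_chartD(1)[OF hol_coordsD(1)[OF manifold_hol_coords]]
 by (auto simp: canonical_bundle_def)

text \<open>Stalks closed under addition and negation that see functions only through their germs.
  The latter makes restriction and the local test for membership work.\<close>

definition ideal_family :: "'a::topological_space ideal_sheaf => bool" where
 "ideal_family J \<longleftrightarrow> (\<forall>x. (\<lambda>y. 0) \<in> J x \<and> (\<forall>f\<in>J x. \<forall>g\<in>J x. (\<lambda>y. f y + g y) \<in> J x) \<and> (\<forall>f\<in>J x. (\<lambda>y. - f y) \<in> J x) \<and>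
  (\<forall>f\<in>J x. \<forall>g W. open W \<longrightarrow> x \<in> W \<longrightarrow> (\<forall>y\<in>W. f y = g y) \<longrightarrow> g \<in> J x))"

lemma ideal_familyD:
 assumes "ideal_family J"
 shows "(\<lambda>y. 0) \<in> J x" "f \<in> J x ==> g \<in> J x ==> (\<lambda>y. f y + g y) \<in> J x" "f \<in> J x ==> (\<lambda>y. - f y) \<in> J x"
  "f \<in> J x ==> open W ==> x \<in> W ==> \<forall>y\<in>W. f y = g y ==> g \<in> J x"
proof -
 note a = assms[unfolded ideal_family_def, THEN spec, of x]
 show "(\<lambda>y. 0) \<in> J x" by (rule a[THEN conjunct1])
 show "(\<lambda>y. f y + g y) \<in> J x" if "f \<in> J x" "g \<in> J x"
  by (rule a[THEN conjunct2, THEN conjunct1, THEN bspec, THEN bspec, OF that])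
 show "(\<lambda>y. - f y) \<in> J x" if "f \<in> J x"
  by (rule a[THEN conjunct2, THEN conjunct2, THEN conjunct1, THEN bspec, OF that])
 show "g \<in> J x" if "f \<in> J x" "open W" "x \<in> W" "\<forall>y\<in>W. f y = g y"
  by (rule a[THEN conjunct2, THEN conjunct2, THEN conjunct2, THEN bspec, OF that(1), THEN spec, THEN spec,
     THEN mp, OF that(2), THEN mp, OF that(3), THEN mp, OF that(4)])
qed

lemma ideal_family_weighted:
 assumes X: "complex_manifold X" and L: "open_cover_bundle L" and w: "good_weight L E w"
 shows "ideal_family (weighted_ideal X L E w)"
 unfolding ideal_family_def
proof (intro allI conjI ballI impI)
 fix x
 obtain i where i: "i \<in> idx L" "x \<in> dom L i" using open_cover_bundleD(2)[OF L] by blast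
 show "(\<lambda>y. 0) \<in> weighted_ideal X L E w x" by (rule weighted_ideal_zero[OF X i open_cover_bundleD(1)[OF L i(1)]])
 show "(\<lambda>y. f y + g y) \<in> weighted_ideal X L E w x" if "f \<in> weighted_ideal X L E w x" "g \<in> weighted_ideal X L E w x" for f g
  by (rule weighted_ideal_add[OF X w i that])
qed (auto intro: weighted_ideal_uminus[OF X] weighted_ideal_cong[OF X])

lemma ideal_family_structure_sheaf:
 assumes X: "complex_manifold X"
 shows "ideal_family (structure_sheaf X)"
 unfolding ideal_family_def
proof (intro allI conjI ballI impI)
 fix x
 show "(\<lambda>y. 0) \<in> structure_sheaf X x" by (auto simp: structure_sheaf_def intro: hol_on_const exI[of _ UNIV])
next
 fix x f g assume "f \<in> structure_sheaf X x" "g \<in> structure_sheaf X x"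
 then obtain V W where "open V" "x \<in> V" "hol_on X V f" "open W" "x \<in> W" "hol_on X W g"
  unfolding structure_sheaf_def mem_Collect_eq by (elim exE conjE) (rule that; assumption)
 then show "(\<lambda>y. f y + g y) \<in> structure_sheaf X x"
  unfolding structure_sheaf_def mem_Collect_eq
  by (intro exI[of _ "V \<inter> W"] conjI hol_on_add) (auto intro: hol_on_subset)
next
 fix x f assume "f \<in> structure_sheaf X x"
 then show "(\<lambda>y. - f y) \<in> structure_sheaf X x"
  unfolding structure_sheaf_def mem_Collect_eq by (elim exE conjE) (intro exI conjI hol_on_uminus; assumption)
next
 fix x f g W assume "f \<in> structure_sheaf X x" and W: "open W" "x \<in> W" "\<forall>y\<in>W. f y = g y"
 then obtain V where V: "open V" "x \<in> V" "hol_on X V f"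
  unfolding structure_sheaf_def mem_Collect_eq by (elim exE conjE) (rule that; assumption)
 have o: "open (V \<inter> W)" using V W by blast
 have "hol_on X (V \<inter> W) g" by (rule hol_on_cong[OF X hol_on_subset[OF V(3)] o]) (use W(3) in auto)
 then show "g \<in> structure_sheaf X x" unfolding structure_sheaf_def mem_Collect_eq using o V W by blast
qed

definition twisted_sections ::
  "('a::t2_space, 'n::finite) chart set => ('a, 'i) line_bundle => 'a ideal_sheaf => 'a set => ('i => 'a => complex) set" where
 "twisted_sections X L J U = {t \<in> hol_sections X L U. \<forall>i\<in>idx L. \<forall>x\<in>U \<inter> dom L i. t i \<in> J x}"

lemma twisted_eq: "twisted X L J = fun_presheaf (twisted_sections X L J)"
 by (simp add: twisted_def fun_presheaf_def twisted_sections_def restr_def[abs_def])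

lemma hol_sectionsI:
 assumes "\<And>i. i \<in> idx L ==> hol_on X (U \<inter> dom L i) (t i)"
  and "\<And>i j x. i \<in> idx L ==> j \<in> idx L ==> x \<in> U ==> x \<in> dom L i ==> x \<in> dom L j ==> t i x = trans L i j x * t j x"
  and "\<And>i x. \<not> (i \<in> idx L \<and> x \<in> U \<inter> dom L i) ==> t i x = 0"
 shows "t \<in> hol_sections X L U"
 unfolding hol_sections_def mem_Collect_eq
proof (intro conjI ballI allI impI)
 show "hol_on X (U \<inter> dom L i) (t i)" if "i \<in> idx L" for i by (rule assms(1)[OF that])
 show "t i x = trans L i j x * t j x" if "i \<in> idx L" "j \<in> idx L" "x \<in> U \<inter> dom L i \<inter> dom L j" for i j x
  by (rule assms(2)[OF that(1,2)]) (use that(3) in simp_all)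
 show "t i x = 0" if "\<not> (i \<in> idx L \<and> x \<in> U \<inter> dom L i)" for i x by (rule assms(3)[OF that])
qed

lemma twisted_sectionsD:
 assumes "t \<in> twisted_sections X L J U"
 shows "t \<in> hol_sections X L U" "i \<in> idx L ==> x \<in> U ==> x \<in> dom L i ==> t i \<in> J x"
 using assms by (auto simp: twisted_sections_def)

lemma twisted_sectionsI:
 assumes "t \<in> hol_sections X L U" "\<And>i x. i \<in> idx L ==> x \<in> U ==> x \<in> dom L i ==> t i \<in> J x"
 shows "t \<in> twisted_sections X L J U"
 using assms by (auto simp: twisted_sections_def)

lemma section_family_twisted:
 assumes X: "complex_manifold X" and L: "open_cover_bundle L" and J: "ideal_family J"
 shows "section_family (twisted_sections X L J)"
proof (rule section_family.intro)
 fix U :: "'a set" assume U: "open U"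
 show "(\<lambda>i x. 0) \<in> twisted_sections X L J U"
  by (intro twisted_sectionsI hol_sectionsI) (auto simp: hol_on_const ideal_familyD(1)[OF J])
 fix t assume t: "t \<in> twisted_sections X L J U"
 note th = twisted_sectionsD(1)[OF t] and tJ = twisted_sectionsD(2)[OF t]
 show "(\<lambda>i x. t i x + u i x) \<in> twisted_sections X L J U" if u: "u \<in> twisted_sections X L J U" for u
 proof (intro twisted_sectionsI hol_sectionsI)
  note uh = twisted_sectionsD(1)[OF u]
  show "hol_on X (U \<inter> dom L i) (\<lambda>x. t i x + u i x)" if "i \<in> idx L" for i
   by (intro hol_on_add hol_sectionsD(1)[OF th that] hol_sectionsD(1)[OF uh that])
  show "t i x + u i x = trans L i j x * (t j x + u j x)"
   if "i \<in> idx L" "j \<in> idx L" "x \<in> U" "x \<in> dom L i" "x \<in> dom L j" for i j x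
   using hol_sectionsD(2)[OF th that] hol_sectionsD(2)[OF uh that] by (simp add: distrib_left)
  show "t i x + u i x = 0" if "\<not> (i \<in> idx L \<and> x \<in> U \<inter> dom L i)" for i x
   using hol_sectionsD(3)[OF th that] hol_sectionsD(3)[OF uh that] by simp
  show "(\<lambda>x. t i x + u i x) \<in> J x" if "i \<in> idx L" "x \<in> U" "x \<in> dom L i" for i x
   by (rule ideal_familyD(2)[OF J tJ[OF that] twisted_sectionsD(2)[OF u that]])
 qed
 show "(\<lambda>i x. - t i x) \<in> twisted_sections X L J U"
 proof (intro twisted_sectionsI hol_sectionsI)
  show "hol_on X (U \<inter> dom L i) (\<lambda>x. - t i x)" if "i \<in> idx L" for i
   by (intro hol_on_uminus hol_sectionsD(1)[OF th that])
  show "- t i x = trans L i j x * - t j x"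
   if "i \<in> idx L" "j \<in> idx L" "x \<in> U" "x \<in> dom L i" "x \<in> dom L j" for i j x
   using hol_sectionsD(2)[OF th that] by simp
  show "- t i x = 0" if "\<not> (i \<in> idx L \<and> x \<in> U \<inter> dom L i)" for i x
   using hol_sectionsD(3)[OF th that] by simp
  show "(\<lambda>x. - t i x) \<in> J x" if "i \<in> idx L" "x \<in> U" "x \<in> dom L i" for i x
   by (rule ideal_familyD(3)[OF J tJ[OF that]])
 qed
 show "t i x = 0" if "x \<notin> U" for i x using hol_sectionsD(3)[OF th, of i x] that by blast
 show "restr V t \<in> twisted_sections X L J V" if V: "open V" "V \<subseteq> U" for V
 proof (intro twisted_sectionsI hol_sectionsI)
  show "hol_on X (V \<inter> dom L i) (restr V t i)" if i: "i \<in> idx L" for i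
  proof (rule hol_on_cong[OF X hol_on_subset[OF hol_sectionsD(1)[OF th i]]])
   show "open (V \<inter> dom L i)" using V(1) open_cover_bundleD(1)[OF L i] by blast
  qed (use V(2) in \<open>auto simp: restr_def\<close>)
  show "restr V t i x = trans L i j x * restr V t j x"
   if "i \<in> idx L" "j \<in> idx L" "x \<in> V" "x \<in> dom L i" "x \<in> dom L j" for i j x
   using hol_sectionsD(2)[OF th that(1,2) _ that(4,5)] that(3) V(2) by (auto simp: restr_def)
  show "restr V t i x = 0" if "\<not> (i \<in> idx L \<and> x \<in> V \<inter> dom L i)" for i x
   using hol_sectionsD(3)[OF th, of i x] that by (auto simp: restr_def)
  show "restr V t i \<in> J x" if "i \<in> idx L" "x \<in> V" "x \<in> dom L i" for i x
  proof (rule ideal_familyD(4)[OF J tJ V(1)])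
   show "i \<in> idx L" "x \<in> U" "x \<in> dom L i" "x \<in> V" using that V(2) by auto
  qed (simp add: restr_def)
 qed
qed

text \<open>Membership in the subsheaf is a condition on stalks, so it can be checked
  locally.\<close>

lemma function_sheaf_pair_twisted:
 assumes X: "complex_manifold X" and L: "open_cover_bundle L" and J: "ideal_family J" "ideal_family J'"
  and sub: "\<And>x. J' x \<subseteq> J x"
 shows "function_sheaf_pair (twisted_sections X L J) (twisted_sections X L J')"
proof (rule function_sheaf_pair.intro[OF section_family_twisted[OF X L J(1)] section_family_twisted[OF X L J(2)]],
  rule function_sheaf_pair_axioms.intro)
 fix U :: "'a set" assume U: "open U"
 show "twisted_sections X L J' U \<subseteq> twisted_sections X L J U" using sub by (auto simp: twisted_sections_def)
 fix t assume t: "t \<in> twisted_sections X L J U"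
  and loc: "\<And>x. x \<in> U ==> \<exists>V. open V \<and> x \<in> V \<and> V \<subseteq> U \<and> restr V t \<in> twisted_sections X L J' V"
 show "t \<in> twisted_sections X L J' U"
 proof (rule twisted_sectionsI[OF twisted_sectionsD(1)[OF t]])
  fix i x assume x: "i \<in> idx L" "x \<in> U" "x \<in> dom L i"
  obtain V where V: "open V" "x \<in> V" "restr V t \<in> twisted_sections X L J' V" using loc[OF x(2)] by blast
  show "t i \<in> J' x"
   by (rule ideal_familyD(4)[OF J(2) twisted_sectionsD(2)[OF V(3) x(1) V(2) x(3)] V(1,2)]) (simp add: restr_def)
 qed
qed

lemma tensor_sec_hol_sections:
 assumes t: "t \<in> hol_sections X L U" and s: "s \<in> hol_sections X M UNIV"
 shows "tensor_sec s t \<in> hol_sections X (lb_tensor L M) U"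
proof (rule hol_sectionsI)
 fix ij assume ij: "ij \<in> idx (lb_tensor L M)"
 obtain i j where [simp]: "ij = (i, j)" by (cases ij)
 have i: "i \<in> idx L" "j \<in> idx M" using ij by auto
 show "hol_on X (U \<inter> dom (lb_tensor L M) ij) (tensor_sec s t ij)"
  unfolding tensor_sec_def
  by (simp, intro hol_on_mult hol_on_subset[OF hol_sectionsD(1)[OF t i(1)]] hol_on_subset[OF hol_sectionsD(1)[OF s i(2)]]) auto
 fix kl x assume kl: "kl \<in> idx (lb_tensor L M)" and x: "x \<in> U" "x \<in> dom (lb_tensor L M) ij" "x \<in> dom (lb_tensor L M) kl"
 obtain k l where [simp]: "kl = (k, l)" by (cases kl)
 have k: "k \<in> idx L" "l \<in> idx M" "x \<in> dom L i" "x \<in> dom M j" "x \<in> dom L k" "x \<in> dom M l" using kl x by auto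
 show "tensor_sec s t ij x = trans (lb_tensor L M) ij kl x * tensor_sec s t kl x"
  using hol_sectionsD(2)[OF t i(1) k(1) x(1) k(3,5)] hol_sectionsD(2)[OF s i(2) k(2) UNIV_I k(4,6)]
  by (simp add: tensor_sec_def)
next
 fix ij x assume n: "\<not> (ij \<in> idx (lb_tensor L M) \<and> x \<in> U \<inter> dom (lb_tensor L M) ij)"
 obtain i j where [simp]: "ij = (i, j)" by (cases ij)
 have "\<not> (i \<in> idx L \<and> x \<in> U \<inter> dom L i) \<or> \<not> (j \<in> idx M \<and> x \<in> UNIV \<inter> dom M j)" using n by auto
 then show "tensor_sec s t ij x = 0"
  using hol_sectionsD(3)[OF t, of i x] hol_sectionsD(3)[OF s, of j x] by (auto simp: tensor_sec_def)
qed

lemma tensor_sec_twisted: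
 assumes s: "s \<in> hol_sections X M UNIV" and t: "t \<in> twisted_sections X L J U"
  and mult: "\<And>x f j. f \<in> J x ==> j \<in> idx M ==> x \<in> dom M j ==> (\<lambda>y. f y * s j y) \<in> JM x"
 shows "tensor_sec s t \<in> twisted_sections X (lb_tensor L M) JM U"
proof (rule twisted_sectionsI[OF tensor_sec_hol_sections[OF twisted_sectionsD(1)[OF t] s]])
 fix ij x assume ij: "ij \<in> idx (lb_tensor L M)" "x \<in> U" "x \<in> dom (lb_tensor L M) ij"
 obtain i j where [simp]: "ij = (i, j)" by (cases ij)
 have i: "i \<in> idx L" "j \<in> idx M" "x \<in> dom L i" "x \<in> dom M j" using ij by auto
 show "tensor_sec s t ij \<in> JM x"
  using mult[OF twisted_sectionsD(2)[OF t i(1) ij(2) i(3)] i(2,4)] by (simp add: tensor_sec_def)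
qed

lemma presheaf_hom_fun:
 assumes "\<And>U t. open U ==> t \<in> S U ==> \<eta> U t \<in> S' U"
  and "\<And>U t u. open U ==> t \<in> S U ==> u \<in> S U ==> \<eta> U (\<lambda>i x. t i x + u i x) = (\<lambda>i x. \<eta> U t i x + \<eta> U u i x)"
  and "\<And>U V t. open U ==> open V ==> V \<subseteq> U ==> t \<in> S U ==> \<eta> V (restr V t) = restr V (\<eta> U t)"
 shows "presheaf_hom (fun_presheaf S) (fun_presheaf S') \<eta>"
proof (rule presheaf_homI)
 show "\<eta> U \<in> hom (Sec (fun_presheaf S) U) (Sec (fun_presheaf S') U)" if U: "open U" for U
  by (rule homI) (simp_all only: fun_presheaf_sel assms(1)[OF U] assms(2)[OF U])
 show "\<eta> V (Res (fun_presheaf S) U V t) = Res (fun_presheaf S') U V (\<eta> U t)"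
  if "open U" "open V" "V \<subseteq> U" "t \<in> carrier (Sec (fun_presheaf S) U)" for U V t
  using assms(3)[OF that(1-3)] that(4) by (simp only: fun_presheaf_sel)
qed

lemma presheaf_hom_tensor_sec:
 assumes s: "s \<in> hol_sections X M UNIV"
  and mult: "\<And>x f j. f \<in> J x ==> j \<in> idx M ==> x \<in> dom M j ==> (\<lambda>y. f y * s j y) \<in> JM x"
 shows "presheaf_hom (twisted X L J) (twisted X (lb_tensor L M) JM) (\<lambda>U. tensor_sec s)"
 unfolding twisted_eq
proof (rule presheaf_hom_fun)
 show "tensor_sec s t \<in> twisted_sections X (lb_tensor L M) JM U" if "t \<in> twisted_sections X L J U" for U t
  by (rule tensor_sec_twisted[OF s that mult])
qed (auto simp: tensor_sec_def restr_def fun_eq_iff distrib_right)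

text \<open>\<open>base\<close> and \<open>step\<close> are the inclusions of the kernels of \<mu>
  and \<nu> in those of \<iota> and \<tau>, written out for abstract ideals; stating the step at
  \<open>Suc \<sigma>\<close> avoids the subtraction in the index.\<close>

lemma twisted_kernel_induction:
 fixes X :: "('a::t2_space, 'n::finite) chart set"
 assumes X: "complex_manifold X" and comp: "compact (UNIV :: 'a set)"
  and L: "open_cover_bundle L" and M: "open_cover_bundle M" "s \<in> hol_sections X M UNIV"
  and id: "ideal_family I" "\<And>\<sigma>. ideal_family (J \<sigma>)" "ideal_family IM" "\<And>\<sigma>. ideal_family (JM \<sigma>)"
  and sub: "\<And>\<sigma> x. J \<sigma> x \<subseteq> J (Suc \<sigma>) x" "\<And>\<sigma> x. J \<sigma> x \<subseteq> I x" "\<And>\<sigma> x. JM \<sigma> x \<subseteq> IM x"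
  and mult: "\<And>x f j. f \<in> I x ==> j \<in> idx M ==> x \<in> dom M j ==> (\<lambda>y. f y * s j y) \<in> IM x"
   "\<And>\<sigma> x f j. f \<in> J \<sigma> x ==> j \<in> idx M ==> x \<in> dom M j ==> (\<lambda>y. f y * s j y) \<in> JM \<sigma> x"
 defines "P \<equiv> twisted X L I" and "Q \<equiv> \<lambda>\<sigma>. twisted X L (J \<sigma>)"
  and "PM \<equiv> twisted X (lb_tensor L M) IM" and "QM \<equiv> \<lambda>\<sigma>. twisted X (lb_tensor L M) (JM \<sigma>)"
 assumes base: "\<And>A. A \<in> carrier (cohomology q (Q 0)) ==>
   cohomology_map q PM (\<lambda>U. tensor_sec s) (cohomology_map q P (\<lambda>U t. t) A) = \<one>\<^bsub>cohomology q PM\<^esub> ==>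
   cohomology_map q P (\<lambda>U t. t) A = \<one>\<^bsub>cohomology q P\<^esub>"
  and step: "\<And>\<sigma> A. \<sigma> < N ==> A \<in> carrier (cohomology q (quotient_sheaf (Q (Suc \<sigma>)) (Q \<sigma>))) ==>
   cohomology_map q (quotient_sheaf PM (QM \<sigma>)) (quotient_sheaf_map PM (QM \<sigma>) (\<lambda>U. tensor_sec s))
    (cohomology_map q (quotient_sheaf P (Q \<sigma>)) (quotient_sheaf_map P (Q \<sigma>) (\<lambda>U t. t)) A) =
     \<one>\<^bsub>cohomology q (quotient_sheaf PM (QM \<sigma>))\<^esub> ==>
   cohomology_map q (quotient_sheaf P (Q \<sigma>)) (quotient_sheaf_map P (Q \<sigma>) (\<lambda>U t. t)) A =
    \<one>\<^bsub>cohomology q (quotient_sheaf P (Q \<sigma>))\<^esub>"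
  and c: "\<U> \<in> coverings" "c \<in> cocycles (Q N) \<U> q"
   "cohomology_map q PM (\<lambda>U. tensor_sec s) (cech_class P q \<U> c) = \<one>\<^bsub>cohomology q PM\<^esub>"
 shows "cech_class P q \<U> c = \<one>\<^bsub>cohomology q P\<^esub>"
proof -
 let ?S = "twisted_sections X L"
 have pair: "function_sheaf_pair (?S I) (?S (J \<sigma>))" "function_sheaf_pair (?S (J (Suc \<sigma>))) (?S (J \<sigma>))" for \<sigma>
  by (rule function_sheaf_pair_twisted[OF X L id(1,2) sub(2)], rule function_sheaf_pair_twisted[OF X L id(2,2) sub(1)])
 have pairM: "function_sheaf_pair (twisted_sections X (lb_tensor L M) IM) (twisted_sections X (lb_tensor L M) (JM \<sigma>))" for \<sigma>
  by (rule function_sheaf_pair_twisted[OF X open_cover_tensor[OF L M(1)] id(3,4) sub(3)])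
 have subM: "sub_presheaf PM (QM \<sigma>)" for \<sigma>
  unfolding PM_def QM_def twisted_eq by (rule function_sheaf_pair.sub_presheaf_fun[OF pairM])
 have \<eta>: "presheaf_hom P PM (\<lambda>U. tensor_sec s)"
  unfolding P_def PM_def by (rule presheaf_hom_tensor_sec[OF M(2) mult(1)])
 have Q_eq: "Q \<sigma> = twisted X L (J \<sigma>)" for \<sigma> by (simp add: Q_def)
 have "\<forall>\<U>\<in>coverings. \<forall>c\<in>cocycles (Q \<sigma>) \<U> q.
   cohomology_map q PM (\<lambda>U. tensor_sec s) (cech_class P q \<U> c) = \<one>\<^bsub>cohomology q PM\<^esub> \<longrightarrow>
   cech_class P q \<U> c = \<one>\<^bsub>cohomology q P\<^esub>" if "\<sigma> \<le> N" for \<sigma>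
  using that
 proof (induction \<sigma>)
  case 0
  show ?case
  proof (intro ballI impI)
   fix \<U> c assume c: "\<U> \<in> coverings" "c \<in> cocycles (Q 0) \<U> q"
    and one: "cohomology_map q PM (\<lambda>U. tensor_sec s) (cech_class P q \<U> c) = \<one>\<^bsub>cohomology q PM\<^esub>"
   interpret IJ: function_sheaf_pair "?S I" "?S (J 0)" by (rule pair)
   have Q0: "ab_presheaf (Q 0)" unfolding Q_def twisted_eq by (rule IJ.S'.ab_presheaf_fun)
   have inc: "presheaf_hom (Q 0) P (\<lambda>U t. t)" unfolding Q_def P_def twisted_eq by (rule IJ.presheaf_hom_inclusion)
   have abP: "ab_presheaf P" unfolding P_def twisted_eq by (rule IJ.ab_presheaf_fun)
   \<comment> \<open>The inclusion is the identity on cochains, so the class of \<open>c\<close> in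
     \<open>P\<close> is the image of its class in \<open>Q 0\<close>, to which \<open>base\<close>
     refers.\<close>
   have "cochain_map (\<lambda>xs t. t) q c = c"
    by (rule IJ.cochain_map_inclusion[OF ab_presheaf.cocycles_cochains[OF Q0 c(2)]])
   then have eq: "cohomology_map q P (\<lambda>U t. t) (cech_class (Q 0) q \<U> c) = cech_class P q \<U> c"
    using cohomology_map_class[OF Q0 abP inc c] by simp
   have "cech_class (Q 0) q \<U> c \<in> carrier (cohomology q (Q 0))"
    using c ab_presheaf.carrier_cohomology[OF Q0] by blast
   from base[OF this] show "cech_class P q \<U> c = \<one>\<^bsub>cohomology q P\<^esub>" using one unfolding eq by blast
  qed
 next
  case (Suc \<sigma>)
  show ?case
  proof (intro ballI impI)
   fix \<U> c assume c: "\<U> \<in> coverings" "c \<in> cocycles (Q (Suc \<sigma>)) \<U> q"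
    and one: "cohomology_map q PM (\<lambda>U. tensor_sec s) (cech_class P q \<U> c) = \<one>\<^bsub>cohomology q PM\<^esub>"
   show "cech_class P q \<U> c = \<one>\<^bsub>cohomology q P\<^esub>"
   proof (rule kernel_induction_step[OF comp pair(1)[of \<sigma>] pair(2)[of \<sigma>] pair(1)[of "Suc \<sigma>"] subM[of \<sigma>],
      where \<eta> = "\<lambda>U. tensor_sec s", folded twisted_eq, folded P_def Q_eq])
    show "presheaf_hom P PM (\<lambda>U. tensor_sec s)" by (rule \<eta>)
    show "tensor_sec s t \<in> carrier (Sec (QM \<sigma>) U)" if "t \<in> ?S (J \<sigma>) U" for U t
     unfolding QM_def twisted_eq fun_presheaf_sel by (rule tensor_sec_twisted[OF M(2) that mult(2)])
    show "cech_class P q \<U> c = \<one>\<^bsub>cohomology q P\<^esub>"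
     if "\<U> \<in> coverings" "c \<in> cocycles (Q \<sigma>) \<U> q"
      "cohomology_map q PM (\<lambda>U. tensor_sec s) (cech_class P q \<U> c) = \<one>\<^bsub>cohomology q PM\<^esub>" for \<U> c
     using Suc.IH[OF Suc_leD[OF Suc.prems]] that by blast
    show "cohomology_map q (quotient_sheaf P (Q \<sigma>)) (quotient_sheaf_map P (Q \<sigma>) (\<lambda>U t. t)) A =
      \<one>\<^bsub>cohomology q (quotient_sheaf P (Q \<sigma>))\<^esub>"
     if "A \<in> carrier (cohomology q (quotient_sheaf (Q (Suc \<sigma>)) (Q \<sigma>)))"
      "cohomology_map q (quotient_sheaf PM (QM \<sigma>)) (quotient_sheaf_map PM (QM \<sigma>) (\<lambda>U. tensor_sec s))
       (cohomology_map q (quotient_sheaf P (Q \<sigma>)) (quotient_sheaf_map P (Q \<sigma>) (\<lambda>U t. t)) A) =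
        \<one>\<^bsub>cohomology q (quotient_sheaf PM (QM \<sigma>))\<^esub>" for A
     using step[of \<sigma> A] that Suc.prems by simp
   qed (rule c one)+
  qed
 qed
 then show ?thesis using c by blast
qed

section \<open>The multiplication maps\<close>

locale snc_pair =
 fixes X :: "('a::t2_space, 'n::finite) chart set" and D :: "'a set set"
  and LD :: "('a, 'd) line_bundle" and sD :: "'d => 'a => complex" and \<phi>Dsm :: "'d => 'a => ereal"
  and F :: "('a, 'f) line_bundle" and \<phi>F :: "'f => 'a => ereal"
  and M :: "('a, 'm) line_bundle" and \<phi>M :: "'m => 'a => ereal"
  and s :: "'m => 'a => complex" and \<psi> :: "'a => ereal"
 assumes X: "complex_manifold X" "compact (UNIV :: 'a set)"
  and D: "snc_divisor X D" "holomorphic_line_bundle X LD" "canonical_section X D LD sD"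
  and psi: "smooth_potential X LD \<phi>Dsm" "\<psi> = psi_D LD sD \<phi>Dsm" "\<forall>x. \<psi> x \<le> - 1"
  and F: "holomorphic_line_bundle X F" "potential X F \<phi>F"
  and M: "holomorphic_line_bundle X M" "potential X M \<phi>M"
  and neat: "neat_analytic_sing X F \<phi>F" "neat_analytic_sing X M \<phi>M"
  and snc: "snc_with_polar_sets X D F \<phi>F M \<phi>M"
  and s: "s \<in> hol_sections X M UNIV" "sup_norm_sq M \<phi>M s < \<infinity>"
begin

abbreviation "IF \<equiv> multiplier_ideal X F \<phi>F"
abbreviation "IFM \<equiv> multiplier_ideal X (lb_tensor F M) (tensor_pot \<phi>F \<phi>M)"
abbreviation "JF \<equiv> adjoint_ideal X \<psi> F \<phi>F"
abbreviation "JFM \<equiv> adjoint_ideal X \<psi> (lb_tensor F M) (tensor_pot \<phi>F \<phi>M)"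

lemma nice_F: "nice_pot F \<phi>F"
 by (rule potential_nice[OF X(1) F neat(1)])

lemma nice_M: "nice_pot M \<phi>M"
 by (rule potential_nice[OF X(1) M neat(2)])

lemma nice_FM: "nice_pot (lb_tensor F M) (tensor_pot \<phi>F \<phi>M)"
 by (rule nice_pot_tensor[OF nice_F nice_M])

lemma nice: "nice_psi \<psi>"
 using nice_psi_D[OF X(1) D(2) _ psi(1)] psi(2,3) D(3) by (simp add: canonical_section_def)

lemma covers:
 "open_cover_bundle F" "open_cover_bundle M" "open_cover_bundle (lb_tensor F M)" "open_cover_bundle (KDF X LD F)"
 using open_cover_line_bundle[OF F(1)] open_cover_line_bundle[OF M(1)] open_cover_line_bundle[OF D(2)]
  open_cover_canonical[OF X(1)]
 by (auto simp: KDF_def intro!: open_cover_tensor)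

lemma local_snc_coordinates:
 obtains V z S where "hol_coords X (V, z)" "x \<in> V" "\<Union>D \<inter> V = {y\<in>V. (\<Prod>k\<in>S. z y $ k) = 0}"
  "pot_snc_on X F \<phi>F (V, z) S"
 using snc[unfolded snc_with_polar_sets_def, THEN conjunct2, THEN conjunct2, THEN spec, of x]
 by (elim exE conjE) (rule that; assumption)

lemma adjoint_le_multiplier:
 assumes L: "open_cover_bundle L" "nice_pot L \<phi>"
 shows "adjoint_ideal X \<psi> L \<phi> \<sigma> x \<subseteq> multiplier_ideal X L \<phi> x"
proof -
 obtain V z S where V: "hol_coords X (V, z)" "x \<in> V" "\<Union>D \<inter> V = {y\<in>V. (\<Prod>k\<in>S. z y $ k) = 0}"
  by (rule local_snc_coordinates)
 obtain W where W: "open W" "x \<in> W" "\<forall>y\<in>W. psi_D LD sD \<phi>Dsm y = - \<infinity> \<longleftrightarrow> (\<Prod>k\<in>S. z y $ k) = 0"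
  by (rule divisor_local_bounds[OF X(1) D(2,3) psi(1) V])
 obtain i where i: "i \<in> idx L" "x \<in> dom L i" using open_cover_bundleD(2)[OF L(1)] by blast
 show ?thesis
 proof (rule adjoint_subset_multiplier[OF X(1) L(2) nice i V(1) _ W(1,2)])
  show "negligible (snd (V, z) ` ({y \<in> W. \<psi> y = - \<infinity>} \<inter> fst (V, z)))"
   by (rule negligible_coordinate_product[where S = S]) (use W(3) psi(2) in auto)
 qed (use V(2) in simp)
qed

lemma adjoint_le_Suc:
 assumes L: "open_cover_bundle L" "nice_pot L \<phi>"
 shows "adjoint_ideal X \<psi> L \<phi> \<sigma> x \<subseteq> adjoint_ideal X \<psi> L \<phi> (Suc \<sigma>) x"
proof -
 obtain i where i: "i \<in> idx L" "x \<in> dom L i" using open_cover_bundleD(2)[OF L(1)] by blast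
 show ?thesis by (rule adjoint_ideal_mono[OF X(1) L(2) nice i]) simp
qed

text \<open>At every point at most \<open>sigma_mlc\<close> coordinates of \<open>S\<close> vanish:
  there are no more of them than components of D through the point. So
  \<open>multiplier_subset_adjoint\<close> applies with this index.\<close>

lemma adjoint_mlc: "JF (sigma_mlc X D) = IF"
proof (intro ext subset_antisym)
 fix x
 show "JF (sigma_mlc X D) x \<subseteq> IF x"
  by (rule adjoint_le_multiplier[OF covers(1) nice_F])
 obtain V z S where V: "hol_coords X (V, z)" "x \<in> V" "\<Union>D \<inter> V = {y\<in>V. (\<Prod>k\<in>S. z y $ k) = 0}"
  "pot_snc_on X F \<phi>F (V, z) S"
  by (rule local_snc_coordinates)
 have "card {k\<in>S. z x $ k = 0} \<le> sigma_mlc X D"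
  using card_hyperplanes_le[OF X(1) D(1) V(1-3)] card_components_le_sigma_mlc[OF X(1) D(1), of x] by linarith
 then show "IF x \<subseteq> JF (sigma_mlc X D) x"
  by (rule multiplier_subset_adjoint[OF X(1) D(2,3) psi(1) nice psi(2) nice_F V])
qed

lemma ideal_families:
 assumes L: "open_cover_bundle L" "nice_pot L \<phi>"
 shows "ideal_family (multiplier_ideal X L \<phi>)" "ideal_family (adjoint_ideal X \<psi> L \<phi> \<sigma>)"
 unfolding multiplier_ideal_eq adjoint_ideal_eq
 by (rule ideal_family_weighted[OF X(1) L(1)], rule good_weight_multiplier[OF L(2)] good_weight_adjoint[OF L(2) nice])+

lemma multiplier_times_section:
 assumes f: "f \<in> IF x" and j: "j \<in> idx M" "x \<in> dom M j"
 shows "(\<lambda>y. f y * s j y) \<in> IFM x"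
proof -
 obtain i where i: "i \<in> idx F" "x \<in> dom F i" using open_cover_bundleD(2)[OF covers(1)] by blast
 have h: "hol_on X (dom M j) (s j)" using hol_sectionsD(1)[OF s(1) j(1)] by simp
 show ?thesis
  using weighted_ideal_times_section[OF X(1) nice_F nice_M open_cover_bundleD(1)[OF covers(2) j(1)] i j h s(2),
    where q = "\<lambda>_ _. 1" and E = "{1}" and f = f]
   good_weight_multiplier[OF nice_F] good_weight_multiplier[OF nice_FM] f
  by (simp add: multiplier_ideal_eq)
qed

lemma adjoint_times_section:
 assumes f: "f \<in> JF \<sigma> x" and j: "j \<in> idx M" "x \<in> dom M j"
 shows "(\<lambda>y. f y * s j y) \<in> JFM \<sigma> x"
proof -
 obtain i where i: "i \<in> idx F" "x \<in> dom F i" using open_cover_bundleD(2)[OF covers(1)] by blast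
 have h: "hol_on X (dom M j) (s j)" using hol_sectionsD(1)[OF s(1) j(1)] by simp
 show ?thesis unfolding adjoint_ideal_eq
  by (rule weighted_ideal_times_section[OF X(1) nice_F nice_M open_cover_bundleD(1)[OF covers(2) j(1)] i j h s(2)
     psi_weight_nonneg good_weight_adjoint[OF nice_F nice] good_weight_adjoint[OF nice_FM nice] f[unfolded adjoint_ideal_eq]])
qed

definition kernels_equal :: "nat => bool" where
 "kernels_equal q \<longleftrightarrow> ker_mu X LD \<psi> F \<phi>F M \<phi>M s 0 q = ker_iota X LD \<psi> F \<phi>F 0 q \<and>
  (\<forall>\<sigma>\<in>{1..sigma_mlc X D}. ker_nu X LD \<psi> F \<phi>F M \<phi>M s \<sigma> q = ker_tau X LD \<psi> F \<phi>F \<sigma> q)"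

lemma sh_J_mlc: "sh_J X LD \<psi> F \<phi>F (sigma_mlc X D) = sh_I X LD F \<phi>F"
 by (simp only: sh_J_def sh_I_def adjoint_mlc)

lemma ab_presheaf_sh: "ab_presheaf (sh_I X LD F \<phi>F)" "ab_presheaf (sh_IM X LD F \<phi>F M \<phi>M)"
 unfolding sh_I_def sh_IM_def twisted_eq
 by (intro section_family.ab_presheaf_fun section_family_twisted[OF X(1)] covers open_cover_tensor
   ideal_families(1)[OF covers(1) nice_F] ideal_families(1)[OF covers(3) nice_FM])+

lemma presheaf_hom_mult: "presheaf_hom (sh_I X LD F \<phi>F) (sh_IM X LD F \<phi>F M \<phi>M) (\<lambda>U. tensor_sec s)"
 unfolding sh_I_def sh_IM_def by (rule presheaf_hom_tensor_sec[OF s(1) multiplier_times_section])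

text \<open>The induction is run up to \<open>sigma_mlc\<close>, where cocycles of the adjoint ideal
  sheaf are those of the multiplier ideal sheaf, so that every cocycle is reached.\<close>

lemma class_one:
 assumes ker: "kernels_equal q" and c: "\<U> \<in> coverings" "c \<in> cocycles (sh_I X LD F \<phi>F) \<U> q"
  and one: "cech_class (sh_IM X LD F \<phi>F M \<phi>M) q \<U> (cochain_map (\<lambda>xs. tensor_sec s) q c) =
   \<one>\<^bsub>cohomology q (sh_IM X LD F \<phi>F M \<phi>M)\<^esub>"
 shows "cech_class (sh_I X LD F \<phi>F) q \<U> c = \<one>\<^bsub>cohomology q (sh_I X LD F \<phi>F)\<^esub>"
 unfolding sh_I_def
proof (rule twisted_kernel_induction[where J = "JF" and N = "sigma_mlc X D" and s = s and M = M
   and JM = "JFM"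
   and IM = "IFM", OF X covers(4) covers(2) s(1)])
 show "ideal_family IF" "ideal_family (JF \<sigma>)" for \<sigma>
  by (rule ideal_families[OF covers(1) nice_F])+
 show "ideal_family IFM"
   "ideal_family (JFM \<sigma>)" for \<sigma>
  by (rule ideal_families[OF covers(3) nice_FM])+
 show "JF \<sigma> x \<subseteq> JF (Suc \<sigma>) x" for \<sigma> x
  by (rule adjoint_le_Suc[OF covers(1) nice_F])
 show "JF \<sigma> x \<subseteq> IF x" for \<sigma> x
  by (rule adjoint_le_multiplier[OF covers(1) nice_F])
 show "JFM \<sigma> x \<subseteq> IFM x" for \<sigma> x
  by (rule adjoint_le_multiplier[OF covers(3) nice_FM])
 show "(\<lambda>y. f y * s j y) \<in> IFM x"
  if "f \<in> IF x" "j \<in> idx M" "x \<in> dom M j" for f j x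
  by (rule multiplier_times_section[OF that])
 show "(\<lambda>y. f y * s j y) \<in> JFM \<sigma> x"
  if "f \<in> JF \<sigma> x" "j \<in> idx M" "x \<in> dom M j" for f j x \<sigma>
  by (rule adjoint_times_section[OF that])
next
 fix A assume A: "A \<in> carrier (cohomology q (twisted X (KDF X LD F) (JF 0)))"
  and 1: "cohomology_map q (twisted X (lb_tensor (KDF X LD F) M) IFM) (\<lambda>U. tensor_sec s)
   (cohomology_map q (twisted X (KDF X LD F) IF) (\<lambda>U t. t) A) =
   \<one>\<^bsub>cohomology q (twisted X (lb_tensor (KDF X LD F) M) IFM)\<^esub>"
 from A 1 have "A \<in> ker_mu X LD \<psi> F \<phi>F M \<phi>M s 0 q"
  unfolding ker_mu_def kernel_def mu_def mult_map_def iota_def sh_I_def sh_IM_def sh_J_def comp_apply by blast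
 then have "A \<in> ker_iota X LD \<psi> F \<phi>F 0 q" using ker unfolding kernels_equal_def by blast
 then show "cohomology_map q (twisted X (KDF X LD F) IF) (\<lambda>U t. t) A =
   \<one>\<^bsub>cohomology q (twisted X (KDF X LD F) IF)\<^esub>"
  unfolding ker_iota_def kernel_def iota_def sh_I_def by blast
next
 fix \<sigma> A assume \<sigma>: "\<sigma> < sigma_mlc X D"
 let ?P = "twisted X (KDF X LD F) IF" and ?Q = "\<lambda>\<sigma>. twisted X (KDF X LD F) (JF \<sigma>)"
 let ?PM = "twisted X (lb_tensor (KDF X LD F) M) IFM"
  and ?QM = "twisted X (lb_tensor (KDF X LD F) M) (JFM \<sigma>)"
 assume A: "A \<in> carrier (cohomology q (quotient_sheaf (?Q (Suc \<sigma>)) (?Q \<sigma>)))"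
  and 1: "cohomology_map q (quotient_sheaf ?PM ?QM) (quotient_sheaf_map ?PM ?QM (\<lambda>U. tensor_sec s))
    (cohomology_map q (quotient_sheaf ?P (?Q \<sigma>)) (quotient_sheaf_map ?P (?Q \<sigma>) (\<lambda>U t. t)) A) =
     \<one>\<^bsub>cohomology q (quotient_sheaf ?PM ?QM)\<^esub>"
 from A 1 have "A \<in> ker_nu X LD \<psi> F \<phi>F M \<phi>M s (Suc \<sigma>) q"
  unfolding ker_nu_def kernel_def nu_def tau_def sh_I_def sh_IM_def sh_J_def sh_JM_def sh_R_def sh_IQ_def sh_IMQ_def
   comp_apply diff_Suc_1 by blast
 moreover have "Suc \<sigma> \<in> {1..sigma_mlc X D}" using \<sigma> by simp
 ultimately have "A \<in> ker_tau X LD \<psi> F \<phi>F (Suc \<sigma>) q" using ker unfolding kernels_equal_def by blast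
 then show "cohomology_map q (quotient_sheaf ?P (?Q \<sigma>)) (quotient_sheaf_map ?P (?Q \<sigma>) (\<lambda>U t. t)) A =
    \<one>\<^bsub>cohomology q (quotient_sheaf ?P (?Q \<sigma>))\<^esub>"
  unfolding ker_tau_def kernel_def tau_def sh_I_def sh_J_def sh_IQ_def diff_Suc_1 by blast
next
 show "\<U> \<in> coverings" by (rule c(1))
 show "c \<in> cocycles (twisted X (KDF X LD F) (JF (sigma_mlc X D))) \<U> q"
  using c(2) by (simp only: adjoint_mlc sh_I_def)
 show "cohomology_map q (twisted X (lb_tensor (KDF X LD F) M) IFM)
   (\<lambda>U. tensor_sec s) (cech_class (twisted X (KDF X LD F) IF) q \<U> c) =
   \<one>\<^bsub>cohomology q (twisted X (lb_tensor (KDF X LD F) M) IFM)\<^esub>"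
  using one cohomology_map_class[OF ab_presheaf_sh presheaf_hom_mult c] by (simp only: sh_I_def sh_IM_def)
qed

lemma inj_on_mult_map:
 assumes "kernels_equal q"
 shows "inj_on (mult_map X LD F \<phi>F M \<phi>M s q) (carrier (cohomology q (sh_I X LD F \<phi>F)))"
 unfolding mult_map_def
 by (rule inj_on_cohomology_map[OF ab_presheaf_sh presheaf_hom_mult]) (rule class_one[OF assms])

text \<open>A map induced by the identity fixes every class. At the last index source and target of
  \<iota> coincide, so \<mu> agrees there with the multiplication map.\<close>

lemma iota_class:
 assumes "A \<in> carrier (cohomology q (sh_I X LD F \<phi>F))"
 shows "iota X LD F \<phi>F q A = A"
proof -
 obtain \<U> c where c: "\<U> \<in> coverings" "c \<in> cocycles (sh_I X LD F \<phi>F) \<U> q" "A = cech_class (sh_I X LD F \<phi>F) q \<U> c"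
  using assms ab_presheaf.carrier_cohomology[OF ab_presheaf_sh(1)] by blast
 have id: "presheaf_hom (sh_I X LD F \<phi>F) (sh_I X LD F \<phi>F) (\<lambda>U t. t)"
  by (rule presheaf_homI) (simp_all add: hom_def)
 have "cochain_map (\<lambda>xs t. t) q c = c"
  using ab_presheaf.cocycles_cochains[OF ab_presheaf_sh(1) c(2)] by (auto simp: cochain_map_def carrier_cochains)
 then show ?thesis
  unfolding iota_def c(3) using cohomology_map_class[OF ab_presheaf_sh(1,1) id c(1,2)] by simp
qed

lemma inj_on_mu:
 assumes "kernels_equal q"
 shows "inj_on (mu X LD F \<phi>F M \<phi>M s q) (carrier (cohomology q (sh_J X LD \<psi> F \<phi>F (sigma_mlc X D))))"
 unfolding sh_J_mlc
proof -
 have "inj_on (mu X LD F \<phi>F M \<phi>M s q) (carrier (cohomology q (sh_I X LD F \<phi>F))) \<longleftrightarrow>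
   inj_on (mult_map X LD F \<phi>F M \<phi>M s q) (carrier (cohomology q (sh_I X LD F \<phi>F)))"
  by (rule inj_on_cong) (simp add: mu_def iota_class)
 then show "inj_on (mu X LD F \<phi>F M \<phi>M s q) (carrier (cohomology q (sh_I X LD F \<phi>F)))"
  using inj_on_mult_map[OF assms] by blast
qed

end

section \<open>Transport along an isomorphism of M with a power of F\<close>

lemma hol_on_local:
 assumes "\<And>x. x \<in> V ==> \<exists>W. open W \<and> x \<in> W \<and> hol_on X W f"
 shows "hol_on X V f"
 unfolding hol_on_def holo_on_def
proof (intro ballI)
 fix \<k> w assume k: "\<k> \<in> X" and w: "w \<in> snd \<k> ` (V \<inter> fst \<k>)"
 then obtain x where x: "x \<in> V" "x \<in> fst \<k>" "w = snd \<k> x" by blast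
 obtain W where W: "x \<in> W" "hol_on X W f" using assms[OF x(1)] by blast
 then have "holo_on (snd \<k> ` (W \<inter> fst \<k>)) (in_chart \<k> f)" using k by (simp add: hol_on_def)
 then show "\<exists>f'. (in_chart \<k> f has_derivative f') (at w) \<and> (\<forall>c v. f' (c *s v) = c * f' v)"
  using x W(1) unfolding holo_on_def by blast
qed

lemma lb_power_sel [simp]:
 "idx (lb_power L m) = idx L" "dom (lb_power L m) = dom L" "trans (lb_power L m) i j x = trans L i j x ^ m"
 by (simp_all add: lb_power_def)

lemma lb_isoD:
 assumes "lb_iso X L L' \<theta>" "i \<in> idx L" "j \<in> idx L'"
 shows "hol_on X (dom L i \<inter> dom L' j) (\<theta> i j)"
  and "x \<in> dom L i ==> x \<in> dom L' j ==> \<theta> i j x \<noteq> 0"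
  and "i' \<in> idx L ==> x \<in> dom L i ==> x \<in> dom L i' ==> x \<in> dom L' j ==> \<theta> i' j x = \<theta> i j x * trans L i i' x"
  and "j' \<in> idx L' ==> x \<in> dom L i ==> x \<in> dom L' j ==> x \<in> dom L' j' ==> \<theta> i j' x = trans L' j' j x * \<theta> i j x"
 using assms(1)[unfolded lb_iso_def, THEN bspec, OF assms(2), THEN bspec, OF assms(3)] by simp_all

text \<open>Under a change of the index \<open>i\<close> the factors of \<open>\<theta>\<close> and
  of \<open>s\<close> compensate each other, so the choice in \<open>lb_iso_sec\<close> is
  immaterial.\<close>

lemma lb_iso_sec_eq:
 assumes \<theta>: "lb_iso X L L' \<theta>" and s: "s \<in> hol_sections X L UNIV" and i: "i \<in> idx L" "x \<in> dom L i" and j: "j \<in> idx L'" "x \<in> dom L' j"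
 shows "lb_iso_sec L L' \<theta> s j x = \<theta> i j x * s i x"
proof -
 define k where "k = (SOME i. i \<in> idx L \<and> x \<in> dom L i)"
 have k: "k \<in> idx L" "x \<in> dom L k" using someI[of "\<lambda>i. i \<in> idx L \<and> x \<in> dom L i" i] i by (auto simp: k_def)
 have "lb_iso_sec L L' \<theta> s j x = \<theta> k j x * s k x" using j by (simp add: lb_iso_sec_def k_def[symmetric])
 also have "\<dots> = \<theta> i j x * (trans L i k x * s k x)"
  using lb_isoD(3)[OF \<theta> i(1) j(1) k(1) i(2) k(2) j(2)] by simp
 also have "trans L i k x * s k x = s i x" using hol_sectionsD(2)[OF s i(1) k(1) UNIV_I i(2) k(2)] by simp
 finally show ?thesis .
qed

lemma lb_iso_sec_hol_sections:
 assumes X: "complex_manifold X" and L: "open_cover_bundle L" "open_cover_bundle L'"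
  and \<theta>: "lb_iso X L L' \<theta>" and s: "s \<in> hol_sections X L UNIV"
 shows "lb_iso_sec L L' \<theta> s \<in> hol_sections X L' UNIV"
proof (rule hol_sectionsI)
 fix j assume j: "j \<in> idx L'"
 show "hol_on X (UNIV \<inter> dom L' j) (lb_iso_sec L L' \<theta> s j)"
 proof (rule hol_on_local)
  fix x assume "x \<in> UNIV \<inter> dom L' j"
  then have xj: "x \<in> dom L' j" by simp
  obtain i where i: "i \<in> idx L" "x \<in> dom L i" using open_cover_bundleD(2)[OF L(1)] by blast
  have o: "open (dom L i \<inter> dom L' j)" using open_cover_bundleD(1)[OF L(1) i(1)] open_cover_bundleD(1)[OF L(2) j] by blast
  have "hol_on X (dom L i \<inter> dom L' j) (lb_iso_sec L L' \<theta> s j)"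
  proof (rule hol_on_cong[OF X _ o])
   show "hol_on X (dom L i \<inter> dom L' j) (\<lambda>x. \<theta> i j x * s i x)"
    by (intro hol_on_mult lb_isoD(1)[OF \<theta> i(1) j] hol_on_subset[OF hol_sectionsD(1)[OF s i(1)]]) auto
   show "\<theta> i j y * s i y = lb_iso_sec L L' \<theta> s j y" if "y \<in> dom L i \<inter> dom L' j" for y
    using lb_iso_sec_eq[OF \<theta> s i(1) _ j, of y] that by simp
  qed
  then show "\<exists>W. open W \<and> x \<in> W \<and> hol_on X W (lb_iso_sec L L' \<theta> s j)" using o i xj by blast
 qed
 fix j' x assume j': "j' \<in> idx L'" and x: "x \<in> dom L' j" "x \<in> dom L' j'"
 obtain i where i: "i \<in> idx L" "x \<in> dom L i" using open_cover_bundleD(2)[OF L(1)] by blast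
 show "lb_iso_sec L L' \<theta> s j x = trans L' j j' x * lb_iso_sec L L' \<theta> s j' x"
  using lb_isoD(4)[OF \<theta> i(1) j' j i(2) x(2,1)]
  by (simp add: lb_iso_sec_eq[OF \<theta> s i j x(1)] lb_iso_sec_eq[OF \<theta> s i j' x(2)])
qed (auto simp: lb_iso_sec_def)

lemma twisted_structure_sheaf_sections:
 assumes L: "open_cover_bundle L" and t: "t \<in> hol_sections X L U" and U: "open U"
 shows "t \<in> twisted_sections X L (structure_sheaf X) U"
proof (rule twisted_sectionsI[OF t])
 fix i x assume i: "i \<in> idx L" "x \<in> U" "x \<in> dom L i"
 have "open (U \<inter> dom L i)" using U open_cover_bundleD(1)[OF L i(1)] by blast
 then show "t i \<in> structure_sheaf X x"
  unfolding structure_sheaf_def mem_Collect_eq using hol_sectionsD(1)[OF t i(1)] i by blast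
qed

lemma tensor_sec_power_hol_sections:
 assumes t: "t \<in> hol_sections X (lb_tensor K F) U" and s: "s \<in> hol_sections X (lb_power F m) UNIV"
 shows "tensor_sec_power s t \<in> hol_sections X (lb_tensor K (lb_power F (m + 1))) U"
proof (rule hol_sectionsI)
 fix ij assume ij: "ij \<in> idx (lb_tensor K (lb_power F (m + 1)))"
 obtain i j where [simp]: "ij = (i, j)" by (cases ij)
 have i: "(i, j) \<in> idx (lb_tensor K F)" "j \<in> idx (lb_power F m)" using ij by auto
 show "hol_on X (U \<inter> dom (lb_tensor K (lb_power F (m + 1))) ij) (tensor_sec_power s t ij)"
  unfolding tensor_sec_power_def
  by (simp, intro hol_on_mult hol_on_subset[OF hol_sectionsD(1)[OF t i(1)]] hol_on_subset[OF hol_sectionsD(1)[OF s i(2)]]) auto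
 fix kl x assume kl: "kl \<in> idx (lb_tensor K (lb_power F (m + 1)))"
  and x: "x \<in> U" "x \<in> dom (lb_tensor K (lb_power F (m + 1))) ij" "x \<in> dom (lb_tensor K (lb_power F (m + 1))) kl"
 obtain k l where [simp]: "kl = (k, l)" by (cases kl)
 have k: "(k, l) \<in> idx (lb_tensor K F)" "l \<in> idx (lb_power F m)" using kl by auto
 have "t (i, j) x = trans (lb_tensor K F) (i, j) (k, l) x * t (k, l) x"
  by (rule hol_sectionsD(2)[OF t i(1) k(1) x(1)]) (use x in auto)
 moreover have "s j x = trans (lb_power F m) j l x * s l x"
  by (rule hol_sectionsD(2)[OF s i(2) k(2)]) (use x in auto)
 ultimately show "tensor_sec_power s t ij x = trans (lb_tensor K (lb_power F (m + 1))) ij kl x * tensor_sec_power s t kl x"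
  by (simp add: tensor_sec_power_def)
next
 fix ij x assume n: "\<not> (ij \<in> idx (lb_tensor K (lb_power F (m + 1))) \<and> x \<in> U \<inter> dom (lb_tensor K (lb_power F (m + 1))) ij)"
 obtain i j where [simp]: "ij = (i, j)" by (cases ij)
 have "t (i, j) x = 0" by (rule hol_sectionsD(3)[OF t]) (use n in auto)
 then show "tensor_sec_power s t ij x = 0" by (simp add: tensor_sec_power_def)
qed

text \<open>Undoes \<open>\<theta>\<close> on part of the bundle: a section of K tensor F^(m+1)
  becomes one of K tensor F tensor M. One frame \<open>j\<close> serves \<open>F\<close> and its
  powers, whence the index \<open>((k, j), i)\<close>.\<close>

definition divide_iso :: "('a, 'm) line_bundle => ('m => 'i => 'a => complex)
  => ('k \<times> 'i => 'a => complex) => ('k \<times> 'i) \<times> 'm => 'a => complex" where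
 "divide_iso M \<theta> u = (\<lambda>((k, j), i) x. if i \<in> idx M \<and> x \<in> dom M i then u (k, j) x / \<theta> i j x else 0)"

text \<open>The transition function of F^(m+1) splits as g times g^m: g stays with \<open>F\<close>,
  while g^m, combined with the change of \<open>\<theta>\<close>, becomes the transition function of
  \<open>M\<close>. Holomorphy holds because \<open>\<theta>\<close> has no zeros.\<close>

lemma divide_iso_hol_sections:
 assumes X: "complex_manifold X" and F: "holomorphic_line_bundle X F" and M: "open_cover_bundle M" 
  and \<theta>: "lb_iso X M (lb_power F m) \<theta>" and K: "open_cover_bundle K"
  and u: "u \<in> hol_sections X (lb_tensor K (lb_power F (m + 1))) U" and U: "open U"
 shows "divide_iso M \<theta> u \<in> hol_sections X (lb_tensor (lb_tensor K F) M) U"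
proof (rule hol_sectionsI)
 fix a assume a: "a \<in> idx (lb_tensor (lb_tensor K F) M)"
 obtain k j i where [simp]: "a = ((k, j), i)" by (metis surj_pair)
 have i: "(k, j) \<in> idx (lb_tensor K (lb_power F (m + 1)))" "j \<in> idx (lb_power F m)" "j \<in> idx F" "i \<in> idx M" using a by auto
 let ?O = "U \<inter> (dom K k \<inter> dom F j \<inter> dom M i)"
 have oO: "open ?O"
  using U open_cover_bundleD(1)[OF K] open_cover_bundleD(1)[OF M i(4)] bundleD(1)[OF F i(3)] a by auto
 have "hol_on X ?O (divide_iso M \<theta> u a)"
 proof (rule hol_on_cong[OF X _ oO])
  show "hol_on X ?O (\<lambda>x. u (k, j) x * inverse (\<theta> i j x))"
  proof (intro hol_on_mult hol_on_inverse[OF X])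
   show "hol_on X ?O (u (k, j))" by (rule hol_on_subset[OF hol_sectionsD(1)[OF u i(1)]]) auto
   show "hol_on X ?O (\<theta> i j)" by (rule hol_on_subset[OF lb_isoD(1)[OF \<theta> i(4,2)]]) auto
   show "\<theta> i j x \<noteq> 0" if "x \<in> ?O" for x by (rule lb_isoD(2)[OF \<theta> i(4,2)]) (use that in auto)
  qed
  show "u (k, j) x * inverse (\<theta> i j x) = divide_iso M \<theta> u a x" if "x \<in> ?O" for x
   using that i(4) by (simp add: divide_iso_def divide_inverse)
 qed
 then show "hol_on X (U \<inter> dom (lb_tensor (lb_tensor K F) M) a) (divide_iso M \<theta> u a)" by simp
 fix a' x assume a': "a' \<in> idx (lb_tensor (lb_tensor K F) M)"
  and x: "x \<in> U" "x \<in> dom (lb_tensor (lb_tensor K F) M) a" "x \<in> dom (lb_tensor (lb_tensor K F) M) a'"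
 obtain k' j' i' where [simp]: "a' = ((k', j'), i')" by (metis surj_pair)
 have i': "(k', j') \<in> idx (lb_tensor K (lb_power F (m + 1)))" "j' \<in> idx (lb_power F m)" "j' \<in> idx F" "i' \<in> idx M" using a' by auto
 have xd: "x \<in> dom F j" "x \<in> dom F j'" "x \<in> dom M i" "x \<in> dom M i'" "x \<in> dom (lb_power F m) j" "x \<in> dom (lb_power F m) j'"
  using x by auto
 let ?g = "trans F j j' x" and ?h = "trans M i i' x"
 have g: "?g \<noteq> 0" by (rule trans_nonzero[OF F i(3) i'(3) xd(1,2)])
 have uu: "u (k, j) x = trans K k k' x * ?g ^ (m + 1) * u (k', j') x"
  using hol_sectionsD(2)[OF u i(1) i'(1) x(1)] x by simp
 have t1: "\<theta> i' j' x = \<theta> i j' x * ?h" by (rule lb_isoD(3)[OF \<theta> i(4) i'(2) i'(4) xd(3,4,6)])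
 have t2: "\<theta> i j x = ?g ^ m * \<theta> i j' x" using lb_isoD(4)[OF \<theta> i(4) i'(2) i(2) xd(3,6,5)] by simp
 have nz: "\<theta> i j' x \<noteq> 0" "\<theta> i' j' x \<noteq> 0"
  by (rule lb_isoD(2)[OF \<theta> i(4) i'(2) xd(3,6)], rule lb_isoD(2)[OF \<theta> i'(4) i'(2) xd(4,6)])
 then have h: "?h \<noteq> 0" using t1 by auto
 have "u (k, j) x / \<theta> i j x = trans K k k' x * ?g * ?h * (u (k', j') x / \<theta> i' j' x)"
  unfolding uu t1 t2 using g h nz(1) by (simp add: field_simps)
 then show "divide_iso M \<theta> u a x = trans (lb_tensor (lb_tensor K F) M) a a' x * divide_iso M \<theta> u a' x"
  using xd(3,4) i(4) i'(4) by (simp add: divide_iso_def)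
next
 fix a x assume n: "\<not> (a \<in> idx (lb_tensor (lb_tensor K F) M) \<and> x \<in> U \<inter> dom (lb_tensor (lb_tensor K F) M) a)"
 obtain k j i where [simp]: "a = ((k, j), i)" by (metis surj_pair)
 show "divide_iso M \<theta> u a x = 0"
 proof (cases "i \<in> idx M \<and> x \<in> dom M i")
  case True
  have "u (k, j) x = 0" by (rule hol_sectionsD(3)[OF u]) (use n True in auto)
  then show ?thesis by (simp add: divide_iso_def)
 qed (auto simp: divide_iso_def)
qed

lemma divide_iso_tensor_sec_power:
 fixes K :: "('a::t2_space, 'k) line_bundle" and F :: "('a, 'f) line_bundle" and M :: "('a, 'm) line_bundle"
 assumes \<theta>: "lb_iso X M (lb_power F m) \<theta>" and s: "s \<in> hol_sections X M UNIV"
  and t: "t \<in> hol_sections X (lb_tensor K F) U"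
 shows "divide_iso M \<theta> (tensor_sec_power (lb_iso_sec M (lb_power F m) \<theta> s) t) = tensor_sec s t"
proof (intro ext)
 fix a :: "('k \<times> 'f) \<times> 'm" and x
 obtain k j i where [simp]: "a = ((k, j), i)" by (metis surj_pair)
 show "divide_iso M \<theta> (tensor_sec_power (lb_iso_sec M (lb_power F m) \<theta> s) t) a x = tensor_sec s t a x"
 proof (cases "i \<in> idx M \<and> x \<in> dom M i")
  case True
  show ?thesis
  proof (cases "j \<in> idx F \<and> x \<in> dom F j")
   case j: True
   have "lb_iso_sec M (lb_power F m) \<theta> s j x = \<theta> i j x * s i x"
    by (rule lb_iso_sec_eq[OF \<theta> s]) (use True j in auto)
   moreover have "\<theta> i j x \<noteq> 0" by (rule lb_isoD(2)[OF \<theta>]) (use True j in auto)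
   ultimately show ?thesis using True by (simp add: divide_iso_def tensor_sec_power_def tensor_sec_def)
  next
   case False
   have "t (k, j) x = 0" by (rule hol_sectionsD(3)[OF t]) (use False in auto)
   then show ?thesis by (simp add: divide_iso_def tensor_sec_power_def tensor_sec_def)
  qed
 next
  case False
  have "s i x = 0" by (rule hol_sectionsD(3)[OF s]) (use False in auto)
  then show ?thesis using False by (auto simp: divide_iso_def tensor_sec_def)
 qed
qed

context snc_pair
begin

text \<open>A class killed by the transported section is still killed after applying
  \<open>divide_iso\<close>, that is, by multiplication with \<open>s\<close>, so
  \<open>class_one\<close> applies. Smoothness identifies both multiplier ideals with the structure
  sheaf, which makes source and target the sheaves of the claim.\<close>

lemma inj_on_tensor_sec_power:
 assumes ker: "kernels_equal q" and sm: "smooth_potential X F \<phi>F" "smooth_potential X M \<phi>M"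
  and \<theta>: "lb_iso X M (lb_power F m) \<theta>"
 shows "inj_on (cohomology_map q (twisted X (KDF X LD (lb_power F (m + 1))) (structure_sheaf X))
   (\<lambda>U. tensor_sec_power (lb_iso_sec M (lb_power F m) \<theta> s)))
  (carrier (cohomology q (twisted X (KDF X LD F) (structure_sheaf X))))"
proof -
 let ?K = "lb_tensor (canonical_bundle X) LD"
 let ?s = "lb_iso_sec M (lb_power F m) \<theta> s"
 let ?T = "twisted X (lb_tensor ?K (lb_power F (m + 1))) (structure_sheaf X)"
 let ?O = "structure_sheaf X"
 have cK: "open_cover_bundle ?K"
  by (rule open_cover_tensor[OF open_cover_canonical[OF X(1)] open_cover_line_bundle[OF D(2)]])
 have cP: "open_cover_bundle (lb_power F l)" for l using covers(1) by (simp add: open_cover_bundle_def)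
 have cKF: "open_cover_bundle (lb_tensor ?K F)" by (rule open_cover_tensor[OF cK covers(1)])
 have cKP: "open_cover_bundle (lb_tensor ?K (lb_power F (m + 1)))" by (rule open_cover_tensor[OF cK cP])
 have contF: "continuous_on (dom F i) (\<lambda>x. real_of_ereal (\<phi>F i x))" if "i \<in> idx F" for i
  by (rule mfd_smooth_on_continuous[OF X(1) smooth_potentialD(3)[OF sm(1) that] bundleD(1)[OF F(1) that]])
 have contM: "continuous_on (dom M j) (\<lambda>x. real_of_ereal (\<phi>M j x))" if "j \<in> idx M" for j
  by (rule mfd_smooth_on_continuous[OF X(1) smooth_potentialD(3)[OF sm(2) that] bundleD(1)[OF M(1) that]])
 have contFM: "continuous_on (dom (lb_tensor F M) ij) (\<lambda>x. real_of_ereal (tensor_pot \<phi>F \<phi>M ij x))"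
  if ij: "ij \<in> idx (lb_tensor F M)" for ij
 proof -
  obtain i j where [simp]: "ij = (i, j)" by (cases ij)
  have i: "i \<in> idx F" "j \<in> idx M" using ij by auto
  have "continuous_on (dom F i \<inter> dom M j) (\<lambda>x. real_of_ereal (\<phi>F i x) + real_of_ereal (\<phi>M j x))"
   by (intro continuous_on_add continuous_on_subset[OF contF[OF i(1)]] continuous_on_subset[OF contM[OF i(2)]]) auto
  then have "continuous_on (dom F i \<inter> dom M j) (\<lambda>x. real_of_ereal (tensor_pot \<phi>F \<phi>M ij x))"
  proof (rule continuous_on_eq)
   fix x assume x: "x \<in> dom F i \<inter> dom M j"
   have "\<bar>\<phi>F i x\<bar> \<noteq> \<infinity>" "\<bar>\<phi>M j x\<bar> \<noteq> \<infinity>"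
    by (rule smooth_potentialD(2)[OF sm(1) i(1)], use x in blast) (rule smooth_potentialD(2)[OF sm(2) i(2)], use x in blast)
   then show "real_of_ereal (\<phi>F i x) + real_of_ereal (\<phi>M j x) = real_of_ereal (tensor_pot \<phi>F \<phi>M ij x)"
    by (cases "\<phi>F i x"; cases "\<phi>M j x") (auto simp: tensor_pot_def)
  qed
  then show ?thesis by simp
 qed
 have I: "sh_I X LD F \<phi>F = twisted X (lb_tensor ?K F) ?O"
  unfolding sh_I_def KDF_def
  by (simp only: multiplier_ideal_continuous[OF X(1) open_cover_bundleD[OF covers(1)] nice_F contF])
 have s': "?s \<in> hol_sections X (lb_power F m) UNIV"
  by (rule lb_iso_sec_hol_sections[OF X(1) covers(2) cP \<theta> s(1)])
 have abT: "ab_presheaf ?T" unfolding twisted_eq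
  by (rule section_family.ab_presheaf_fun[OF section_family_twisted[OF X(1) cKP ideal_family_structure_sheaf[OF X(1)]]])
 have hT: "presheaf_hom (sh_I X LD F \<phi>F) ?T (\<lambda>U. tensor_sec_power ?s)"
  unfolding I twisted_eq
 proof (rule presheaf_hom_fun)
  show "tensor_sec_power ?s t \<in> twisted_sections X (lb_tensor ?K (lb_power F (m + 1))) ?O U"
   if "open U" "t \<in> twisted_sections X (lb_tensor ?K F) ?O U" for U t
   by (rule twisted_structure_sheaf_sections[OF cKP tensor_sec_power_hol_sections[OF twisted_sectionsD(1)[OF that(2)] s'] that(1)])
 qed (auto simp: tensor_sec_power_def restr_def fun_eq_iff distrib_right)
 have OIM: "IFM = ?O"
  by (rule multiplier_ideal_continuous[OF X(1) open_cover_bundleD[OF covers(3)] nice_FM contFM])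
 have hM: "presheaf_hom ?T (sh_IM X LD F \<phi>F M \<phi>M) (\<lambda>U. divide_iso M \<theta>)"
  unfolding sh_IM_def KDF_def twisted_eq OIM
 proof (rule presheaf_hom_fun)
  fix U :: "'a set" and u assume U: "open U" and u: "u \<in> twisted_sections X (lb_tensor ?K (lb_power F (m + 1))) ?O U"
  have "divide_iso M \<theta> u \<in> hol_sections X (lb_tensor (lb_tensor ?K F) M) U"
   by (rule divide_iso_hol_sections[OF X(1) F(1) covers(2) \<theta> cK twisted_sectionsD(1)[OF u] U])
  from twisted_structure_sheaf_sections[OF open_cover_tensor[OF cKF covers(2)] this U]
  show "divide_iso M \<theta> u \<in> twisted_sections X (lb_tensor (lb_tensor ?K F) M) ?O U" .
 qed (auto simp: divide_iso_def restr_def fun_eq_iff add_divide_distrib)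
 have "inj_on (cohomology_map q ?T (\<lambda>U. tensor_sec_power ?s)) (carrier (cohomology q (sh_I X LD F \<phi>F)))"
 proof (rule inj_on_cohomology_map[OF ab_presheaf_sh(1) abT hT])
  fix \<U> c assume c: "\<U> \<in> coverings" "c \<in> cocycles (sh_I X LD F \<phi>F) \<U> q"
  let ?c = "cochain_map (\<lambda>xs. tensor_sec_power ?s) q c"
  assume one: "cech_class ?T q \<U> ?c = \<one>\<^bsub>cohomology q ?T\<^esub>"
  have cc: "?c \<in> cocycles ?T \<U> q"
   by (rule cochain_morphism.cocycles_map[OF presheaf_hom_cochain_morphism[OF ab_presheaf_sh(1) abT hT c(1)] c(2)])
  have "cochain_map (\<lambda>xs. divide_iso M \<theta>) q ?c = cochain_map (\<lambda>xs. tensor_sec s) q c"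
  proof -
   have "divide_iso M \<theta> (tensor_sec_power ?s (c xs)) = tensor_sec s (c xs)" if xs: "xs \<in> simplices q" for xs
   proof -
    have "c \<in> carrier (cochains (sh_I X LD F \<phi>F) \<U> q)" by (rule ab_presheaf.cocycles_cochains[OF ab_presheaf_sh(1) c(2)])
    then have "c xs \<in> carrier (Sec (sh_I X LD F \<phi>F) (cap \<U> xs))" using xs by (auto simp: carrier_cochains)
    then have "c xs \<in> hol_sections X (lb_tensor ?K F) (cap \<U> xs)"
     unfolding I twisted_eq by (simp add: twisted_sections_def)
    then show ?thesis by (rule divide_iso_tensor_sec_power[OF \<theta> s(1)])
   qed
   then show ?thesis by (auto simp: cochain_map_def)
  qed
  then have "cech_class (sh_IM X LD F \<phi>F M \<phi>M) q \<U> (cochain_map (\<lambda>xs. tensor_sec s) q c) = \<one>\<^bsub>cohomology q (sh_IM X LD F \<phi>F M \<phi>M)\<^esub>"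
   using presheaf_hom_class_one[OF abT ab_presheaf_sh(2) hM c(1) cc one] by simp
  then show "cech_class (sh_I X LD F \<phi>F) q \<U> c = \<one>\<^bsub>cohomology q (sh_I X LD F \<phi>F)\<^esub>" by (rule class_one[OF ker c])
 qed
 then show ?thesis unfolding I KDF_def .
qed

end

theorem theorem1p3p2:
  fixes X :: "('a::t2_space, 'n::finite) chart set"
    and \<omega> :: "('a, 'n) chart \<Rightarrow> 'a \<Rightarrow> complex^'n^'n"
    and D :: "'a set set"
    and LD :: "('a, 'd) line_bundle" and sD :: "'d \<Rightarrow> 'a \<Rightarrow> complex" and \<phi>Dsm :: "'d \<Rightarrow> 'a \<Rightarrow> ereal"
    and F :: "('a, 'f) line_bundle" and \<phi>F :: "'f \<Rightarrow> 'a \<Rightarrow> ereal"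
    and M :: "('a, 'm) line_bundle" and \<phi>M :: "'m \<Rightarrow> 'a \<Rightarrow> ereal"
    and s :: "'m \<Rightarrow> 'a \<Rightarrow> complex"
    and \<psi> :: "'a \<Rightarrow> ereal"
  assumes X: "complex_manifold X" "compact (UNIV :: 'a set)" "kaehler_form X \<omega>"
    and D: "snc_divisor X D" "holomorphic_line_bundle X LD" "canonical_section X D LD sD"
    and psi: "smooth_potential X LD \<phi>Dsm" "\<psi> = psi_D LD sD \<phi>Dsm" "\<forall>x. \<psi> x \<le> - 1"
    and F: "holomorphic_line_bundle X F" "potential X F \<phi>F"
    and M: "holomorphic_line_bundle X M" "potential X M \<phi>M"
    and curvature: "curvature_nonneg X F \<phi>F" "\<exists>C>0. curvature_bounds X \<omega> C F \<phi>F M \<phi>M"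
    and neat: "neat_analytic_sing X F \<phi>F" "neat_analytic_sing X M \<phi>M"
    and polar: "\<forall>Z\<in>lc_centres X D. \<not> Z \<subseteq> polar_set F \<phi>F \<and> \<not> Z \<subseteq> polar_set M \<phi>M"
    and snc: "snc_with_polar_sets X D F \<phi>F M \<phi>M"
    and s: "s \<in> hol_sections X M UNIV" "\<exists>i\<in>idx M. \<exists>x\<in>dom M i. s i x \<noteq> 0"
           "sup_norm_sq M \<phi>M s < \<infinity>"
  shows
    "(\<forall>q. ker_mu X LD \<psi> F \<phi>F M \<phi>M s 0 q = ker_iota X LD \<psi> F \<phi>F 0 q \<and>
          (\<forall>\<sigma>\<in>{1..sigma_mlc X D}.
             ker_nu X LD \<psi> F \<phi>F M \<phi>M s \<sigma> q = ker_tau X LD \<psi> F \<phi>F \<sigma> q) \<longrightarrow>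
        inj_on (mu X LD F \<phi>F M \<phi>M s q)
          (carrier (cohomology q (sh_J X LD \<psi> F \<phi>F (sigma_mlc X D)))) \<and>
        inj_on (mult_map X LD F \<phi>F M \<phi>M s q) (carrier (cohomology q (sh_I X LD F \<phi>F)))) \<and>
     (\<forall>m \<theta>.
        smooth_potential X F \<phi>F \<and> smooth_potential X M \<phi>M \<and>
        m \<ge> 1 \<and> lb_iso X M (lb_power F m) \<theta> \<and>
        (\<forall>Z\<in>lc_centres X D. \<exists>x\<in>Z. \<exists>i\<in>idx M. x \<in> dom M i \<and> s i x \<noteq> 0) \<and>
        (\<forall>q. ker_mu X LD \<psi> F \<phi>F M \<phi>M s 0 q = ker_iota X LD \<psi> F \<phi>F 0 q \<and>
          (\<forall>\<sigma>\<in>{1..sigma_mlc X D}.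
             ker_nu X LD \<psi> F \<phi>F M \<phi>M s \<sigma> q = ker_tau X LD \<psi> F \<phi>F \<sigma> q)) \<longrightarrow>
        (\<forall>q. inj_on
          (cohomology_map q (twisted X (KDF X LD (lb_power F (m + 1))) (structure_sheaf X))
             (\<lambda>U. tensor_sec_power (lb_iso_sec M (lb_power F m) \<theta> s)))
          (carrier (cohomology q (twisted X (KDF X LD F) (structure_sheaf X))))))"
proof -
  interpret snc_pair X D LD sD \<phi>Dsm F \<phi>F M \<phi>M s \<psi>
    by (rule snc_pair.intro[OF X(1,2) D psi F M neat snc s(1,3)])
  show ?thesis
    unfolding kernels_equal_def[symmetric]
    using inj_on_mu inj_on_mult_map inj_on_tensor_sec_power by blast
qed

end
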